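(* Let $C$ be a smooth complex projective curve, let $S$ be the ruled surface $C\times\mathbb P^1$, and let $y$ be an affine coordinate of $\mathbb P^1$. A rational vector field $X$ on $S$ tangent to the rational fibration $S\to C$ is birationally integrable if and only if $X=(a(x)y^2+2b(x)y+c(x))\,\partial_y$, with $a,b,c\in\mathbb C(C)$, and $$\Delta(X):=b(x)^2-a(x)c(x)\equiv\kappa^2$$ is constant. In that case there is a birational automorphism $\phi\in\mathrm{Bir}_C(S)$ such that $\phi^*X=2\kappa\, y\,\partial_y$ if $\kappa\in\mathbb C^*$, or $\phi^*X=\partial_y$ if $\kappa=0$, and therefore $X$ is regularizable.
   Context: $\mathbb C(C)$ is the field of rational functions of $C$, and $x$ denotes the variable on $C$. The rational fibration $S\to C$ is the natural projection $C\times\mathbb P^1\to C$. $\mathrm{Bir}(S)$ is the group of birational transformations of $S$, and $\mathrm{Bir}_C(S)$ is the subgroup of those preserving each fibre of this projection. For a birational map $f\colon S'\dashrightarrow S$ between smooth complex projective surfaces and a rational vector field $X$ on $S$, $f^*X$ denotes the pull-back, equal to $(df)^{-1}(X\circ f)$ on the Zariski open set where $f$ is a local isomorphism and $X\circ f$ is holomorphic. An admissible open subset of $\mathbb C\times S$ is any Euclidean open neighborhood of $\{0\}\times V$ in $\mathbb C\times S$, where $V\subset S$ contains a non-empty Zariski open subset of $S$. A rational vector field $X$ on $S$ is birationally integrable if there are a group morphism $\phi\colon(\mathbb C,+)\to\mathrm{Bir}(S)$ and an admissible open subset $U\subset\mathbb C\times S$ on which the local flow $\varphi^X$ of $X$ is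 well defined and satisfies $\varphi^X_t(p)=\phi(t)(p)$ for every $(t,p)\in U$. $X$ is regularizable if there exist a smooth complex projective surface $S'$ and a birational map $f\colon S'\dashrightarrow S$ such that $f^*X$ is holomorphic on $S'$.
   Formalization: The normal form φ*X = ∂_y for κ = 0 is stated only for X ≠ 0, since the zero field is birationally integrable with κ = 0 but all its pull-backs vanish; the equivalence and regularizability include X = 0. *)

theory Defs
  imports "HOL-Analysis.Analysis" "HOL-Library.Poly_Mapping" "HOL-Library.FuncSet"
    "HOL-Algebra.Ring"
begin

section \<open>Points of projective space\<close>

text \<open>
  A point is a non-zero sequence of homogeneous coordinates up to scaling;
  \<open>P\<^sup>n\<close> consists of the points whose coordinates of index larger than \<open>n\<close> vanish.  Thus all
  the \<open>P\<^sup>n\<close> live in one type, and \<open>n\<close> can be quantified over.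
\<close>

definition proj_rel :: "(nat \<Rightarrow> complex) \<Rightarrow> (nat \<Rightarrow> complex) \<Rightarrow> bool" where
  "proj_rel u v \<longleftrightarrow> u \<noteq> (\<lambda>_. 0) \<and> (\<exists>c. c \<noteq> 0 \<and> v = (\<lambda>i. c * u i))"

lemma proj_rel_sym: "proj_rel u v \<Longrightarrow> proj_rel v u"
proof -
  assume a: "proj_rel u v"
  then obtain c where c: "c \<noteq> 0" "v = (\<lambda>i. c * u i)" and u: "u \<noteq> (\<lambda>_. 0)"
    by (auto simp: proj_rel_def)
  from u obtain i where "u i \<noteq> 0" by auto
  with c have "v i \<noteq> 0" by simp
  then have "v \<noteq> (\<lambda>_. 0)" by auto
  moreover have "u = (\<lambda>i. inverse c * v i)" using c by (auto simp: field_simps)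
  ultimately show ?thesis
    unfolding proj_rel_def using c(1) by (intro conjI exI[of _ "inverse c"]) auto
qed

lemma proj_rel_trans: "proj_rel u v \<Longrightarrow> proj_rel v w \<Longrightarrow> proj_rel u w"
proof -
  assume a: "proj_rel u v" and b: "proj_rel v w"
  from a obtain c where c: "c \<noteq> 0" "v = (\<lambda>i. c * u i)" and u: "u \<noteq> (\<lambda>_. 0)"
    by (auto simp: proj_rel_def)
  from b obtain e where e: "e \<noteq> 0" "w = (\<lambda>i. e * v i)" by (auto simp: proj_rel_def)
  have "w = (\<lambda>i. (e * c) * u i)" using c e by (auto simp: mult.assoc)
  then show ?thesis
    unfolding proj_rel_def using u c(1) e(1) by (intro conjI exI[of _ "e * c"]) auto
qed

quotient_type point = "nat \<Rightarrow> complex" / partial: proj_rel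
proof (rule part_equivpI)
  show "\<exists>x. proj_rel x x"
    by (rule exI[of _ "\<lambda>_. 1"]) (auto simp: proj_rel_def fun_eq_iff intro!: exI[of _ 1])
  show "symp proj_rel" by (auto intro: sympI proj_rel_sym)
  show "transp proj_rel" by (auto intro: transpI proj_rel_trans)
qed

text \<open>
  \<open>rep_point p\<close> is some choice of homogeneous coordinates of \<open>p\<close>; it is used below only in ways
  that do not depend on this choice.
\<close>

definition proj_space :: "nat \<Rightarrow> point set" where
  "proj_space n = {p. \<forall>i>n. rep_point p i = 0}"

text \<open>
  The Euclidean topology is the quotient topology (sequences carry the product topology).  It
  induces the usual compact topology on every \<open>P\<^sup>n\<close>.
\<close>

instantiation point :: topological_space
begin

definition open_point :: "point set \<Rightarrow> bool" where
  "open_point U \<longleftrightarrow> open {v. v \<noteq> (\<lambda>_. 0) \<and> abs_point v \<in> U}"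

instance
proof
  have "{v::nat \<Rightarrow> complex. v \<noteq> (\<lambda>_. 0)} = (\<Union>i. {v. v i \<noteq> 0})"
    by (auto simp: fun_eq_iff)
  also have "open \<dots>"
    by (intro open_UN ballI open_Collect_neq continuous_on_product_coordinates
        continuous_on_const)
  finally show "open (UNIV :: point set)" by (simp add: open_point_def)
next
  fix S T :: "point set" assume "open S" "open T"
  then have "open ({v. v \<noteq> (\<lambda>_. 0) \<and> abs_point v \<in> S} \<inter> {v. v \<noteq> (\<lambda>_. 0) \<and> abs_point v \<in> T})"
    unfolding open_point_def by (rule open_Int)
  also have "\<dots> = {v. v \<noteq> (\<lambda>_. 0) \<and> abs_point v \<in> S \<inter> T}" by auto
  finally show "open (S \<inter> T)" by (simp add: open_point_def)
next
  fix K :: "point set set" assume "\<forall>S\<in>K. open S"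
  then have "open (\<Union>S\<in>K. {v. v \<noteq> (\<lambda>_. 0) \<and> abs_point v \<in> S})"
    by (intro open_UN) (auto simp: open_point_def)
  also have "\<dots> = {v. v \<noteq> (\<lambda>_. 0) \<and> abs_point v \<in> \<Union>K}" by auto
  finally show "open (\<Union>K)" by (simp add: open_point_def)
qed

end


section \<open>Smooth projective varieties\<close>

type_synonym mpoly = "(nat \<Rightarrow>\<^sub>0 nat) \<Rightarrow>\<^sub>0 complex"

definition peval :: "mpoly \<Rightarrow> (nat \<Rightarrow> complex) \<Rightarrow> complex" where
  "peval F v = (\<Sum>m \<in> Poly_Mapping.keys F.
     Poly_Mapping.lookup F m * (\<Prod>i \<in> Poly_Mapping.keys m. v i ^ Poly_Mapping.lookup m i))"

definition homogeneous :: "nat \<Rightarrow> mpoly \<Rightarrow> bool" where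
  "homogeneous d F \<longleftrightarrow>
     (\<forall>m \<in> Poly_Mapping.keys F. (\<Sum>i \<in> Poly_Mapping.keys m. Poly_Mapping.lookup m i) = d)"

definition is_form :: "mpoly \<Rightarrow> bool" where
  "is_form F \<longleftrightarrow> (\<exists>d. homogeneous d F)"

definition vanishes :: "mpoly \<Rightarrow> point \<Rightarrow> bool" where
  "vanishes F p \<longleftrightarrow> peval F (rep_point p) = 0"

definition zero_set :: "mpoly set \<Rightarrow> point set" where
  "zero_set A = {p. \<forall>F\<in>A. vanishes F p}"

definition zariski_open_in :: "point set \<Rightarrow> point set \<Rightarrow> bool" where
  "zariski_open_in S W \<longleftrightarrow> (\<exists>A. (\<forall>F\<in>A. is_form F) \<and> W = S - zero_set A)"

definition projective_variety :: "nat \<Rightarrow> point set \<Rightarrow> bool" where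
  "projective_variety n S \<longleftrightarrow>
     (\<exists>A. (\<forall>F\<in>A. is_form F) \<and> S = proj_space n \<inter> zero_set A) \<and>
     S \<noteq> {} \<and>
     (\<forall>A B. (\<forall>F\<in>A. is_form F) \<longrightarrow> (\<forall>F\<in>B. is_form F) \<longrightarrow>
        S \<subseteq> zero_set A \<union> zero_set B \<longrightarrow> S \<subseteq> zero_set A \<or> S \<subseteq> zero_set B)"

text \<open>
  Smoothness of dimension \<open>d\<close> at \<open>p\<close>, for \<open>S \<subseteq> P\<^sup>n\<close>: on the Zariski neighbourhood \<open>H \<noteq> 0\<close> of
  \<open>p\<close>, \<open>S\<close> is the zero set of \<open>n - d\<close> forms whose differentials at \<open>p\<close> are linearly
  independent.
\<close>

definition smooth_at :: "nat \<Rightarrow> nat \<Rightarrow> point set \<Rightarrow> point \<Rightarrow> bool" where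
  "smooth_at n d S p \<longleftrightarrow>
     (\<exists>(F :: nat \<Rightarrow> mpoly) H.
        (\<forall>k<n - d. is_form (F k)) \<and> is_form H \<and> \<not> vanishes H p \<and>
        (\<forall>q \<in> proj_space n. \<not> vanishes H q \<longrightarrow> (q \<in> S \<longleftrightarrow> (\<forall>k<n - d. vanishes (F k) q))) \<and>
        (\<forall>c :: nat \<Rightarrow> complex.
           (\<forall>i\<le>n. (\<Sum>k<n - d. c k *
               deriv (\<lambda>z. peval (F k) ((rep_point p)(i := z))) (rep_point p i)) = 0)
           \<longrightarrow> (\<forall>k<n - d. c k = 0)))"

definition smooth_projective :: "nat \<Rightarrow> nat \<Rightarrow> point set \<Rightarrow> bool" where
  "smooth_projective n d S \<longleftrightarrow>
     projective_variety n S \<and> d \<le> n \<and> (\<forall>p\<in>S. smooth_at n d S p)"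

abbreviation smooth_projective_curve :: "nat \<Rightarrow> point set \<Rightarrow> bool" where
  "smooth_projective_curve n C \<equiv> smooth_projective n 1 C"

abbreviation smooth_projective_surface :: "nat \<Rightarrow> point set \<Rightarrow> bool" where
  "smooth_projective_surface n S \<equiv> smooth_projective n 2 S"


section \<open>Rational functions\<close>

text \<open>
  A rational function on \<open>S\<close> is represented by the partial function defined exactly at the points
  where it is regular.  If a partial function \<open>f\<close> is given by a quotient of forms on some
  non-empty Zariski open subset of \<open>S\<close>, then \<open>rat_ext S f\<close> is the rational function so defined.
\<close>

type_synonym ratfun = "point \<Rightarrow> complex option"

definition form_quotient :: "mpoly \<Rightarrow> mpoly \<Rightarrow> point \<Rightarrow> complex" where
  "form_quotient F G p = peval F (rep_point p) / peval G (rep_point p)"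

definition regular_value :: "point set \<Rightarrow> ratfun \<Rightarrow> point \<Rightarrow> complex \<Rightarrow> bool" where
  "regular_value S f p z \<longleftrightarrow> p \<in> S \<and>
     (\<exists>F G d. homogeneous d F \<and> homogeneous d G \<and> \<not> vanishes G p \<and> z = form_quotient F G p \<and>
        (\<exists>W. zariski_open_in S W \<and> W \<noteq> {} \<and>
           (\<forall>q\<in>W. \<not> vanishes G q \<and> f q = Some (form_quotient F G q))))"

definition rat_ext :: "point set \<Rightarrow> ratfun \<Rightarrow> ratfun" where
  "rat_ext S f = (\<lambda>p. if \<exists>z. regular_value S f p z then Some (THE z. regular_value S f p z) else None)"

definition rational_functions :: "point set \<Rightarrow> ratfun set" where
  "rational_functions S = {f. f = rat_ext S f \<and> dom f \<noteq> {}}"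

definition const_fun :: "point set \<Rightarrow> complex \<Rightarrow> ratfun" where
  "const_fun S c = (\<lambda>p. if p \<in> S then Some c else None)"

definition pointwise :: "(complex \<Rightarrow> complex \<Rightarrow> complex) \<Rightarrow> ratfun \<Rightarrow> ratfun \<Rightarrow> ratfun" where
  "pointwise h f g =
     (\<lambda>p. case (f p, g p) of (Some u, Some v) \<Rightarrow> Some (h u v) | _ \<Rightarrow> None)"

definition function_field :: "point set \<Rightarrow> ratfun ring" where
  "function_field S =
     \<lparr>carrier = rational_functions S,
      mult = (\<lambda>f g. rat_ext S (pointwise (*) f g)),
      one = const_fun S 1,
      zero = const_fun S 0,
      add = (\<lambda>f g. rat_ext S (pointwise (+) f g))\<rparr>"


section \<open>Rational and birational maps\<close>

text \<open>
  As for functions, a rational map is represented by the partial map on its domain of regularity: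
  \<open>map_ext S f\<close> is the maximal regular extension of the map given generically by \<open>f\<close>.
\<close>

type_synonym ratmap = "point \<Rightarrow> point option"

definition form_map :: "(nat \<Rightarrow> mpoly) \<Rightarrow> point \<Rightarrow> point" where
  "form_map F p = abs_point (\<lambda>i. peval (F i) (rep_point p))"

definition regular_map_value :: "point set \<Rightarrow> ratmap \<Rightarrow> point \<Rightarrow> point \<Rightarrow> bool" where
  "regular_map_value S f p q \<longleftrightarrow> p \<in> S \<and>
     (\<exists>F d. (\<forall>i. homogeneous d (F i)) \<and> (\<exists>i. \<not> vanishes (F i) p) \<and> q = form_map F p \<and>
        (\<exists>W. zariski_open_in S W \<and> W \<noteq> {} \<and>
           (\<forall>r\<in>W. (\<exists>i. \<not> vanishes (F i) r) \<and> f r = Some (form_map F r))))"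

definition map_ext :: "point set \<Rightarrow> ratmap \<Rightarrow> ratmap" where
  "map_ext S f =
     (\<lambda>p. if \<exists>q. regular_map_value S f p q then Some (THE q. regular_map_value S f p q) else None)"

definition rational_map :: "point set \<Rightarrow> point set \<Rightarrow> ratmap \<Rightarrow> bool" where
  "rational_map S' S f \<longleftrightarrow> f = map_ext S' f \<and> dom f \<noteq> {} \<and> ran f \<subseteq> S"

definition id_map :: "point set \<Rightarrow> ratmap" where
  "id_map S = (\<lambda>p. if p \<in> S then Some p else None)"

definition birational_map :: "point set \<Rightarrow> point set \<Rightarrow> ratmap \<Rightarrow> bool" where
  "birational_map S' S f \<longleftrightarrow> rational_map S' S f \<and>
     (\<exists>g. rational_map S S' g \<and>
        map_ext S' (g \<circ>\<^sub>m f) = id_map S' \<and> map_ext S (f \<circ>\<^sub>m g) = id_map S)"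

definition Bir :: "point set \<Rightarrow> ratmap monoid" where
  "Bir S = \<lparr>carrier = {f. birational_map S S f}, mult = (\<lambda>f g. map_ext S (f \<circ>\<^sub>m g)), one = id_map S\<rparr>"

definition pull_fun :: "point set \<Rightarrow> ratmap \<Rightarrow> ratfun \<Rightarrow> ratfun" where
  "pull_fun S' f g = rat_ext S' (g \<circ>\<^sub>m f)"


section \<open>Rational vector fields\<close>

text \<open>
  A rational vector field on \<open>S\<close> is a \<open>\<complex>\<close>-derivation \<open>X\<close> of the function field; its value at a
  point \<open>p\<close> where it is holomorphic is the tangent vector (point derivation)
  \<open>g \<mapsto> (X g)(p)\<close> on functions regular at \<open>p\<close>.
\<close>

type_synonym vfield = "ratfun \<Rightarrow> ratfun"

definition rational_vector_field :: "point set \<Rightarrow> vfield \<Rightarrow> bool" where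
  "rational_vector_field S X \<longleftrightarrow>
     (let K = function_field S in
       X \<in> carrier K \<rightarrow>\<^sub>E carrier K \<and>
       (\<forall>g\<in>carrier K. \<forall>h\<in>carrier K. X (g \<oplus>\<^bsub>K\<^esub> h) = X g \<oplus>\<^bsub>K\<^esub> X h) \<and>
       (\<forall>g\<in>carrier K. \<forall>h\<in>carrier K.
          X (g \<otimes>\<^bsub>K\<^esub> h) = (X g \<otimes>\<^bsub>K\<^esub> h) \<oplus>\<^bsub>K\<^esub> (g \<otimes>\<^bsub>K\<^esub> X h)) \<and>
       (\<forall>c. X (const_fun S c) = \<zero>\<^bsub>K\<^esub>))"

definition vf_scale :: "point set \<Rightarrow> ratfun \<Rightarrow> vfield \<Rightarrow> vfield" where
  "vf_scale S r X = (\<lambda>g \<in> carrier (function_field S). r \<otimes>\<^bsub>function_field S\<^esub> X g)"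

definition zero_vf :: "point set \<Rightarrow> vfield" where
  "zero_vf S = (\<lambda>g \<in> carrier (function_field S). \<zero>\<^bsub>function_field S\<^esub>)"

definition holomorphic_vf_at :: "point set \<Rightarrow> vfield \<Rightarrow> point \<Rightarrow> bool" where
  "holomorphic_vf_at S X p \<longleftrightarrow> p \<in> S \<and>
     (\<forall>g\<in>carrier (function_field S). p \<in> dom g \<longrightarrow> p \<in> dom (X g))"

definition holomorphic_vf :: "point set \<Rightarrow> vfield \<Rightarrow> bool" where
  "holomorphic_vf S X \<longleftrightarrow> (\<forall>p\<in>S. holomorphic_vf_at S X p)"

text \<open>
  Since \<open>(df\<^sub>p v)(g) = v(g \<circ> f)\<close>, the equation \<open>f\<^sup>*X = (df)\<^sup>-\<^sup>1 (X \<circ> f)\<close> says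
  \<open>(f\<^sup>*X)(g \<circ> f) = (X g) \<circ> f\<close> for all rational functions \<open>g\<close> on the target; as \<open>g\<close> varies,
  \<open>g \<circ> f\<close> runs through all of the function field of the source.
\<close>

definition pull_vf :: "point set \<Rightarrow> point set \<Rightarrow> ratmap \<Rightarrow> vfield \<Rightarrow> vfield" where
  "pull_vf S' S f X =
     (\<lambda>h \<in> carrier (function_field S').
        pull_fun S' f (X (inv_into (carrier (function_field S)) (pull_fun S' f) h)))"

definition regularizable :: "point set \<Rightarrow> vfield \<Rightarrow> bool" where
  "regularizable S X \<longleftrightarrow>
     (\<exists>m S' f. smooth_projective_surface m S' \<and> birational_map S' S f \<and>
        holomorphic_vf S' (pull_vf S' S f X))"


section \<open>Flows and birational integrability\<close>

definition integral_curve :: "point set \<Rightarrow> vfield \<Rightarrow> complex set \<Rightarrow> (complex \<Rightarrow> point) \<Rightarrow> bool" where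
  "integral_curve S X T \<gamma> \<longleftrightarrow> continuous_on T \<gamma> \<and>
     (\<forall>t\<in>T. holomorphic_vf_at S X (\<gamma> t) \<and>
        (\<forall>g\<in>carrier (function_field S). \<gamma> t \<in> dom g \<longrightarrow>
           ((\<lambda>s. the (g (\<gamma> s))) has_field_derivative the (X g (\<gamma> t))) (at t)))"

definition admissible :: "point set \<Rightarrow> (complex \<times> point) set \<Rightarrow> bool" where
  "admissible S U \<longleftrightarrow> openin (top_of_set (UNIV \<times> S)) U \<and>
     (\<exists>V W. V \<subseteq> S \<and> zariski_open_in S W \<and> W \<noteq> {} \<and> W \<subseteq> V \<and> {0} \<times> V \<subseteq> U)"

text \<open>
  For complex time the flow is single-valued only along a connected time domain containing
  \<open>0\<close>: the local flow is well defined on \<open>U\<close>, and given by \<open>\<Phi>\<close>, if every non-empty slice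
  \<open>{t. (t, p) \<in> U}\<close> is such a domain and carries the integral curve of \<open>X\<close> through \<open>p\<close>.
\<close>

definition local_flow_on ::
    "point set \<Rightarrow> vfield \<Rightarrow> (complex \<times> point) set \<Rightarrow> (complex \<Rightarrow> point \<Rightarrow> point) \<Rightarrow> bool" where
  "local_flow_on S X U \<Phi> \<longleftrightarrow>
     (\<forall>p. let T = {t. (t, p) \<in> U} in T \<noteq> {} \<longrightarrow>
        0 \<in> T \<and> connected T \<and> \<Phi> 0 p = p \<and> integral_curve S X T (\<lambda>t. \<Phi> t p))"

definition birationally_integrable :: "point set \<Rightarrow> vfield \<Rightarrow> bool" where
  "birationally_integrable S X \<longleftrightarrow>
     (\<exists>\<phi> \<in> hom \<lparr>carrier = UNIV, mult = (+), one = (0::complex)\<rparr> (Bir S).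
        \<exists>U \<Phi>. admissible S U \<and> local_flow_on S X U \<Phi> \<and>
          (\<forall>(t, p) \<in> U. \<phi> t p = Some (\<Phi> t p)))"


section \<open>The ruled surface \<open>C \<times> P\<^sup>1\<close>\<close>

text \<open>
  For \<open>C \<subseteq> P\<^sup>n\<close> the product \<open>C \<times> P\<^sup>1\<close> is realised in \<open>P\<^sup>2\<^sup>n\<^sup>+\<^sup>1\<close> by the Segre embedding
  \<open>z\<^sub>2\<^sub>i\<^sub>+\<^sub>j = x\<^sub>i w\<^sub>j\<close>.
\<close>

definition segre :: "point \<Rightarrow> point \<Rightarrow> point" where
  "segre p w = abs_point (\<lambda>k. rep_point p (k div 2) * rep_point w (k mod 2))"

definition ruled :: "point set \<Rightarrow> point set" where
  "ruled C = {segre p w | p w. p \<in> C \<and> w \<in> proj_space 1}"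

definition base_pt :: "point \<Rightarrow> point" where
  "base_pt s = (THE p. \<exists>w \<in> proj_space 1. s = segre p w)"

definition fibre_pt :: "point \<Rightarrow> point" where
  "fibre_pt s = (THE w. w \<in> proj_space 1 \<and> (\<exists>p. s = segre p w))"

definition Bir_fib :: "point set \<Rightarrow> ratmap set" where
  "Bir_fib C = {f \<in> carrier (Bir (ruled C)). \<forall>s\<in>dom f. base_pt (the (f s)) = base_pt s}"

definition affine_coordinate :: "ratfun \<Rightarrow> bool" where
  "affine_coordinate y \<longleftrightarrow>
     (\<exists>\<alpha> \<beta> \<gamma> \<delta>. \<alpha> * \<delta> - \<beta> * \<gamma> \<noteq> 0 \<and>
        y = (\<lambda>w. if w \<in> proj_space 1 \<and> \<gamma> * rep_point w 0 + \<delta> * rep_point w 1 \<noteq> 0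
                 then Some ((\<alpha> * rep_point w 0 + \<beta> * rep_point w 1) /
                            (\<gamma> * rep_point w 0 + \<delta> * rep_point w 1))
                 else None))"

text \<open>Rational functions on \<open>C\<close> and on \<open>P\<^sup>1\<close>, viewed as rational functions on \<open>C \<times> P\<^sup>1\<close>.\<close>

definition from_base :: "point set \<Rightarrow> ratfun \<Rightarrow> ratfun" where
  "from_base C a = rat_ext (ruled C) (\<lambda>s. if s \<in> ruled C then a (base_pt s) else None)"

definition from_fibre :: "point set \<Rightarrow> ratfun \<Rightarrow> ratfun" where
  "from_fibre C y = rat_ext (ruled C) (\<lambda>s. if s \<in> ruled C then y (fibre_pt s) else None)"

definition tangent_to_fibration :: "point set \<Rightarrow> vfield \<Rightarrow> bool" where
  "tangent_to_fibration C X \<longleftrightarrow>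
     (\<forall>a\<in>carrier (function_field C). X (from_base C a) = \<zero>\<^bsub>function_field (ruled C)\<^esub>)"

definition partial_y :: "point set \<Rightarrow> ratfun \<Rightarrow> vfield" where
  "partial_y C y =
     (THE D. rational_vector_field (ruled C) D \<and> tangent_to_fibration C D \<and>
        D (from_fibre C y) = \<one>\<^bsub>function_field (ruled C)\<^esub>)"

definition riccati_vf :: "point set \<Rightarrow> ratfun \<Rightarrow> ratfun \<Rightarrow> ratfun \<Rightarrow> ratfun \<Rightarrow> vfield" where
  "riccati_vf C y a b c =
     (let K = function_field (ruled C); Y = from_fibre C y in
       vf_scale (ruled C)
         (from_base C a \<otimes>\<^bsub>K\<^esub> (Y \<otimes>\<^bsub>K\<^esub> Y)
           \<oplus>\<^bsub>K\<^esub> const_fun (ruled C) 2 \<otimes>\<^bsub>K\<^esub> from_base C b \<otimes>\<^bsub>K\<^esub> Y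
           \<oplus>\<^bsub>K\<^esub> from_base C c)
         (partial_y C y))"

definition discriminant :: "point set \<Rightarrow> ratfun \<Rightarrow> ratfun \<Rightarrow> ratfun \<Rightarrow> ratfun" where
  "discriminant C a b c =
     (b \<otimes>\<^bsub>function_field C\<^esub> b) \<ominus>\<^bsub>function_field C\<^esub> (a \<otimes>\<^bsub>function_field C\<^esub> c)"

end

(*
  A derivation of the function field of C x P^1 that kills the functions of C is v d/dy for a rational
  function v.  If its flow is birational, then for small fixed times t it preserves the fibres: this
  holds on an uncountable, hence Zariski dense, set of points, because the curve C is uncountable while
  proper closed subsets of C are finite.  A birational map preserving the fibres acts on almost every
  fibre by a Moebius transformation, so it preserves cross-ratios; differentiating at t = 0 shows that
  v is quadratic in y, with coefficients a, 2b, c in C(C).  Then the time t map is explicit, and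
  G(p) = (time t image of a fixed u) is a rational function of p, so that (sinh(k t)/k)^2, with
  k^2 = b^2 - a c, is a rational function on C.  Since C(C) has transcendence degree one, it would be
  algebraic over k^2 if k^2 were not constant, which contradicts the infinitely many zeros
  k t = i pi j of the hyperbolic sine.

  Conversely, if k is constant, the matrices exp(t (b, c; -a, -b)) have entries in C(C) and give the
  required one-parameter group; diagonalising or triangularising them over C(C) yields the normal forms.
*)
theory Submission
  imports Defs "HOL-Complex_Analysis.Complex_Analysis" "HOL-Library.Function_Algebras"
    "HOL-Computational_Algebra.Fundamental_Theorem_Algebra"
begin

text \<open>The flow of a point exists for a time that depends on the point, with no lower bound,
  while a birational map is compared with it at one fixed time. Flow times above
  \<open>1 / (N + 1)\<close> define countably many classes of points, so uncountability yields one
  time that serves infinitely many points on infinitely many fibres, and this is already Zariski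
  dense. Differentiating at \<open>t = 0\<close>, on the other hand, needs times that tend to
  \<open>0\<close>, each with its own exceptional closed set; hence the times
  \<open>e / 2 ^ k\<close>, and "almost all" in the sense of countable exceptions. The explicit
  Riccati flow is first known for large \<open>k\<close> only; doubling the time by the group law
  brings it back to \<open>e\<close>. There \<open>cosh\<close> is eliminated through
  \<open>cosh^2 - sinh^2 = 1\<close>, which is why the square of \<open>sinh (k t) / k\<close>
  appears. That proper closed subsets of the curve are finite is deduced from algebraic dependence,
  and this from extending point derivations to finitely generated algebras, played against
  smoothness in its Jacobian form. Smoothness also gives uncountability, by an implicit function
  argument.\<close>

abbreviation crd :: "point \<Rightarrow> nat \<Rightarrow> complex" where "crd \<equiv> rep_point"

section \<open>Forms as functions\<close>

text \<open>Forms of degree \<open>d\<close> taken as functions of the coordinate sequence, since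
  only values and degrees matter. In this shape substitution and differentiation are inductions over
  five rules. The rule \<open>zero\<close> holds in every degree, as it does for
  \<open>homogeneous\<close>.\<close>

inductive hp :: "nat => ((nat => complex) => complex) => bool" where
 zero: "hp d (\<lambda>_. 0)"
| const: "hp 0 (\<lambda>_. c)"
| var: "hp 1 (\<lambda>v. v i)"
| add: "hp d f ==> hp d g ==> hp d (\<lambda>v. f v + g v)"
| mult: "hp d f ==> hp e g ==> hp (d + e) (\<lambda>v. f v * g v)"

definition meval :: "(nat \<Rightarrow>\<^sub>0 nat) => (nat => complex) => complex" where
 "meval m v = (\<Prod>i\<in>Poly_Mapping.keys m. v i ^ Poly_Mapping.lookup m i)"

definition mdeg :: "(nat \<Rightarrow>\<^sub>0 nat) => nat" where
 "mdeg m = (\<Sum>i\<in>Poly_Mapping.keys m. Poly_Mapping.lookup m i)"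

lemma meval_superset:
 assumes "finite I" "Poly_Mapping.keys m \<subseteq> I"
 shows "meval m v = (\<Prod>i\<in>I. v i ^ Poly_Mapping.lookup m i)"
 unfolding meval_def by (rule prod.mono_neutral_left) (use assms in \<open>auto simp: in_keys_iff\<close>)

lemma mdeg_superset:
 assumes "finite I" "Poly_Mapping.keys m \<subseteq> I"
 shows "mdeg m = (\<Sum>i\<in>I. Poly_Mapping.lookup m i)"
 unfolding mdeg_def by (rule sum.mono_neutral_left) (use assms in \<open>auto simp: in_keys_iff\<close>)

lemma meval_add: "meval (m + m') v = meval m v * meval m' v"
proof -
 let ?I = "Poly_Mapping.keys m \<union> Poly_Mapping.keys m'"
 have "meval (m + m') v = (\<Prod>i\<in>?I. v i ^ Poly_Mapping.lookup (m + m') i)"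
  by (rule meval_superset) (auto simp: Poly_Mapping.keys_add)
 also have "\<dots> = (\<Prod>i\<in>?I. v i ^ Poly_Mapping.lookup m i) * (\<Prod>i\<in>?I. v i ^ Poly_Mapping.lookup m' i)"
  by (simp add: lookup_add power_add prod.distrib)
 also have "\<dots> = meval m v * meval m' v"
  by (simp add: meval_superset[of ?I])
 finally show ?thesis .
qed

lemma mdeg_add: "mdeg (m + m') = mdeg m + mdeg m'"
proof -
 let ?I = "Poly_Mapping.keys m \<union> Poly_Mapping.keys m'"
 have "mdeg (m + m') = (\<Sum>i\<in>?I. Poly_Mapping.lookup (m + m') i)"
  by (rule mdeg_superset) (auto simp: Poly_Mapping.keys_add)
 also have "\<dots> = mdeg m + mdeg m'"
  by (simp add: mdeg_superset[of ?I] lookup_add sum.distrib)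
 finally show ?thesis .
qed

lemma peval_superset:
 assumes "finite M" "Poly_Mapping.keys F \<subseteq> M"
 shows "peval F v = (\<Sum>m\<in>M. Poly_Mapping.lookup F m * meval m v)"
 unfolding peval_def meval_def[symmetric]
 by (rule sum.mono_neutral_left) (use assms in \<open>auto simp: in_keys_iff\<close>)

lemma peval_add: "peval (F + G) v = peval F v + peval G v"
proof -
 let ?I = "Poly_Mapping.keys F \<union> Poly_Mapping.keys G"
 have "peval (F + G) v = (\<Sum>m\<in>?I. Poly_Mapping.lookup (F + G) m * meval m v)"
  by (rule peval_superset) (auto simp: Poly_Mapping.keys_add)
 also have "\<dots> = peval F v + peval G v"
  by (simp add: peval_superset[of ?I] lookup_add sum.distrib algebra_simps)
 finally show ?thesis .
qed

lemma peval_zero [simp]: "peval 0 v = 0"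
 by (simp add: peval_def)

lemma peval_single: "peval (Poly_Mapping.single m c) v = c * meval m v"
 by (cases "c = 0") (simp_all add: peval_def meval_def)

lemma peval_sum: "finite I ==> peval (\<Sum>i\<in>I. F i) v = (\<Sum>i\<in>I. peval (F i) v)"
 by (induction I rule: finite_induct) (simp_all add: peval_add)

lemma poly_mapping_sum_singles:
 "F = (\<Sum>m\<in>Poly_Mapping.keys F. Poly_Mapping.single m (Poly_Mapping.lookup F m))"
 by (rule poly_mapping_eqI)
  (auto simp: lookup_sum lookup_single when_def sum.delta' in_keys_iff)

lemma peval_mult: "peval (F * G) v = peval F v * peval G v"
proof -
 let ?K = "Poly_Mapping.keys F" and ?L = "Poly_Mapping.keys G"
 have "F * G = (\<Sum>m\<in>?K. Poly_Mapping.single m (Poly_Mapping.lookup F m)) *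
   (\<Sum>m\<in>?L. Poly_Mapping.single m (Poly_Mapping.lookup G m))"
  using poly_mapping_sum_singles[of F] poly_mapping_sum_singles[of G] by simp
 also have "\<dots> = (\<Sum>m\<in>?K. \<Sum>k\<in>?L. Poly_Mapping.single (m + k)
   (Poly_Mapping.lookup F m * Poly_Mapping.lookup G k))"
  by (simp add: sum_product mult_single)
 finally have "peval (F * G) v = (\<Sum>m\<in>?K. \<Sum>k\<in>?L.
   (Poly_Mapping.lookup F m * Poly_Mapping.lookup G k) * meval (m + k) v)"
  by (simp add: peval_sum peval_single)
 also have "\<dots> = (\<Sum>m\<in>?K. Poly_Mapping.lookup F m * meval m v) *
   (\<Sum>k\<in>?L. Poly_Mapping.lookup G k * meval k v)"
  by (simp add: sum_product meval_add algebra_simps)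
 finally show ?thesis by (simp add: peval_def meval_def)
qed

lemma homogeneous_iff: "homogeneous d F \<longleftrightarrow> (\<forall>m\<in>Poly_Mapping.keys F. mdeg m = d)"
 by (simp add: homogeneous_def mdeg_def)

lemma hp_imp_homogeneous: "hp d f ==> \<exists>F. homogeneous d F \<and> f = peval F"
proof (induction rule: hp.induct)
 case (zero d)
 show ?case by (rule exI[of _ 0]) (auto simp: homogeneous_def)
next
 case (const c)
 show ?case
  by (rule exI[of _ "Poly_Mapping.single 0 c"])
   (auto simp: homogeneous_iff peval_single mdeg_def meval_def)
next
 case (var i)
 show ?case
  by (rule exI[of _ "Poly_Mapping.single (Poly_Mapping.single i 1) 1"])
   (auto simp: homogeneous_iff peval_single mdeg_def meval_def)
next
 case (add d f g)
 then obtain F G where "homogeneous d F" "f = peval F" "homogeneous d G" "g = peval G" by blast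
 thus ?case
  using Poly_Mapping.keys_add[of F G]
  by (intro exI[of _ "F + G"]) (auto simp: homogeneous_iff peval_add)
next
 case (mult d f e g)
 then obtain F G where "homogeneous d F" "f = peval F" "homogeneous e G" "g = peval G" by blast
 thus ?case
  using keys_mult[of F G]
  by (intro exI[of _ "F * G"]) (fastforce simp: homogeneous_iff peval_mult mdeg_add)
qed

lemma hp_cmult: "hp d f ==> hp d (\<lambda>v. c * f v)"
 using hp.mult[OF hp.const[of c], of d f] by simp

lemma hp_var: "hp (Suc 0) (\<lambda>v. v i)"
 using hp.var by simp

lemma hp_uminus: "hp d f ==> hp d (\<lambda>v. - f v)"
 using hp_cmult[of d f "-1"] by simp

lemma hp_diff: "hp d f ==> hp d g ==> hp d (\<lambda>v. f v - g v)"
 using hp.add[OF _ hp_uminus, of d f g] by simp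

lemma hp_mult': "hp d f ==> hp e g ==> k = d + e ==> hp k (\<lambda>v. f v * g v)"
 using hp.mult by simp

lemma hp_power: "hp d f ==> hp (d * k) (\<lambda>v. f v ^ k)"
proof (induction k)
 case 0
 thus ?case using hp.const[of 1] by simp
next
 case (Suc k)
 thus ?case using hp.mult[of d f "d * k" "\<lambda>v. f v ^ k"] by simp
qed

lemma hp_sum: "(\<And>i. i \<in> I ==> hp d (f i)) ==> hp d (\<lambda>v. \<Sum>i\<in>I. f i v)"
 by (induction I rule: infinite_finite_induct) (auto intro: hp.zero hp.add)

lemma hp_prod: "finite I ==> (\<And>i. i \<in> I ==> hp (d i) (f i)) ==> hp (\<Sum>i\<in>I. d i) (\<lambda>v. \<Prod>i\<in>I. f i v)"
proof (induction I rule: finite_induct)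
 case empty
 thus ?case using hp.const[of 1] by simp
next
 case (insert x F)
 thus ?case using hp.mult[of "d x" "f x" "\<Sum>i\<in>F. d i" "\<lambda>v. \<Prod>i\<in>F. f i v"] by simp
qed

lemma hp_meval: "hp (mdeg m) (meval m)"
proof -
 have "hp (\<Sum>i\<in>Poly_Mapping.keys m. Poly_Mapping.lookup m i)
   (\<lambda>v. \<Prod>i\<in>Poly_Mapping.keys m. v i ^ Poly_Mapping.lookup m i)"
  using hp_power[OF hp.var] by (intro hp_prod) simp_all
 moreover have "meval m = (\<lambda>v. \<Prod>i\<in>Poly_Mapping.keys m. v i ^ Poly_Mapping.lookup m i)"
  by (simp add: fun_eq_iff meval_def)
 ultimately show ?thesis by (simp add: mdeg_def)
qed

lemma homogeneous_imp_hp: assumes "homogeneous d F" shows "hp d (peval F)"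
proof -
 have "hp d (\<lambda>v. \<Sum>m\<in>Poly_Mapping.keys F. Poly_Mapping.lookup F m * meval m v)"
  using assms hp_meval unfolding homogeneous_iff by (intro hp_sum hp_cmult) metis
 moreover have "peval F = (\<lambda>v. \<Sum>m\<in>Poly_Mapping.keys F. Poly_Mapping.lookup F m * meval m v)"
  by (simp add: fun_eq_iff peval_def meval_def)
 ultimately show ?thesis by simp
qed

lemma hp_scale: "hp d f ==> f (\<lambda>i. c * v i) = c ^ d * f v"
 by (induction rule: hp.induct) (simp_all add: algebra_simps power_add)

lemma hp_subst: "hp d f ==> (\<And>i. hp e (g i)) ==> hp (d * e) (\<lambda>v. f (\<lambda>i. g i v))"
proof (induction rule: hp.induct)
 case (mult d f d' g)
 thus ?case using hp.mult by (simp add: add_mult_distrib)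
next
 case (add d f g)
 thus ?case by (intro hp.add) auto
next
 case (zero d)
 show ?case by (rule hp.zero)
next
 case (const c)
 show ?case using hp.const by simp
next
 case (var i)
 thus ?case by simp
qed

lemma hp_subst1: "hp d f ==> (\<And>i. hp (Suc 0) (g i)) ==> hp d (\<lambda>v. f (\<lambda>i. g i v))"
 using hp_subst[of d f 1 g] by simp

lemma hp_continuous_on: "hp d f ==> continuous_on A f"
proof (induction rule: hp.induct)
 case (var i)
 show ?case by (rule continuous_on_subset[OF continuous_on_product_coordinates]) simp
next
 case (add d f g)
 thus ?case by (intro continuous_on_add)
next
 case (mult d f e g)
 thus ?case by (intro continuous_on_mult)
next
 case (zero d)
 show ?case by (rule continuous_on_const)
next
 case (const c)
 show ?case by (rule continuous_on_const)
qed

text \<open>The form \<open>g\<close> is the derivative of \<open>f\<close> in the direction of the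
  vector field \<open>N\<close>, characterised by its effect along curves. The factor
  \<open>k\<close> admits curves whose velocity is a multiple of \<open>N\<close>, in particular
  \<open>N\<close> divided by a denominator. The induction is the Leibniz rule.\<close>

lemma hp_deriv_ex:
 assumes "hp d f" "\<And>i. hp (Suc e) (N i)"
 shows "\<exists>g. hp (d + e) g \<and> (\<forall>(c :: complex => nat => complex) t k.
  (\<forall>i. (DERIV (\<lambda>s. c s i) t :> k * N i (c t))) -->
   (DERIV (\<lambda>s. f (c s)) t :> k * g (c t)))"
 using assms
proof (induction rule: hp.induct)
 case (zero d)
 thus ?case by (intro exI[of _ "\<lambda>_. 0"]) (auto intro: hp.intros)
next
 case (const c)
 thus ?case by (intro exI[of _ "\<lambda>_. 0"]) (auto intro: hp.intros)
next
 case (var i)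
 thus ?case by (intro exI[of _ "N i"]) auto
next
 case (add d f g)
 then obtain f' g' where "hp (d + e) f'" "hp (d + e) g'"
  "\<forall>(c :: complex => nat => complex) t k.
  (\<forall>i. (DERIV (\<lambda>s. c s i) t :> k * N i (c t))) -->
   (DERIV (\<lambda>s. f (c s)) t :> k * f' (c t))"
  "\<forall>(c :: complex => nat => complex) t k.
  (\<forall>i. (DERIV (\<lambda>s. c s i) t :> k * N i (c t))) -->
   (DERIV (\<lambda>s. g (c s)) t :> k * g' (c t))" by blast
 thus ?case
  by (intro exI[of _ "\<lambda>v. f' v + g' v"]) (auto intro!: hp.add derivative_intros simp: distrib_left)
next
 case (mult d f d' g)
 then obtain f' g' where *: "hp (d + e) f'" "hp (d' + e) g'"
  "\<forall>(c :: complex => nat => complex) t k.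
  (\<forall>i. (DERIV (\<lambda>s. c s i) t :> k * N i (c t))) -->
   (DERIV (\<lambda>s. f (c s)) t :> k * f' (c t))"
  "\<forall>(c :: complex => nat => complex) t k.
  (\<forall>i. (DERIV (\<lambda>s. c s i) t :> k * N i (c t))) -->
   (DERIV (\<lambda>s. g (c s)) t :> k * g' (c t))" by blast
 have 1: "hp (d + d' + e) (\<lambda>v. f' v * g v + f v * g' v)"
  using mult.hyps *(1,2) by (intro hp.add hp_mult'[OF *(1) mult.hyps(2)] hp_mult'[OF mult.hyps(1) *(2)]) auto
 show ?case
 proof (intro exI[of _ "\<lambda>v. f' v * g v + f v * g' v"] conjI 1 allI impI)
  fix c :: "complex => nat => complex" and t k
  assume c: "\<forall>i. (DERIV (\<lambda>s. c s i) t :> k * N i (c t))"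
  hence "DERIV (\<lambda>s. f (c s)) t :> k * f' (c t)"
   "DERIV (\<lambda>s. g (c s)) t :> k * g' (c t)" using * by blast+
  from DERIV_mult[OF this]
  show "DERIV (\<lambda>s. f (c s) * g (c s)) t :> k * (f' (c t) * g (c t) + f (c t) * g' (c t))"
   by (simp add: algebra_simps)
 qed
qed

lemma hp_line_poly: "hp d f ==> \<exists>P. \<forall>t. f (\<lambda>i. v i + t * w i) = poly P t"
proof (induction rule: hp.induct)
 case (zero d)
 show ?case by (rule exI[of _ 0]) simp
next
 case (const c)
 show ?case by (rule exI[of _ "[:c:]"]) simp
next
 case (var i)
 show ?case by (rule exI[of _ "[:v i, w i:]"]) simp
next
 case (add d f g)
 then obtain P Q where "\<forall>t. f (\<lambda>i. v i + t * w i) = poly P t"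
  "\<forall>t. g (\<lambda>i. v i + t * w i) = poly Q t" by blast
 thus ?case by (intro exI[of _ "P + Q"]) simp
next
 case (mult d f e g)
 then obtain P Q where "\<forall>t. f (\<lambda>i. v i + t * w i) = poly P t"
  "\<forall>t. g (\<lambda>i. v i + t * w i) = poly Q t" by blast
 thus ?case by (intro exI[of _ "P * Q"]) simp
qed


section \<open>Points\<close>

lemma proj_rel_refl: "v \<noteq> (\<lambda>_. 0) ==> proj_rel v v"
 by (auto simp: proj_rel_def intro!: exI[of _ 1])

lemma rep_point_nonzero: "crd p \<noteq> (\<lambda>_. 0)"
 using Quotient3_rep_reflp[OF Quotient3_point, of p] by (auto simp: proj_rel_def)

lemma abs_rep_point [simp]: "abs_point (crd p) = p"
 by (rule Quotient3_abs_rep[OF Quotient3_point])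

lemma abs_point_eq_iff:
 "u \<noteq> (\<lambda>_. 0) ==> v \<noteq> (\<lambda>_. 0) ==> abs_point u = abs_point v \<longleftrightarrow> (\<exists>c. c \<noteq> 0 \<and> v = (\<lambda>i. c * u i))"
 using Quotient3_rel[OF Quotient3_point, of u v] proj_rel_refl[of u] proj_rel_refl[of v]
 by (auto simp: proj_rel_def)

lemma abs_point_scale: "c \<noteq> 0 ==> v \<noteq> (\<lambda>_. 0) ==> abs_point (\<lambda>i. c * v i) = abs_point v"
 by (rule sym, subst abs_point_eq_iff) (auto simp: fun_eq_iff)

lemma rep_abs_point:
 assumes "v \<noteq> (\<lambda>_. 0)"
 obtains c where "c \<noteq> 0" "crd (abs_point v) = (\<lambda>i. c * v i)"
 using abs_point_eq_iff[OF assms rep_point_nonzero, of "abs_point v"] by auto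

lemma rep_point_coord: obtains i where "crd p i \<noteq> 0"
 using rep_point_nonzero[of p] by (auto simp: fun_eq_iff)

lemma proj_space_abs: "v \<noteq> (\<lambda>_. 0) ==> abs_point v \<in> proj_space n \<longleftrightarrow> (\<forall>i>n. v i = 0)"
 by (erule rep_abs_point) (auto simp: proj_space_def)

lemma hp_abs_zero_iff: "hp d f ==> v \<noteq> (\<lambda>_. 0) ==> f (crd (abs_point v)) = 0 \<longleftrightarrow> f v = 0"
 by (erule rep_abs_point) (simp add: hp_scale)

lemma hp_abs_quotient:
 "hp d f ==> hp d g ==> v \<noteq> (\<lambda>_. 0) ==>
  f (crd (abs_point v)) / g (crd (abs_point v)) = f v / g v"
 by (erule rep_abs_point) (simp add: hp_scale)

text \<open>The vanishing of the 2 x 2 minors makes the two coordinate vectors proportional; the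
  factor is read off at a non-zero coordinate of \<open>p\<close>.\<close>

lemma point_eqI:
 assumes "\<And>i j. crd p i * crd q j = crd p j * crd q i"
 shows "p = q"
proof -
 obtain i where i: "crd p i \<noteq> 0" by (rule rep_point_coord)
 have q: "crd q = (\<lambda>j. (crd q i / crd p i) * crd p j)"
  using assms[of i] i by (auto simp: field_simps)
 have "crd q i \<noteq> 0"
 proof
  assume "crd q i = 0"
  hence "crd q = (\<lambda>_. 0)" using q by simp
  thus False using rep_point_nonzero by blast
 qed
 hence "abs_point (crd q) = abs_point (crd p)"
  using i rep_point_nonzero[of p] by (subst q, subst abs_point_scale) auto
 thus ?thesis by simp
qed

lemma hp_open_points: "hp d f ==> open {p. f (crd p) \<noteq> 0}"
proof -
 assume f: "hp d f"
 have "{v. v \<noteq> (\<lambda>_. 0) \<and> abs_point v \<in> {p. f (crd p) \<noteq> 0}} = (\<Union>i. {v. v i \<noteq> 0}) \<inter> {v. f v \<noteq> 0}"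
  using hp_abs_zero_iff[OF f] by (auto simp: fun_eq_iff)
 moreover have "open \<dots>"
  by (intro open_Int open_UN ballI open_Collect_neq continuous_on_product_coordinates
    continuous_on_const hp_continuous_on[OF f])
 ultimately show ?thesis by (simp add: open_point_def)
qed

lemma continuous_on_abs_point: "continuous_on {v. v \<noteq> (\<lambda>_. 0)} abs_point"
proof -
 have o: "open {v::nat => complex. v \<noteq> (\<lambda>_. 0)}"
 proof -
  have "{v::nat => complex. v \<noteq> (\<lambda>_. 0)} = (\<Union>i. {v. v i \<noteq> 0})" by (auto simp: fun_eq_iff)
  also have "open \<dots>"
   by (intro open_UN ballI open_Collect_neq continuous_on_product_coordinates continuous_on_const)
  finally show ?thesis .
 qed
 show ?thesis
  unfolding continuous_on_open_vimage[OF o]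
 proof (intro allI impI)
  fix B :: "point set" assume "open B"
  hence "open {v. v \<noteq> (\<lambda>_. 0) \<and> abs_point v \<in> B}" by (simp add: open_point_def)
  moreover have "abs_point -` B \<inter> {v. v \<noteq> (\<lambda>_. 0)} = {v. v \<noteq> (\<lambda>_. 0) \<and> abs_point v \<in> B}" by auto
  ultimately show "open (abs_point -` B \<inter> {v. v \<noteq> (\<lambda>_. 0)})" by simp
 qed
qed

section \<open>Generic points and rational functions\<close>

text \<open>Generated by the non-empty sets \<open>F \<noteq> 0\<close> on \<open>S\<close>, so that
  \<open>eventually\<close> means on a non-empty Zariski open subset and the shrinking of such
  subsets becomes filter reasoning. Irreducibility makes these sets a filter base
  (\<open>eventually_generic\<close>).\<close>

definition generic :: "point set => point filter" where
 "generic S = (INF F\<in>{F. (\<exists>d. hp d F) \<and> (\<exists>p\<in>S. F (crd p) \<noteq> 0)}.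
   principal {p\<in>S. F (crd p) \<noteq> 0})"

text \<open>Rational functions are handled as total functions of which only the generic values
  count; the maximal partial function is recovered by \<open>RF\<close>.\<close>

definition rat_germ :: "point set => (point => complex) => bool" where
 "rat_germ S h \<longleftrightarrow> (\<exists>d F G. hp d F \<and> hp d G \<and>
   (\<forall>\<^sub>F q in generic S. G (crd q) \<noteq> 0 \<and> h q = F (crd q) / G (crd q)))"

definition regular_at :: "point set => (point => complex) => point => complex => bool" where
 "regular_at S h p z \<longleftrightarrow> p \<in> S \<and> (\<exists>d F G. hp d F \<and> hp d G \<and> G (crd p) \<noteq> 0 \<and>
   z = F (crd p) / G (crd p) \<and>
   (\<forall>\<^sub>F q in generic S. h q = F (crd q) / G (crd q)))"

definition RF :: "point set => (point => complex) => ratfun" where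
 "RF S h = rat_ext S (\<lambda>p. Some (h p))"

text \<open>The assumption \<open>prime\<close> is irreducibility in terms of open sets: two
  non-empty principal open sets meet.\<close>

locale irreducible =
 fixes S :: "point set"
 assumes nonempty: "S \<noteq> {}"
  and prime: "\<And>d F e G p q. hp d F ==> hp e G ==> p \<in> S ==> F (crd p) \<noteq> 0 ==>
   q \<in> S ==> G (crd q) \<noteq> 0 ==> \<exists>r\<in>S. F (crd r) \<noteq> 0 \<and> G (crd r) \<noteq> 0"
begin

abbreviation generically :: "(point => bool) => bool" (binder "\<forall>\<^sub>G" 10) where
 "generically P \<equiv> eventually P (generic S)"

lemma eventually_generic:
 "eventually P (generic S) \<longleftrightarrow>
  (\<exists>d F. hp d F \<and> (\<exists>p\<in>S. F (crd p) \<noteq> 0) \<and> (\<forall>p\<in>S. F (crd p) \<noteq> 0 --> P p))"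
proof -
 let ?B = "{F. (\<exists>d. hp d F) \<and> (\<exists>p\<in>S. F (crd p) \<noteq> 0)}"
 have "eventually P (generic S) \<longleftrightarrow>
   (\<exists>F\<in>?B. eventually P (principal {p\<in>S. F (crd p) \<noteq> 0}))"
  unfolding generic_def
 proof (rule eventually_INF_base)
  have "(\<lambda>_. 1) \<in> ?B" using nonempty hp.const[of 1] by auto
  thus "?B \<noteq> {}" by blast
 next
  fix F G assume "F \<in> ?B" "G \<in> ?B"
  then obtain d e p q where *: "hp d F" "hp e G" "p \<in> S" "F (crd p) \<noteq> 0"
   "q \<in> S" "G (crd q) \<noteq> 0" by blast
  obtain r where "r \<in> S" "F (crd r) \<noteq> 0 \<and> G (crd r) \<noteq> 0"
   using prime[OF *] by blast
  hence "(\<lambda>v. F v * G v) \<in> ?B" using hp.mult[OF *(1,2)] by auto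
  moreover have "principal {p \<in> S. F (crd p) * G (crd p) \<noteq> 0} \<le>
    inf (principal {p \<in> S. F (crd p) \<noteq> 0}) (principal {p \<in> S. G (crd p) \<noteq> 0})"
   by auto
  ultimately show "\<exists>x\<in>?B. principal {p \<in> S. x (crd p) \<noteq> 0} \<le>
    inf (principal {p \<in> S. F (crd p) \<noteq> 0}) (principal {p \<in> S. G (crd p) \<noteq> 0})"
   by (intro bexI[of _ "\<lambda>v. F v * G v"]) simp_all
 qed
 thus ?thesis by (auto simp: eventually_principal)
qed

lemma generic_nonzero:
 "hp d F ==> p \<in> S ==> F (crd p) \<noteq> 0 ==> \<forall>\<^sub>G q. F (crd q) \<noteq> 0"
 unfolding eventually_generic by blast

lemma generic_in: "\<forall>\<^sub>G q. q \<in> S"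
 unfolding eventually_generic using nonempty hp.const[of 1] by (intro exI[of _ 0] exI[of _ "\<lambda>_. 1"]) auto

lemma generic_ex: "eventually P (generic S) ==> \<exists>p\<in>S. P p"
 unfolding eventually_generic by blast

lemma generic_zero:
 assumes "hp d F" "\<forall>\<^sub>G q. F (crd q) = 0" "p \<in> S"
 shows "F (crd p) = 0"
proof (rule ccontr)
 assume "F (crd p) \<noteq> 0"
 from eventually_conj[OF generic_nonzero[OF assms(1,3) this] assms(2)] show False
  using generic_ex by force
qed

lemma zariski_open_generic:
 assumes "zariski_open_in S W" "W \<noteq> {}"
 shows "\<forall>\<^sub>G q. q \<in> W"
proof -
 obtain A where A: "\<forall>F\<in>A. is_form F" "W = S - zero_set A"
  using assms(1) by (auto simp: zariski_open_in_def)
 obtain p F where p: "p \<in> S" "F \<in> A" "\<not> vanishes F p"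
  using assms(2) A by (auto simp: zero_set_def)
 obtain d where "hp d (peval F)" using A(1) p(2) homogeneous_imp_hp unfolding is_form_def by blast
 thus ?thesis
  unfolding eventually_generic using p A
  by (intro exI[of _ d] exI[of _ "peval F"]) (auto simp: vanishes_def zero_set_def)
qed

lemma generic_zariski_open:
 assumes "eventually P (generic S)"
 shows "\<exists>W. zariski_open_in S W \<and> W \<noteq> {} \<and> (\<forall>q\<in>W. P q)"
proof -
 obtain d F where F: "hp d F" "\<exists>p\<in>S. F (crd p) \<noteq> 0" "\<forall>p\<in>S. F (crd p) \<noteq> 0 --> P p"
  using assms by (auto simp: eventually_generic)
 obtain F' where F': "homogeneous d F'" "F = peval F'" using hp_imp_homogeneous[OF F(1)] by blast
 show ?thesis
  unfolding zariski_open_in_def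
  by (intro exI[of _ "S - zero_set {F'}"] conjI exI[of _ "{F'}"])
   (use F F' in \<open>auto simp: is_form_def zero_set_def vanishes_def\<close>)
qed

lemma regular_value_iff:
 "regular_value S f p z \<longleftrightarrow> p \<in> S \<and> (\<exists>d F G. hp d F \<and> hp d G \<and> G (crd p) \<noteq> 0 \<and>
   z = F (crd p) / G (crd p) \<and>
   (\<forall>\<^sub>G q. f q = Some (F (crd q) / G (crd q))))" (is "?L \<longleftrightarrow> ?R")
proof
 assume ?L
 then obtain F G d W where *: "p \<in> S" "homogeneous d F" "homogeneous d G" "\<not> vanishes G p"
  "z = form_quotient F G p" "zariski_open_in S W" "W \<noteq> {}"
  "\<forall>q\<in>W. \<not> vanishes G q \<and> f q = Some (form_quotient F G q)"
  unfolding regular_value_def by blast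
 have "\<forall>\<^sub>G q. f q = Some (form_quotient F G q)"
  by (rule eventually_mono[OF zariski_open_generic[OF *(6,7)]]) (use *(8) in blast)
 thus ?R
  using * homogeneous_imp_hp
  by (intro conjI exI[of _ d] exI[of _ "peval F"] exI[of _ "peval G"])
   (auto simp: form_quotient_def vanishes_def)
next
 assume ?R
 then obtain d F G where *: "p \<in> S" "hp d F" "hp d G" "G (crd p) \<noteq> 0"
  "z = F (crd p) / G (crd p)"
  "\<forall>\<^sub>G q. f q = Some (F (crd q) / G (crd q))" by blast
 obtain F' G' where **: "homogeneous d F'" "F = peval F'" "homogeneous d G'" "G = peval G'"
  using hp_imp_homogeneous *(2,3) by metis
 have "\<forall>\<^sub>G q. G (crd q) \<noteq> 0 \<and> f q = Some (F (crd q) / G (crd q))"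
  by (rule eventually_conj[OF generic_nonzero[OF *(3,1,4)] *(6)])
 from generic_zariski_open[OF this] obtain W where W: "zariski_open_in S W" "W \<noteq> {}"
  "\<forall>q\<in>W. G (crd q) \<noteq> 0 \<and> f q = Some (F (crd q) / G (crd q))" by blast
 show ?L
  unfolding regular_value_def
  by (intro conjI *(1) exI[of _ F'] exI[of _ G'] exI[of _ d] exI[of _ W])
   (use * ** W in \<open>auto simp: vanishes_def form_quotient_def\<close>)
qed

text \<open>Two representations agree generically, so the cross-multiplied difference is a form that
  vanishes generically, hence everywhere on \<open>S\<close> and in particular at
  \<open>p\<close>.\<close>

lemma regular_value_unique:
 assumes "regular_value S f p z" "regular_value S f p z'"
 shows "z = z'"
proof -
 obtain d F G where 1: "p \<in> S" "hp d F" "hp d G" "G (crd p) \<noteq> 0"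
  "z = F (crd p) / G (crd p)"
  "\<forall>\<^sub>G q. f q = Some (F (crd q) / G (crd q))"
  using assms(1) unfolding regular_value_iff by blast
 obtain d' F' G' where 2: "p \<in> S" "hp d' F'" "hp d' G'" "G' (crd p) \<noteq> 0"
  "z' = F' (crd p) / G' (crd p)"
  "\<forall>\<^sub>G q. f q = Some (F' (crd q) / G' (crd q))"
  using assms(2) unfolding regular_value_iff by blast
 have "\<forall>\<^sub>G q. F (crd q) * G' (crd q) - G (crd q) * F' (crd q) = 0"
  using generic_nonzero[OF 1(3,1,4)] generic_nonzero[OF 2(3,1,4)] 1(6) 2(6)
  by eventually_elim (auto simp: field_simps)
 from generic_zero[OF _ this 1(1)] have "F (crd p) * G' (crd p) - G (crd p) * F' (crd p) = 0"
  using hp_diff[OF hp.mult[OF 1(2) 2(3)] hp.mult[OF 1(3) 2(2)]] by blast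
 hence "F (crd p) * G' (crd p) = F' (crd p) * G (crd p)" by (simp add: mult.commute)
 thus ?thesis unfolding 1(5) 2(5) using 1(4) 2(4) by (simp add: frac_eq_eq)
qed

lemma rat_ext_Some: "rat_ext S f p = Some z \<longleftrightarrow> regular_value S f p z"
proof -
 have "(THE z. regular_value S f p z) = z" if "regular_value S f p z" for z
  using that regular_value_unique by blast
 thus ?thesis unfolding rat_ext_def by auto
qed

lemma rat_ext_cong: "\<forall>\<^sub>G q. f q = g q ==> rat_ext S f = rat_ext S g"
proof -
 assume *: "\<forall>\<^sub>G q. f q = g q"
 have "regular_value S f p z \<longleftrightarrow> regular_value S g p z" for p z
 proof -
  have "eventually (\<lambda>q. f q = k q) (generic S) \<longleftrightarrow> eventually (\<lambda>q. g q = k q) (generic S)" for k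
   using * by (intro iffI; elim eventually_rev_mp) (auto elim: eventually_mono)
  thus ?thesis unfolding regular_value_iff by simp
 qed
 hence "regular_value S f p = regular_value S g p" for p by (intro ext) simp
 thus ?thesis by (intro ext) (simp only: rat_ext_def)
qed

lemma RF_Some: "RF S h p = Some z \<longleftrightarrow> regular_at S h p z"
 unfolding RF_def rat_ext_Some regular_value_iff regular_at_def by simp

lemma RF_outside: "p \<notin> S ==> RF S h p = None"
 using RF_Some[of h p] by (cases "RF S h p") (auto simp: regular_at_def)

lemma RF_cong: "\<forall>\<^sub>G q. h q = k q ==> RF S h = RF S k"
 unfolding RF_def by (rule rat_ext_cong) (auto elim: eventually_mono)

lemma rat_germ_cong: "\<forall>\<^sub>G q. h q = k q ==> rat_germ S h ==> rat_germ S k"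
proof -
 assume *: "\<forall>\<^sub>G q. h q = k q" and "rat_germ S h"
 then obtain d F G where "hp d F" "hp d G"
   "\<forall>\<^sub>G q. G (crd q) \<noteq> 0 \<and> h q = F (crd q) / G (crd q)"
  unfolding rat_germ_def by blast
 moreover from this(3) * have "\<forall>\<^sub>G q. G (crd q) \<noteq> 0 \<and> k q = F (crd q) / G (crd q)"
  by eventually_elim simp
 ultimately show ?thesis unfolding rat_germ_def by blast
qed

lemma RF_generic:
 assumes "rat_germ S h"
 shows "\<forall>\<^sub>G q. RF S h q = Some (h q)"
proof -
 obtain d F G where *: "hp d F" "hp d G"
   "\<forall>\<^sub>G q. G (crd q) \<noteq> 0 \<and> h q = F (crd q) / G (crd q)"
  using assms unfolding rat_germ_def by blast
 have "\<forall>\<^sub>G q. h q = F (crd q) / G (crd q)"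
  using *(3) by eventually_elim simp
 hence R: "RF S h q = Some (h q)" if "q \<in> S" "G (crd q) \<noteq> 0 \<and> h q = F (crd q) / G (crd q)" for q
  unfolding RF_Some regular_at_def using that *(1,2) by blast
 show ?thesis using *(3) generic_in by eventually_elim (rule R)
qed

lemma RF_eq_iff:
 assumes "rat_germ S h" "rat_germ S k"
 shows "RF S h = RF S k \<longleftrightarrow> (\<forall>\<^sub>G q. h q = k q)"
proof
 assume eq: "RF S h = RF S k"
 show "\<forall>\<^sub>G q. h q = k q"
  using RF_generic[OF assms(1)] RF_generic[OF assms(2)] by eventually_elim (simp add: eq)
qed (rule RF_cong)

lemma regular_at_germ: assumes "regular_at S h p z" shows "rat_germ S h"
proof -
 obtain d F G where *: "p \<in> S" "hp d F" "hp d G" "G (crd p) \<noteq> 0"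
   "\<forall>\<^sub>G q. h q = F (crd q) / G (crd q)"
  using assms unfolding regular_at_def by blast
 have "\<forall>\<^sub>G q. G (crd q) \<noteq> 0 \<and> h q = F (crd q) / G (crd q)"
  using generic_nonzero[OF *(3,1,4)] *(5) by eventually_elim simp
 thus ?thesis unfolding rat_germ_def using * by blast
qed

section \<open>Elements of the function field as germs\<close>

lemma carrier_iff: "f \<in> carrier (function_field S) \<longleftrightarrow> (\<exists>h. rat_germ S h \<and> f = RF S h)"
proof
 assume "f \<in> carrier (function_field S)"
 hence f: "f = rat_ext S f" "\<exists>p z. f p = Some z" by (auto simp: function_field_def rational_functions_def)
 then obtain p z where "f p = Some z" by (auto simp: dom_def)
 hence "regular_value S f p z" using f(1) rat_ext_Some[of f p z] by simp
 then obtain d F G where *: "p \<in> S" "hp d F" "hp d G" "G (crd p) \<noteq> 0"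
  "\<forall>\<^sub>G q. f q = Some (F (crd q) / G (crd q))"
  unfolding regular_value_iff by blast
 let ?h = "\<lambda>q. F (crd q) / G (crd q)"
 have "rat_germ S ?h" unfolding rat_germ_def
  by (intro exI[of _ d] exI[of _ F] exI[of _ G]) (use * generic_nonzero[OF *(3,1,4)] in auto)
 moreover have "f = RF S ?h" unfolding RF_def by (subst f(1), rule rat_ext_cong, rule *(5))
 ultimately show "\<exists>h. rat_germ S h \<and> f = RF S h" by blast
next
 assume "\<exists>h. rat_germ S h \<and> f = RF S h"
 then obtain h where h: "rat_germ S h" "f = RF S h" by blast
 have "rat_ext S f = rat_ext S (\<lambda>p. Some (h p))" using h by (auto intro: rat_ext_cong RF_generic)
 hence "f = rat_ext S f" using h(2) by (simp add: RF_def)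
 moreover have "dom f \<noteq> {}" using generic_ex[OF RF_generic[OF h(1)]] h(2) by auto
 ultimately show "f \<in> carrier (function_field S)" by (simp add: function_field_def rational_functions_def)
qed

lemma RF_carrier: "rat_germ S h ==> RF S h \<in> carrier (function_field S)"
 using carrier_iff by blast

lemma carrier_E:
 assumes "f \<in> carrier (function_field S)"
 obtains h where "rat_germ S h" "f = RF S h"
 using assms carrier_iff by blast

lemma rat_germ_quotient:
 "hp d F ==> hp d G ==> p \<in> S ==> G (crd p) \<noteq> 0 ==>
  rat_germ S (\<lambda>q. F (crd q) / G (crd q))"
 unfolding rat_germ_def
 by (intro exI[of _ d] exI[of _ F] exI[of _ G]) (use generic_nonzero[of d G p] in auto)

lemma rat_germ_const: "rat_germ S (\<lambda>_. c)"
 unfolding rat_germ_def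
 by (rule exI[of _ 0], rule exI[of _ "\<lambda>_. c"], rule exI[of _ "\<lambda>_. 1"]) (auto intro: hp.const)

lemma rat_germ_add:
 assumes "rat_germ S h" "rat_germ S k" shows "rat_germ S (\<lambda>q. h q + k q)"
proof -
 obtain d F G where 1: "hp d F" "hp d G"
   "\<forall>\<^sub>G q. G (crd q) \<noteq> 0 \<and> h q = F (crd q) / G (crd q)"
  using assms(1) unfolding rat_germ_def by blast
 obtain e F' G' where 2: "hp e F'" "hp e G'"
   "\<forall>\<^sub>G q. G' (crd q) \<noteq> 0 \<and> k q = F' (crd q) / G' (crd q)"
  using assms(2) unfolding rat_germ_def by blast
 have "hp (d + e) (\<lambda>v. F v * G' v + G v * F' v)" "hp (d + e) (\<lambda>v. G v * G' v)"
  using 1 2 by (auto intro: hp.intros)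
 moreover have "\<forall>\<^sub>G q. G (crd q) * G' (crd q) \<noteq> 0 \<and>
   h q + k q = (F (crd q) * G' (crd q) + G (crd q) * F' (crd q)) / (G (crd q) * G' (crd q))"
  using 1(3) 2(3) by eventually_elim (auto simp: field_simps)
 ultimately show ?thesis unfolding rat_germ_def by blast
qed

lemma rat_germ_mult:
 assumes "rat_germ S h" "rat_germ S k" shows "rat_germ S (\<lambda>q. h q * k q)"
proof -
 obtain d F G where 1: "hp d F" "hp d G"
   "\<forall>\<^sub>G q. G (crd q) \<noteq> 0 \<and> h q = F (crd q) / G (crd q)"
  using assms(1) unfolding rat_germ_def by blast
 obtain e F' G' where 2: "hp e F'" "hp e G'"
   "\<forall>\<^sub>G q. G' (crd q) \<noteq> 0 \<and> k q = F' (crd q) / G' (crd q)"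
  using assms(2) unfolding rat_germ_def by blast
 have "hp (d + e) (\<lambda>v. F v * F' v)" "hp (d + e) (\<lambda>v. G v * G' v)"
  using 1 2 by (auto intro: hp.intros)
 moreover have "\<forall>\<^sub>G q. G (crd q) * G' (crd q) \<noteq> 0 \<and>
   h q * k q = (F (crd q) * F' (crd q)) / (G (crd q) * G' (crd q))"
  using 1(3) 2(3) by eventually_elim auto
 ultimately show ?thesis unfolding rat_germ_def by blast
qed

text \<open>A form vanishes on all of \<open>S\<close> or is non-zero on a non-empty open set; this
  is applied to the numerator. All later case distinctions on coefficients such as
  \<open>a = 0\<close> rest on this dichotomy.\<close>

lemma rat_germ_zero_or_nonzero:
 assumes "rat_germ S h"
 shows "(\<forall>\<^sub>G q. h q = 0) \<or> (\<forall>\<^sub>G q. h q \<noteq> 0)"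
proof -
 obtain d F G where 1: "hp d F" "hp d G"
   "\<forall>\<^sub>G q. G (crd q) \<noteq> 0 \<and> h q = F (crd q) / G (crd q)"
  using assms(1) unfolding rat_germ_def by blast
 show ?thesis
 proof (cases "\<exists>p\<in>S. F (crd p) \<noteq> 0")
  case True
  hence "\<forall>\<^sub>G q. F (crd q) \<noteq> 0" using generic_nonzero 1(1) by blast
  hence "\<forall>\<^sub>G q. h q \<noteq> 0" using 1(3) by eventually_elim auto
  thus ?thesis by blast
 next
  case False
  have "\<forall>\<^sub>G q. h q = 0" using 1(3) generic_in by eventually_elim (use False in auto)
  thus ?thesis by blast
 qed
qed

lemma rat_germ_inverse:
 assumes "rat_germ S h" shows "rat_germ S (\<lambda>q. inverse (h q))"
proof -
 obtain d F G where 1: "hp d F" "hp d G"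
   "\<forall>\<^sub>G q. G (crd q) \<noteq> 0 \<and> h q = F (crd q) / G (crd q)"
  using assms(1) unfolding rat_germ_def by blast
 from rat_germ_zero_or_nonzero[OF assms] show ?thesis
 proof
  assume "\<forall>\<^sub>G q. h q = 0"
  hence "\<forall>\<^sub>G q. 0 = inverse (h q)" by eventually_elim simp
  thus ?thesis by (rule rat_germ_cong) (rule rat_germ_const)
 next
  assume "\<forall>\<^sub>G q. h q \<noteq> 0"
  hence "\<forall>\<^sub>G q. F (crd q) \<noteq> 0 \<and> inverse (h q) = G (crd q) / F (crd q)"
   using 1(3) by eventually_elim auto
  thus ?thesis unfolding rat_germ_def using 1 by blast
 qed
qed

lemma rat_germ_divide:
 "rat_germ S h ==> rat_germ S k ==> rat_germ S (\<lambda>q. h q / k q)"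
 unfolding divide_inverse by (intro rat_germ_mult rat_germ_inverse)

lemma rat_germ_uminus: "rat_germ S h ==> rat_germ S (\<lambda>q. - h q)"
 using rat_germ_mult[OF rat_germ_const[of "-1"]] by simp

lemma rat_germ_diff: "rat_germ S h ==> rat_germ S k ==> rat_germ S (\<lambda>q. h q - k q)"
 using rat_germ_add[OF _ rat_germ_uminus, of h k] by simp

lemma rat_germ_power: "rat_germ S h ==> rat_germ S (\<lambda>q. h q ^ k)"
 by (induction k) (auto intro: rat_germ_const rat_germ_mult)

lemmas rat_germ_intros = rat_germ_const rat_germ_add rat_germ_mult rat_germ_inverse rat_germ_divide
 rat_germ_uminus rat_germ_diff rat_germ_power

lemma regular_at_const: "p \<in> S ==> regular_at S (\<lambda>_. c) p c"
 unfolding regular_at_def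
 by (rule conjI, assumption, rule exI[of _ 0], rule exI[of _ "\<lambda>_. c"], rule exI[of _ "\<lambda>_. 1"])
  (auto intro: hp.const)

lemma regular_at_add:
 assumes "regular_at S h p z" "regular_at S k p w"
 shows "regular_at S (\<lambda>q. h q + k q) p (z + w)"
proof -
 obtain d F G where 1: "p \<in> S" "hp d F" "hp d G" "G (crd p) \<noteq> 0"
   "z = F (crd p) / G (crd p)"
   "\<forall>\<^sub>G q. h q = F (crd q) / G (crd q)"
  using assms(1) unfolding regular_at_def by blast
 obtain e F' G' where 2: "p \<in> S" "hp e F'" "hp e G'" "G' (crd p) \<noteq> 0"
   "w = F' (crd p) / G' (crd p)"
   "\<forall>\<^sub>G q. k q = F' (crd q) / G' (crd q)"
  using assms(2) unfolding regular_at_def by blast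
 have "hp (d + e) (\<lambda>v. F v * G' v + G v * F' v)" "hp (d + e) (\<lambda>v. G v * G' v)"
  using 1 2 by (auto intro: hp.intros)
 moreover have "\<forall>\<^sub>G q. h q + k q = (F (crd q) * G' (crd q) + G (crd q) * F' (crd q)) / (G (crd q) * G' (crd q))"
  using 1(6) 2(6) generic_nonzero[OF 1(3,1,4)] generic_nonzero[OF 2(3,1,4)] by eventually_elim (auto simp: field_simps)
 ultimately show ?thesis unfolding regular_at_def using 1 2
  by (intro conjI exI[of _ "d + e"] exI[of _ "\<lambda>v. F v * G' v + G v * F' v"] exI[of _ "\<lambda>v. G v * G' v"])
   (auto simp: field_simps)
qed

lemma regular_at_mult:
 assumes "regular_at S h p z" "regular_at S k p w"
 shows "regular_at S (\<lambda>q. h q * k q) p (z * w)"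
proof -
 obtain d F G where 1: "p \<in> S" "hp d F" "hp d G" "G (crd p) \<noteq> 0"
   "z = F (crd p) / G (crd p)"
   "\<forall>\<^sub>G q. h q = F (crd q) / G (crd q)"
  using assms(1) unfolding regular_at_def by blast
 obtain e F' G' where 2: "p \<in> S" "hp e F'" "hp e G'" "G' (crd p) \<noteq> 0"
   "w = F' (crd p) / G' (crd p)"
   "\<forall>\<^sub>G q. k q = F' (crd q) / G' (crd q)"
  using assms(2) unfolding regular_at_def by blast
 have "hp (d + e) (\<lambda>v. F v * F' v)" "hp (d + e) (\<lambda>v. G v * G' v)"
  using 1 2 by (auto intro: hp.intros)
 moreover have "\<forall>\<^sub>G q. h q * k q = (F (crd q) * F' (crd q)) / (G (crd q) * G' (crd q))"
  using 1(6) 2(6) by eventually_elim auto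
 ultimately show ?thesis unfolding regular_at_def using 1 2
  by (intro conjI exI[of _ "d + e"] exI[of _ "\<lambda>v. F v * F' v"] exI[of _ "\<lambda>v. G v * G' v"]) auto
qed

lemma regular_at_unique: "regular_at S h p z ==> regular_at S h p w ==> z = w"
 using RF_Some[of h p z] RF_Some[of h p w] by simp

lemma regular_at_cong: "\<forall>\<^sub>G q. h q = k q ==> regular_at S h p z ==> regular_at S k p z"
 using RF_cong[of h k] RF_Some by metis

lemma RF_add:
 assumes "rat_germ S h" "rat_germ S k"
 shows "RF S h \<oplus>\<^bsub>function_field S\<^esub> RF S k = RF S (\<lambda>q. h q + k q)"
proof -
 have "\<forall>\<^sub>G q. pointwise (+) (RF S h) (RF S k) q = Some (h q + k q)"
  using RF_generic[OF assms(1)] RF_generic[OF assms(2)] by eventually_elim (simp add: pointwise_def)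
 thus ?thesis unfolding function_field_def RF_def by (simp add: rat_ext_cong RF_def)
qed

lemma RF_mult:
 assumes "rat_germ S h" "rat_germ S k"
 shows "RF S h \<otimes>\<^bsub>function_field S\<^esub> RF S k = RF S (\<lambda>q. h q * k q)"
proof -
 have "\<forall>\<^sub>G q. pointwise (*) (RF S h) (RF S k) q = Some (h q * k q)"
  using RF_generic[OF assms(1)] RF_generic[OF assms(2)] by eventually_elim (simp add: pointwise_def)
 thus ?thesis unfolding function_field_def RF_def by (simp add: rat_ext_cong RF_def)
qed

lemma const_fun_RF: "const_fun S c = RF S (\<lambda>_. c)"
proof
 fix p
 show "const_fun S c p = RF S (\<lambda>_. c) p"
 proof (cases "p \<in> S")
  case True
  thus ?thesis using RF_Some[of "\<lambda>_. c" p c] regular_at_const[of p c] by (simp add: const_fun_def)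
 qed (simp add: RF_outside const_fun_def)
qed

lemma zero_RF: "\<zero>\<^bsub>function_field S\<^esub> = RF S (\<lambda>_. 0)"
 by (simp add: function_field_def const_fun_RF)

lemma one_RF: "\<one>\<^bsub>function_field S\<^esub> = RF S (\<lambda>_. 1)"
 by (simp add: function_field_def const_fun_RF)

lemma abelian_group_function_field: "abelian_group (function_field S)"
proof (rule abelian_groupI)
 fix x y z
 assume x: "x \<in> carrier (function_field S)"
 then obtain h where h: "rat_germ S h" "x = RF S h" by (rule carrier_E)
 show "\<zero>\<^bsub>function_field S\<^esub> \<oplus>\<^bsub>function_field S\<^esub> x = x"
  using h by (simp add: zero_RF RF_add rat_germ_intros)
 show "\<exists>y\<in>carrier (function_field S). y \<oplus>\<^bsub>function_field S\<^esub> x = \<zero>\<^bsub>function_field S\<^esub>"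
  using h by (intro bexI[of _ "RF S (\<lambda>q. - h q)"]) (simp_all add: zero_RF RF_add rat_germ_intros RF_carrier)
 assume y: "y \<in> carrier (function_field S)"
 then obtain k where k: "rat_germ S k" "y = RF S k" by (rule carrier_E)
 show "x \<oplus>\<^bsub>function_field S\<^esub> y \<in> carrier (function_field S)"
  using h k by (simp add: RF_add rat_germ_intros RF_carrier)
 show "x \<oplus>\<^bsub>function_field S\<^esub> y = y \<oplus>\<^bsub>function_field S\<^esub> x"
  using h k by (simp add: RF_add rat_germ_intros add.commute)
 assume z: "z \<in> carrier (function_field S)"
 then obtain l where l: "rat_germ S l" "z = RF S l" by (rule carrier_E)
 show "x \<oplus>\<^bsub>function_field S\<^esub> y \<oplus>\<^bsub>function_field S\<^esub> z = x \<oplus>\<^bsub>function_field S\<^esub> (y \<oplus>\<^bsub>function_field S\<^esub> z)"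
  using h k l by (simp add: RF_add rat_germ_intros add.assoc)
next
 show "\<zero>\<^bsub>function_field S\<^esub> \<in> carrier (function_field S)"
  by (simp add: zero_RF RF_carrier rat_germ_intros)
qed

lemma RF_minus:
 assumes "rat_germ S h" "rat_germ S k"
 shows "RF S h \<ominus>\<^bsub>function_field S\<^esub> RF S k = RF S (\<lambda>q. h q - k q)"
proof -
 interpret abelian_group "function_field S" by (rule abelian_group_function_field)
 have "\<ominus>\<^bsub>function_field S\<^esub> RF S k = RF S (\<lambda>q. - k q)"
  by (rule minus_equality) (simp_all add: assms RF_add rat_germ_intros RF_carrier zero_RF)
 thus ?thesis using assms by (simp add: a_minus_def RF_add rat_germ_intros)
qed

end

lemma projective_variety_irreducible:
 assumes "projective_variety n S"
 shows "irreducible S"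
proof
 show "S \<noteq> {}" using assms by (simp add: projective_variety_def)
next
 fix d F e G p q
 assume *: "hp d F" "hp e G" "p \<in> S" "F (crd p) \<noteq> 0" "q \<in> S" "G (crd q) \<noteq> 0"
 obtain F' where F': "homogeneous d F'" "F = peval F'" using hp_imp_homogeneous[OF *(1)] by blast
 obtain G' where G': "homogeneous e G'" "G = peval G'" using hp_imp_homogeneous[OF *(2)] by blast
 have forms: "\<forall>F\<in>{F'}. is_form F" "\<forall>F\<in>{G'}. is_form F" using F' G' by (auto simp: is_form_def)
 have "\<not> S \<subseteq> zero_set {F'}" "\<not> S \<subseteq> zero_set {G'}"
  using * F' G' by (auto simp: zero_set_def vanishes_def)
 hence "\<not> S \<subseteq> zero_set {F'} \<union> zero_set {G'}"
  using assms forms unfolding projective_variety_def by blast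
 thus "\<exists>r\<in>S. F (crd r) \<noteq> 0 \<and> G (crd r) \<noteq> 0"
  using F' G' by (auto simp: zero_set_def vanishes_def)
qed

lemma irreducible_projective_variety:
 assumes "irreducible S" "\<forall>F\<in>A. is_form F" "S = proj_space n \<inter> zero_set A"
 shows "projective_variety n S"
 unfolding projective_variety_def
proof (intro conjI allI impI)
 interpret irreducible S by (rule assms(1))
 show "\<exists>A. (\<forall>F\<in>A. is_form F) \<and> S = proj_space n \<inter> zero_set A" using assms by blast
 show "S \<noteq> {}" by (rule nonempty)
 fix A B assume *: "\<forall>F\<in>A. is_form F" "\<forall>F\<in>B. is_form F" "S \<subseteq> zero_set A \<union> zero_set B"
 show "S \<subseteq> zero_set A \<or> S \<subseteq> zero_set B"
 proof (rule ccontr)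
  assume "\<not> (S \<subseteq> zero_set A \<or> S \<subseteq> zero_set B)"
  then obtain p q F G where **: "p \<in> S" "F \<in> A" "\<not> vanishes F p" "q \<in> S" "G \<in> B" "\<not> vanishes G q"
   by (auto simp: zero_set_def)
  obtain d e where "hp d (peval F)" "hp e (peval G)"
   using *(1,2) ** homogeneous_imp_hp unfolding is_form_def by blast
  then obtain r where "r \<in> S" "\<not> vanishes F r" "\<not> vanishes G r"
   using prime[of d "peval F" e "peval G" p q] ** by (auto simp: vanishes_def)
  thus False using *(3) ** by (auto simp: zero_set_def)
 qed
qed

section \<open>The ruled surface\<close>

text \<open>The decomposable tensor of \<open>x\<close> and \<open>(a, b)\<close> in the numbering
  of \<open>segre\<close>.\<close>

definition seg :: "(nat => complex) => complex => complex => nat => complex" where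
 "seg x a b = (\<lambda>k. x (k div 2) * (if even k then a else b))"

definition rp :: "point => complex => complex => point" where
 "rp p a b = abs_point (seg (crd p) a b)"

definition P1pt :: "complex => complex => point" where
 "P1pt a b = abs_point (\<lambda>i. if i = 0 then a else if i = 1 then b else 0)"

lemma seg_eval: "seg x a b (2 * i) = x i * a" "seg x a b (Suc (2 * i)) = x i * b"
 by (simp_all add: seg_def)

lemma seg_nonzero:
 assumes "x \<noteq> (\<lambda>_. 0)" "a \<noteq> 0 \<or> b \<noteq> 0" shows "seg x a b \<noteq> (\<lambda>_. 0)"
proof
 assume s: "seg x a b = (\<lambda>_. 0)"
 obtain i where "x i \<noteq> 0" using assms(1) by auto
 thus False using seg_eval(1)[of x a b i] seg_eval(2)[of x a b i] assms(2) s by auto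
qed

lemma rep_rp:
 assumes "a \<noteq> 0 \<or> b \<noteq> 0"
 obtains c where "c \<noteq> 0" "crd (rp p a b) = (\<lambda>k. c * seg (crd p) a b k)"
 using rep_abs_point[OF seg_nonzero[OF rep_point_nonzero assms]] unfolding rp_def by blast

lemma P1pt_vec_nonzero: "a \<noteq> 0 \<or> b \<noteq> 0 ==> (\<lambda>i::nat. if i = 0 then a else if i = 1 then b else 0) \<noteq> (\<lambda>_. 0::complex)"
 by (metis zero_neq_one)

lemma P1pt_in: "a \<noteq> 0 \<or> b \<noteq> 0 ==> P1pt a b \<in> proj_space 1"
 unfolding P1pt_def by (subst proj_space_abs[OF P1pt_vec_nonzero]) auto

lemma rep_P1pt:
 assumes "a \<noteq> 0 \<or> b \<noteq> 0"
 obtains c where "c \<noteq> 0" "crd (P1pt a b) 0 = c * a" "crd (P1pt a b) 1 = c * b"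
proof -
 obtain c where c: "c \<noteq> 0" "crd (P1pt a b) = (\<lambda>i. c * (if i = 0 then a else if i = 1 then b else 0))"
  using rep_abs_point[OF P1pt_vec_nonzero[OF assms]] unfolding P1pt_def by blast
 show thesis by (rule that[OF c(1)]) (simp_all add: c(2))
qed

lemma P1_coords_nonzero: "w \<in> proj_space 1 ==> crd w 0 \<noteq> 0 \<or> crd w 1 \<noteq> 0"
proof (rule ccontr)
 assume "w \<in> proj_space 1" "\<not> (crd w 0 \<noteq> 0 \<or> crd w 1 \<noteq> 0)"
 hence "crd w i = 0" for i
  by (cases "i = 0"; cases "i = 1") (auto simp: proj_space_def)
 thus False using rep_point_nonzero[of w] by auto
qed

lemma rp_scale: "c \<noteq> 0 ==> a \<noteq> 0 \<or> b \<noteq> 0 ==> rp p (c * a) (c * b) = rp p a b"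
proof -
 assume c: "c \<noteq> 0" "a \<noteq> 0 \<or> b \<noteq> 0"
 have "seg (crd p) (c * a) (c * b) = (\<lambda>k. c * seg (crd p) a b k)"
  by (auto simp: seg_def)
 thus ?thesis
  unfolding rp_def using abs_point_scale[OF c(1) seg_nonzero[OF rep_point_nonzero c(2)]] by simp
qed

lemma segre_rp: "segre p w = rp p (crd w 0) (crd w 1)"
proof -
 have "crd w (k mod 2) = (if even k then crd w 0 else crd w 1)" for k
  by (cases "even k") (auto simp: even_iff_mod_2_eq_zero odd_iff_mod_2_eq_one)
 thus ?thesis by (simp add: segre_def rp_def seg_def del: One_nat_def)
qed

lemma rp_segre: assumes "a \<noteq> 0 \<or> b \<noteq> 0" shows "rp p a b = segre p (P1pt a b)"
proof -
 obtain c where c: "c \<noteq> 0" "crd (P1pt a b) 0 = c * a" "crd (P1pt a b) 1 = c * b"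
  using rep_P1pt[OF assms] .
 show ?thesis unfolding segre_rp c(2,3) by (rule rp_scale[OF c(1) assms, symmetric])
qed

lemma ruled_iff: "s \<in> ruled C \<longleftrightarrow> (\<exists>p\<in>C. \<exists>a b. (a \<noteq> 0 \<or> b \<noteq> 0) \<and> s = rp p a b)"
proof
 assume "s \<in> ruled C"
 then obtain p w where "p \<in> C" "w \<in> proj_space 1" "s = segre p w" by (auto simp: ruled_def)
 thus "\<exists>p\<in>C. \<exists>a b. (a \<noteq> 0 \<or> b \<noteq> 0) \<and> s = rp p a b"
  using P1_coords_nonzero segre_rp by blast
next
 assume "\<exists>p\<in>C. \<exists>a b. (a \<noteq> 0 \<or> b \<noteq> 0) \<and> s = rp p a b"
 thus "s \<in> ruled C" unfolding ruled_def using rp_segre P1pt_in by blast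
qed

lemma rp_eq_iff:
 assumes "a \<noteq> 0 \<or> b \<noteq> 0" "a' \<noteq> 0 \<or> b' \<noteq> 0"
 shows "rp p a b = rp q a' b' \<longleftrightarrow> p = q \<and> a * b' = a' * b"
proof
 assume e: "rp p a b = rp q a' b'"
 obtain c where c: "c \<noteq> 0" "seg (crd q) a' b' = (\<lambda>k. c * seg (crd p) a b k)"
  using e abs_point_eq_iff[OF seg_nonzero[OF rep_point_nonzero assms(1)] seg_nonzero[OF rep_point_nonzero assms(2)]]
  unfolding rp_def by blast
 have A: "crd q i * a' = c * crd p i * a" "crd q i * b' = c * crd p i * b" for i
  using fun_cong[OF c(2), of "2 * i"] fun_cong[OF c(2), of "Suc (2 * i)"] by (simp_all add: seg_eval)
 have pq: "crd p i * crd q j = crd p j * crd q i" for i j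
 proof (cases "a' = 0")
  case False
  have "crd p i * (crd q j * a') = crd p j * (crd q i * a')"
   by (simp add: A)
  thus ?thesis using False by (simp add: mult.assoc[symmetric])
 next
  case True
  hence "b' \<noteq> 0" using assms by auto
  have "crd p i * (crd q j * b') = crd p j * (crd q i * b')"
   by (simp add: A)
  thus ?thesis using \<open>b' \<noteq> 0\<close> by (simp add: mult.assoc[symmetric])
 qed
 hence "p = q" by (rule point_eqI)
 obtain i where i: "crd p i \<noteq> 0" by (rule rep_point_coord)
 have "a' = c * a" "b' = c * b" using A[of i] i \<open>p = q\<close> by (simp_all add: mult.commute mult.left_commute)
 thus "p = q \<and> a * b' = a' * b" using \<open>p = q\<close> by simp
next
 assume e: "p = q \<and> a * b' = a' * b"
 show "rp p a b = rp q a' b'"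
 proof (cases "a = 0")
  case False
  hence "a' \<noteq> 0" using e assms by auto
  have "b = (a / a') * b'" "a = (a / a') * a'" using e False \<open>a' \<noteq> 0\<close> by (auto simp: field_simps)
  thus ?thesis using rp_scale[of "a / a'" a' b' q] e False \<open>a' \<noteq> 0\<close> by auto
 next
  case True
  hence "b \<noteq> 0" "a' = 0" "b' \<noteq> 0" using e assms by auto
  thus ?thesis using rp_scale[of "b / b'" a' b' q] e True by auto
 qed
qed

lemma base_pt_rp [simp]: assumes "a \<noteq> 0 \<or> b \<noteq> 0" shows "base_pt (rp p a b) = p"
 unfolding base_pt_def
proof (rule the_equality)
 show "\<exists>w\<in>proj_space 1. rp p a b = segre p w" using rp_segre[OF assms] P1pt_in[OF assms] by blast
 fix q assume "\<exists>w\<in>proj_space 1. rp p a b = segre q w"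
 then obtain w where w: "w \<in> proj_space 1" "rp p a b = segre q w" by blast
 show "q = p" using rp_eq_iff[OF assms P1_coords_nonzero[OF w(1)], of p q] w(2) unfolding segre_rp by simp
qed

lemma fibre_pt_rp: assumes "a \<noteq> 0 \<or> b \<noteq> 0" shows "fibre_pt (rp p a b) = P1pt a b"
 unfolding fibre_pt_def
proof (rule the_equality)
 show "P1pt a b \<in> proj_space 1 \<and> (\<exists>q. rp p a b = segre q (P1pt a b))"
  using rp_segre[OF assms] P1pt_in[OF assms] by blast
 fix w assume w: "w \<in> proj_space 1 \<and> (\<exists>q. rp p a b = segre q w)"
 then obtain q where q: "rp p a b = rp q (crd w 0) (crd w 1)" by (auto simp: segre_rp)
 obtain c where c: "c \<noteq> 0" "crd (P1pt a b) 0 = c * a" "crd (P1pt a b) 1 = c * b"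
  using rep_P1pt[OF assms] .
 have e: "a * crd w 1 = crd w 0 * b"
  using rp_eq_iff[OF assms P1_coords_nonzero] w q by blast
 show "w = P1pt a b"
 proof (rule point_eqI)
  fix i j
  have z: "crd w k = 0" "crd (P1pt a b) k = 0" if "k \<noteq> 0" "k \<noteq> 1" for k
   using w P1pt_in[OF assms] that by (auto simp: proj_space_def)
  show "crd w i * crd (P1pt a b) j = crd w j * crd (P1pt a b) i"
  proof -
   have k: "crd w 0 * crd (P1pt a b) 1 = crd w 1 * crd (P1pt a b) 0"
    using c(2,3) e by (simp add: algebra_simps)
   have A: "l = 0 \<or> l = 1 \<or> crd w l = 0 \<and> crd (P1pt a b) l = 0" for l
    using z by blast
   show ?thesis using A[of i] A[of j] k by (elim disjE) (simp_all del: One_nat_def)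
  qed
 qed
qed

lemma hp_rp_zero_iff:
 assumes "hp d F" "a \<noteq> 0 \<or> b \<noteq> 0"
 shows "F (crd (rp p a b)) = 0 \<longleftrightarrow> F (seg (crd p) a b) = 0"
 unfolding rp_def by (rule hp_abs_zero_iff[OF assms(1) seg_nonzero[OF rep_point_nonzero assms(2)]])

lemma hp_rp_quotient:
 assumes "hp d F" "hp d G" "a \<noteq> 0 \<or> b \<noteq> 0"
 shows "F (crd (rp p a b)) / G (crd (rp p a b)) =
  F (seg (crd p) a b) / G (seg (crd p) a b)"
 unfolding rp_def by (rule hp_abs_quotient[OF assms(1,2) seg_nonzero[OF rep_point_nonzero assms(3)]])

lemma hp_seg: "hp d F ==> hp d (\<lambda>x. F (seg x a b))"
proof -
 assume F: "hp d F"
 have "hp (Suc 0) (\<lambda>x. seg x a b k)" for k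
  using hp_cmult[OF hp_var, of "if even k then a else b" "k div 2"] by (simp add: seg_def mult.commute)
 from hp_subst1[OF F this] show ?thesis .
qed

lemma poly_nonroot:
 fixes P Q R :: "complex poly"
 assumes "P \<noteq> 0" "Q \<noteq> 0" "R \<noteq> 0"
 shows "\<exists>t. poly P t \<noteq> 0 \<and> poly Q t \<noteq> 0 \<and> poly R t \<noteq> 0"
proof -
 have "finite {t. poly (P * Q * R) t = 0}" using assms by (intro poly_roots_finite) simp
 hence "\<exists>t. t \<notin> {t. poly (P * Q * R) t = 0}"
  using infinite_UNIV_char_0 ex_new_if_finite by blast
 thus ?thesis by auto
qed

text \<open>With its fibre coordinates fixed, a form on the product is a form on \<open>C\<close>,
  so irreducibility of \<open>C\<close> provides one base point over which neither form vanishes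
  identically. On that fibre the line joining the two fibre coordinates turns both forms into
  non-zero polynomials in \<open>t\<close>, which have a common non-root.\<close>

lemma ruled_irreducible:
 assumes "irreducible C" shows "irreducible (ruled C)"
proof
 interpret irreducible C by (rule assms)
 obtain p where "p \<in> C" using nonempty by auto
 hence "rp p 1 0 \<in> ruled C" unfolding ruled_iff by (intro bexI[of _ p] exI[of _ 1] exI[of _ 0]) auto
 thus "ruled C \<noteq> {}" by auto
 fix d F e G r s
 assume *: "hp d F" "hp e G" "r \<in> ruled C" "F (crd r) \<noteq> 0" "s \<in> ruled C" "G (crd s) \<noteq> 0"
 obtain p1 a0 b0 where 1: "p1 \<in> C" "a0 \<noteq> 0 \<or> b0 \<noteq> 0" "r = rp p1 a0 b0" using *(3) unfolding ruled_iff by blast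
 obtain p2 a1 b1 where 2: "p2 \<in> C" "a1 \<noteq> 0 \<or> b1 \<noteq> 0" "s = rp p2 a1 b1" using *(5) unfolding ruled_iff by blast
 have n: "F (seg (crd p1) a0 b0) \<noteq> 0" "G (seg (crd p2) a1 b1) \<noteq> 0"
  using *(4,6) 1 2 hp_rp_zero_iff[OF *(1)] hp_rp_zero_iff[OF *(2)] by auto
 obtain p where p: "p \<in> C" "F (seg (crd p) a0 b0) \<noteq> 0" "G (seg (crd p) a1 b1) \<noteq> 0"
  using prime[OF hp_seg[OF *(1)] hp_seg[OF *(2)] 1(1) n(1) 2(1) n(2)] by blast
 let ?v = "seg (crd p) a0 b0" and ?w = "seg (crd p) (a1 - a0) (b1 - b0)"
 have lin: "(\<lambda>i. ?v i + t * ?w i) = seg (crd p) (a0 + t * (a1 - a0)) (b0 + t * (b1 - b0))" for t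
  by (auto simp: seg_def fun_eq_iff algebra_simps)
 obtain P where P: "\<And>t. F (seg (crd p) (a0 + t * (a1 - a0)) (b0 + t * (b1 - b0))) = poly P t"
  using hp_line_poly[OF *(1), of ?v ?w] unfolding lin by blast
 obtain Q where Q: "\<And>t. G (seg (crd p) (a0 + t * (a1 - a0)) (b0 + t * (b1 - b0))) = poly Q t"
  using hp_line_poly[OF *(2), of ?v ?w] unfolding lin by blast
 have "poly P 0 \<noteq> 0" "poly Q 1 \<noteq> 0" using p(2,3) P[of 0] Q[of 1] by auto
 hence "P \<noteq> 0" "Q \<noteq> 0" by auto
 \<comment> \<open>The line may pass through the origin, which is not a point of \<open>P^1\<close>;
   \<open>R\<close> is a fibre coordinate along the line that is non-zero at
   \<open>t = 0\<close>.\<close>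
 moreover obtain R where R: "R \<noteq> 0" "\<And>t. poly R t \<noteq> 0 ==> a0 + t * (a1 - a0) \<noteq> 0 \<or> b0 + t * (b1 - b0) \<noteq> 0"
 proof (cases "a0 = 0")
  case True
  hence "[:b0, b1 - b0:] \<noteq> 0" using 1(2) by auto
  thus ?thesis by (rule that) auto
 next
  case False
  hence "[:a0, a1 - a0:] \<noteq> 0" by auto
  thus ?thesis by (rule that) auto
 qed
 ultimately obtain t where t: "poly P t \<noteq> 0" "poly Q t \<noteq> 0" "poly R t \<noteq> 0" using poly_nonroot by blast
 let ?r = "rp p (a0 + t * (a1 - a0)) (b0 + t * (b1 - b0))"
 have "?r \<in> ruled C" using R(2)[OF t(3)] p(1) unfolding ruled_iff by blast
 moreover have "F (crd ?r) \<noteq> 0" "G (crd ?r) \<noteq> 0"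
  using t P Q hp_rp_zero_iff[OF *(1) R(2)[OF t(3)]] hp_rp_zero_iff[OF *(2) R(2)[OF t(3)]] by auto
 ultimately show "\<exists>r\<in>ruled C. F (crd r) \<noteq> 0 \<and> G (crd r) \<noteq> 0" by blast
qed

text \<open>The constants form the matrix of the affine coordinate \<open>y\<close>, the quotient of
  \<open>\<alpha> w0 + \<beta> w1\<close> by \<open>\<gamma> w0 + \<delta> w1\<close>. Fixing them
  here lets all later calculations use \<open>y\<close> itself as the coordinate of the
  fibres.\<close>

locale ruled_surface = C: irreducible C for C :: "point set" +
 fixes \<alpha> \<beta> \<gamma> \<delta> :: complex
 assumes det: "\<alpha> * \<delta> - \<beta> * \<gamma> \<noteq> 0"

sublocale ruled_surface \<subseteq> S: irreducible "ruled C"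
 by (rule ruled_irreducible) (rule C.irreducible_axioms)

context ruled_surface
begin

abbreviation "S \<equiv> ruled C"

abbreviation generic_point :: "(point => bool) => bool" (binder "\<forall>\<^sub>S" 10) where
 "generic_point P \<equiv> eventually P (generic S)"

abbreviation generic_base_point :: "(point => bool) => bool" (binder "\<forall>\<^sub>C" 10) where
 "generic_base_point P \<equiv> eventually P (generic C)"

definition cw0 :: "complex => complex => complex" where
 "cw0 u0 u1 = (\<delta> * u0 - \<beta> * u1) / (\<alpha> * \<delta> - \<beta> * \<gamma>)"

definition cw1 :: "complex => complex => complex" where
 "cw1 u0 u1 = (\<alpha> * u1 - \<gamma> * u0) / (\<alpha> * \<delta> - \<beta> * \<gamma>)"

definition sq :: "(nat => complex) => complex => complex => nat => complex" where
 "sq x u0 u1 = seg x (cw0 u0 u1) (cw1 u0 u1)"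

text \<open>
 \<open>rq p u0 u1\<close> is the point over \<open>p\<close> at which the given affine coordinate of \<open>P\<^sup>1\<close> is \<open>u0 / u1\<close>;
 \<open>cw0\<close> and \<open>cw1\<close> translate it to the standard coordinates.
\<close>

definition rq :: "point => complex => complex => point" where
 "rq p u0 u1 = rp p (cw0 u0 u1) (cw1 u0 u1)"

definition pt :: "point => complex => point" where
 "pt p u = rq p u 1"

text \<open>Linear forms that read off \<open>x i * u0\<close> and \<open>x i * u1\<close> from the
  Segre coordinates (\<open>U_sq\<close>). Substituted for the variables, they turn forms on
  \<open>C\<close> into forms on the surface.\<close>

definition U0 :: "nat => (nat => complex) => complex" where
 "U0 i z = \<alpha> * z (2 * i) + \<beta> * z (Suc (2 * i))"

definition U1 :: "nat => (nat => complex) => complex" where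
 "U1 i z = \<gamma> * z (2 * i) + \<delta> * z (Suc (2 * i))"

definition yc :: "point => complex" where
 "yc s = (\<alpha> * crd (fibre_pt s) 0 + \<beta> * crd (fibre_pt s) 1) /
     (\<gamma> * crd (fibre_pt s) 0 + \<delta> * crd (fibre_pt s) 1)"

lemma cw_u: "\<alpha> * cw0 u0 u1 + \<beta> * cw1 u0 u1 = u0" "\<gamma> * cw0 u0 u1 + \<delta> * cw1 u0 u1 = u1"
proof -
 let ?D = "\<alpha> * \<delta> - \<beta> * \<gamma>"
 have "\<alpha> * cw0 u0 u1 + \<beta> * cw1 u0 u1 = (u0 * ?D) / ?D" "\<gamma> * cw0 u0 u1 + \<delta> * cw1 u0 u1 = (u1 * ?D) / ?D"
  unfolding cw0_def cw1_def times_divide_eq_right add_divide_distrib[symmetric] by (simp_all add: algebra_simps)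
 thus "\<alpha> * cw0 u0 u1 + \<beta> * cw1 u0 u1 = u0" "\<gamma> * cw0 u0 u1 + \<delta> * cw1 u0 u1 = u1" using det by simp_all
qed

lemma cw_w: "cw0 (\<alpha> * a + \<beta> * b) (\<gamma> * a + \<delta> * b) = a" "cw1 (\<alpha> * a + \<beta> * b) (\<gamma> * a + \<delta> * b) = b"
proof -
 let ?D = "\<alpha> * \<delta> - \<beta> * \<gamma>"
 have "\<delta> * (\<alpha> * a + \<beta> * b) - \<beta> * (\<gamma> * a + \<delta> * b) = a * ?D"
  "\<alpha> * (\<gamma> * a + \<delta> * b) - \<gamma> * (\<alpha> * a + \<beta> * b) = b * ?D" by (simp_all add: algebra_simps)
 thus "cw0 (\<alpha> * a + \<beta> * b) (\<gamma> * a + \<delta> * b) = a" "cw1 (\<alpha> * a + \<beta> * b) (\<gamma> * a + \<delta> * b) = b"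
  unfolding cw0_def cw1_def using det by simp_all
qed

lemma cw_nonzero: "u0 \<noteq> 0 \<or> u1 \<noteq> 0 ==> cw0 u0 u1 \<noteq> 0 \<or> cw1 u0 u1 \<noteq> 0"
 using cw_u[of u0 u1] by auto

lemma cw_scale: "cw0 (c * u0) (c * u1) = c * cw0 u0 u1" "cw1 (c * u0) (c * u1) = c * cw1 u0 u1"
 by (simp_all add: cw0_def cw1_def algebra_simps)

lemma U_sq: "U0 i (sq x u0 u1) = x i * u0" "U1 i (sq x u0 u1) = x i * u1"
proof -
 have "U0 i (sq x u0 u1) = x i * (\<alpha> * cw0 u0 u1 + \<beta> * cw1 u0 u1)"
  "U1 i (sq x u0 u1) = x i * (\<gamma> * cw0 u0 u1 + \<delta> * cw1 u0 u1)"
  unfolding U0_def U1_def sq_def seg_eval by (simp_all add: algebra_simps)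
 thus "U0 i (sq x u0 u1) = x i * u0" "U1 i (sq x u0 u1) = x i * u1" by (simp_all add: cw_u)
qed

lemma hp_U: "hp (Suc 0) (U0 i)" "hp (Suc 0) (U1 i)"
proof -
 have "hp (Suc 0) (\<lambda>z. a * z (2 * i) + b * z (Suc (2 * i)))" for a b
  by (intro hp.add hp_cmult hp_var)
 thus "hp (Suc 0) (U0 i)" "hp (Suc 0) (U1 i)" by (auto simp: U0_def[abs_def] U1_def[abs_def])
qed

lemma sq_eq: "sq x u0 u1 k = x (k div 2) * (if even k then cw0 u0 u1 else cw1 u0 u1)"
 by (simp add: sq_def seg_def)

lemma sq_scale: "sq x (c * u0) (c * u1) = (\<lambda>k. c * sq x u0 u1 k)"
 by (auto simp: sq_eq cw_scale)

lemma sq_linear: "(\<lambda>k. sq x u0 u1 k + t * sq x v0 v1 k) = sq x (u0 + t * v0) (u1 + t * v1)"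
 by (auto simp: sq_eq cw0_def cw1_def algebra_simps add_divide_distrib diff_divide_distrib fun_eq_iff)

lemma sq_nonzero: "u0 \<noteq> 0 \<or> u1 \<noteq> 0 ==> x \<noteq> (\<lambda>_. 0) ==> sq x u0 u1 \<noteq> (\<lambda>_. 0)"
 unfolding sq_def by (intro seg_nonzero cw_nonzero)

lemma rq_abs: "rq p u0 u1 = abs_point (sq (crd p) u0 u1)"
 by (simp add: rq_def rp_def sq_def)

lemma rep_rq:
 assumes "u0 \<noteq> 0 \<or> u1 \<noteq> 0"
 obtains c where "c \<noteq> 0" "crd (rq p u0 u1) = (\<lambda>k. c * sq (crd p) u0 u1 k)"
 using rep_rp[OF cw_nonzero[OF assms]] unfolding rq_def sq_def by blast

lemma rq_scale: "c \<noteq> 0 ==> u0 \<noteq> 0 \<or> u1 \<noteq> 0 ==> rq p (c * u0) (c * u1) = rq p u0 u1"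
 unfolding rq_def cw_scale by (rule rp_scale[OF _ cw_nonzero])

lemma rq_pt: "u1 \<noteq> 0 ==> rq p u0 u1 = pt p (u0 / u1)"
 using rq_scale[of u1 "u0 / u1" 1 p] by (simp add: pt_def)

lemma S_iff: "s \<in> S \<longleftrightarrow> (\<exists>p\<in>C. \<exists>u0 u1. (u0 \<noteq> 0 \<or> u1 \<noteq> 0) \<and> s = rq p u0 u1)"
proof
 assume "s \<in> S"
 then obtain p a b where *: "p \<in> C" "a \<noteq> 0 \<or> b \<noteq> 0" "s = rp p a b" unfolding ruled_iff by blast
 let ?u0 = "\<alpha> * a + \<beta> * b" and ?u1 = "\<gamma> * a + \<delta> * b"
 have "s = rq p ?u0 ?u1" by (simp add: rq_def cw_w *(3))
 moreover have "?u0 \<noteq> 0 \<or> ?u1 \<noteq> 0" using cw_w[of a b] *(2) by (auto simp: cw0_def cw1_def)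
 ultimately show "\<exists>p\<in>C. \<exists>u0 u1. (u0 \<noteq> 0 \<or> u1 \<noteq> 0) \<and> s = rq p u0 u1" using *(1) by blast
next
 assume "\<exists>p\<in>C. \<exists>u0 u1. (u0 \<noteq> 0 \<or> u1 \<noteq> 0) \<and> s = rq p u0 u1"
 thus "s \<in> S" unfolding ruled_iff rq_def using cw_nonzero by blast
qed

lemma S_E:
 assumes "s \<in> S" obtains p u0 u1 where "p \<in> C" "u0 \<noteq> 0 \<or> u1 \<noteq> 0" "s = rq p u0 u1"
 using assms unfolding S_iff by blast

lemma rq_in: "p \<in> C ==> u0 \<noteq> 0 \<or> u1 \<noteq> 0 ==> rq p u0 u1 \<in> S"
 unfolding S_iff by blast

lemma pt_in: "p \<in> C ==> pt p u \<in> S"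
 unfolding pt_def by (rule rq_in) auto

lemma rq_eq_iff:
 assumes "u0 \<noteq> 0 \<or> u1 \<noteq> 0" "v0 \<noteq> 0 \<or> v1 \<noteq> 0"
 shows "rq p u0 u1 = rq q v0 v1 \<longleftrightarrow> p = q \<and> u0 * v1 = v0 * u1"
proof -
 let ?D = "\<alpha> * \<delta> - \<beta> * \<gamma>"
 have "cw0 u0 u1 * cw1 v0 v1 - cw0 v0 v1 * cw1 u0 u1 = (u0 * v1 - v0 * u1) / ?D"
  using det by (simp add: cw0_def cw1_def divide_simps) (simp add: algebra_simps)
 hence "cw0 u0 u1 * cw1 v0 v1 = cw0 v0 v1 * cw1 u0 u1 \<longleftrightarrow> u0 * v1 = v0 * u1"
  using det by (metis divide_eq_0_iff eq_iff_diff_eq_0)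
 thus ?thesis unfolding rq_def rp_eq_iff[OF cw_nonzero[OF assms(1)] cw_nonzero[OF assms(2)]] by simp
qed

lemma pt_eq_iff [simp]: "pt p u = pt q v \<longleftrightarrow> p = q \<and> u = v"
 unfolding pt_def by (subst rq_eq_iff) auto

lemma base_rq [simp]: "u0 \<noteq> 0 \<or> u1 \<noteq> 0 ==> base_pt (rq p u0 u1) = p"
 unfolding rq_def by (rule base_pt_rp[OF cw_nonzero])

lemma base_pt_pt [simp]: "base_pt (pt p u) = p"
 unfolding pt_def by simp

lemma base_in: "s \<in> S ==> base_pt s \<in> C"
 by (erule S_E) simp

lemma yc_rq: assumes "u0 \<noteq> 0 \<or> u1 \<noteq> 0" shows "yc (rq p u0 u1) = u0 / u1"
proof -
 obtain c where c: "c \<noteq> 0" "crd (P1pt (cw0 u0 u1) (cw1 u0 u1)) 0 = c * cw0 u0 u1"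
  "crd (P1pt (cw0 u0 u1) (cw1 u0 u1)) 1 = c * cw1 u0 u1"
  using rep_P1pt[OF cw_nonzero[OF assms]] .
 have "yc (rq p u0 u1) = (c * (\<alpha> * cw0 u0 u1 + \<beta> * cw1 u0 u1)) / (c * (\<gamma> * cw0 u0 u1 + \<delta> * cw1 u0 u1))"
  unfolding yc_def rq_def fibre_pt_rp[OF cw_nonzero[OF assms]] c(2,3) by (simp add: algebra_simps)
 thus ?thesis using c(1) by (simp add: cw_u)
qed

lemma yc_pt [simp]: "yc (pt p u) = u"
 unfolding pt_def by (subst yc_rq) auto

lemma hp_rq_zero_iff:
 assumes "hp d F" "u0 \<noteq> 0 \<or> u1 \<noteq> 0"
 shows "F (crd (rq p u0 u1)) = 0 \<longleftrightarrow> F (sq (crd p) u0 u1) = 0"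
 unfolding rq_def sq_def by (rule hp_rp_zero_iff[OF assms(1) cw_nonzero[OF assms(2)]])

lemma hp_pt_zero_iff: "hp d F ==> F (crd (pt p u)) = 0 \<longleftrightarrow> F (sq (crd p) u 1) = 0"
 unfolding pt_def by (rule hp_rq_zero_iff) auto

lemma hp_rq_quotient:
 assumes "hp d F" "hp d G" "u0 \<noteq> 0 \<or> u1 \<noteq> 0"
 shows "F (crd (rq p u0 u1)) / G (crd (rq p u0 u1)) =
  F (sq (crd p) u0 u1) / G (sq (crd p) u0 u1)"
 unfolding rq_def sq_def by (rule hp_rp_quotient[OF assms(1,2) cw_nonzero[OF assms(3)]])

lemma hp_pt_quotient:
 "hp d F ==> hp d G ==> F (crd (pt p u)) / G (crd (pt p u)) =
  F (sq (crd p) u 1) / G (sq (crd p) u 1)"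
 unfolding pt_def by (rule hp_rq_quotient) auto

lemma hp_sq: "hp d F ==> hp d (\<lambda>x. F (sq x u0 u1))"
 unfolding sq_def by (rule hp_seg)

lemma hp_sq_poly: "hp d F ==> \<exists>P. \<forall>u. F (sq x u 1) = poly P u"
 using hp_line_poly[of d F "sq x 0 1" "sq x 1 0"] unfolding sq_linear by simp

lemma U1_nonzero_pt: assumes "s \<in> S" "U1 i (crd s) \<noteq> 0" obtains p u where "p \<in> C" "s = pt p u"
proof -
 obtain p u0 u1 where *: "p \<in> C" "u0 \<noteq> 0 \<or> u1 \<noteq> 0" "s = rq p u0 u1" using assms(1) by (rule S_E)
 have "U1 i (sq (crd p) u0 u1) \<noteq> 0" using assms(2) hp_rq_zero_iff[OF hp_U(2) *(2)] *(3) by blast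
 hence "u1 \<noteq> 0" by (auto simp: U_sq)
 thus thesis using that[of p "u0 / u1"] * rq_pt by simp
qed

lemma U1_generic: "\<exists>i. \<forall>\<^sub>S s. U1 i (crd s) \<noteq> 0"
proof -
 obtain p where p: "p \<in> C" using C.nonempty by auto
 obtain i where i: "crd p i \<noteq> 0" by (rule rep_point_coord)
 have "U1 i (crd (pt p 0)) \<noteq> 0" using hp_pt_zero_iff[OF hp_U(2)] i by (simp add: U_sq)
 thus ?thesis using S.generic_nonzero[OF hp_U(2) pt_in[OF p]] by blast
qed

lemma generic_pt: "\<forall>\<^sub>S s. \<exists>p\<in>C. \<exists>u. s = pt p u"
proof -
 obtain i where "\<forall>\<^sub>S s. U1 i (crd s) \<noteq> 0" using U1_generic by blast
 thus ?thesis using S.generic_in by eventually_elim (metis U1_nonzero_pt)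
qed

lemma generic_base:
 assumes "eventually P (generic C)" shows "\<forall>\<^sub>S s. P (base_pt s)"
proof -
 obtain d F p where F: "hp d F" "p \<in> C" "F (crd p) \<noteq> 0" "\<forall>p\<in>C. F (crd p) \<noteq> 0 --> P p"
  using assms unfolding C.eventually_generic by blast
 let ?F = "\<lambda>z. F (\<lambda>i. U1 i z)"
 have h: "hp d ?F" by (rule hp_subst1[OF F(1)]) (rule hp_U)
 have e: "?F (crd (pt q u)) = 0 \<longleftrightarrow> F (crd q) = 0" for q u
  by (subst hp_pt_zero_iff[OF h]) (simp add: U_sq)
 have "\<forall>\<^sub>S s. ?F (crd s) \<noteq> 0"
  using S.generic_nonzero[OF h pt_in[OF F(2)]] F(3) e by blast
 thus ?thesis using generic_pt by eventually_elim (use e F(4) in auto)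
qed

lemma generic_fibre_aux:
 assumes "eventually P (generic S)"
 obtains d F p u where "hp d F" "p \<in> C" "F (crd (pt p u)) \<noteq> 0"
  "\<forall>s\<in>S. F (crd s) \<noteq> 0 --> P s"
proof -
 obtain d F r where F: "hp d F" "r \<in> S" "F (crd r) \<noteq> 0" "\<forall>s\<in>S. F (crd s) \<noteq> 0 --> P s"
  using assms unfolding S.eventually_generic by blast
 from eventually_conj[OF S.generic_nonzero[OF F(1-3)] generic_pt]
 obtain p u where "p \<in> C" "F (crd (pt p u)) \<noteq> 0" using S.generic_ex by blast
 thus thesis using that F by blast
qed

text \<open>Over a fixed base point a form is a polynomial in the fibre coordinate, and for a
  generic base point this polynomial is not zero; the exceptions are among its roots.\<close>

lemma generic_fibre:
 assumes "eventually P (generic S)"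
 shows "\<forall>\<^sub>C p. finite {u. \<not> P (pt p u)}"
proof -
 obtain d F p0 u0 where F: "hp d F" "p0 \<in> C" "F (crd (pt p0 u0)) \<noteq> 0"
  "\<forall>s\<in>S. F (crd s) \<noteq> 0 --> P s"
  using generic_fibre_aux[OF assms] .
 have "F (sq (crd p0) u0 1) \<noteq> 0" using F hp_pt_zero_iff by blast
 from C.generic_nonzero[OF hp_sq[OF F(1)] F(2) this]
 show ?thesis using C.generic_in
 proof eventually_elim
  case (elim p)
  obtain Q where Q: "\<And>u. F (sq (crd p) u 1) = poly Q u" using hp_sq_poly[OF F(1)] by blast
  hence "Q \<noteq> 0" using elim(1) by auto
  hence "finite {u. poly Q u = 0}" by (rule poly_roots_finite)
  moreover have "{u. \<not> P (pt p u)} \<subseteq> {u. poly Q u = 0}"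
  proof
   fix u assume "u \<in> {u. \<not> P (pt p u)}"
   hence "F (crd (pt p u)) = 0" using F(4) pt_in[OF elim(2)] by blast
   thus "u \<in> {u. poly Q u = 0}" using hp_pt_zero_iff[OF F(1)] Q by simp
  qed
  ultimately show ?case by (rule rev_finite_subset)
 qed
qed

text \<open>One good base point \<open>p0\<close> suffices: for all but finitely many
  \<open>u\<close> the form is non-zero at \<open>pt p0 u\<close>, and then the form that it induces
  on \<open>C\<close> along the section \<open>u\<close> is non-zero generically.\<close>

lemma generic_section:
 assumes "eventually P (generic S)"
 shows "finite {u. \<not> (\<forall>\<^sub>C p. P (pt p u))}"
proof -
 obtain d F p0 u0 where F: "hp d F" "p0 \<in> C" "F (crd (pt p0 u0)) \<noteq> 0"
  "\<forall>s\<in>S. F (crd s) \<noteq> 0 --> P s"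
  using generic_fibre_aux[OF assms] .
 obtain Q where Q: "\<And>u. F (sq (crd p0) u 1) = poly Q u" using hp_sq_poly[OF F(1)] by blast
 have "poly Q u0 \<noteq> 0" using F(3) hp_pt_zero_iff[OF F(1)] Q by simp
 hence "finite {u. poly Q u = 0}" by (intro poly_roots_finite) auto
 moreover have "\<forall>\<^sub>C p. P (pt p u)" if "poly Q u \<noteq> 0" for u
 proof -
  have "F (sq (crd p0) u 1) \<noteq> 0" using that Q by simp
  from C.generic_nonzero[OF hp_sq[OF F(1)] F(2) this]
  show ?thesis using C.generic_in
   by eventually_elim (use F(4) pt_in hp_pt_zero_iff[OF F(1)] in blast)
 qed
 ultimately show ?thesis by (elim rev_finite_subset) blast
qed

lemma regular_at_base:
 assumes "regular_at C h p z" "s \<in> S" "base_pt s = p"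
 shows "regular_at S (\<lambda>s. h (base_pt s)) s z"
proof -
 obtain d F G where *: "p \<in> C" "hp d F" "hp d G" "G (crd p) \<noteq> 0"
   "z = F (crd p) / G (crd p)"
   "\<forall>\<^sub>C q. h q = F (crd q) / G (crd q)"
  using assms(1) unfolding regular_at_def by blast
 obtain u0 u1 where s: "u0 \<noteq> 0 \<or> u1 \<noteq> 0" "s = rq p u0 u1" using assms(2,3) by (elim S_E) auto
 \<comment> \<open>At the point at infinity of a fibre \<open>U1\<close> vanishes, so the family is
   chosen whose fibre coordinate is non-zero at \<open>s\<close>; \<open>a * v0 + b * v1\<close>
   denotes that coordinate.\<close>
 define U where "U = (if u1 \<noteq> 0 then U1 else U0)"
 define a b where "a = (if u1 \<noteq> 0 then 0 else 1 :: complex)" and "b = (if u1 \<noteq> 0 then 1 else 0 :: complex)"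
 have U: "U i (sq x v0 v1) = x i * (a * v0 + b * v1)" for i x v0 v1
  by (auto simp: U_def a_def b_def U_sq)
 have hU: "hp (Suc 0) (U i)" for i by (auto simp: U_def hp_U)
 have hF: "hp d (\<lambda>z. F (\<lambda>i. U i z))" and hG: "hp d (\<lambda>z. G (\<lambda>i. U i z))"
  by (rule hp_subst1[OF *(2) hU], rule hp_subst1[OF *(3) hU])
 have sc: "K (\<lambda>i. U i (sq x v0 v1)) = (a * v0 + b * v1) ^ d * K x" if "hp d K" for K x v0 v1
  unfolding U using hp_scale[OF that, of "a * v0 + b * v1" x] by (simp add: mult.commute)
 have n: "a * u0 + b * u1 \<noteq> 0" using s(1) by (auto simp: a_def b_def)
 have g: "\<forall>\<^sub>S q. \<exists>p v0 v1. (v0 \<noteq> 0 \<or> v1 \<noteq> 0) \<and> a * v0 + b * v1 \<noteq> 0 \<and> q = rq p v0 v1"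
 proof -
  obtain i where i: "crd p i \<noteq> 0" by (rule rep_point_coord)
  have "U i (crd s) \<noteq> 0" using hp_rq_zero_iff[OF hU s(1)] i n by (simp add: s(2) U)
  from S.generic_nonzero[OF hU assms(2) this] S.generic_in show ?thesis
  proof eventually_elim
   case (elim q)
   obtain p v0 v1 where q: "v0 \<noteq> 0 \<or> v1 \<noteq> 0" "q = rq p v0 v1" using elim(2) by (elim S_E) blast
   thus ?case using elim(1) hp_rq_zero_iff[OF hU q(1)] by (metis U mult_zero_right)
  qed
 qed
 have 1: "G (\<lambda>i. U i (crd s)) \<noteq> 0"
  unfolding s(2) hp_rq_zero_iff[OF hG s(1)] sc[OF *(3)] using n *(4) by simp
 have 2: "z = F (\<lambda>i. U i (crd s)) / G (\<lambda>i. U i (crd s))"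
  unfolding s(2) hp_rq_quotient[OF hF hG s(1)] sc[OF *(3)] sc[OF *(2)] using n *(5) by simp
 have 3: "\<forall>\<^sub>S q. h (base_pt q) = F (\<lambda>i. U i (crd q)) / G (\<lambda>i. U i (crd q))"
  using generic_base[OF *(6)] g
 proof eventually_elim
  case (elim q)
  then obtain p v0 v1 where q: "v0 \<noteq> 0 \<or> v1 \<noteq> 0" "a * v0 + b * v1 \<noteq> 0" "q = rq p v0 v1" by blast
  show ?case
   unfolding elim(1) unfolding q(3) hp_rq_quotient[OF hF hG q(1)] sc[OF *(3)] sc[OF *(2)]
   using q by simp
 qed
 show ?thesis unfolding regular_at_def using assms(2) hF hG 1 2 3 by blast
qed

lemma rat_germ_base: assumes "rat_germ C h" shows "rat_germ S (\<lambda>s. h (base_pt s))"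
proof -
 obtain p where p: "p \<in> C" "RF C h p = Some (h p)"
  using C.generic_ex[OF C.RF_generic[OF assms]] by blast
 show ?thesis
  by (rule S.regular_at_germ[OF regular_at_base[OF p(2)[unfolded C.RF_Some] pt_in[OF p(1)] base_pt_pt]])
qed

lemma regular_at_yc:
 assumes "p \<in> C" "u1 \<noteq> 0" shows "regular_at S yc (rq p u0 u1) (u0 / u1)"
proof -
 obtain i where i: "crd p i \<noteq> 0" by (rule rep_point_coord)
 have nz: "u0 \<noteq> 0 \<or> u1 \<noteq> 0" using assms by simp
 have 1: "U1 i (crd (rq p u0 u1)) \<noteq> 0"
  using hp_rq_zero_iff[OF hp_U(2) nz] i assms by (simp add: U_sq)
 have 2: "u0 / u1 = U0 i (crd (rq p u0 u1)) / U1 i (crd (rq p u0 u1))"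
  using hp_rq_quotient[OF hp_U(1) hp_U(2) nz] i by (simp add: U_sq)
 have 3: "\<forall>\<^sub>S q. yc q = U0 i (crd q) / U1 i (crd q)"
  using S.generic_nonzero[OF hp_U(2) rq_in[OF assms(1) nz] 1] S.generic_in
 proof eventually_elim
  case (elim q)
  obtain p v0 v1 where q: "v0 \<noteq> 0 \<or> v1 \<noteq> 0" "q = rq p v0 v1" using elim(2) by (elim S_E) blast
  have "crd p i \<noteq> 0" using elim(1) hp_rq_zero_iff[OF hp_U(2) q(1)] q(2) by (auto simp: U_sq)
  thus ?case unfolding q(2) hp_rq_quotient[OF hp_U(1) hp_U(2) q(1)] yc_rq[OF q(1)]
   by (simp add: U_sq)
 qed
 show ?thesis unfolding regular_at_def using rq_in[OF assms(1) nz] 1 2 3 hp_U by blast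
qed

lemma rat_germ_yc: "rat_germ S yc"
proof -
 obtain p where "p \<in> C" using C.nonempty by auto
 thus ?thesis using S.regular_at_germ[OF regular_at_yc[of p 1]] by simp
qed

lemma from_base_RF:
 assumes "rat_germ C h" shows "from_base C (RF C h) = RF S (\<lambda>s. h (base_pt s))"
 unfolding from_base_def RF_def[of S]
proof (rule S.rat_ext_cong)
 show "\<forall>\<^sub>S q. (if q \<in> S then RF C h (base_pt q) else None) = Some (h (base_pt q))"
  using generic_base[OF C.RF_generic[OF assms]] S.generic_in by eventually_elim simp
qed

definition yfun :: ratfun where
 "yfun = (\<lambda>w. if w \<in> proj_space 1 \<and> \<gamma> * crd w 0 + \<delta> * crd w 1 \<noteq> 0
         then Some ((\<alpha> * crd w 0 + \<beta> * crd w 1) /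
              (\<gamma> * crd w 0 + \<delta> * crd w 1))
         else None)"

lemma from_fibre_RF: "from_fibre C yfun = RF S yc"
 unfolding from_fibre_def RF_def[of S]
proof (rule S.rat_ext_cong)
 show "\<forall>\<^sub>S q. (if q \<in> S then yfun (fibre_pt q) else None) = Some (yc q)"
  using generic_pt
 proof eventually_elim
  case (elim q)
  then obtain p u where q: "p \<in> C" "q = pt p u" by blast
  have nz: "cw0 u 1 \<noteq> 0 \<or> cw1 u 1 \<noteq> 0" by (rule cw_nonzero) simp
  obtain c where c: "c \<noteq> 0" "crd (P1pt (cw0 u 1) (cw1 u 1)) 0 = c * cw0 u 1"
   "crd (P1pt (cw0 u 1) (cw1 u 1)) 1 = c * cw1 u 1"
   using rep_P1pt[OF nz] .
  have f: "fibre_pt q = P1pt (cw0 u 1) (cw1 u 1)"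
   unfolding q(2) pt_def rq_def by (rule fibre_pt_rp[OF nz])
  have "\<gamma> * crd (fibre_pt q) 0 + \<delta> * crd (fibre_pt q) 1 = c * (\<gamma> * cw0 u 1 + \<delta> * cw1 u 1)"
   unfolding f c by (simp add: algebra_simps)
  hence "\<gamma> * crd (fibre_pt q) 0 + \<delta> * crd (fibre_pt q) 1 \<noteq> 0" using c(1) by (simp add: cw_u)
  moreover have "q \<in> S" using pt_in[OF q(1)] q(2) by simp
  moreover have "fibre_pt q \<in> proj_space 1" unfolding f by (rule P1pt_in[OF nz])
  ultimately show ?case by (simp add: yfun_def yc_def del: One_nat_def)
 qed
qed

end

lemma regular_atI:
 "p \<in> S ==> hp d F ==> hp d G ==> G (crd p) \<noteq> 0 ==> z = F (crd p) / G (crd p) ==>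
  \<forall>\<^sub>F q in generic S. h q = F (crd q) / G (crd q) ==> regular_at S h p z"
 unfolding regular_at_def by blast

context ruled_surface
begin

section \<open>Vector fields tangent to the fibration\<close>

definition dy :: "(point => complex) => point => complex" where
 "dy h s = deriv (\<lambda>u. h (pt (base_pt s) u)) (yc s)"

definition dop :: "(point => complex) => vfield" where
 "dop v = (\<lambda>g \<in> carrier (function_field S). RF S (\<lambda>s. v s * dy (\<lambda>q. the (g q)) s))"

text \<open>The exceptions in a fibre are finite, hence closed, so a generic property holds on a
  Euclidean neighbourhood within the fibre. This allows generic equations to be differentiated along
  fibres.\<close>

lemma generic_nhds:
 assumes "eventually P (generic S)"
 shows "\<forall>\<^sub>S s. \<exists>p\<in>C. \<exists>u. s = pt p u \<and> (\<forall>\<^sub>F u' in nhds u. P (pt p u'))"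
 using generic_base[OF generic_fibre[OF assms]] assms generic_pt
proof eventually_elim
 case (elim s)
 then obtain p u where s: "p \<in> C" "s = pt p u" by blast
 let ?B = "{u. \<not> P (pt p u)}"
 have "open (- ?B)" using elim(1) s by (intro open_Compl finite_imp_closed) simp
 moreover have "u \<in> - ?B" using elim(2) s by simp
 ultimately have "\<forall>\<^sub>F u' in nhds u. u' \<in> - ?B" by (rule eventually_nhds_in_open)
 hence "\<forall>\<^sub>F u' in nhds u. P (pt p u')" by eventually_elim simp
 thus ?case using s by blast
qed

lemma dy_cong:
 assumes "\<forall>\<^sub>S s. h s = k s" shows "\<forall>\<^sub>S s. dy h s = dy k s"
 using generic_nhds[OF assms]
proof eventually_elim
 case (elim s)
 then obtain p u where s: "p \<in> C" "s = pt p u" "\<forall>\<^sub>F u' in nhds u. h (pt p u') = k (pt p u')" by blast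
 show ?case unfolding dy_def s(2) base_pt_pt yc_pt by (rule deriv_cong_ev[OF s(3)]) simp
qed

lemma sq_deriv:
 assumes "DERIV c0 t :> d0" "DERIV c1 t :> d1"
 shows "DERIV (\<lambda>\<tau>. sq x (c0 \<tau>) (c1 \<tau>) k) t :> sq x d0 d1 k"
proof -
 let ?D = "\<alpha> * \<delta> - \<beta> * \<gamma>"
 have "DERIV (\<lambda>\<tau>. cw0 (c0 \<tau>) (c1 \<tau>)) t :> cw0 d0 d1"
  "DERIV (\<lambda>\<tau>. cw1 (c0 \<tau>) (c1 \<tau>)) t :> cw1 d0 d1"
  unfolding cw0_def cw1_def
  by (intro DERIV_cdivide DERIV_diff DERIV_cmult assms)+
 thus ?thesis unfolding sq_eq by (cases "even k") (simp_all add: DERIV_cmult)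
qed

lemma quotient_sq_homogeneous:
 assumes "hp d F" "hp d G" "b \<noteq> 0"
 shows "F (sq x a b) / G (sq x a b) = F (sq x (a / b) 1) / G (sq x (a / b) 1)"
proof -
 have "sq x a b = (\<lambda>k. b * sq x (a / b) 1 k)" using sq_scale[of x b "a / b" 1] assms(3) by simp
 thus ?thesis using hp_scale[OF assms(1), of b] hp_scale[OF assms(2), of b] assms(3) by simp
qed

lemma quotient_sq_deriv_ex:
 assumes "hp d F" "hp d G" "G (sq x u 1) \<noteq> 0"
 shows "\<exists>K. (DERIV (\<lambda>u. F (sq x u 1) / G (sq x u 1)) u :> K)"
proof -
 obtain P where P: "\<And>u. F (sq x u 1) = poly P u" using hp_sq_poly[OF assms(1)] by blast
 obtain R where R: "\<And>u. G (sq x u 1) = poly R u" using hp_sq_poly[OF assms(2)] by blast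
 have "DERIV (\<lambda>u. poly P u / poly R u) u :> (poly (pderiv P) u * poly R u - poly P u * poly (pderiv R) u) / (poly R u * poly R u)"
  by (rule DERIV_divide[OF poly_DERIV poly_DERIV]) (use assms(3) R in simp)
 thus ?thesis unfolding P R by blast
qed

text \<open>
 A vector field whose direction in the homogeneous coordinates of the fibre is given by forms
 (up to the common denominator \<open>Q\<close>) is holomorphic wherever \<open>Q\<close> does not vanish, including
 at the points at infinity of the fibres.
\<close>

lemma linear_field_regular:
 assumes n: "\<And>i. hp (Suc e) (n0 i)" "\<And>i. hp (Suc e) (n1 i)" and Q: "hp e Q"
  and M: "\<And>x u0 u1 i. n0 i (sq x u0 u1) = x i * M0 x u0 u1"
   "\<And>x u0 u1 i. n1 i (sq x u0 u1) = x i * M1 x u0 u1"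
  and v: "\<forall>\<^sub>S s. v s * Q (sq (crd (base_pt s)) (yc s) 1) =
   M0 (crd (base_pt s)) (yc s) 1 - yc s * M1 (crd (base_pt s)) (yc s) 1"
  and h: "regular_at S h (rq p u0 u1) z" and p: "p \<in> C" and u: "u0 \<noteq> 0 \<or> u1 \<noteq> 0"
  and Qn: "Q (sq (crd p) u0 u1) \<noteq> 0"
 shows "\<exists>w. regular_at S (\<lambda>s. v s * dy h s) (rq p u0 u1) w \<and>
  (\<forall>c0 c1 t. c0 t = u0 --> c1 t = u1 -->
   (DERIV c0 t :> M0 (crd p) u0 u1 / Q (sq (crd p) u0 u1)) -->
   (DERIV c1 t :> M1 (crd p) u0 u1 / Q (sq (crd p) u0 u1)) -->
   (DERIV (\<lambda>\<tau>. the (RF S h (rq p (c0 \<tau>) (c1 \<tau>)))) t :> w))"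
proof -
 let ?s = "rq p u0 u1" and ?x = "crd p"
 obtain d F G where FG: "hp d F" "hp d G" "G (crd ?s) \<noteq> 0"
   "\<forall>\<^sub>S q. h q = F (crd q) / G (crd q)"
  using h unfolding regular_at_def by blast
 have s: "?s \<in> S" by (rule rq_in[OF p u])
 have Gn: "G (sq ?x u0 u1) \<noteq> 0" using FG(3) hp_rq_zero_iff[OF FG(2) u] by blast
 \<comment> \<open>The direction \<open>(n0, n1)\<close> in the fibre coordinates, lifted to the
   Segre coordinates. It consists of forms, so \<open>hp_deriv_ex\<close> applies to it.\<close>
 define N where "N k z = (if even k then cw0 (n0 (k div 2) z) (n1 (k div 2) z)
   else cw1 (n0 (k div 2) z) (n1 (k div 2) z))" for k z
 have lin: "hp (Suc e) (\<lambda>z. (a * n0 i z - b * n1 i z) / c)" "hp (Suc e) (\<lambda>z. (a * n1 i z - b * n0 i z) / c)" for a b c i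
  using hp_cmult[OF hp_diff[OF hp_cmult[OF n(1)] hp_cmult[OF n(2)]], of "inverse c" a i b i]
   hp_cmult[OF hp_diff[OF hp_cmult[OF n(2)] hp_cmult[OF n(1)]], of "inverse c" a i b i]
  by (simp_all add: divide_inverse mult.commute)
 have hN: "hp (Suc e) (N k)" for k
  unfolding N_def[abs_def] cw0_def cw1_def by (cases "even k") (simp_all add: lin)
 have Nsq: "N k (sq x a b) = sq x (M0 x a b) (M1 x a b) k" for k x a b
  unfolding N_def M cw_scale sq_eq[of x "M0 x a b"] by simp
 obtain LF where LF: "hp (d + e) LF" "\<forall>(c :: complex => nat => complex) t k.
  (\<forall>i. (DERIV (\<lambda>s. c s i) t :> k * N i (c t))) -->
   (DERIV (\<lambda>s. F (c s)) t :> k * LF (c t))"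
  using hp_deriv_ex[where N = N, OF FG(1) hN] by blast
 obtain LG where LG: "hp (d + e) LG" "\<forall>(c :: complex => nat => complex) t k.
  (\<forall>i. (DERIV (\<lambda>s. c s i) t :> k * N i (c t))) -->
   (DERIV (\<lambda>s. G (c s)) t :> k * LG (c t))"
  using hp_deriv_ex[where N = N, OF FG(2) hN] by blast
 \<comment> \<open>The quotient rule for \<open>F / G\<close> in the direction \<open>N\<close>
   gives \<open>A / B\<close>; the field applied to \<open>h\<close> will be
   \<open>A / (B * Q)\<close>.\<close>
 define A where "A = (\<lambda>z. LF z * G z - F z * LG z)"
 define B where "B = (\<lambda>z. G z * G z)"
 have qd: "DERIV (\<lambda>\<tau>. F (sq x (c0 \<tau>) (c1 \<tau>)) / G (sq x (c0 \<tau>) (c1 \<tau>))) t :> k * (A (sq x (c0 t) (c1 t)) / B (sq x (c0 t) (c1 t)))"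
  if "DERIV c0 t :> k * M0 x (c0 t) (c1 t)"
   "DERIV c1 t :> k * M1 x (c0 t) (c1 t)" "G (sq x (c0 t) (c1 t)) \<noteq> 0"
  for x c0 c1 t k
 proof -
  have c: "DERIV (\<lambda>\<tau>. sq x (c0 \<tau>) (c1 \<tau>) i) t :> k * N i (sq x (c0 t) (c1 t))" for i
   using sq_deriv[OF that(1,2)] unfolding Nsq sq_scale by blast
  from DERIV_divide[OF LF(2)[rule_format, of "\<lambda>\<tau>. sq x (c0 \<tau>) (c1 \<tau>)", OF c] LG(2)[rule_format, of "\<lambda>\<tau>. sq x (c0 \<tau>) (c1 \<tau>)", OF c] that(3)]
  moreover have "(k * LF z * G z - F z * (k * LG z)) / (G z * G z) = k * (A z / B z)" for z
  proof -
   have "k * LF z * G z - F z * (k * LG z) = k * A z" unfolding A_def by (simp add: algebra_simps)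
   thus ?thesis unfolding B_def by simp
  qed
  ultimately show ?thesis by simp
 qed
 have hA: "hp (d + d + e) A" unfolding A_def
  by (intro hp_diff hp_mult'[OF LF(1) FG(2)] hp_mult'[OF FG(1) LG(1)]) auto
 have hB: "hp (d + d + e) (\<lambda>z. B z * Q z)" unfolding B_def
  by (intro hp_mult'[OF hp.mult[OF FG(2) FG(2)] Q]) simp
 have Qgen: "\<forall>\<^sub>S q. Q (crd q) \<noteq> 0"
  using S.generic_nonzero[OF Q s] Qn hp_rq_zero_iff[OF Q u] by blast
 have gen: "\<forall>\<^sub>S q. v q * dy h q = A (crd q) / (B (crd q) * Q (crd q))"
  using generic_nhds[OF FG(4)] S.generic_nonzero[OF FG(2) s FG(3)] v Qgen
 proof (eventually_elim)
  case (elim q)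
  then obtain p u where q: "p \<in> C" "q = pt p u"
   "\<forall>\<^sub>F u' in nhds u. h (pt p u') = F (crd (pt p u')) / G (crd (pt p u'))" by blast
  let ?x = "crd p"
  have G: "G (sq ?x u 1) \<noteq> 0" using elim(2) hp_pt_zero_iff[OF FG(2)] q(2) by simp
  have Qz: "Q (sq ?x u 1) \<noteq> 0" using elim(4) hp_pt_zero_iff[OF Q] q(2) by simp
  define K where "K u = F (sq ?x u 1) / G (sq ?x u 1)" for u
  obtain K1 where K1: "DERIV K u :> K1"
   using quotient_sq_deriv_ex[OF FG(1,2) G] unfolding K_def[abs_def] by blast
  have "\<forall>\<^sub>F u' in nhds u. h (pt p u') = K u'"
   using q(3) unfolding K_def hp_pt_quotient[OF FG(1,2)] by simp
  hence "dy h q = deriv K u"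
   unfolding dy_def q(2) base_pt_pt yc_pt by (rule deriv_cong_ev) simp
  hence dyh: "dy h q = K1" using DERIV_imp_deriv[OF K1] by simp
  let ?m0 = "M0 ?x u 1" and ?m1 = "M1 ?x u 1"
  \<comment> \<open>The affine coordinate of the straight curve with homogeneous coordinates
    \<open>u + \<tau> m0\<close> and \<open>1 + \<tau> m1\<close>. Its velocity
    \<open>m0 - u m1\<close> is the right-hand side of the hypothesis \<open>v\<close>, so computing
    one derivative in homogeneous and in affine coordinates gives the claim.\<close>
  let ?g = "\<lambda>\<tau>. (u + \<tau> * ?m0) / (1 + \<tau> * ?m1)"
  have g: "DERIV ?g 0 :> (?m0 - u * ?m1)"
   by (auto intro!: derivative_eq_intros)
  have "DERIV K (?g 0) :> K1" using K1 by simp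
  from DERIV_chain2[OF this g]
  have 1: "DERIV (\<lambda>\<tau>. K (?g \<tau>)) 0 :> K1 * (?m0 - u * ?m1)" .
  have "DERIV (\<lambda>\<tau>. F (sq ?x (u + \<tau> * ?m0) (1 + \<tau> * ?m1)) / G (sq ?x (u + \<tau> * ?m0) (1 + \<tau> * ?m1))) 0 :> 1 * (A (sq ?x (u + 0 * ?m0) (1 + 0 * ?m1)) / B (sq ?x (u + 0 * ?m0) (1 + 0 * ?m1)))"
   by (rule qd) (use G in \<open>auto intro!: derivative_eq_intros\<close>)
  hence 2: "DERIV (\<lambda>\<tau>. F (sq ?x (u + \<tau> * ?m0) (1 + \<tau> * ?m1)) / G (sq ?x (u + \<tau> * ?m0) (1 + \<tau> * ?m1))) 0 :> A (sq ?x u 1) / B (sq ?x u 1)" by simp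
  have "isCont (\<lambda>\<tau>. 1 + \<tau> * ?m1) 0" by (intro continuous_intros)
  hence "\<forall>\<^sub>F \<tau> in at 0. 1 + \<tau> * ?m1 \<noteq> 0"
   by (intro tendsto_imp_eventually_ne[of _ 1]) (auto simp: isCont_def)
  hence "\<forall>\<^sub>F \<tau> in nhds 0. 1 + \<tau> * ?m1 \<noteq> 0" by (simp add: eventually_nhds_conv_at)
  hence "\<forall>\<^sub>F \<tau> in nhds 0. F (sq ?x (u + \<tau> * ?m0) (1 + \<tau> * ?m1)) / G (sq ?x (u + \<tau> * ?m0) (1 + \<tau> * ?m1)) = K (?g \<tau>)"
   by eventually_elim (unfold K_def, rule quotient_sq_homogeneous[OF FG(1,2)])
  from DERIV_cong_ev[OF refl this refl, THEN iffD1, OF 2]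
  have "DERIV (\<lambda>\<tau>. K (?g \<tau>)) 0 :> A (sq ?x u 1) / B (sq ?x u 1)" .
  from DERIV_unique[OF this 1]
  have "A (sq ?x u 1) / B (sq ?x u 1) = K1 * (v q * Q (sq ?x u 1))"
   using elim(3) by (simp add: q(2))
  hence "v q * dy h q = A (sq ?x u 1) / (B (sq ?x u 1) * Q (sq ?x u 1))"
  proof -
   have "v q * dy h q = K1 * (v q * Q (sq ?x u 1)) / Q (sq ?x u 1)" unfolding dyh using Qz by simp
   also have "\<dots> = A (sq ?x u 1) / B (sq ?x u 1) / Q (sq ?x u 1)"
    using \<open>A (sq ?x u 1) / B (sq ?x u 1) = K1 * (v q * Q (sq ?x u 1))\<close> by simp
   finally show ?thesis by simp
  qed
  also have "\<dots> = A (crd q) / (B (crd q) * Q (crd q))"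
   using hp_pt_quotient[OF hA hB, of p u] by (simp add: q(2))
  finally show ?case .
 qed
 let ?w = "A (sq ?x u0 u1) / (B (sq ?x u0 u1) * Q (sq ?x u0 u1))"
 have reg: "regular_at S (\<lambda>s. v s * dy h s) ?s ?w"
 proof (rule regular_atI[OF s hA hB _ _ gen])
  show "B (crd ?s) * Q (crd ?s) \<noteq> 0"
   using FG(3) Qn hp_rq_zero_iff[OF Q u] by (simp add: B_def)
  show "?w = A (crd ?s) / (B (crd ?s) * Q (crd ?s))"
   using hp_rq_quotient[OF hA hB u, of p] by simp
 qed
 show ?thesis
 proof (intro exI[of _ ?w] conjI reg allI impI)
  fix c0 c1 t assume c: "c0 t = u0" "c1 t = u1"
   "DERIV c0 t :> M0 ?x u0 u1 / Q (sq ?x u0 u1)"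
   "DERIV c1 t :> M1 ?x u0 u1 / Q (sq ?x u0 u1)"
  have D: "DERIV (\<lambda>\<tau>. F (sq ?x (c0 \<tau>) (c1 \<tau>)) / G (sq ?x (c0 \<tau>) (c1 \<tau>))) t :> (1 / Q (sq ?x u0 u1)) * (A (sq ?x (c0 t) (c1 t)) / B (sq ?x (c0 t) (c1 t)))"
   by (rule qd) (use c Gn in simp_all)
  have cont: "(c0 \<longlongrightarrow> u0) (at t)" "(c1 \<longlongrightarrow> u1) (at t)"
   using DERIV_isCont[OF c(3)] DERIV_isCont[OF c(4)] c(1,2) by (simp_all add: isCont_def)
  have e1: "\<forall>\<^sub>F \<tau> in at t. c0 \<tau> \<noteq> 0 \<or> c1 \<tau> \<noteq> 0"
   using u
  proof
   assume "u0 \<noteq> 0"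
   from tendsto_imp_eventually_ne[OF cont(1) this] show ?thesis by eventually_elim simp
  next
   assume "u1 \<noteq> 0"
   from tendsto_imp_eventually_ne[OF cont(2) this] show ?thesis by eventually_elim simp
  qed
  have "((\<lambda>\<tau>. G (sq ?x (c0 \<tau>) (c1 \<tau>))) \<longlongrightarrow> G (sq ?x u0 u1)) (at t)"
  proof -
   have "DERIV (\<lambda>\<tau>. sq ?x (c0 \<tau>) (c1 \<tau>) i) t :> (1 / Q (sq ?x u0 u1)) * N i (sq ?x (c0 t) (c1 t))" for i
    using sq_deriv[OF c(3,4), of ?x i] sq_scale[of ?x "1 / Q (sq ?x u0 u1)" "M0 ?x u0 u1" "M1 ?x u0 u1"] unfolding Nsq c(1,2) by simp
   from DERIV_isCont[OF LG(2)[rule_format, of "\<lambda>\<tau>. sq ?x (c0 \<tau>) (c1 \<tau>)", OF this]] show ?thesis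
    by (simp add: isCont_def c(1,2))
  qed
  from tendsto_imp_eventually_ne[OF this Gn] e1
  have "\<forall>\<^sub>F \<tau> in at t. G (sq ?x (c0 \<tau>) (c1 \<tau>)) \<noteq> 0 \<and> (c0 \<tau> \<noteq> 0 \<or> c1 \<tau> \<noteq> 0)"
   by eventually_elim simp
  hence "\<forall>\<^sub>F \<tau> in nhds t. G (sq ?x (c0 \<tau>) (c1 \<tau>)) \<noteq> 0 \<and> (c0 \<tau> \<noteq> 0 \<or> c1 \<tau> \<noteq> 0)"
   using Gn u by (simp add: eventually_nhds_conv_at c(1,2))
  hence ev: "\<forall>\<^sub>F \<tau> in nhds t. the (RF S h (rq p (c0 \<tau>) (c1 \<tau>))) =
    F (sq ?x (c0 \<tau>) (c1 \<tau>)) / G (sq ?x (c0 \<tau>) (c1 \<tau>))"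
  proof eventually_elim
   case (elim \<tau>)
   hence nz: "c0 \<tau> \<noteq> 0 \<or> c1 \<tau> \<noteq> 0" by simp
   have "regular_at S h (rq p (c0 \<tau>) (c1 \<tau>)) (F (sq ?x (c0 \<tau>) (c1 \<tau>)) / G (sq ?x (c0 \<tau>) (c1 \<tau>)))"
    by (rule regular_atI[OF rq_in[OF p nz] FG(1,2) _ _ FG(4)])
     (use elim hp_rq_zero_iff[OF FG(2) nz] hp_rq_quotient[OF FG(1,2) nz] in auto)
   thus ?case by (simp add: S.RF_Some[symmetric])
  qed
  show "DERIV (\<lambda>\<tau>. the (RF S h (rq p (c0 \<tau>) (c1 \<tau>)))) t :> ?w"
   using DERIV_cong_ev[OF refl ev refl, THEN iffD2, OF D] c(1,2) by (simp add: mult.commute)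
 qed
qed

lemma dy_has_deriv:
 assumes "rat_germ S h"
 shows "\<forall>\<^sub>S s. (DERIV (\<lambda>u. h (pt (base_pt s) u)) (yc s) :> dy h s)"
proof -
 obtain d F G where FG: "hp d F" "hp d G"
   "\<forall>\<^sub>S q. G (crd q) \<noteq> 0 \<and> h q = F (crd q) / G (crd q)"
  using assms unfolding rat_germ_def by blast
 show ?thesis using generic_nhds[OF FG(3)]
 proof eventually_elim
  case (elim q)
  then obtain p u where q: "p \<in> C" "q = pt p u"
   "\<forall>\<^sub>F u' in nhds u. G (crd (pt p u')) \<noteq> 0 \<and> h (pt p u') = F (crd (pt p u')) / G (crd (pt p u'))" by blast
  have G: "G (sq (crd p) u 1) \<noteq> 0"
   using eventually_nhds_x_imp_x[OF q(3)] hp_pt_zero_iff[OF FG(2)] by blast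
  have ev: "\<forall>\<^sub>F u' in nhds u. h (pt p u') = F (sq (crd p) u' 1) / G (sq (crd p) u' 1)"
   using q(3) unfolding hp_pt_quotient[OF FG(1,2)] by eventually_elim simp
  obtain K where "DERIV (\<lambda>u. F (sq (crd p) u 1) / G (sq (crd p) u 1)) u :> K"
   using quotient_sq_deriv_ex[OF FG(1,2) G] by blast
  hence K: "DERIV (\<lambda>u. h (pt p u)) u :> K"
   using DERIV_cong_ev[OF refl ev refl] by blast
  thus ?case using DERIV_imp_deriv[OF K] by (simp add: dy_def q(2))
 qed
qed

lemma dy_eqI:
 assumes "rat_germ S h"
  and "\<forall>\<^sub>S s. (DERIV (\<lambda>u. h (pt (base_pt s) u)) (yc s) :> k s)"
 shows "\<forall>\<^sub>S s. dy h s = k s"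
 using dy_has_deriv[OF assms(1)] assms(2) by eventually_elim (rule DERIV_unique)

text \<open>In homogeneous coordinates the field \<open>d/dy\<close> has the direction
  \<open>(u1, 0)\<close> with denominator \<open>1\<close>, so it has no pole, not even at infinity.
  For \<open>c * yc\<close> times this field, in the next lemma, the direction is
  \<open>(c * u0, 0)\<close>.\<close>

lemma dy_regular:
 assumes "regular_at S h s z"
 shows "\<exists>w. regular_at S (dy h) s w"
proof -
 have "s \<in> S" using assms by (simp add: regular_at_def)
 then obtain p u0 u1 where s: "p \<in> C" "u0 \<noteq> 0 \<or> u1 \<noteq> 0" "s = rq p u0 u1" by (rule S_E)
 have "\<exists>w. regular_at S (\<lambda>s. (\<lambda>_. 1) s * dy h s) (rq p u0 u1) w \<and>
  (\<forall>c0 c1 t. c0 t = u0 --> c1 t = u1 -->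
   (DERIV c0 t :> (\<lambda>x u0 u1. u1) (crd p) u0 u1 / (\<lambda>_. 1) (sq (crd p) u0 u1)) -->
   (DERIV c1 t :> (\<lambda>x u0 u1. 0) (crd p) u0 u1 / (\<lambda>_. 1) (sq (crd p) u0 u1)) -->
   (DERIV (\<lambda>\<tau>. the (RF S h (rq p (c0 \<tau>) (c1 \<tau>)))) t :> w))"
  by (rule linear_field_regular[where e = 0 and ?n0.0 = U1 and ?n1.0 = "\<lambda>_ _. 0"])
   (use assms s in \<open>auto simp: U_sq hp_U intro: hp.intros\<close>)
 thus ?thesis using s(3) by auto
qed

lemma yc_dy_regular:
 assumes "regular_at S h s z"
 shows "\<exists>w. regular_at S (\<lambda>s. c * yc s * dy h s) s w"
proof -
 have "s \<in> S" using assms by (simp add: regular_at_def)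
 then obtain p u0 u1 where s: "p \<in> C" "u0 \<noteq> 0 \<or> u1 \<noteq> 0" "s = rq p u0 u1" by (rule S_E)
 have "\<exists>w. regular_at S (\<lambda>s. (\<lambda>s. c * yc s) s * dy h s) (rq p u0 u1) w \<and>
  (\<forall>c0 c1 t. c0 t = u0 --> c1 t = u1 -->
   (DERIV c0 t :> (\<lambda>x u0 u1. c * u0) (crd p) u0 u1 / (\<lambda>_. 1) (sq (crd p) u0 u1)) -->
   (DERIV c1 t :> (\<lambda>x u0 u1. 0) (crd p) u0 u1 / (\<lambda>_. 1) (sq (crd p) u0 u1)) -->
   (DERIV (\<lambda>\<tau>. the (RF S h (rq p (c0 \<tau>) (c1 \<tau>)))) t :> w))"
  by (rule linear_field_regular[where e = 0 and ?n0.0 = "\<lambda>i z. c * U0 i z" and ?n1.0 = "\<lambda>_ _. 0"])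
   (use assms s in \<open>auto simp: U_sq hp_U intro: hp.intros hp_cmult\<close>)
 thus ?thesis using s(3) by auto
qed

lemma rat_germ_dy: assumes "rat_germ S h" shows "rat_germ S (dy h)"
proof -
 obtain s where "s \<in> S" "RF S h s = Some (h s)" using S.generic_ex[OF S.RF_generic[OF assms]] by blast
 thus ?thesis using dy_regular S.regular_at_germ S.RF_Some by blast
qed

lemma dy_add:
 assumes "rat_germ S h" "rat_germ S k"
 shows "\<forall>\<^sub>S s. dy (\<lambda>s. h s + k s) s = dy h s + dy k s"
proof (rule dy_eqI)
 show "\<forall>\<^sub>S s. (DERIV (\<lambda>u. h (pt (base_pt s) u) + k (pt (base_pt s) u)) (yc s) :> dy h s + dy k s)"
  using dy_has_deriv[OF assms(1)] dy_has_deriv[OF assms(2)] by eventually_elim (rule DERIV_add)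
qed (intro S.rat_germ_add assms)

lemma dy_mult:
 assumes "rat_germ S h" "rat_germ S k"
 shows "\<forall>\<^sub>S s. dy (\<lambda>s. h s * k s) s = dy h s * k s + h s * dy k s"
proof (rule dy_eqI)
 show "\<forall>\<^sub>S s. (DERIV (\<lambda>u. h (pt (base_pt s) u) * k (pt (base_pt s) u)) (yc s) :> dy h s * k s + h s * dy k s)"
  using dy_has_deriv[OF assms(1)] dy_has_deriv[OF assms(2)] generic_pt
 proof eventually_elim
  case (elim s)
  then obtain p u where "s = pt p u" by blast
  thus ?case using DERIV_mult[OF elim(1,2)] by (simp add: algebra_simps)
 qed
qed (intro S.rat_germ_mult assms)

lemma dy_base: "rat_germ C h ==> \<forall>\<^sub>S s. dy (\<lambda>s. h (base_pt s)) s = 0"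
 by (rule dy_eqI) (auto simp: rat_germ_base)

lemma dy_const: "dy (\<lambda>_. c) s = 0"
 by (simp add: dy_def)

lemma dy_yc: "dy yc s = 1"
 by (simp add: dy_def)

lemma dop_RF:
 assumes "rat_germ S h" "rat_germ S v"
 shows "dop v (RF S h) = RF S (\<lambda>s. v s * dy h s)"
proof -
 have "\<forall>\<^sub>S s. the (RF S h s) = h s" using S.RF_generic[OF assms(1)] by eventually_elim simp
 from dy_cong[OF this] have "RF S (\<lambda>s. v s * dy (\<lambda>q. the (RF S h q)) s) = RF S (\<lambda>s. v s * dy h s)"
  by (intro S.RF_cong) (auto elim: eventually_mono)
 thus ?thesis using S.RF_carrier[OF assms(1)] by (simp add: dop_def)
qed

lemma dop_extensional: "dop v \<in> extensional (carrier (function_field S))"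
 by (simp add: dop_def)

lemma dop_vf: assumes v: "rat_germ S v" shows "rational_vector_field S (dop v)"
 unfolding rational_vector_field_def Let_def
proof (intro conjI ballI allI)
 show "dop v \<in> carrier (function_field S) \<rightarrow>\<^sub>E carrier (function_field S)"
 proof (rule PiE_I)
  fix g assume "g \<in> carrier (function_field S)"
  then obtain h where h: "rat_germ S h" "g = RF S h" by (rule S.carrier_E)
  show "dop v g \<in> carrier (function_field S)"
   unfolding h(2) dop_RF[OF h(1) v] by (intro S.RF_carrier S.rat_germ_mult v rat_germ_dy h)
 qed (simp add: dop_def)
next
 fix g1 g2 assume "g1 \<in> carrier (function_field S)" "g2 \<in> carrier (function_field S)"
 then obtain h k where h: "rat_germ S h" "g1 = RF S h" and k: "rat_germ S k" "g2 = RF S k"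
  by (elim S.carrier_E) blast
 note germs = h(1) k(1) rat_germ_dy v S.rat_germ_intros
 show "dop v (g1 \<oplus>\<^bsub>function_field S\<^esub> g2) = dop v g1 \<oplus>\<^bsub>function_field S\<^esub> dop v g2"
  unfolding h(2) k(2) S.RF_add[OF h(1) k(1)] dop_RF[OF h(1) v] dop_RF[OF k(1) v]
   dop_RF[OF S.rat_germ_add[OF h(1) k(1)] v] S.RF_add[OF S.rat_germ_mult[OF v rat_germ_dy[OF h(1)]] S.rat_germ_mult[OF v rat_germ_dy[OF k(1)]]]
  using dy_add[OF h(1) k(1)] by (intro S.RF_cong) (auto elim!: eventually_mono simp: algebra_simps)
 show "dop v (g1 \<otimes>\<^bsub>function_field S\<^esub> g2) =
   dop v g1 \<otimes>\<^bsub>function_field S\<^esub> g2 \<oplus>\<^bsub>function_field S\<^esub> g1 \<otimes>\<^bsub>function_field S\<^esub> dop v g2"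
  unfolding h(2) k(2) dop_RF[OF h(1) v] dop_RF[OF k(1) v] S.RF_mult[OF h(1) k(1)]
   dop_RF[OF S.rat_germ_mult[OF h(1) k(1)] v]
  using dy_mult[OF h(1) k(1)]
  by (simp add: S.RF_mult S.RF_add germs, intro S.RF_cong) (auto elim!: eventually_mono simp: algebra_simps)
next
 fix c show "dop v (const_fun S c) = \<zero>\<^bsub>function_field S\<^esub>"
  unfolding S.const_fun_RF dop_RF[OF S.rat_germ_const v] S.zero_RF by (simp add: dy_const)
qed

lemma dop_tangent: assumes v: "rat_germ S v" shows "tangent_to_fibration C (dop v)"
 unfolding tangent_to_fibration_def
proof
 fix a assume "a \<in> carrier (function_field C)"
 then obtain h where h: "rat_germ C h" "a = RF C h" by (rule C.carrier_E)
 show "dop v (from_base C a) = \<zero>\<^bsub>function_field S\<^esub>"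
  unfolding h(2) from_base_RF[OF h(1)] dop_RF[OF rat_germ_base[OF h(1)] v] S.zero_RF
  using dy_base[OF h(1)] by (intro S.RF_cong) (auto elim: eventually_mono)
qed

lemma rat_germ_U1_quotient:
 assumes "hp d F" "\<forall>\<^sub>S s. U1 i (crd s) \<noteq> 0"
 shows "rat_germ S (\<lambda>s. F (crd s) / U1 i (crd s) ^ d)"
proof -
 have 1: "hp d (\<lambda>z. U1 i z ^ d)" using hp_power[OF hp_U(2)[of i], of d] by simp
 have "\<forall>\<^sub>S s. U1 i (crd s) ^ d \<noteq> 0 \<and>
   F (crd s) / U1 i (crd s) ^ d = F (crd s) / U1 i (crd s) ^ d"
  using assms(2) by eventually_elim simp
 thus ?thesis unfolding rat_germ_def using assms(1) 1 by blast
qed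

text \<open>A derivation is determined by its values on generators. The functions called
  \<open>good\<close>, on which \<open>X\<close> and \<open>dop v\<close> agree, contain the
  constants, the functions of the base and \<open>yc\<close>; being closed under sums and products
  they contain every form divided by a power of \<open>U1 i\<close>, and a quotient of two such
  functions is reached at the end.\<close>

lemma tangent_vf_dop:
 assumes X: "rational_vector_field S X" and T: "tangent_to_fibration C X"
  and v: "rat_germ S v" "X (RF S yc) = RF S v"
 shows "X = dop v"
proof -
 let ?K = "function_field S"
 have Xadd: "X (g \<oplus>\<^bsub>?K\<^esub> h) = X g \<oplus>\<^bsub>?K\<^esub> X h"
  and Xmult: "X (g \<otimes>\<^bsub>?K\<^esub> h) = (X g \<otimes>\<^bsub>?K\<^esub> h) \<oplus>\<^bsub>?K\<^esub> (g \<otimes>\<^bsub>?K\<^esub> X h)"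
  if "g \<in> carrier ?K" "h \<in> carrier ?K" for g h
  using X that unfolding rational_vector_field_def Let_def by blast+
 have X0: "X \<in> carrier ?K \<rightarrow>\<^sub>E carrier ?K" and Xconst': "\<And>c. X (const_fun S c) = \<zero>\<^bsub>?K\<^esub>"
  using X unfolding rational_vector_field_def Let_def by blast+
 define good where "good h \<longleftrightarrow> rat_germ S h \<and> X (RF S h) = RF S (\<lambda>s. v s * dy h s)" for h
 have good_cong: "good k" if "good h" "\<forall>\<^sub>S s. h s = k s" for h k
 proof -
  have "RF S (\<lambda>s. v s * dy h s) = RF S (\<lambda>s. v s * dy k s)"
   using dy_cong[OF that(2)] by (intro S.RF_cong) (auto elim: eventually_mono)
  thus ?thesis using that S.RF_cong[OF that(2)] S.rat_germ_cong[OF that(2)] by (simp add: good_def)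
 qed
 have good_const: "good (\<lambda>_. c)" for c
  using Xconst' by (simp add: good_def S.rat_germ_const S.const_fun_RF S.zero_RF dy_const)
 have good_add: "good (\<lambda>s. h s + k s)" if "good h" "good k" for h k
 proof -
  have hk: "rat_germ S h" "rat_germ S k" using that by (auto simp: good_def)
  have "X (RF S (\<lambda>s. h s + k s)) = RF S (\<lambda>s. v s * dy h s + v s * dy k s)"
   using that Xadd[OF S.RF_carrier[OF hk(1)] S.RF_carrier[OF hk(2)]] hk
   by (simp add: good_def S.RF_add rat_germ_dy v(1) S.rat_germ_mult)
  also have "\<dots> = RF S (\<lambda>s. v s * dy (\<lambda>s. h s + k s) s)"
   using dy_add[OF hk] by (intro S.RF_cong) (auto elim!: eventually_mono simp: algebra_simps)
  finally show ?thesis using hk by (simp add: good_def S.rat_germ_add)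
 qed
 have Xm: "X (RF S (\<lambda>s. h s * k s)) = RF S (\<lambda>s. a s * k s + h s * b s)"
  if "rat_germ S h" "rat_germ S k" "rat_germ S a" "rat_germ S b" "X (RF S h) = RF S a" "X (RF S k) = RF S b" for h k a b
  using Xmult[OF S.RF_carrier[OF that(1)] S.RF_carrier[OF that(2)]] that
  by (simp add: S.RF_mult S.RF_add S.rat_germ_mult)
 have good_mult: "good (\<lambda>s. h s * k s)" if "good h" "good k" for h k
 proof -
  have hk: "rat_germ S h" "rat_germ S k" using that by (auto simp: good_def)
  have "X (RF S (\<lambda>s. h s * k s)) = RF S (\<lambda>s. (v s * dy h s) * k s + h s * (v s * dy k s))"
   by (rule Xm) (use that hk in \<open>auto simp: good_def rat_germ_dy v(1) S.rat_germ_mult\<close>)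
  also have "\<dots> = RF S (\<lambda>s. v s * dy (\<lambda>s. h s * k s) s)"
   using dy_mult[OF hk] by (intro S.RF_cong) (auto elim!: eventually_mono simp: algebra_simps)
  finally show ?thesis using hk by (simp add: good_def S.rat_germ_mult)
 qed
 have good_base: "good (\<lambda>s. h (base_pt s))" if "rat_germ C h" for h
 proof -
  have "X (RF S (\<lambda>s. h (base_pt s))) = RF S (\<lambda>_. 0)"
   using T C.RF_carrier[OF that] unfolding tangent_to_fibration_def
   by (simp add: from_base_RF[OF that, symmetric] S.zero_RF[symmetric])
  also have "\<dots> = RF S (\<lambda>s. v s * dy (\<lambda>s. h (base_pt s)) s)"
   using dy_base[OF that] by (intro S.RF_cong) (auto elim: eventually_mono)
  finally show ?thesis using rat_germ_base[OF that] by (simp add: good_def)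
 qed
 have good_yc: "good yc" using v rat_germ_yc by (simp add: good_def dy_yc)
 obtain i where i: "\<forall>\<^sub>S s. U1 i (crd s) \<noteq> 0" using U1_generic by blast
 have xi: "\<forall>\<^sub>S s. crd (base_pt s) i \<noteq> 0"
  using i generic_pt by eventually_elim (auto simp: hp_pt_zero_iff[OF hp_U(2)] U_sq)
 have good_form: "good (\<lambda>s. F (crd s) / U1 i (crd s) ^ d)" if "hp d F" for d F
  using that
 proof (induction rule: hp.induct)
  case (zero d)
  thus ?case using good_const[of 0] by simp
 next
  case (const c)
  thus ?case using good_const[of c] by simp
 next
  case (var k)
  obtain p where p: "p \<in> C" "crd p i \<noteq> 0"
   using S.generic_ex[OF xi] base_in by blast
  have b: "rat_germ C (\<lambda>p. crd p (k div 2) / crd p i)"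
   by (rule C.rat_germ_quotient[OF hp_var hp_var p])
  \<comment> \<open>On the affine part of the fibre the coordinate \<open>sq x u 1 k\<close> is a
    base coordinate times an affine function of \<open>u\<close>, with these two
    coefficients.\<close>
  define c0 c1 where "c0 = (if even k then cw0 0 1 else cw1 0 1)" and "c1 = (if even k then cw0 1 0 else cw1 1 0)"
  have "good (\<lambda>s. (crd (base_pt s) (k div 2) / crd (base_pt s) i) * (c0 + c1 * yc s))"
   by (intro good_mult good_add good_const good_yc good_base[OF b])
  thus ?case
  proof (rule good_cong)
   show "\<forall>\<^sub>S s. (crd (base_pt s) (k div 2) / crd (base_pt s) i) * (c0 + c1 * yc s) =
     crd s k / U1 i (crd s) ^ 1"
    using generic_pt
   proof eventually_elim
    case (elim s)
    then obtain p u where s: "p \<in> C" "s = pt p u" by blast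
    have "crd s k / U1 i (crd s) = sq (crd p) u 1 k / U1 i (sq (crd p) u 1)"
     unfolding s(2) by (rule hp_pt_quotient[OF hp_var hp_U(2)])
    moreover have "sq (crd p) u 1 k = crd p (k div 2) * (c0 + c1 * u)"
     unfolding sq_eq c0_def c1_def cw0_def cw1_def
     by (cases "even k") (simp_all add: add_divide_distrib[symmetric] algebra_simps)
    ultimately show ?case by (simp add: s(2) U_sq)
   qed
  qed
 next
  case (add d f g)
  thus ?case using good_add by (simp add: add_divide_distrib)
 next
  case (mult d f e g)
  thus ?case using good_mult[OF mult.IH] by (simp add: power_add)
 qed
 have good_all: "good h" if h: "rat_germ S h" for h
 proof -
  obtain d F G where FG: "hp d F" "hp d G"
   "\<forall>\<^sub>S q. G (crd q) \<noteq> 0 \<and> h q = F (crd q) / G (crd q)"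
   using h unfolding rat_germ_def by blast
  let ?f = "\<lambda>s. F (crd s) / U1 i (crd s) ^ d" and ?g = "\<lambda>s. G (crd s) / U1 i (crd s) ^ d"
  have f: "good ?f" and g: "good ?g" using good_form FG by blast+
  \<comment> \<open>The Leibniz rule applied to the product \<open>h * ?g\<close> determines the
    value of \<open>X\<close> on \<open>h\<close>, because \<open>?g\<close> is generically
    non-zero.\<close>
  have fg: "\<forall>\<^sub>S s. ?f s = h s * ?g s" using FG(3) i by eventually_elim simp
  have gr: "rat_germ S ?g" using g by (simp add: good_def)
  have "X (RF S h) \<in> carrier ?K" using X0 S.RF_carrier[OF h] by blast
  then obtain w where w: "rat_germ S w" "X (RF S h) = RF S w" by (rule S.carrier_E)
  have "RF S (\<lambda>s. v s * dy ?f s) = X (RF S (\<lambda>s. h s * ?g s))"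
   using f S.RF_cong[OF fg] by (simp add: good_def)
  also have "\<dots> = RF S (\<lambda>s. w s * ?g s + h s * (v s * dy ?g s))"
   by (rule Xm) (use h gr w g v(1) in \<open>auto simp: good_def rat_germ_dy S.rat_germ_mult\<close>)
  finally have e: "RF S (\<lambda>s. v s * dy ?f s) = RF S (\<lambda>s. w s * ?g s + h s * (v s * dy ?g s))" .
  have "rat_germ S (\<lambda>s. v s * dy ?f s)" "rat_germ S (\<lambda>s. w s * ?g s + h s * (v s * dy ?g s))"
   by (intro S.rat_germ_add S.rat_germ_mult rat_germ_dy h w(1) v(1) gr rat_germ_U1_quotient[OF FG(1) i])+
  from S.RF_eq_iff[OF this] e
  have "\<forall>\<^sub>S s. v s * dy ?f s = w s * ?g s + h s * (v s * dy ?g s)" by blast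
  hence "\<forall>\<^sub>S s. w s = v s * dy h s"
   using dy_cong[OF fg] dy_mult[OF h gr] FG(3) i
  proof eventually_elim
   case (elim s)
   have "v s * (dy h s * ?g s + h s * dy ?g s) = w s * ?g s + h s * (v s * dy ?g s)"
    using elim(1,2,3) by simp
   hence "(v s * dy h s) * ?g s = w s * ?g s" by (simp add: algebra_simps)
   thus ?case using elim(4,5) by simp
  qed
  hence "RF S w = RF S (\<lambda>s. v s * dy h s)" by (rule S.RF_cong)
  thus ?thesis using h w by (simp add: good_def)
 qed
 show ?thesis
 proof (rule extensionalityI[OF _ dop_extensional])
  show "X \<in> extensional (carrier ?K)" using X0 by (simp add: PiE_def)
  fix g assume "g \<in> carrier ?K"
  then obtain h where h: "rat_germ S h" "g = RF S h" by (rule S.carrier_E)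
  thus "X g = dop v g" using good_all[OF h(1)] dop_RF[OF h(1) v(1)] by (simp add: good_def)
 qed
qed

lemma tangent_vf_E:
 assumes "rational_vector_field S X" "tangent_to_fibration C X"
 obtains v where "rat_germ S v" "X = dop v"
proof -
 have "X \<in> carrier (function_field S) \<rightarrow>\<^sub>E carrier (function_field S)"
  using assms(1) unfolding rational_vector_field_def Let_def by blast
 hence "X (RF S yc) \<in> carrier (function_field S)" using S.RF_carrier[OF rat_germ_yc] by blast
 then obtain v where v: "rat_germ S v" "X (RF S yc) = RF S v" by (rule S.carrier_E)
 thus thesis using that tangent_vf_dop[OF assms v] by blast
qed

lemma dop_yc: "rat_germ S v ==> dop v (RF S yc) = RF S v"
 by (simp add: dop_RF rat_germ_yc dy_yc)

lemma dop_eq_iff: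
 assumes "rat_germ S v" "rat_germ S w"
 shows "dop v = dop w \<longleftrightarrow> (\<forall>\<^sub>S s. v s = w s)"
proof
 assume "dop v = dop w"
 hence "RF S v = RF S w" using dop_yc assms by metis
 thus "\<forall>\<^sub>S s. v s = w s" using S.RF_eq_iff assms by blast
next
 assume "\<forall>\<^sub>S s. v s = w s"
 hence "RF S v = RF S w" by (rule S.RF_cong)
 thus "dop v = dop w"
  using tangent_vf_dop[OF dop_vf[OF assms(1)] dop_tangent[OF assms(1)] assms(2)] dop_yc[OF assms(1)] by simp
qed

lemma partial_y_dop: "partial_y C yfun = dop (\<lambda>_. 1)"
 unfolding partial_y_def from_fibre_RF
proof (rule the_equality)
 show "rational_vector_field S (dop (\<lambda>_. 1)) \<and> tangent_to_fibration C (dop (\<lambda>_. 1)) \<and>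
   dop (\<lambda>_. 1) (RF S yc) = \<one>\<^bsub>function_field S\<^esub>"
  by (simp add: dop_vf dop_tangent dop_yc S.rat_germ_const S.one_RF)
 fix D assume "rational_vector_field S D \<and> tangent_to_fibration C D \<and> D (RF S yc) = \<one>\<^bsub>function_field S\<^esub>"
 thus "D = dop (\<lambda>_. 1)" using tangent_vf_dop[OF _ _ S.rat_germ_const] S.one_RF by simp
qed

lemma vf_scale_dop:
 assumes "rat_germ S r" "rat_germ S v"
 shows "vf_scale S (RF S r) (dop v) = dop (\<lambda>s. r s * v s)"
proof (rule extensionalityI[OF _ dop_extensional])
 show "vf_scale S (RF S r) (dop v) \<in> extensional (carrier (function_field S))" by (simp add: vf_scale_def)
 fix g assume "g \<in> carrier (function_field S)"
 then obtain h where h: "rat_germ S h" "g = RF S h" by (rule S.carrier_E)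
 thus "vf_scale S (RF S r) (dop v) g = dop (\<lambda>s. r s * v s) g"
  using assms by (simp add: vf_scale_def dop_RF S.RF_mult S.RF_carrier rat_germ_dy S.rat_germ_mult mult.assoc)
qed

lemma zero_vf_dop: "zero_vf S = dop (\<lambda>_. 0)"
 by (simp add: zero_vf_def dop_def S.zero_RF)

lemma scale_partial_y: "rat_germ S r ==> vf_scale S (RF S r) (partial_y C yfun) = dop r"
 by (simp add: partial_y_dop vf_scale_dop S.rat_germ_const)

lemma riccati_dop:
 assumes "rat_germ C a" "rat_germ C b" "rat_germ C c"
 shows "riccati_vf C yfun (RF C a) (RF C b) (RF C c) =
  dop (\<lambda>s. a (base_pt s) * (yc s * yc s) + 2 * b (base_pt s) * yc s + c (base_pt s))"
 unfolding riccati_vf_def Let_def from_fibre_RF from_base_RF[OF assms(1)] from_base_RF[OF assms(2)]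
  from_base_RF[OF assms(3)] S.const_fun_RF
 using assms by (simp add: S.RF_mult S.RF_add S.rat_germ_intros rat_germ_base rat_germ_yc scale_partial_y)

lemma discriminant_RF:
 assumes "rat_germ C a" "rat_germ C b" "rat_germ C c"
 shows "discriminant C (RF C a) (RF C b) (RF C c) = RF C (\<lambda>p. b p * b p - a p * c p)"
 unfolding discriminant_def using assms by (simp add: C.RF_mult C.RF_minus C.rat_germ_intros)

end

section \<open>Rational maps\<close>

definition fmap :: "(nat => (nat => complex) => complex) => point => point" where
 "fmap F p = abs_point (\<lambda>i. F i (crd p))"

text \<open>Closedness through the vanishing ideal, with no reference to an ambient
  \<open>P^n\<close> or to chosen equations. In this form it passes to the Segre product and bounds
  the values of extended maps.\<close>

definition zclosed :: "point set => bool" where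
 "zclosed S \<longleftrightarrow> (\<forall>q. (\<forall>e G. hp e G --> (\<forall>p\<in>S. G (crd p) = 0) --> G (crd q) = 0) --> q \<in> S)"

lemma zclosedD:
 "zclosed S ==> (\<And>e G. hp e G ==> (\<And>p. p \<in> S ==> G (crd p) = 0) ==> G (crd q) = 0) ==> q \<in> S"
 unfolding zclosed_def by blast

lemma zclosed_variety:
 assumes "\<forall>F\<in>A. is_form F" "S = proj_space n \<inter> zero_set A"
 shows "zclosed S"
 unfolding zclosed_def
proof (intro allI impI)
 fix q assume q: "\<forall>e G. hp e G --> (\<forall>p\<in>S. G (crd p) = 0) --> G (crd q) = 0"
 have "crd q i = 0" if "i > n" for i
  using q[rule_format, OF hp_var[of i]] assms(2) that by (simp add: proj_space_def)
 moreover have "vanishes F q" if "F \<in> A" for F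
 proof -
  have "is_form F" using assms(1) that by blast
  then obtain d where "homogeneous d F" unfolding is_form_def by blast
  hence "hp d (peval F)" by (rule homogeneous_imp_hp)
  thus ?thesis using q[rule_format, of d "peval F"] assms(2) that by (auto simp: zero_set_def vanishes_def)
 qed
 ultimately show "q \<in> S" using assms(2) by (simp add: proj_space_def zero_set_def)
qed

lemma zclosed_projective_variety: "projective_variety n S ==> zclosed S"
 using zclosed_variety unfolding projective_variety_def by blast

lemma fmap_rep:
 assumes "F i (crd p) \<noteq> 0"
 obtains c where "c \<noteq> 0" "crd (fmap F p) = (\<lambda>i. c * F i (crd p))"
proof -
 have "(\<lambda>i. F i (crd p)) \<noteq> (\<lambda>_. 0)" using assms by (auto simp: fun_eq_iff)
 thus thesis using that rep_abs_point unfolding fmap_def by blast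
qed

lemma hp_fmap_zero_iff:
 assumes "hp d G" "F i (crd p) \<noteq> 0"
 shows "G (crd (fmap F p)) = 0 \<longleftrightarrow> G (\<lambda>i. F i (crd p)) = 0"
proof -
 have "(\<lambda>i. F i (crd p)) \<noteq> (\<lambda>_. 0)" using assms by (auto simp: fun_eq_iff)
 thus ?thesis using hp_abs_zero_iff[OF assms(1)] unfolding fmap_def by blast
qed

context irreducible
begin

lemma regular_map_value_iff:
 "regular_map_value S f p q \<longleftrightarrow> p \<in> S \<and> (\<exists>d F. (\<forall>i. hp d (F i)) \<and> (\<exists>i. F i (crd p) \<noteq> 0) \<and>
   q = fmap F p \<and> (\<forall>\<^sub>G r. f r = Some (fmap F r)))" (is "?L \<longleftrightarrow> ?R")
proof
 assume ?L
 then obtain F d W where *: "p \<in> S" "\<forall>i. homogeneous d (F i)" "\<exists>i. \<not> vanishes (F i) p"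
  "q = form_map F p" "zariski_open_in S W" "W \<noteq> {}"
  "\<forall>r\<in>W. (\<exists>i. \<not> vanishes (F i) r) \<and> f r = Some (form_map F r)"
  unfolding regular_map_value_def by blast
 define G where "G i = peval (F i)" for i
 have e: "form_map F r = fmap G r" for r by (simp add: form_map_def fmap_def G_def)
 have "\<forall>\<^sub>G r. f r = Some (fmap G r)"
  by (rule eventually_mono[OF zariski_open_generic[OF *(5,6)]]) (use *(7) e in simp)
 moreover have "\<forall>i. hp d (G i)" using *(2) homogeneous_imp_hp by (simp add: G_def)
 moreover have "\<exists>i. G i (crd p) \<noteq> 0" using *(3) by (simp add: G_def vanishes_def)
 moreover have "q = fmap G p" using *(4) e by simp
 ultimately show ?R using *(1) by blast
next
 assume ?R
 then obtain d F i where *: "p \<in> S" "\<forall>i. hp d (F i)" "F i (crd p) \<noteq> 0" "q = fmap F p"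
  "\<forall>\<^sub>G r. f r = Some (fmap F r)" by blast
 have "\<forall>i. \<exists>F'. homogeneous d F' \<and> F i = peval F'" using *(2) hp_imp_homogeneous by blast
 then obtain F' where F': "\<And>i. homogeneous d (F' i)" "\<And>i. F i = peval (F' i)" by metis
 have e: "form_map F' r = fmap F r" for r by (simp add: form_map_def fmap_def F'(2))
 have "\<forall>\<^sub>G r. F i (crd r) \<noteq> 0 \<and> f r = Some (fmap F r)"
  by (rule eventually_conj[OF generic_nonzero[OF *(2)[rule_format] *(1,3)] *(5)])
 from generic_zariski_open[OF this] obtain W where W: "zariski_open_in S W" "W \<noteq> {}"
  "\<forall>r\<in>W. F i (crd r) \<noteq> 0 \<and> f r = Some (fmap F r)" by blast
 have "(\<exists>i. \<not> vanishes (F' i) p)" "q = form_map F' p"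
  "\<forall>r\<in>W. (\<exists>i. \<not> vanishes (F' i) r) \<and> f r = Some (form_map F' r)"
  using * W(3) F'(2) e by (auto simp: vanishes_def)
 thus ?L unfolding regular_map_value_def using *(1) F'(1) W(1,2) by blast
qed

lemma regular_map_value_unique:
 assumes "regular_map_value S f p q" "regular_map_value S f p q'"
 shows "q = q'"
proof -
 obtain d F i where 1: "p \<in> S" "\<forall>i. hp d (F i)" "F i (crd p) \<noteq> 0" "q = fmap F p"
  "\<forall>\<^sub>G r. f r = Some (fmap F r)"
  using assms(1) unfolding regular_map_value_iff by blast
 obtain d' F' i' where 2: "p \<in> S" "\<forall>i. hp d' (F' i)" "F' i' (crd p) \<noteq> 0" "q' = fmap F' p"
  "\<forall>\<^sub>G r. f r = Some (fmap F' r)"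
  using assms(2) unfolding regular_map_value_iff by blast
 have eq: "F j (crd p) * F' k (crd p) - F k (crd p) * F' j (crd p) = 0" for j k
 proof (rule generic_zero[OF _ _ 1(1)])
  show "hp (d + d') (\<lambda>z. F j z * F' k z - F k z * F' j z)" using 1(2) 2(2) by (intro hp_diff hp.mult) auto
  show "\<forall>\<^sub>G r. F j (crd r) * F' k (crd r) - F k (crd r) * F' j (crd r) = 0"
   using 1(5) 2(5) generic_nonzero[OF 1(2)[rule_format] 1(1,3)] generic_nonzero[OF 2(2)[rule_format] 2(1,3)]
  proof eventually_elim
   case (elim r)
   obtain c where c: "c \<noteq> 0" "crd (fmap F r) = (\<lambda>i. c * F i (crd r))" using fmap_rep[of F] elim(3) .
   obtain c' where c': "c' \<noteq> 0" "crd (fmap F' r) = (\<lambda>i. c' * F' i (crd r))" using fmap_rep[of F'] elim(4) .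
   have e: "c * F i (crd r) = c' * F' i (crd r)" for i
    using elim(1,2) c(2) c'(2) by (metis option.inject)
   have "c * (F j (crd r) * F' k (crd r)) = c * (F k (crd r) * F' j (crd r))"
    unfolding mult.assoc[symmetric] e by simp
   thus ?case using c(1) by simp
  qed
 qed
 obtain c where c: "c \<noteq> 0" "crd (fmap F p) = (\<lambda>i. c * F i (crd p))" using fmap_rep[of F] 1(3) .
 obtain c' where c': "c' \<noteq> 0" "crd (fmap F' p) = (\<lambda>i. c' * F' i (crd p))" using fmap_rep[of F'] 2(3) .
 show ?thesis unfolding 1(4) 2(4)
  by (rule point_eqI) (use eq in \<open>simp add: c(2) c'(2) algebra_simps\<close>)
qed

lemma map_ext_Some: "map_ext S f p = Some q \<longleftrightarrow> regular_map_value S f p q"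
proof -
 have "(THE q. regular_map_value S f p q) = q" if "regular_map_value S f p q" for q
  using that regular_map_value_unique by blast
 thus ?thesis unfolding map_ext_def by auto
qed

lemma map_ext_SomeI:
 assumes "p \<in> S" "\<And>i. hp d (F i)" "F i (crd p) \<noteq> 0" "\<forall>\<^sub>G r. f r = Some (fmap F r)"
 shows "map_ext S f p = Some (fmap F p)"
 unfolding map_ext_Some regular_map_value_iff using assms by blast

lemma map_ext_cong: "\<forall>\<^sub>G q. f q = g q ==> map_ext S f = map_ext S g"
proof -
 assume *: "\<forall>\<^sub>G q. f q = g q"
 have "regular_map_value S f p q \<longleftrightarrow> regular_map_value S g p q" for p q
 proof -
  have "eventually (\<lambda>q. f q = k q) (generic S) \<longleftrightarrow> eventually (\<lambda>q. g q = k q) (generic S)" for k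
   using * by (intro iffI; elim eventually_rev_mp) (auto elim: eventually_mono)
  thus ?thesis unfolding regular_map_value_iff by simp
 qed
 hence "regular_map_value S f p = regular_map_value S g p" for p by (intro ext) simp
 thus ?thesis by (intro ext) (simp only: map_ext_def)
qed

lemma map_ext_generic:
 assumes "map_ext S f p = Some q"
 shows "\<forall>\<^sub>G r. map_ext S f r = f r \<and> f r \<noteq> None"
proof -
 obtain d F i where 1: "p \<in> S" "\<forall>i. hp d (F i)" "F i (crd p) \<noteq> 0" "q = fmap F p"
  "\<forall>\<^sub>G r. f r = Some (fmap F r)"
  using assms(1) unfolding map_ext_Some regular_map_value_iff by blast
 show ?thesis using generic_nonzero[OF 1(2)[rule_format] 1(1,3)] generic_in 1(5)
 proof eventually_elim
  case (elim r)
  have "map_ext S f r = Some (fmap F r)"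
   by (rule map_ext_SomeI[OF elim(2) _ elim(1) 1(5)]) (use 1(2) in blast)
  thus ?case using elim(3) by simp
 qed
qed

lemma map_ext_idem: "map_ext S (map_ext S f) = map_ext S f"
proof (cases "dom (map_ext S f) = {}")
 case False
 then obtain p q where "map_ext S f p = Some q" by (auto simp: dom_def)
 from map_ext_generic[OF this] show ?thesis by (intro map_ext_cong) (auto elim: eventually_mono)
next
 case True
 hence e: "map_ext S f = (\<lambda>_. None)" by auto
 have "map_ext S (\<lambda>_. None) p = None" for p
 proof (rule ccontr)
  assume "map_ext S (\<lambda>_. None) p \<noteq> None"
  then obtain q where "map_ext S (\<lambda>_. None) p = Some q" by auto
  from generic_ex[OF map_ext_generic[OF this]] show False by simp
 qed
 thus ?thesis unfolding e by auto
qed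

text \<open>An equation of \<open>T\<close>, pulled back along the forms that represent the map, is
  a form vanishing generically on \<open>S\<close>, hence also at the point \<open>p\<close> to
  which the map has been extended.\<close>

lemma map_ext_closed:
 assumes "map_ext S f p = Some q" "zclosed T" "\<forall>\<^sub>G r. \<forall>t. f r = Some t --> t \<in> T"
 shows "q \<in> T"
proof -
 obtain d F i where 1: "p \<in> S" "\<forall>i. hp d (F i)" "F i (crd p) \<noteq> 0" "q = fmap F p"
  "\<forall>\<^sub>G r. f r = Some (fmap F r)"
  using assms(1) unfolding map_ext_Some regular_map_value_iff by blast
 show ?thesis
 proof (rule zclosedD[OF assms(2)])
  fix e G assume G: "hp e G" "\<And>p. p \<in> T ==> G (crd p) = 0"
  have h: "hp (e * d) (\<lambda>z. G (\<lambda>i. F i z))" by (rule hp_subst[OF G(1)]) (use 1(2) in blast)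
  have "\<forall>\<^sub>G r. G (\<lambda>i. F i (crd r)) = 0"
   using generic_nonzero[OF 1(2)[rule_format] 1(1,3)] 1(5) assms(3)
  proof eventually_elim
   case (elim r)
   thus ?case using G(2) hp_fmap_zero_iff[OF G(1), of F i r] by simp
  qed
  from generic_zero[OF h this 1(1)] show "G (crd q) = 0"
   using hp_fmap_zero_iff[OF G(1), of F i p] 1(3,4) by simp
 qed
qed

lemma id_map_ext: "map_ext S Some = id_map S"
proof
 fix p
 show "map_ext S Some p = id_map S p"
 proof (cases "p \<in> S")
  case True
  obtain i where "crd p i \<noteq> 0" by (rule rep_point_coord)
  from map_ext_SomeI[where F = "\<lambda>i v. v i", OF True hp_var this] show ?thesis
   using True by (simp add: fmap_def id_map_def)
 next
  case False
  have "map_ext S Some p = None"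
   using False map_ext_Some[of Some p] by (cases "map_ext S Some p") (auto simp: regular_map_value_iff)
  thus ?thesis using False by (simp add: id_map_def)
 qed
qed

lemma map_ext_id_generic:
 assumes "map_ext S f = id_map S" shows "\<forall>\<^sub>G r. f r = Some r"
proof -
 obtain p where p: "p \<in> S" using nonempty by auto
 hence "map_ext S f p = Some p" by (simp add: assms id_map_def)
 from map_ext_generic[OF this] generic_in show ?thesis
  by eventually_elim (simp add: assms id_map_def)
qed

lemma pull_fun_RF:
 assumes "rat_germ S h" "\<forall>\<^sub>G s. f s = Some (m s)"
  "\<And>P. eventually P (generic S) ==> \<forall>\<^sub>G s. P (m s)"
 shows "pull_fun S f (RF S h) = RF S (\<lambda>s. h (m s))"
 unfolding pull_fun_def RF_def[of S "\<lambda>s. h (m s)"]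
proof (rule rat_ext_cong)
 show "\<forall>\<^sub>G s. (RF S h \<circ>\<^sub>m f) s = Some (h (m s))"
  using assms(3)[OF RF_generic[OF assms(1)]] assms(2) by eventually_elim (simp add: map_comp_def)
qed

text \<open>Lets the entries of a matrix of rational functions be replaced by forms of one degree,
  which changes the matrix only by a scalar.\<close>

lemma regular_at_common_denominator:
 fixes n :: nat
 assumes "\<And>i. i < n ==> regular_at S (h i) p (z i)" "p \<in> S"
 shows "\<exists>d G F. hp d G \<and> G (crd p) \<noteq> 0 \<and> (\<forall>i<n. hp d (F i) \<and> z i = F i (crd p) / G (crd p) \<and>
   (\<forall>\<^sub>G q. h i q = F i (crd q) / G (crd q)))"
 using assms
proof (induction n)
 case 0
 show ?case by (intro exI[of _ 0] exI[of _ "\<lambda>_. 1"]) (auto intro: hp.const)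
next
 case (Suc n)
 have "regular_at S (h i) p (z i)" if "i < n" for i using Suc.prems(1)[of i] that by simp
 from Suc.IH[OF this Suc.prems(2)]
 obtain d G F where 1: "hp d G" "G (crd p) \<noteq> 0"
  "\<forall>i<n. hp d (F i) \<and> z i = F i (crd p) / G (crd p) \<and>
   (\<forall>\<^sub>G q. h i q = F i (crd q) / G (crd q))" by blast
 have "regular_at S (h n) p (z n)" using Suc.prems by simp
 then obtain e F' G' where 2: "hp e F'" "hp e G'" "G' (crd p) \<noteq> 0"
   "z n = F' (crd p) / G' (crd p)"
   "\<forall>\<^sub>G q. h n q = F' (crd q) / G' (crd q)"
  unfolding regular_at_def by blast
 define K where "K i v = (if i < n then F i v * G' v else G v * F' v)" for i v
 have "hp (d + e) (K i)" if "i < Suc n" for i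
  using 1 2 by (cases "i < n") (auto simp: K_def[abs_def] intro: hp.mult)
 moreover have "z i = K i (crd p) / (G (crd p) * G' (crd p))" if "i < Suc n" for i
 proof (cases "i < n")
  case True
  thus ?thesis using 1 2 by (simp add: K_def)
 next
  case False
  hence "i = n" using that by simp
  thus ?thesis using 1 2 by (simp add: K_def)
 qed
 moreover have "\<forall>\<^sub>G q. h i q = K i (crd q) / (G (crd q) * G' (crd q))" if "i < Suc n" for i
 proof (cases "i < n")
  case True
  hence "\<forall>\<^sub>G q. h i q = F i (crd q) / G (crd q)" using 1 by blast
  thus ?thesis using generic_nonzero[OF 2(2) Suc.prems(2) 2(3)]
   by eventually_elim (simp add: K_def True)
 next
  case False
  hence "i = n" using that by simp
  show ?thesis using 2(5) generic_nonzero[OF 1(1) Suc.prems(2) 1(2)]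
   by eventually_elim (simp add: K_def \<open>i = n\<close>)
 qed
 moreover have "hp (d + e) (\<lambda>v. G v * G' v)" "G (crd p) * G' (crd p) \<noteq> 0"
  using 1 2 by (auto intro: hp.mult)
 ultimately show ?case
  by (intro exI[of _ "d + e"] exI[of _ "\<lambda>v. G v * G' v"] exI[of _ K]) auto
qed

end

lemma rational_mapI:
 assumes "irreducible S" "zclosed T" "map_ext S f p \<noteq> None" "\<forall>\<^sub>F r in generic S. \<forall>t. f r = Some t --> t \<in> T"
 shows "rational_map S T (map_ext S f)"
proof -
 interpret irreducible S by fact
 show ?thesis unfolding rational_map_def
  using assms(3) map_ext_closed[OF _ assms(2,4)] by (auto simp: map_ext_idem ran_def)
qed

text \<open>The minors of the Segre matrix vanish on the product, so they vanish at \<open>q\<close>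
  and the coordinates of \<open>q\<close> form a matrix of rank one. A non-zero column gives the
  base point, and the equations of \<open>C\<close> in the variables of that column show that it
  lies on \<open>C\<close>; a non-zero row gives the fibre coordinates.\<close>

lemma zclosed_ruled: assumes "zclosed C" shows "zclosed (ruled C)"
 unfolding zclosed_def
proof (intro allI impI)
 fix q assume q: "\<forall>e G. hp e G --> (\<forall>p\<in>ruled C. G (crd p) = 0) --> G (crd q) = 0"
 let ?z = "crd q"
 have rel: "?z (2 * i + k) * ?z (2 * j + l) = ?z (2 * i + l) * ?z (2 * j + k)" if "k < 2" "l < 2" for i j k l
 proof -
  have "(\<lambda>z. z (2 * i + k) * z (2 * j + l) - z (2 * i + l) * z (2 * j + k)) ?z = 0"
  proof (rule q[rule_format])
   show "hp (Suc 0 + Suc 0) (\<lambda>z. z (2 * i + k) * z (2 * j + l) - z (2 * i + l) * z (2 * j + k))"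
    by (intro hp_diff hp.mult hp_var)
   fix s assume "s \<in> ruled C"
   then obtain p a b where s: "p \<in> C" "a \<noteq> 0 \<or> b \<noteq> 0" "s = rp p a b" unfolding ruled_iff by blast
   obtain c where c: "c \<noteq> 0" "crd (rp p a b) = (\<lambda>k. c * seg (crd p) a b k)" using rep_rp[OF s(2)] .
   have sg: "seg (crd p) a b (2 * m + k) = crd p m * (if even k then a else b)" if "k < 2" for m k
    using that by (auto simp: seg_def)
   show "crd s (2 * i + k) * crd s (2 * j + l) - crd s (2 * i + l) * crd s (2 * j + k) = 0"
    unfolding s(3) c(2) using that by (simp add: sg)
  qed
  thus ?thesis by simp
 qed
 obtain m where m: "?z m \<noteq> 0" by (rule rep_point_coord)
 \<comment> \<open>Row and column of a non-zero entry of the coordinate matrix of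
   \<open>q\<close>.\<close>
 define i0 k0 where "i0 = m div 2" and "k0 = m mod 2"
 have k0: "k0 < 2" and m': "m = 2 * i0 + k0" by (simp_all add: i0_def k0_def)
 define x where "x i = ?z (2 * i + k0)" for i
 have x0: "x i0 \<noteq> 0" using m m' by (simp add: x_def)
 hence xn: "x \<noteq> (\<lambda>_. 0)" by auto
 let ?a = "?z (2 * i0)" and ?b = "?z (2 * i0 + 1)"
 have ab: "?a \<noteq> 0 \<or> ?b \<noteq> 0" using m m' k0 by (cases "k0 = 0") (auto simp: less_2_cases_iff)
 have sg: "seg x ?a ?b = (\<lambda>k. x i0 * ?z k)"
 proof
  fix k :: nat
  have k: "k = 2 * (k div 2) + k mod 2" by simp
  have "seg x ?a ?b k = x (k div 2) * ?z (2 * i0 + k mod 2)"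
   unfolding seg_def by (cases "even k") (auto simp: even_iff_mod_2_eq_zero odd_iff_mod_2_eq_one)
  also have "\<dots> = ?z (2 * (k div 2) + k mod 2) * x i0"
   unfolding x_def using rel[of k0 "k mod 2" "k div 2" i0] k0 by simp
  finally show "seg x ?a ?b k = x i0 * ?z k" using k by (simp add: mult.commute)
 qed
 define p where "p = abs_point x"
 obtain c where c: "c \<noteq> 0" "crd p = (\<lambda>i. c * x i)" using rep_abs_point[OF xn] unfolding p_def .
 have "p \<in> C"
 proof (rule zclosedD[OF assms])
  fix e G assume G: "hp e G" "\<And>p. p \<in> C ==> G (crd p) = 0"
  have h: "hp e (\<lambda>z. G (\<lambda>i. z (2 * i + k0)))" by (rule hp_subst1[OF G(1)]) (rule hp_var)
  have "(\<lambda>z. G (\<lambda>i. z (2 * i + k0))) ?z = 0"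
  proof (rule q[rule_format, OF h])
   fix s assume "s \<in> ruled C"
   then obtain p a b where s: "p \<in> C" "a \<noteq> 0 \<or> b \<noteq> 0" "s = rp p a b" unfolding ruled_iff by blast
   have "(\<lambda>i. seg (crd p) a b (2 * i + k0)) = (\<lambda>i. (if even k0 then a else b) * crd p i)"
    using k0 by (auto simp: seg_def)
   hence "G (\<lambda>i. seg (crd p) a b (2 * i + k0)) = 0"
    using hp_scale[OF G(1)] G(2)[OF s(1)] by simp
   thus "G (\<lambda>i. crd s (2 * i + k0)) = 0" using hp_rp_zero_iff[OF h s(2), of p] s(3) by simp
  qed
  hence "G x = 0" by (simp add: x_def[abs_def])
  thus "G (crd p) = 0" unfolding c(2) using hp_scale[OF G(1)] by simp
 qed
 moreover have "rp p ?a ?b = q"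
 proof -
  have "seg (crd p) ?a ?b = (\<lambda>k. (c * x i0) * ?z k)"
   using sg unfolding c(2) by (auto simp: seg_def fun_eq_iff mult.assoc)
  thus ?thesis unfolding rp_def using abs_point_scale[of "c * x i0" ?z] c(1) x0 rep_point_nonzero[of q] by simp
 qed
 moreover have "rp p ?a ?b \<in> ruled C" unfolding ruled_iff using ab \<open>p \<in> C\<close> by blast
 ultimately show "q \<in> ruled C" by simp
qed

context ruled_surface
begin

section \<open>Moebius transformations of the fibres\<close>

text \<open>The value is given in homogeneous coordinates, so that a vanishing denominator yields
  the point at infinity instead of a default value.\<close>

definition mob :: "(point => complex) => (point => complex) => (point => complex) => (point => complex) => point => point" where
 "mob a b c d s = rq (base_pt s) (a (base_pt s) * yc s + b (base_pt s)) (c (base_pt s) * yc s + d (base_pt s))"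

definition Mob :: "(point => complex) => (point => complex) => (point => complex) => (point => complex) => ratmap" where
 "Mob a b c d = map_ext S (\<lambda>s. Some (mob a b c d s))"

lemma mob_pt: "mob a b c d (pt p u) = rq p (a p * u + b p) (c p * u + d p)"
 by (simp add: mob_def)

text \<open>After a common denominator is cleared, the entries become forms in the base coordinates,
  and these are replaced by the \<open>U0\<close> or the \<open>U1\<close>, whichever are usable at
  the given point. The substitution introduces the factor \<open>L v0 v1 ^ e\<close>, which is
  common to all coordinates and so disappears in projective space.\<close>

lemma mob_forms:
 assumes reg: "regular_at C a p a'" "regular_at C b p b'" "regular_at C c p c'" "regular_at C d p d'"
  and u: "u0 \<noteq> 0 \<or> u1 \<noteq> 0" and v: "a' * u0 + b' * u1 \<noteq> 0 \<or> c' * u0 + d' * u1 \<noteq> 0"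
 obtains e T i where "\<forall>i. hp e (T i)" "T i (crd (rq p u0 u1)) \<noteq> 0"
  "fmap T (rq p u0 u1) = rq p (a' * u0 + b' * u1) (c' * u0 + d' * u1)"
  "\<forall>\<^sub>S s. mob a b c d s = fmap T s"
proof -
 have p: "p \<in> C" using reg(1) by (simp add: regular_at_def)
 define hs zs where "hs i = [a, b, c, d] ! i" and "zs i = [a', b', c', d'] ! i" for i
 have "regular_at C (hs i) p (zs i)" if "i < 4" for i
 proof -
  have "i = 0 \<or> i = 1 \<or> i = 2 \<or> i = 3" using that by auto
  thus ?thesis using reg by (auto simp: hs_def zs_def)
 qed
 from C.regular_at_common_denominator[of 4 hs p zs, OF this p]
 obtain e Q H where QH: "hp e Q" "Q (crd p) \<noteq> 0" "\<forall>i<4. hp e (H i) \<and> zs i = H i (crd p) / Q (crd p) \<and>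
   (\<forall>\<^sub>C q. hs i q = H i (crd q) / Q (crd q))" by blast
 have Hval: "a' = H 0 (crd p) / Q (crd p)" "b' = H 1 (crd p) / Q (crd p)"
  "c' = H 2 (crd p) / Q (crd p)" "d' = H 3 (crd p) / Q (crd p)"
  using QH(3)[rule_format, of 0] QH(3)[rule_format, of 1] QH(3)[rule_format, of 2] QH(3)[rule_format, of 3]
  by (auto simp: zs_def)
 have Hgen: "\<forall>\<^sub>C q. a q = H 0 (crd q) / Q (crd q)"
  "\<forall>\<^sub>C q. b q = H 1 (crd q) / Q (crd q)"
  "\<forall>\<^sub>C q. c q = H 2 (crd q) / Q (crd q)"
  "\<forall>\<^sub>C q. d q = H 3 (crd q) / Q (crd q)"
  using QH(3)[rule_format, of 0] QH(3)[rule_format, of 1] QH(3)[rule_format, of 2] QH(3)[rule_format, of 3]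
  by (auto simp: hs_def)
 define U where "U = (if u1 \<noteq> 0 then U1 else U0)"
 define L where "L v0 v1 = (if u1 \<noteq> 0 then v1 else v0)" for v0 v1 :: complex
 have U: "U i (sq x v0 v1) = L v0 v1 * x i" for i x v0 v1
  by (auto simp: U_def L_def U_sq)
 have hU: "hp (Suc 0) (U i)" for i by (auto simp: U_def hp_U)
 define K where "K j z = H j (\<lambda>i. U i z)" for j z
 have hK: "hp e (K j)" if "j < 4" for j
  unfolding K_def[abs_def] by (rule hp_subst1[OF _ hU]) (use QH(3) that in blast)
 have Ksq: "K j (sq x v0 v1) = L v0 v1 ^ e * H j x" if "j < 4" for j x v0 v1
  unfolding K_def U by (rule hp_scale) (use QH(3) that in blast)
 define t0 t1 where "t0 i z = K 0 z * U0 i z + K 1 z * U1 i z" and "t1 i z = K 2 z * U0 i z + K 3 z * U1 i z" for i z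
 have ht: "hp (e + Suc 0) (t0 i)" "hp (e + Suc 0) (t1 i)" for i
  unfolding t0_def[abs_def] t1_def[abs_def] by (intro hp.add hp.mult hK hp_U; simp)+
 have tsq: "t0 i (sq x v0 v1) = x i * (L v0 v1 ^ e * (H 0 x * v0 + H 1 x * v1))"
  "t1 i (sq x v0 v1) = x i * (L v0 v1 ^ e * (H 2 x * v0 + H 3 x * v1))" for i x v0 v1
  by (simp_all add: t0_def t1_def Ksq U_sq algebra_simps)
 define T where "T k z = (if even k then cw0 (t0 (k div 2) z) (t1 (k div 2) z) else cw1 (t0 (k div 2) z) (t1 (k div 2) z))" for k z
 have hT: "hp (e + Suc 0) (T k)" for k
 proof -
  have "hp (e + Suc 0) (\<lambda>z. inverse k3 * (k1 * t0 i z - k2 * t1 i z))" "hp (e + Suc 0) (\<lambda>z. inverse k3 * (k1 * t1 i z - k2 * t0 i z))" for k1 k2 k3 i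
   by (intro hp_cmult hp_diff ht)+
  thus ?thesis unfolding T_def[abs_def] cw0_def cw1_def
   by (cases "even k") (simp_all add: divide_inverse mult.commute)
 qed
 have Tsq: "T k (sq x v0 v1) = L v0 v1 ^ e * sq x (H 0 x * v0 + H 1 x * v1) (H 2 x * v0 + H 3 x * v1) k" for k x v0 v1
  unfolding T_def tsq cw_scale sq_eq[of x "H 0 x * v0 + H 1 x * v1"] by (simp add: algebra_simps)
 have fT: "fmap T (rq q v0 v1) = rq q (a1 * v0 + b1 * v1) (c1 * v0 + d1 * v1)"
  if vv: "v0 \<noteq> 0 \<or> v1 \<noteq> 0" and that: "L v0 v1 \<noteq> 0" "Q (crd q) \<noteq> 0" "a1 = H 0 (crd q) / Q (crd q)"
   "b1 = H 1 (crd q) / Q (crd q)" "c1 = H 2 (crd q) / Q (crd q)" "d1 = H 3 (crd q) / Q (crd q)"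
  for q v0 v1 a1 b1 c1 d1
 proof -
  obtain k where k: "k \<noteq> 0" "crd (rq q v0 v1) = (\<lambda>i. k * sq (crd q) v0 v1 i)" using rep_rq[OF vv] .
  let ?x = "crd q"
  have "T i (crd (rq q v0 v1)) = (k ^ (e + Suc 0) * L v0 v1 ^ e * Q ?x) * sq ?x (a1 * v0 + b1 * v1) (c1 * v0 + d1 * v1) i" for i
  proof -
   have "sq ?x (H 0 ?x * v0 + H 1 ?x * v1) (H 2 ?x * v0 + H 3 ?x * v1) = (\<lambda>k. Q ?x * sq ?x (a1 * v0 + b1 * v1) (c1 * v0 + d1 * v1) k)"
    unfolding sq_scale[symmetric] using that by (simp add: distrib_left)
   thus ?thesis unfolding k(2) hp_scale[OF hT] Tsq by (simp add: mult.assoc)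
  qed
  hence "fmap T (rq q v0 v1) = abs_point (\<lambda>i. (k ^ (e + Suc 0) * L v0 v1 ^ e * Q ?x) * sq ?x (a1 * v0 + b1 * v1) (c1 * v0 + d1 * v1) i)"
   by (simp add: fmap_def)
  also have "\<dots> = rq q (a1 * v0 + b1 * v1) (c1 * v0 + d1 * v1)"
  proof (cases "sq ?x (a1 * v0 + b1 * v1) (c1 * v0 + d1 * v1) = (\<lambda>_. 0)")
   case True
   thus ?thesis by (simp add: rq_abs)
  next
   case False
   thus ?thesis unfolding rq_abs using k(1) that by (intro abs_point_scale) auto
  qed
  finally show ?thesis .
 qed
 have Lu: "L u0 u1 \<noteq> 0" using u by (auto simp: L_def)
 have one: "fmap T (rq p u0 u1) = rq p (a' * u0 + b' * u1) (c' * u0 + d' * u1)"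
  by (rule fT[OF u Lu QH(2) Hval])
 have "\<exists>i. T i (crd (rq p u0 u1)) \<noteq> 0"
 proof -
  have "sq (crd p) (a' * u0 + b' * u1) (c' * u0 + d' * u1) \<noteq> (\<lambda>_. 0)"
   by (rule sq_nonzero[OF v rep_point_nonzero])
  then obtain i where i: "sq (crd p) (a' * u0 + b' * u1) (c' * u0 + d' * u1) i \<noteq> 0" by auto
  have "sq (crd p) (H 0 (crd p) * u0 + H 1 (crd p) * u1) (H 2 (crd p) * u0 + H 3 (crd p) * u1) i =
    Q (crd p) * sq (crd p) (a' * u0 + b' * u1) (c' * u0 + d' * u1) i"
   using fun_cong[OF sq_scale[of "crd p" "Q (crd p)" "a' * u0 + b' * u1" "c' * u0 + d' * u1"], of i] QH(2)
   by (simp add: Hval distrib_left)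
  hence "T i (sq (crd p) u0 u1) \<noteq> 0" unfolding Tsq using i QH(2) Lu by simp
  thus ?thesis using hp_rq_zero_iff[OF hT u] by blast
 qed
 then obtain i where i: "T i (crd (rq p u0 u1)) \<noteq> 0" by blast
 have gen: "\<forall>\<^sub>S s. mob a b c d s = fmap T s"
 proof -
  obtain j where j: "crd p j \<noteq> 0" by (rule rep_point_coord)
  have "U j (crd (rq p u0 u1)) \<noteq> 0" using hp_rq_zero_iff[OF hU u] j Lu by (simp add: U)
  from S.generic_nonzero[OF hU rq_in[OF p u] this] generic_pt
   generic_base[OF Hgen(1)] generic_base[OF Hgen(2)] generic_base[OF Hgen(3)] generic_base[OF Hgen(4)]
   generic_base[OF C.generic_nonzero[OF QH(1) p QH(2)]]
  show ?thesis
  proof eventually_elim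
   case (elim s)
   then obtain q v where s: "q \<in> C" "s = pt q v" by blast
   have "L v 1 \<noteq> 0" using elim(1) hp_pt_zero_iff[OF hU] s(2) by (auto simp: U)
   thus ?case
    using fT[of v 1 q "a q" "b q" "c q" "d q"] elim s(2) by (simp add: mob_pt pt_def[symmetric])
  qed
 qed
 show thesis by (rule that[OF _ i one gen]) (use hT in blast)
qed

lemma Mob_regular:
 assumes "regular_at C a p a'" "regular_at C b p b'" "regular_at C c p c'" "regular_at C d p d'"
  and u: "u0 \<noteq> 0 \<or> u1 \<noteq> 0" and "a' * u0 + b' * u1 \<noteq> 0 \<or> c' * u0 + d' * u1 \<noteq> 0"
 shows "Mob a b c d (rq p u0 u1) = Some (rq p (a' * u0 + b' * u1) (c' * u0 + d' * u1))"
proof -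
 obtain e T i where T: "\<forall>i. hp e (T i)" "T i (crd (rq p u0 u1)) \<noteq> 0"
  "fmap T (rq p u0 u1) = rq p (a' * u0 + b' * u1) (c' * u0 + d' * u1)"
  "\<forall>\<^sub>S s. mob a b c d s = fmap T s"
  using mob_forms[OF assms] .
 have "p \<in> C" using assms(1) by (simp add: regular_at_def)
 from S.map_ext_SomeI[where F = T, OF rq_in[OF this u] T(1)[rule_format] T(2)] T(3,4) show ?thesis
  unfolding Mob_def by (auto elim: eventually_mono)
qed

text \<open>That two points of the product lie over the same base point is expressed by bilinear
  equations between their Segre coordinates. For a map given by forms these are again equations of
  forms, so preservation of fibres is a closed condition.\<close>

lemma base_relation:
 assumes r: "r \<in> S" and t: "fmap F r \<in> S" "base_pt (fmap F r) = base_pt r" "F i0 (crd r) \<noteq> 0" and kl: "k < 2" "l < 2"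
 shows "crd r (2 * i + k) * F (2 * j + l) (crd r) = crd r (2 * j + k) * F (2 * i + l) (crd r)"
proof -
 have par: "k < 2 ==> seg x u v (2 * i + k) = x i * (if even k then u else v)" for k x u v and i :: nat
  by (auto simp: seg_def)
 obtain p u v where p: "u \<noteq> 0 \<or> v \<noteq> 0" "r = rp p u v" using r unfolding ruled_iff by blast
 obtain p' u' v' where p': "u' \<noteq> 0 \<or> v' \<noteq> 0" "fmap F r = rp p' u' v'" using t(1) unfolding ruled_iff by blast
 have pp: "p' = p" using t(2) p p' by simp
 obtain k1 where k1: "k1 \<noteq> 0" "crd r = (\<lambda>i. k1 * seg (crd p) u v i)" using rep_rp[OF p(1)] p(2) by metis
 obtain k2 where k2: "k2 \<noteq> 0" "crd (fmap F r) = (\<lambda>i. k2 * seg (crd p) u' v' i)" using rep_rp[OF p'(1)] p'(2) pp by metis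
 obtain k3 where k3: "k3 \<noteq> 0" "crd (fmap F r) = (\<lambda>i. k3 * F i (crd r))" using fmap_rep[of F] t(3) .
 have Fi: "F i (crd r) = (k2 / k3) * seg (crd p) u' v' i" for i
  using fun_cong[OF k2(2), of i] fun_cong[OF k3(2), of i] k3(1) by (simp add: field_simps)
 show ?thesis unfolding Fi unfolding k1(2) using kl by (simp add: par)
qed

text \<open>The generic relations hold at \<open>s\<close> by density. Choosing a non-zero fibre
  coordinate of the point and one of its image cancels the fibre factors, and the remaining minors
  identify the base points.\<close>

lemma base_from_relation:
 assumes F2: "\<forall>i. hp e (F i)"
  and gen: "\<forall>\<^sub>S r. \<forall>i j k l. k < 2 --> l < 2 -->
   crd r (2 * i + k) * F (2 * j + l) (crd r) = crd r (2 * j + k) * F (2 * i + l) (crd r)"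
  and s: "s \<in> S" and F3: "F i0 (crd s) \<noteq> 0" and q: "fmap F s \<in> S"
 shows "base_pt (fmap F s) = base_pt s"
proof -
 have par: "k < 2 ==> seg x u v (2 * i + k) = x i * (if even k then u else v)" for k x u v and i :: nat
  by (auto simp: seg_def)
 have rel: "crd s (2 * i + k) * F (2 * j + l) (crd s) - crd s (2 * j + k) * F (2 * i + l) (crd s) = 0"
  if kl: "k < 2" "l < 2" for i j k l
 proof (rule S.generic_zero[OF _ _ s])
  show "hp (Suc 0 + e) (\<lambda>z. z (2 * i + k) * F (2 * j + l) z - z (2 * j + k) * F (2 * i + l) z)"
   by (intro hp_diff hp.mult hp_var F2[rule_format])
  show "\<forall>\<^sub>S r. crd r (2 * i + k) * F (2 * j + l) (crd r) - crd r (2 * j + k) * F (2 * i + l) (crd r) = 0"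
   using gen by eventually_elim (use kl in simp)
 qed
 obtain p u v where p: "u \<noteq> 0 \<or> v \<noteq> 0" "s = rp p u v" using s unfolding ruled_iff by blast
 obtain p' u' v' where p': "u' \<noteq> 0 \<or> v' \<noteq> 0" "fmap F s = rp p' u' v'" using q unfolding ruled_iff by blast
 obtain k1 where k1: "k1 \<noteq> 0" "crd s = (\<lambda>i. k1 * seg (crd p) u v i)" using rep_rp[OF p(1)] p(2) by metis
 obtain k2 where k2: "k2 \<noteq> 0" "crd (fmap F s) = (\<lambda>i. k2 * seg (crd p') u' v' i)" using rep_rp[OF p'(1)] p'(2) by metis
 obtain k3 where k3: "k3 \<noteq> 0" "crd (fmap F s) = (\<lambda>i. k3 * F i (crd s))" using fmap_rep[of F] F3 .
 have Fi: "F i (crd s) = (k2 / k3) * seg (crd p') u' v' i" for i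
  using fun_cong[OF k2(2), of i] fun_cong[OF k3(2), of i] k3(1) by (simp add: field_simps)
 define k where "k = (if u \<noteq> 0 then 0 else 1 :: nat)"
 define l where "l = (if u' \<noteq> 0 then 0 else 1 :: nat)"
 define A where "A = (if even k then u else v)"
 define B where "B = (if even l then u' else v')"
 have kl: "k < 2" "l < 2" "A \<noteq> 0" "B \<noteq> 0"
  using p(1) p'(1) by (auto simp: k_def l_def A_def B_def)
 have "p = p'"
 proof (rule point_eqI)
  fix i j
  have "k1 * (crd p i * A) * (k2 / k3 * (crd p' j * B)) - k1 * (crd p j * A) * (k2 / k3 * (crd p' i * B)) = 0"
   using rel[OF kl(1,2), of i j] unfolding Fi unfolding k1(2) by (simp only: par[OF kl(1)] par[OF kl(2)] A_def B_def)
  hence "k1 * (k2 / k3) * A * B * (crd p i * crd p' j - crd p j * crd p' i) = 0"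
   by (simp only: algebra_simps)
  thus "crd p i * crd p' j = crd p j * crd p' i" using k1(1) k2(1) k3(1) kl(3,4) by auto
 qed
 thus ?thesis using p p' by simp
qed

end

section \<open>Birational maps given by matrices over the function field of the curve\<close>

locale moebius = ruled_surface +
 fixes a b c d :: "point => complex"
 assumes germs: "rat_germ C a" "rat_germ C b" "rat_germ C c" "rat_germ C d"
  and nondeg: "\<forall>\<^sub>C p. a p * d p - b p * c p \<noteq> 0"
begin

lemma mob_nonzero:
 fixes a' b' c' d' u0 u1 :: complex
 assumes "a' * d' - b' * c' \<noteq> 0" "u0 \<noteq> 0 \<or> u1 \<noteq> 0"
 shows "a' * u0 + b' * u1 \<noteq> 0 \<or> c' * u0 + d' * u1 \<noteq> 0"
proof (rule ccontr)
 assume "\<not> ?thesis"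
 hence z: "a' * u0 + b' * u1 = 0" "c' * u0 + d' * u1 = 0" by auto
 have "(a' * d' - b' * c') * u0 = d' * (a' * u0 + b' * u1) - b' * (c' * u0 + d' * u1)"
  "(a' * d' - b' * c') * u1 = a' * (c' * u0 + d' * u1) - c' * (a' * u0 + b' * u1)" by (simp_all add: algebra_simps)
 thus False using assms z by auto
qed

lemma regular_generic:
 "\<forall>\<^sub>C p. regular_at C a p (a p) \<and> regular_at C b p (b p) \<and> regular_at C c p (c p) \<and>
  regular_at C d p (d p) \<and> a p * d p - b p * c p \<noteq> 0"
 using C.RF_generic[OF germs(1)] C.RF_generic[OF germs(2)] C.RF_generic[OF germs(3)] C.RF_generic[OF germs(4)] nondeg
 by eventually_elim (simp add: C.RF_Some)

lemma Mob_generic: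
 "\<forall>\<^sub>C p. \<forall>u0 u1. u0 \<noteq> 0 \<or> u1 \<noteq> 0 -->
  (a p * u0 + b p * u1 \<noteq> 0 \<or> c p * u0 + d p * u1 \<noteq> 0) \<and>
  Mob a b c d (rq p u0 u1) = Some (rq p (a p * u0 + b p * u1) (c p * u0 + d p * u1))"
 using regular_generic
proof eventually_elim
 case (elim p)
 thus ?case using Mob_regular[of a p "a p" b "b p" c "c p" d "d p"] mob_nonzero[of "a p" "d p" "b p" "c p"] by blast
qed

lemma Mob_generic_mob: "\<forall>\<^sub>S s. Mob a b c d s = Some (mob a b c d s) \<and> base_pt (mob a b c d s) = base_pt s \<and> mob a b c d s \<in> S"
 using generic_base[OF Mob_generic] generic_pt
proof eventually_elim
 case (elim s)
 then obtain p u where s: "p \<in> C" "s = pt p u" by blast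
 have "(a p * u + b p \<noteq> 0 \<or> c p * u + d p \<noteq> 0) \<and> Mob a b c d (rq p u 1) = Some (rq p (a p * u + b p) (c p * u + d p))"
  using elim(1)[rule_format, of u 1] s(2) by simp
 thus ?case using s by (simp add: mob_pt pt_def[symmetric] rq_in)
qed

text \<open>Dominance of the map: the preimage of a non-empty open set is open, and it is non-empty
  because some point over which the matrix is regular and invertible can be lifted.\<close>

lemma generic_mob:
 assumes "eventually P (generic S)"
 shows "\<forall>\<^sub>S s. P (mob a b c d s)"
proof -
 obtain e F p0 v where F: "hp e F" "p0 \<in> C" "F (crd (pt p0 v)) \<noteq> 0" "\<forall>s\<in>S. F (crd s) \<noteq> 0 --> P s"
  using generic_fibre_aux[OF assms] .
 have "F (sq (crd p0) v 1) \<noteq> 0" using F hp_pt_zero_iff by blast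
 from eventually_conj[OF C.generic_nonzero[OF hp_sq[OF F(1)] F(2) this] regular_generic]
 obtain p where p: "p \<in> C" "F (sq (crd p) v 1) \<noteq> 0" "regular_at C a p (a p)" "regular_at C b p (b p)"
  "regular_at C c p (c p)" "regular_at C d p (d p)" "a p * d p - b p * c p \<noteq> 0"
  using C.generic_ex by blast
 let ?D = "a p * d p - b p * c p"
 \<comment> \<open>The adjugate matrix applied to \<open>(v, 1)\<close>: its image under the matrix
   is \<open>?D\<close> times \<open>(v, 1)\<close>, which is the point
   \<open>pt p v\<close>.\<close>
 define u0 u1 where "u0 = d p * v - b p" and "u1 = a p - c p * v"
 have Du: "a p * u0 + b p * u1 = ?D * v" "c p * u0 + d p * u1 = ?D * 1"
  by (simp_all add: u0_def u1_def algebra_simps)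
 have u: "u0 \<noteq> 0 \<or> u1 \<noteq> 0" using Du p(7) by auto
 obtain k T i where T: "\<forall>i. hp k (T i)" "T i (crd (rq p u0 u1)) \<noteq> 0"
  "fmap T (rq p u0 u1) = rq p (a p * u0 + b p * u1) (c p * u0 + d p * u1)"
  "\<forall>\<^sub>S s. mob a b c d s = fmap T s"
  using mob_forms[OF p(3-6) u mob_nonzero[OF p(7) u]] .
 have "fmap T (rq p u0 u1) = pt p v" unfolding T(3) Du pt_def by (rule rq_scale[OF p(7)]) simp
 hence "F (crd (fmap T (rq p u0 u1))) \<noteq> 0" using hp_pt_zero_iff[OF F(1)] p(2) by simp
 hence n: "F (\<lambda>i. T i (crd (rq p u0 u1))) \<noteq> 0" using hp_fmap_zero_iff[OF F(1), of T i] T(2) by blast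
 have "hp (e * k) (\<lambda>z. F (\<lambda>i. T i z))" by (rule hp_subst[OF F(1) T(1)[rule_format]])
 from S.generic_nonzero[OF this rq_in[OF p(1) u] n] S.generic_nonzero[OF T(1)[rule_format] rq_in[OF p(1) u] T(2)] T(4) Mob_generic_mob
 show ?thesis
 proof eventually_elim
  case (elim s)
  have "F (crd (fmap T s)) \<noteq> 0" using hp_fmap_zero_iff[OF F(1), of T i] elim by blast
  thus ?case using elim F(4) by simp
 qed
qed

lemma rat_germ_mob:
 assumes "rat_germ S h" shows "rat_germ S (\<lambda>s. h (mob a b c d s))"
proof -
 obtain e F G where FG: "hp e F" "hp e G"
  "\<forall>\<^sub>S q. G (crd q) \<noteq> 0 \<and> h q = F (crd q) / G (crd q)"
  using assms unfolding rat_germ_def by blast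
 obtain p where p: "p \<in> C" "regular_at C a p (a p)" "regular_at C b p (b p)"
  "regular_at C c p (c p)" "regular_at C d p (d p)" "a p * d p - b p * c p \<noteq> 0"
  using C.generic_ex[OF regular_generic] by blast
 have u: "(1::complex) \<noteq> 0 \<or> (0::complex) \<noteq> 0" by simp
 obtain k T i where T: "\<forall>i. hp k (T i)" "T i (crd (rq p 1 0)) \<noteq> 0"
  "fmap T (rq p 1 0) = rq p (a p * 1 + b p * 0) (c p * 1 + d p * 0)"
  "\<forall>\<^sub>S s. mob a b c d s = fmap T s"
  using mob_forms[OF p(2-5) u mob_nonzero[OF p(6) u]] .
 have hF: "hp (e * k) (\<lambda>z. F (\<lambda>i. T i z))" and hG: "hp (e * k) (\<lambda>z. G (\<lambda>i. T i z))"
  by (rule hp_subst[OF FG(1) T(1)[rule_format]], rule hp_subst[OF FG(2) T(1)[rule_format]])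
 have "\<forall>\<^sub>S s. G (\<lambda>i. T i (crd s)) \<noteq> 0 \<and>
   h (mob a b c d s) = F (\<lambda>i. T i (crd s)) / G (\<lambda>i. T i (crd s))"
  using generic_mob[OF FG(3)] S.generic_nonzero[OF T(1)[rule_format] rq_in[OF p(1) u] T(2)] T(4)
 proof eventually_elim
  case (elim s)
  have nz: "(\<lambda>i. T i (crd s)) \<noteq> (\<lambda>_. 0)" using elim(2) by (auto simp: fun_eq_iff)
  show ?case using elim(1) hp_abs_zero_iff[OF FG(2) nz] hp_abs_quotient[OF FG(1,2) nz]
   unfolding elim(3) fmap_def by simp
 qed
 thus ?thesis unfolding rat_germ_def using hF hG by blast
qed

lemma pull_fun_Mob:
 assumes "rat_germ S h"
 shows "pull_fun S (Mob a b c d) (RF S h) = RF S (\<lambda>s. h (mob a b c d s))"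
 by (rule S.pull_fun_RF[OF assms _ generic_mob]) (use Mob_generic_mob in \<open>auto elim: eventually_mono\<close>)

lemma Mob_rational_map: assumes "zclosed C" shows "rational_map S S (Mob a b c d)"
proof -
 obtain s where "Mob a b c d s \<noteq> None" using S.generic_ex[OF Mob_generic_mob] by auto
 thus ?thesis unfolding Mob_def
  by (rule rational_mapI[OF S.irreducible_axioms zclosed_ruled[OF assms]])
   (use Mob_generic_mob in \<open>auto elim!: eventually_mono\<close>)
qed

lemma Mob_comp:
 assumes "moebius C \<alpha> \<beta> \<gamma> \<delta> a1 b1 c1 d1"
 shows "map_ext S (Mob a1 b1 c1 d1 \<circ>\<^sub>m Mob a b c d) =
  Mob (\<lambda>p. a1 p * a p + b1 p * c p) (\<lambda>p. a1 p * b p + b1 p * d p)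
    (\<lambda>p. c1 p * a p + d1 p * c p) (\<lambda>p. c1 p * b p + d1 p * d p)"
proof -
 interpret M1: moebius C \<alpha> \<beta> \<gamma> \<delta> a1 b1 c1 d1 by fact
 show ?thesis unfolding Mob_def[of "\<lambda>p. a1 p * a p + b1 p * c p"]
 proof (rule S.map_ext_cong)
  show "\<forall>\<^sub>S s. (Mob a1 b1 c1 d1 \<circ>\<^sub>m Mob a b c d) s =
    Some (mob (\<lambda>p. a1 p * a p + b1 p * c p) (\<lambda>p. a1 p * b p + b1 p * d p)
    (\<lambda>p. c1 p * a p + d1 p * c p) (\<lambda>p. c1 p * b p + d1 p * d p) s)"
   using generic_base[OF Mob_generic] generic_base[OF M1.Mob_generic] generic_pt
  proof eventually_elim
   case (elim s)
   then obtain p u where s: "p \<in> C" "s = pt p u" by blast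
   let ?v0 = "a p * u + b p" and ?v1 = "c p * u + d p"
   have 1: "?v0 \<noteq> 0 \<or> ?v1 \<noteq> 0" "Mob a b c d s = Some (rq p ?v0 ?v1)"
    using elim(1)[rule_format, of u 1] s(2) by (simp_all add: pt_def)
   have 2: "Mob a1 b1 c1 d1 (rq p ?v0 ?v1) = Some (rq p (a1 p * ?v0 + b1 p * ?v1) (c1 p * ?v0 + d1 p * ?v1))"
    using elim(2)[rule_format, OF 1(1)] s(2) by simp
   have e: "a1 p * ?v0 + b1 p * ?v1 = (a1 p * a p + b1 p * c p) * u + (a1 p * b p + b1 p * d p)"
    "c1 p * ?v0 + d1 p * ?v1 = (c1 p * a p + d1 p * c p) * u + (c1 p * b p + d1 p * d p)"
    by (simp_all add: algebra_simps)
   show ?case using 1(2) 2 unfolding e by (simp add: map_comp_def s(2) mob_pt)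
  qed
 qed
qed

text \<open>The adjugate is inverse to the matrix up to the scalar \<open>a * d - b * c\<close>, and
  generically non-zero scalars act as the identity by \<open>Mob_scalar\<close>.\<close>

lemma inverse_moebius: "moebius C \<alpha> \<beta> \<gamma> \<delta> d (\<lambda>p. - b p) (\<lambda>p. - c p) a"
 by unfold_locales (use germs nondeg in \<open>auto intro: C.rat_germ_uminus elim!: eventually_mono simp: mult.commute\<close>)

lemma base_preserved:
 assumes m: "map_ext S f s = Some q" and q: "q \<in> S"
  and gen: "\<forall>\<^sub>S r. \<forall>t. f r = Some t --> t \<in> S \<and> base_pt t = base_pt r"
 shows "base_pt q = base_pt s"
proof -
 obtain e F i where F: "s \<in> S" "\<forall>i. hp e (F i)" "F i (crd s) \<noteq> 0" "q = fmap F s"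
  "\<forall>\<^sub>S r. f r = Some (fmap F r)"
  using m unfolding S.map_ext_Some S.regular_map_value_iff by blast
 have "\<forall>\<^sub>S r. \<forall>i j k l. k < 2 --> l < 2 -->
   crd r (2 * i + k) * F (2 * j + l) (crd r) = crd r (2 * j + k) * F (2 * i + l) (crd r)"
  using gen F(5) S.generic_nonzero[OF F(2)[rule_format] F(1,3)] S.generic_in
  by eventually_elim (use base_relation in blast)
 from base_from_relation[OF F(2) this F(1,3) q[unfolded F(4)]] show ?thesis unfolding F(4) .
qed

end

lemma (in ruled_surface) Mob_scalar:
 assumes "\<forall>\<^sub>C p. a p \<noteq> 0 \<and> b p = 0 \<and> c p = 0 \<and> d p = a p"
 shows "Mob a b c d = id_map S"
 unfolding Mob_def S.id_map_ext[symmetric]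
proof (rule S.map_ext_cong)
 show "\<forall>\<^sub>S s. Some (mob a b c d s) = Some s"
  using generic_base[OF assms] generic_pt
 proof eventually_elim
  case (elim s)
  then obtain p u where s: "p \<in> C" "s = pt p u" by blast
  have "rq p (a p * u) (a p * 1) = rq p u 1" by (rule rq_scale) (use elim s in auto)
  moreover have "mob a b c d s = rq p (a p * u + b p) (c p * u + d p)" unfolding s(2) by (rule mob_pt)
  ultimately show ?case using elim(1) s(2) by (simp add: pt_def)
 qed
qed

context moebius
begin

lemma Mob_birational: assumes "zclosed C" shows "birational_map S S (Mob a b c d)"
proof -
 interpret I: moebius C \<alpha> \<beta> \<gamma> \<delta> d "\<lambda>p. - b p" "\<lambda>p. - c p" a by (rule inverse_moebius)
 show ?thesis unfolding birational_map_def
 proof (intro conjI exI[of _ "Mob d (\<lambda>p. - b p) (\<lambda>p. - c p) a"] Mob_rational_map I.Mob_rational_map assms)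
  show "map_ext S (Mob d (\<lambda>p. - b p) (\<lambda>p. - c p) a \<circ>\<^sub>m Mob a b c d) = id_map S"
   unfolding Mob_comp[OF I.moebius_axioms] by (rule Mob_scalar) (use nondeg in \<open>auto elim!: eventually_mono simp: algebra_simps\<close>)
  show "map_ext S (Mob a b c d \<circ>\<^sub>m Mob d (\<lambda>p. - b p) (\<lambda>p. - c p) a) = id_map S"
   unfolding I.Mob_comp[OF moebius_axioms] by (rule Mob_scalar) (use nondeg in \<open>auto elim!: eventually_mono simp: algebra_simps\<close>)
 qed
qed

lemma Mob_Bir: "zclosed C ==> Mob a b c d \<in> carrier (Bir S)"
 by (simp add: Bir_def Mob_birational)

lemma Mob_Bir_fib: assumes "zclosed C" shows "Mob a b c d \<in> Bir_fib C"
 unfolding Bir_fib_def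
proof (intro CollectI conjI ballI Mob_Bir assms)
 fix s assume "s \<in> dom (Mob a b c d)"
 then obtain q where q: "Mob a b c d s = Some q" by auto
 have "q \<in> S" using Mob_rational_map[OF assms] q by (auto simp: rational_map_def ran_def)
 have "base_pt q = base_pt s"
  by (rule base_preserved[OF q[unfolded Mob_def] \<open>q \<in> S\<close>])
   (use Mob_generic_mob in \<open>auto elim!: eventually_mono\<close>)
 thus "base_pt (the (Mob a b c d s)) = base_pt s" using q by simp
qed

text \<open>By the dichotomy for germs the denominator would otherwise vanish generically, hence at
  infinitely many points of some fibre with invertible matrix; then \<open>c\<close> and
  \<open>d\<close> are both zero there.\<close>

lemma cd_generic: "\<forall>\<^sub>S s. c (base_pt s) * yc s + d (base_pt s) \<noteq> 0"
proof -
 have g: "rat_germ S (\<lambda>s. c (base_pt s) * yc s + d (base_pt s))"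
  by (intro S.rat_germ_add S.rat_germ_mult rat_germ_base germs rat_germ_yc)
 show ?thesis
 proof (rule ccontr)
  assume "\<not> ?thesis"
  hence z: "\<forall>\<^sub>S s. c (base_pt s) * yc s + d (base_pt s) = 0"
   using S.rat_germ_zero_or_nonzero[OF g] by blast
  obtain p where p: "finite {u. \<not> (c p * u + d p = 0)}" "a p * d p - b p * c p \<noteq> 0"
   using C.generic_ex[OF eventually_conj[OF generic_fibre[OF z] nondeg]] by auto
  hence "infinite (- {u. \<not> (c p * u + d p = 0)})" using infinite_UNIV_char_0 by (metis Compl_eq_Diff_UNIV Diff_infinite_finite)
  hence inf: "infinite {u. poly [:d p, c p:] u = 0}" by (simp add: Collect_neg_eq[symmetric] algebra_simps)
  hence "[:d p, c p:] = 0" using poly_roots_finite by blast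
  thus False using p(2) by simp
 qed
qed

lemma dy_mob:
 assumes h: "rat_germ S h"
 shows "\<forall>\<^sub>S s. dy (\<lambda>s. h (mob a b c d s)) s =
  dy h (mob a b c d s) * ((a (base_pt s) * d (base_pt s) - b (base_pt s) * c (base_pt s)) / (c (base_pt s) * yc s + d (base_pt s))\<^sup>2)"
proof (rule dy_eqI[OF rat_germ_mob[OF h]])
 show "\<forall>\<^sub>S s. (DERIV (\<lambda>u. h (mob a b c d (pt (base_pt s) u))) (yc s) :> dy h (mob a b c d s) * ((a (base_pt s) * d (base_pt s) - b (base_pt s) * c (base_pt s)) / (c (base_pt s) * yc s + d (base_pt s))\<^sup>2))"
  using generic_mob[OF dy_has_deriv[OF h]] cd_generic generic_pt
 proof eventually_elim
  case (elim s)
  then obtain p u where s: "p \<in> C" "s = pt p u" by blast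
  have cd: "c p * u + d p \<noteq> 0" using elim(2) s(2) by simp
  let ?M = "\<lambda>u. (a p * u + b p) / (c p * u + d p)"
  have m: "mob a b c d (pt p u) = pt p (?M u)" if "c p * u + d p \<noteq> 0" for u
   unfolding mob_pt by (rule rq_pt[OF that])
  have M: "DERIV ?M u :> (a p * d p - b p * c p) / (c p * u + d p)\<^sup>2"
  proof -
   have "DERIV ?M u :> (a p * (c p * u + d p) - (a p * u + b p) * c p) / ((c p * u + d p) * (c p * u + d p))"
    by (rule DERIV_divide) (use cd in \<open>auto intro!: derivative_eq_intros\<close>)
   moreover have "a p * (c p * u + d p) - (a p * u + b p) * c p = a p * d p - b p * c p" by (simp add: algebra_simps)
   ultimately show ?thesis by (simp add: power2_eq_square)
  qed
  have "DERIV (\<lambda>v. h (pt p v)) (?M u) :> dy h (mob a b c d s)"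
   using elim(1) m[OF cd] by (simp add: s(2))
  from DERIV_chain2[OF this M]
  have D: "DERIV (\<lambda>u. h (pt p (?M u))) u :> dy h (mob a b c d s) * ((a p * d p - b p * c p) / (c p * u + d p)\<^sup>2)" .
  have "((\<lambda>u. c p * u + d p) \<longlongrightarrow> c p * u + d p) (at u)" by (intro tendsto_intros)
  from tendsto_imp_eventually_ne[OF this cd] have "\<forall>\<^sub>F v in nhds u. c p * v + d p \<noteq> 0"
   using cd by (simp add: eventually_nhds_conv_at)
  hence ev: "\<forall>\<^sub>F v in nhds u. h (mob a b c d (pt p v)) = h (pt p (?M v))"
   by eventually_elim (simp add: m)
  show ?case using DERIV_cong_ev[OF refl ev refl, THEN iffD2, OF D] by (simp add: s(2))
 qed
qed

text \<open>The hypothesis \<open>vw\<close> is the transformation law: the field at the image point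
  equals \<open>w\<close> times the derivative of the fibre map. As \<open>pull_vf\<close> uses an
  inverse image of functions, surjectivity of the pull-back is obtained from the adjugate, and
  equality of germs replaces injectivity.\<close>

lemma pull_vf_Mob:
 assumes v: "rat_germ S v" and w: "rat_germ S w"
  and vw: "\<forall>\<^sub>S s. v (mob a b c d s) =
   w s * ((a (base_pt s) * d (base_pt s) - b (base_pt s) * c (base_pt s)) / (c (base_pt s) * yc s + d (base_pt s))\<^sup>2)"
 shows "pull_vf S S (Mob a b c d) (dop v) = dop w"
proof (rule extensionalityI[OF _ dop_extensional])
 interpret I: moebius C \<alpha> \<beta> \<gamma> \<delta> d "\<lambda>p. - b p" "\<lambda>p. - c p" a by (rule inverse_moebius)
 let ?K = "carrier (function_field S)" and ?m = "mob a b c d" and ?n = "mob d (\<lambda>p. - b p) (\<lambda>p. - c p) a"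
 show "pull_vf S S (Mob a b c d) (dop v) \<in> extensional ?K" by (simp add: pull_vf_def)
 fix g assume g: "g \<in> ?K"
 then obtain h where h: "rat_germ S h" "g = RF S h" by (rule S.carrier_E)
 have "\<forall>\<^sub>S s. ?n (?m s) = s"
  using cd_generic generic_pt generic_base[OF nondeg]
 proof eventually_elim
  case (elim s)
  then obtain p u where s: "p \<in> C" "s = pt p u" by blast
  have cd: "c p * u + d p \<noteq> 0" and D: "a p * d p - b p * c p \<noteq> 0" using elim s(2) by simp_all
  let ?M = "(a p * u + b p) / (c p * u + d p)"
  have "?m s = pt p ?M" unfolding s(2) mob_pt by (rule rq_pt[OF cd])
  hence "?n (?m s) = rq p (d p * ?M - b p) (a p - c p * ?M)" by (simp add: mob_pt)
  moreover have "d p * ?M - b p = ((a p * d p - b p * c p) / (c p * u + d p)) * u"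
   "a p - c p * ?M = ((a p * d p - b p * c p) / (c p * u + d p)) * 1"
   using cd by (simp_all add: divide_simps) (simp_all add: algebra_simps)
  ultimately have "?n (?m s) = rq p (((a p * d p - b p * c p) / (c p * u + d p)) * u) (((a p * d p - b p * c p) / (c p * u + d p)) * 1)" by simp
  also have "\<dots> = s" unfolding s(2) pt_def by (rule rq_scale) (use cd D in auto)
  finally show ?case .
 qed
 hence "\<forall>\<^sub>S s. h (?n (?m s)) = h s" by eventually_elim simp
 hence "pull_fun S (Mob a b c d) (RF S (\<lambda>s. h (?n s))) = g"
  unfolding pull_fun_Mob[OF I.rat_germ_mob[OF h(1)]] h(2) by (rule S.RF_cong)
 hence surj: "g \<in> pull_fun S (Mob a b c d) ` ?K" using S.RF_carrier[OF I.rat_germ_mob[OF h(1)]] by blast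
 let ?g = "inv_into ?K (pull_fun S (Mob a b c d)) g"
 have "?g \<in> ?K" by (rule inv_into_into[OF surj])
 then obtain k where k: "rat_germ S k" "?g = RF S k" by (rule S.carrier_E)
 have "pull_fun S (Mob a b c d) ?g = g" by (rule f_inv_into_f[OF surj])
 hence "RF S (\<lambda>s. k (?m s)) = g" unfolding k(2) pull_fun_Mob[OF k(1)] .
 hence "RF S (\<lambda>s. k (?m s)) = RF S h" unfolding h(2) .
 hence kh: "\<forall>\<^sub>S s. k (?m s) = h s" using S.RF_eq_iff[OF rat_germ_mob[OF k(1)] h(1)] by blast
 have "pull_vf S S (Mob a b c d) (dop v) g = pull_fun S (Mob a b c d) (dop v ?g)"
  using g by (simp add: pull_vf_def)
 also have "\<dots> = RF S (\<lambda>s. v (?m s) * dy k (?m s))"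
  unfolding k(2) dop_RF[OF k(1) v] by (rule pull_fun_Mob[OF S.rat_germ_mult[OF v rat_germ_dy[OF k(1)]]])
 also have "\<dots> = RF S (\<lambda>s. w s * dy h s)"
 proof (rule S.RF_cong)
  show "\<forall>\<^sub>S s. v (?m s) * dy k (?m s) = w s * dy h s"
   using vw dy_mob[OF k(1)] dy_cong[OF kh] by eventually_elim simp
 qed
 also have "\<dots> = dop w g" unfolding h(2) dop_RF[OF h(1) w] ..
 finally show "pull_vf S S (Mob a b c d) (dop v) g = dop w g" .
qed

end

context ruled_surface
begin

section \<open>Normal forms\<close>

definition ric :: "(point => complex) => (point => complex) => (point => complex) => point => complex" where
 "ric a b c s = a (base_pt s) * (yc s * yc s) + 2 * b (base_pt s) * yc s + c (base_pt s)"

lemma rat_germ_ric: "rat_germ C a ==> rat_germ C b ==> rat_germ C c ==> rat_germ S (ric a b c)"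
 unfolding ric_def[abs_def]
 by (intro S.rat_germ_add S.rat_germ_mult rat_germ_base rat_germ_yc S.rat_germ_const)

text \<open>The condition \<open>rel\<close> is the transformation law with the square of the
  denominator \<open>C' * u + D\<close> cleared, so that it becomes an identity for every
  \<open>u\<close>.\<close>

lemma pull_ric:
 assumes germs: "rat_germ C A" "rat_germ C B" "rat_germ C C'" "rat_germ C D"
  and nondeg: "\<forall>\<^sub>C p. A p * D p - B p * C' p \<noteq> 0"
  and abc: "rat_germ C a" "rat_germ C b" "rat_germ C c"
  and w: "rat_germ S (\<lambda>s. W (yc s))"
  and rel: "\<forall>\<^sub>C p. \<forall>u. a p * (A p * u + B p)\<^sup>2 + 2 * b p * (A p * u + B p) * (C' p * u + D p) +
   c p * (C' p * u + D p)\<^sup>2 = W u * (A p * D p - B p * C' p)"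
  and closed: "zclosed C"
 shows "\<exists>\<phi>\<in>Bir_fib C. pull_vf S S \<phi> (dop (ric a b c)) = dop (\<lambda>s. W (yc s))"
proof -
 interpret M: moebius C \<alpha> \<beta> \<gamma> \<delta> A B C' D by unfold_locales fact+
 have "pull_vf S S (Mob A B C' D) (dop (ric a b c)) = dop (\<lambda>s. W (yc s))"
 proof (rule M.pull_vf_Mob[OF rat_germ_ric[OF abc] w])
  show "\<forall>\<^sub>S s. ric a b c (mob A B C' D s) = W (yc s) *
    ((A (base_pt s) * D (base_pt s) - B (base_pt s) * C' (base_pt s)) / (C' (base_pt s) * yc s + D (base_pt s))\<^sup>2)"
   using generic_base[OF rel] M.cd_generic generic_pt
  proof eventually_elim
   case (elim s)
   then obtain p u where s: "p \<in> C" "s = pt p u" by blast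
   have cd: "C' p * u + D p \<noteq> 0" using elim(2) s(2) by simp
   have m: "mob A B C' D s = pt p ((A p * u + B p) / (C' p * u + D p))"
    unfolding s(2) mob_pt by (rule rq_pt[OF cd])
   define X Y where "X = A p * u + B p" and "Y = C' p * u + D p"
   have r: "a p * X\<^sup>2 + 2 * b p * X * Y + c p * Y\<^sup>2 = W u * (A p * D p - B p * C' p)"
    using elim(1) s(2) by (simp add: X_def Y_def)
   have Y: "Y \<noteq> 0" using cd by (simp add: Y_def)
   have "ric a b c (pt p (X / Y)) = (a p * X\<^sup>2 + 2 * b p * X * Y + c p * Y\<^sup>2) / Y\<^sup>2"
    using Y by (simp add: ric_def field_simps power2_eq_square)
   thus ?case unfolding m X_def[symmetric] Y_def[symmetric] r
    by (simp add: s(2) Y_def)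
  qed
 qed
 thus ?thesis using M.Mob_Bir_fib[OF closed] by blast
qed

text \<open>The field \<open>2 \<kappa> y d/dy\<close> vanishes at \<open>0\<close>, with multiplier
  \<open>2 \<kappa>\<close>, and at infinity. The matrix must send these to the zeros of the
  quadratic, which are rational over \<open>C\<close> because the discriminant is the square of a
  constant. If \<open>a = 0\<close>, one zero is at infinity and \<open>b\<close> is one of the two
  constants \<open>\<kappa>\<close> and \<open>-\<kappa>\<close>.\<close>

lemma normal_form_nonzero:
 assumes abc: "rat_germ C a" "rat_germ C b" "rat_germ C c"
  and disc: "\<forall>\<^sub>C p. b p * b p - a p * c p = \<kappa>\<^sup>2" and k: "\<kappa> \<noteq> 0" and closed: "zclosed C"
 shows "\<exists>\<phi>\<in>Bir_fib C. pull_vf S S \<phi> (dop (ric a b c)) = dop (\<lambda>s. 2 * \<kappa> * yc s)"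
proof -
 note gi = C.rat_germ_const C.rat_germ_add C.rat_germ_mult C.rat_germ_uminus C.rat_germ_diff C.rat_germ_divide abc
 have w: "rat_germ S (\<lambda>s. 2 * \<kappa> * yc s)" by (intro S.rat_germ_mult S.rat_germ_const rat_germ_yc)
 from C.rat_germ_zero_or_nonzero[OF abc(1)] show ?thesis
 proof
  assume a: "\<forall>\<^sub>C p. a p \<noteq> 0"
  show ?thesis
  \<comment> \<open>The columns are the two zeros: \<open>0\<close> goes to
    \<open>(\<kappa> - b) / a\<close>, where the quadratic has derivative \<open>2 \<kappa>\<close>,
    and infinity goes to \<open>(- b - \<kappa>) / a\<close>.\<close>
  proof (rule pull_ric[where A = "\<lambda>p. - b p - \<kappa>" and B = "\<lambda>p. \<kappa> - b p" and C' = a and D = a and W = "\<lambda>u. 2 * \<kappa> * u", OF _ _ _ _ _ abc w _ closed])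
   show "\<forall>\<^sub>C p. (- b p - \<kappa>) * a p - (\<kappa> - b p) * a p \<noteq> 0"
    using a
   proof eventually_elim
    case (elim p)
    have "(- b p - \<kappa>) * a p - (\<kappa> - b p) * a p = - 2 * \<kappa> * a p" by (simp add: algebra_simps)
    thus ?case using k elim by simp
   qed
   show "\<forall>\<^sub>C p. \<forall>u. a p * ((- b p - \<kappa>) * u + (\<kappa> - b p))\<^sup>2 +
     2 * b p * ((- b p - \<kappa>) * u + (\<kappa> - b p)) * (a p * u + a p) + c p * (a p * u + a p)\<^sup>2 =
     2 * \<kappa> * u * ((- b p - \<kappa>) * a p - (\<kappa> - b p) * a p)"
    using disc
   proof (eventually_elim, intro allI)
    fix p u assume d: "b p * b p - a p * c p = \<kappa>\<^sup>2"
    have ac: "a p * c p = b p * b p - \<kappa> * \<kappa>" using d by (simp add: power2_eq_square algebra_simps)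
    have "a p * ((- b p - \<kappa>) * u + (\<kappa> - b p))\<^sup>2 +
     2 * b p * ((- b p - \<kappa>) * u + (\<kappa> - b p)) * (a p * u + a p) + c p * (a p * u + a p)\<^sup>2 =
     a p * (((- b p - \<kappa>) * u + (\<kappa> - b p))\<^sup>2 + 2 * b p * ((- b p - \<kappa>) * u + (\<kappa> - b p)) * (u + 1) + (a p * c p) * (u + 1)\<^sup>2)"
     by (simp add: algebra_simps power2_eq_square)
    also have "\<dots> = 2 * \<kappa> * u * ((- b p - \<kappa>) * a p - (\<kappa> - b p) * a p)"
     unfolding ac by (simp add: algebra_simps power2_eq_square)
    finally show "a p * ((- b p - \<kappa>) * u + (\<kappa> - b p))\<^sup>2 +
     2 * b p * ((- b p - \<kappa>) * u + (\<kappa> - b p)) * (a p * u + a p) + c p * (a p * u + a p)\<^sup>2 =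
     2 * \<kappa> * u * ((- b p - \<kappa>) * a p - (\<kappa> - b p) * a p)" .
   qed
  qed (intro gi)+
 next
  assume a: "\<forall>\<^sub>C p. a p = 0"
  have bk: "rat_germ C (\<lambda>p. b p - \<kappa>)" by (intro gi)
  from C.rat_germ_zero_or_nonzero[OF bk] show ?thesis
  proof
   assume b: "\<forall>\<^sub>C p. b p - \<kappa> = 0"
   show ?thesis
   \<comment> \<open>Here the finite zero \<open>- c / (2 \<kappa>)\<close> has multiplier
     \<open>2 \<kappa>\<close>; a translation moves it to \<open>0\<close>.\<close>
   proof (rule pull_ric[where A = "\<lambda>p. 1" and B = "\<lambda>p. - c p / (2 * \<kappa>)" and C' = "\<lambda>p. 0" and D = "\<lambda>p. 1" and W = "\<lambda>u. 2 * \<kappa> * u", OF _ _ _ _ _ abc w _ closed])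
    show "\<forall>\<^sub>C p. \<forall>u. a p * (1 * u + - c p / (2 * \<kappa>))\<^sup>2 + 2 * b p * (1 * u + - c p / (2 * \<kappa>)) * (0 * u + 1) +
     c p * (0 * u + 1)\<^sup>2 = 2 * \<kappa> * u * (1 * 1 - (- c p / (2 * \<kappa>)) * 0)"
     using a b by eventually_elim (use k in \<open>auto simp: field_simps\<close>)
   qed (intro gi | simp)+
  next
   assume b: "\<forall>\<^sub>C p. b p - \<kappa> \<noteq> 0"
   have b': "\<forall>\<^sub>C p. b p = - \<kappa>"
    using a b disc
   proof eventually_elim
    case (elim p)
    have "(b p - \<kappa>) * (b p + \<kappa>) = 0" using elim by (simp add: algebra_simps power2_eq_square)
    thus ?case using elim by (simp add: eq_neg_iff_add_eq_0)
   qed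
   show ?thesis
   \<comment> \<open>Now the finite zero \<open>c / (2 \<kappa>)\<close> has multiplier
     \<open>-2 \<kappa>\<close>, so it must correspond to infinity and the zero at infinity to
     \<open>0\<close>.\<close>
   proof (rule pull_ric[where A = "\<lambda>p. c p / (2 * \<kappa>)" and B = "\<lambda>p. 1" and C' = "\<lambda>p. 1" and D = "\<lambda>p. 0" and W = "\<lambda>u. 2 * \<kappa> * u", OF _ _ _ _ _ abc w _ closed])
    show "\<forall>\<^sub>C p. \<forall>u. a p * (c p / (2 * \<kappa>) * u + 1)\<^sup>2 + 2 * b p * (c p / (2 * \<kappa>) * u + 1) * (1 * u + 0) +
     c p * (1 * u + 0)\<^sup>2 = 2 * \<kappa> * u * (c p / (2 * \<kappa>) * 0 - 1 * 1)"
     using a b' by eventually_elim (use k in \<open>auto simp: field_simps power2_eq_square\<close>)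
   qed (intro gi | simp)+
  qed
 qed
qed

text \<open>The quadratic has one double zero, which must be sent to infinity, the only zero of
  \<open>d/dy\<close>. What remains is a scaling of the fibre coordinate.\<close>

lemma normal_form_zero:
 assumes abc: "rat_germ C a" "rat_germ C b" "rat_germ C c"
  and disc: "\<forall>\<^sub>C p. b p * b p - a p * c p = 0" and closed: "zclosed C"
  and nz: "dop (ric a b c) \<noteq> zero_vf S"
 shows "\<exists>\<phi>\<in>Bir_fib C. pull_vf S S \<phi> (dop (ric a b c)) = dop (\<lambda>s. 1)"
proof -
 note gi = C.rat_germ_const C.rat_germ_add C.rat_germ_mult C.rat_germ_uminus C.rat_germ_diff C.rat_germ_divide abc
 have w: "rat_germ S (\<lambda>s. 1)" by (intro S.rat_germ_const)
 from C.rat_germ_zero_or_nonzero[OF abc(1)] show ?thesis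
 proof
  assume a: "\<forall>\<^sub>C p. a p \<noteq> 0"
  show ?thesis
  \<comment> \<open>Infinity goes to the double zero \<open>- b / a\<close>; the entry
    \<open>-1\<close> makes the determinant \<open>a\<close>, the factor by which the transformed
    quadratic is a constant.\<close>
  proof (rule pull_ric[where A = "\<lambda>p. - b p" and B = "\<lambda>p. - 1" and C' = a and D = "\<lambda>_. 0" and W = "\<lambda>u. 1", OF _ _ _ _ _ abc w _ closed])
   show "\<forall>\<^sub>C p. - b p * 0 - (- 1) * a p \<noteq> 0" using a by eventually_elim simp
   show "\<forall>\<^sub>C p. \<forall>u. a p * (- b p * u + - 1)\<^sup>2 + 2 * b p * (- b p * u + - 1) * (a p * u + 0) +
     c p * (a p * u + 0)\<^sup>2 = 1 * (- b p * 0 - (- 1) * a p)"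
    using disc
   proof (eventually_elim, intro allI)
    fix p u assume d: "b p * b p - a p * c p = 0"
    hence ac: "a p * c p = b p * b p" by simp
    have "a p * (- b p * u + - 1)\<^sup>2 + 2 * b p * (- b p * u + - 1) * (a p * u + 0) + c p * (a p * u + 0)\<^sup>2 =
     a p * ((b p * u + 1)\<^sup>2 - 2 * b p * u * (b p * u + 1) + (a p * c p) * u\<^sup>2)"
     by (simp add: algebra_simps power2_eq_square)
    also have "\<dots> = 1 * (- b p * 0 - (- 1) * a p)"
     unfolding ac by (simp add: algebra_simps power2_eq_square)
    finally show "a p * (- b p * u + - 1)\<^sup>2 + 2 * b p * (- b p * u + - 1) * (a p * u + 0) +
     c p * (a p * u + 0)\<^sup>2 = 1 * (- b p * 0 - (- 1) * a p)" .
   qed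
  qed (intro gi)+
 next
  assume a: "\<forall>\<^sub>C p. a p = 0"
  have b: "\<forall>\<^sub>C p. b p = 0" using a disc by eventually_elim simp
  \<comment> \<open>With \<open>a = b = 0\<close> the field is \<open>c d/dy\<close>, and this is
    where the zero field has to be excluded: it is its own pull-back and has no such normal
    form.\<close>
  have c: "\<forall>\<^sub>C p. c p \<noteq> 0"
  proof (rule ccontr)
   assume "\<not> ?thesis"
   hence c: "\<forall>\<^sub>C p. c p = 0" using C.rat_germ_zero_or_nonzero[OF abc(3)] by blast
   have "\<forall>\<^sub>S s. ric a b c s = 0"
    using generic_base[OF a] generic_base[OF b] generic_base[OF c] by eventually_elim (simp add: ric_def)
   hence "dop (ric a b c) = dop (\<lambda>_. 0)"
    using dop_eq_iff[OF rat_germ_ric[OF abc] S.rat_germ_const] by blast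
   thus False using nz zero_vf_dop by simp
  qed
  show ?thesis
  proof (rule pull_ric[where A = c and B = "\<lambda>p. 0" and C' = "\<lambda>p. 0" and D = "\<lambda>p. 1" and W = "\<lambda>u. 1", OF _ _ _ _ _ abc w _ closed])
   show "\<forall>\<^sub>C p. c p * 1 - 0 * 0 \<noteq> 0" using c by simp
   show "\<forall>\<^sub>C p. \<forall>u. a p * (c p * u + 0)\<^sup>2 + 2 * b p * (c p * u + 0) * (0 * u + 1) +
     c p * (0 * u + 1)\<^sup>2 = 1 * (c p * 1 - 0 * 0)"
    using a b by eventually_elim simp
  qed (intro gi)+
 qed
qed

section \<open>Holomorphy of the normal forms\<close>

lemma holomorphic_dop:
 assumes v: "rat_germ S v" and reg: "\<And>h s z. regular_at S h s z ==> \<exists>w. regular_at S (\<lambda>s. v s * dy h s) s w"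
 shows "holomorphic_vf S (dop v)"
 unfolding holomorphic_vf_def holomorphic_vf_at_def
proof (intro ballI conjI impI)
 fix s g assume s: "s \<in> S" "g \<in> carrier (function_field S)" "s \<in> dom g"
 obtain h where h: "rat_germ S h" "g = RF S h" using s(2) by (rule S.carrier_E)
 obtain z where "g s = Some z" using s(3) by auto
 hence "regular_at S h s z" by (simp add: h(2) S.RF_Some)
 then obtain w where "RF S (\<lambda>s. v s * dy h s) s = Some w" using reg S.RF_Some by blast
 thus "s \<in> dom (dop v g)" unfolding h(2) dop_RF[OF h(1) v] by auto
qed

lemma holomorphic_dop_1: "holomorphic_vf S (dop (\<lambda>_. 1))"
 by (rule holomorphic_dop) (use dy_regular S.rat_germ_const in auto)

lemma holomorphic_dop_yc: "holomorphic_vf S (dop (\<lambda>s. c * yc s))"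
 by (rule holomorphic_dop) (use yc_dy_regular in \<open>auto intro!: S.rat_germ_mult S.rat_germ_const rat_germ_yc\<close>)

lemma holomorphic_dop_0: "holomorphic_vf S (dop (\<lambda>_. 0))"
proof (rule holomorphic_dop[OF S.rat_germ_const])
 fix h s z assume "regular_at S h s z"
 hence "s \<in> S" by (simp add: regular_at_def)
 thus "\<exists>w. regular_at S (\<lambda>s. 0 * dy h s) s w" using S.regular_at_const[of s 0] by auto
qed

end

section \<open>Smoothness of the ruled surface\<close>

definition pd :: "((nat => complex) => complex) => nat => (nat => complex) => complex" where
 "pd f i v = deriv (\<lambda>z. f (v(i := z))) (v i)"

lemma hp_partial:
 assumes "hp d f" shows "DERIV (\<lambda>z. f (v(i := z))) (v i) :> pd f i v"
proof -
 have e: "v(i := z) = (\<lambda>j. (v(i := 0)) j + z * (if j = i then 1 else 0))" for z by auto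
 obtain P where "\<And>z. f (v(i := z)) = poly P z"
  using hp_line_poly[OF assms, of "v(i := 0)" "\<lambda>j. if j = i then 1 else 0"] e by metis
 thus ?thesis unfolding pd_def by (simp add: DERIV_imp_deriv[OF poly_DERIV])
qed

lemma pd_eqI: "hp d f ==> (DERIV (\<lambda>z. f (v(i := z))) (v i) :> D) ==> pd f i v = D"
 using hp_partial DERIV_unique by blast

text \<open>Partial derivatives of a form of degree \<open>d\<close> are homogeneous of degree
  \<open>d - 1\<close>; the extra factor \<open>c\<close> avoids a subtraction of natural
  numbers.\<close>

lemma pd_scale:
 assumes "hp d f" "c \<noteq> 0" shows "c * pd f i (\<lambda>j. c * v j) = c ^ d * pd f i v"
proof -
 have e: "f ((\<lambda>j. c * v j)(i := z)) = c ^ d * f (v(i := inverse c * z))" for z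
 proof -
  have "(\<lambda>j. c * v j)(i := z) = (\<lambda>j. c * (v(i := inverse c * z)) j)" using assms(2) by auto
  thus ?thesis by (simp only: hp_scale[OF assms(1)])
 qed
 have "DERIV (\<lambda>z. inverse c * z) (c * v i) :> inverse c"
  by (auto intro!: derivative_eq_intros)
 moreover have "((\<lambda>z. f (v(i := z))) has_field_derivative pd f i v) (at (inverse c * (c * v i)))"
  using hp_partial[OF assms(1), of v i] assms(2) by (simp add: mult.assoc[symmetric])
 ultimately have "DERIV (\<lambda>z. f (v(i := inverse c * z))) (c * v i) :> pd f i v * inverse c"
  using DERIV_chain2 by blast
 from DERIV_cmult[OF this, of "c ^ d"]
 have "DERIV (\<lambda>z. f ((\<lambda>j. c * v j)(i := z))) (c * v i) :> c ^ d * (pd f i v * inverse c)"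
  unfolding e .
 from pd_eqI[OF assms(1) this] have "pd f i (\<lambda>j. c * v j) = c ^ d * (pd f i v * inverse c)" .
 thus ?thesis using assms(2) by simp
qed

lemma smooth_atE:
 assumes "smooth_at n d S p"
 obtains f e h d' where "\<forall>k<n - d. hp (e k) (f k)" "hp d' h" "h (crd p) \<noteq> 0"
  "\<forall>q\<in>proj_space n. h (crd q) \<noteq> 0 --> (q \<in> S \<longleftrightarrow> (\<forall>k<n - d. f k (crd q) = 0))"
  "\<forall>c. (\<forall>i\<le>n. (\<Sum>k<n - d. c k * pd (f k) i (crd p)) = 0) --> (\<forall>k<n - d. c k = 0)"
proof -
 obtain F H where *: "\<forall>k<n - d. is_form (F k)" "is_form H" "\<not> vanishes H p"
  "\<forall>q \<in> proj_space n. \<not> vanishes H q --> (q \<in> S \<longleftrightarrow> (\<forall>k<n - d. vanishes (F k) q))"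
  "\<forall>c :: nat => complex. (\<forall>i\<le>n. (\<Sum>k<n - d. c k *
        deriv (\<lambda>z. peval (F k) ((crd p)(i := z))) (crd p i)) = 0)
      --> (\<forall>k<n - d. c k = 0)"
  using assms unfolding smooth_at_def by (elim exE conjE) (rule that)
 have "\<forall>k. \<exists>e. k < n - d --> hp e (peval (F k))"
  using *(1) homogeneous_imp_hp unfolding is_form_def by metis
 then obtain e where e: "\<forall>k<n - d. hp (e k) (peval (F k))" by metis
 obtain d' where d': "hp d' (peval H)" using *(2) homogeneous_imp_hp unfolding is_form_def by metis
 have h: "peval H (crd p) \<noteq> 0" using *(3) by (simp add: vanishes_def)
 have "\<forall>q\<in>proj_space n. peval H (crd q) \<noteq> 0 --> (q \<in> S \<longleftrightarrow> (\<forall>k<n - d. peval (F k) (crd q) = 0))"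
  using *(4) by (simp add: vanishes_def)
 moreover have "\<forall>c. (\<forall>i\<le>n. (\<Sum>k<n - d. c k * pd (peval (F k)) i (crd p)) = 0) --> (\<forall>k<n - d. c k = 0)"
  using *(5) by (simp add: pd_def)
 ultimately show thesis using that[of e "\<lambda>k. peval (F k)" d' "peval H"] e d' h by blast
qed

lemma sum_lessThan_add: "(\<Sum>k<r + (n::nat). g k) = (\<Sum>k<r. g k) + (\<Sum>m<n. g (r + m) :: complex)"
 by (induction n) simp_all

lemma smooth_atI:
 assumes "\<And>k. k < n - d ==> \<exists>e. hp e (f k)" "hp e h" "h (crd p) \<noteq> 0"
  "\<And>q. q \<in> proj_space n ==> h (crd q) \<noteq> 0 ==> q \<in> S \<longleftrightarrow> (\<forall>k<n - d. f k (crd q) = 0)"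
  "\<And>c. (\<forall>i\<le>n. (\<Sum>k<n - d. c k * pd (f k) i (crd p)) = 0) ==> (\<forall>k<n - d. c k = 0)"
 shows "smooth_at n d S p"
proof -
 have "\<forall>k. \<exists>F. k < n - d --> is_form F \<and> f k = peval F"
  using assms(1) hp_imp_homogeneous unfolding is_form_def by metis
 then obtain F where F: "\<And>k. k < n - d ==> is_form (F k)" "\<And>k. k < n - d ==> f k = peval (F k)" by metis
 obtain H where H: "is_form H" "h = peval H" using hp_imp_homogeneous[OF assms(2)] unfolding is_form_def by blast
 show ?thesis unfolding smooth_at_def
 proof (intro exI[of _ F] exI[of _ H] conjI allI impI ballI)
  fix q assume "q \<in> proj_space n" "\<not> vanishes H q"
  thus "q \<in> S \<longleftrightarrow> (\<forall>k<n - d. vanishes (F k) q)"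
   using assms(4)[of q] F(2) H(2) by (simp add: vanishes_def)
 next
  fix c :: "nat => complex" and k
  assume *: "\<forall>i\<le>n. (\<Sum>k<n - d. c k * deriv (\<lambda>z. peval (F k) ((crd p)(i := z))) (crd p i)) = 0" "k < n - d"
  have "\<forall>i\<le>n. (\<Sum>k<n - d. c k * pd (f k) i (crd p)) = 0"
   using *(1) F(2) by (simp add: pd_def)
  thus "c k = 0" using assms(5) *(2) by blast
 qed (use F(1) H assms(3) in \<open>auto simp: vanishes_def\<close>)
qed

text \<open>Write the Segre coordinates as a matrix with two columns. Local equations are the
  equations of \<open>C\<close> in a column \<open>j0\<close> that is non-zero at the point, and the
  minors that make the other column \<open>j1\<close> proportional to it. The former do not involve
  column \<open>j1\<close>, and in the directions of column \<open>j1\<close> the minors have a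
  diagonal Jacobian. So the Jacobian is block triangular and independence reduces to that on
  \<open>C\<close>.\<close>

lemma smooth_at_ruled:
 assumes Csub: "C \<subseteq> proj_space n" and n: "1 \<le> n" and sm: "smooth_at n 1 C p" and p: "p \<in> C" and ab: "a \<noteq> 0 \<or> b \<noteq> 0"
 shows "smooth_at (2 * n + 1) 2 (ruled C) (rp p a b)"
proof -
 define r where "r = n - 1"
 obtain f e h eh where f: "\<forall>k<r. hp (e k) (f k)" "hp eh h" "h (crd p) \<noteq> 0"
  "\<forall>q\<in>proj_space n. h (crd q) \<noteq> 0 --> (q \<in> C \<longleftrightarrow> (\<forall>k<r. f k (crd q) = 0))"
  "\<forall>c. (\<forall>i\<le>n. (\<Sum>k<r. c k * pd (f k) i (crd p)) = 0) --> (\<forall>k<r. c k = 0)"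
  using smooth_atE[OF sm] unfolding r_def .
 have e: "hp (e k) (f k)" if "k < r" for k using f(1) that by blast
 note eh = f(2)
 obtain i0 where i0: "crd p i0 \<noteq> 0" by (rule rep_point_coord)
 have i0n: "i0 \<le> n"
 proof (rule ccontr)
  assume "\<not> i0 \<le> n"
  thus False using Csub p i0 by (auto simp: proj_space_def)
 qed
 \<comment> \<open>The column in which the fibre coordinate is non-zero, so that column
   \<open>j0\<close> of the point is a non-zero multiple of \<open>crd p\<close>.\<close>
 define j0 where "j0 = (if a \<noteq> 0 then 0 else 1 :: nat)"
 define j1 where "j1 = 1 - j0"
 have j: "j0 < 2" "j1 < 2" "j0 \<noteq> j1" by (auto simp: j0_def j1_def)
 define w where "w u v l = (if even l then u else v)" for u v :: complex and l :: nat
 have wj0: "w a b j0 \<noteq> 0" using ab by (auto simp: w_def j0_def)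
 have sg: "seg x u v (2 * i + l) = x i * w u v l" if "l < 2" for x u v i l
  using that by (auto simp: seg_def w_def)
 define X where "X z i = z (2 * i + j0)" for z :: "nat => complex" and i
 \<comment> \<open>Enumerates the rows \<open>0, ..., n\<close> except the pivot row
   \<open>i0\<close>, whose minor is identically zero.\<close>
 define im where "im m = (if m < i0 then m else Suc m)" for m
 have im: "im m \<le> n" "im m \<noteq> i0" if "m < n" for m using that by (auto simp: im_def)
 have im_inj: "im m = im m' \<longleftrightarrow> m = m'" for m m' by (auto simp: im_def split: if_splits)
 have im_surj: "\<exists>m<n. i = im m" if "i \<le> n" "i \<noteq> i0" for i
 proof (cases "i < i0")
  case True
  thus ?thesis using i0n by (intro exI[of _ i]) (auto simp: im_def)
 next
  case False
  thus ?thesis using that i0n by (intro exI[of _ "i - 1"]) (auto simp: im_def)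
 qed
 define q where "q i z = z (2 * i + j1) * z (2 * i0 + j0) - z (2 * i + j0) * z (2 * i0 + j1)" for i and z :: "nat => complex"
 define g where "g k z = (if k < r then f k (X z) else q (im (k - r)) z)" for k z
 define h' where "h' z = z (2 * i0 + j0) * h (X z)" for z
 have hX: "hp d (\<lambda>z. F (X z))" if "hp d F" for d F
  unfolding X_def by (rule hp_subst1[OF that]) (rule hp_var)
 have hq: "hp (Suc 0 + Suc 0) (q i)" for i
  unfolding q_def[abs_def] by (intro hp_diff hp.mult hp_var)
 have hg1: "g k = (\<lambda>z. f k (X z))" if "k < r" for k using that by (auto simp: g_def)
 have hg2: "g (r + m) = q (im m)" for m by (auto simp: g_def)
 have hg: "\<exists>e. hp e (g k)" for k
  using hX[OF e, of k] hq[of "im (k - r)"] by (cases "k < r") (auto simp: g_def[abs_def])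
 have hh: "hp (Suc 0 + eh) h'" unfolding h'_def[abs_def] by (intro hp.mult hp_var hX eh)
 \<comment> \<open>The codimension of a surface in \<open>P^(2n+1)\<close>: \<open>n - 1\<close>
   equations of the curve and \<open>n\<close> minors.\<close>
 have num: "2 * n + 1 - 2 = r + n" using n by (simp add: r_def)
 let ?s = "rp p a b"
 obtain c0 where c0: "c0 \<noteq> 0" "crd ?s = (\<lambda>k. c0 * seg (crd p) a b k)" using rep_rp[OF ab] .
 have Xs: "X (crd ?s) = (\<lambda>i. (c0 * w a b j0) * crd p i)"
  unfolding c0(2) X_def using sg[OF j(1)] by auto
 have zs: "crd ?s (2 * i0 + j0) \<noteq> 0" unfolding c0(2) sg[OF j(1)] using c0(1) i0 wj0 by simp
 show ?thesis
 proof (rule smooth_atI[where f = g and h = h'])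
  show "\<exists>e. hp e (g k)" for k by (rule hg)
  show "hp (Suc 0 + eh) h'" by (rule hh)
  show "h' (crd ?s) \<noteq> 0"
   unfolding h'_def Xs hp_scale[OF eh] using zs f(3) c0(1) wj0 by simp
 next
  fix rr assume rr: "rr \<in> proj_space (2 * n + 1)" "h' (crd rr) \<noteq> 0"
  let ?z = "crd rr"
  have z0: "?z (2 * i0 + j0) \<noteq> 0" and hz: "h (X ?z) \<noteq> 0" using rr(2) by (auto simp: h'_def)
  have gall: "(\<forall>k<2 * n + 1 - 2. g k ?z = 0) \<longleftrightarrow> (\<forall>k<r. f k (X ?z) = 0) \<and> (\<forall>m<n. q (im m) ?z = 0)"
  proof
   assume "\<forall>k<2 * n + 1 - 2. g k ?z = 0"
   hence *: "\<forall>k<r + n. g k ?z = 0" unfolding num .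
   have "f k (X ?z) = 0" if "k < r" for k using *[rule_format, of k] that by (simp add: g_def)
   moreover have "q (im m) ?z = 0" if "m < n" for m using *[rule_format, of "r + m"] that n by (simp add: hg2)
   ultimately show "(\<forall>k<r. f k (X ?z) = 0) \<and> (\<forall>m<n. q (im m) ?z = 0)" by blast
  next
   assume *: "(\<forall>k<r. f k (X ?z) = 0) \<and> (\<forall>m<n. q (im m) ?z = 0)"
   show "\<forall>k<2 * n + 1 - 2. g k ?z = 0"
    unfolding g_def num using * by (auto simp: not_less)
  qed
  show "rr \<in> ruled C \<longleftrightarrow> (\<forall>k<2 * n + 1 - 2. g k ?z = 0)"
  proof
   assume "rr \<in> ruled C"
   then obtain p' u v where p': "p' \<in> C" "u \<noteq> 0 \<or> v \<noteq> 0" "rr = rp p' u v" unfolding ruled_iff by blast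
   obtain c where c: "c \<noteq> 0" "?z = (\<lambda>k. c * seg (crd p') u v k)" using rep_rp[OF p'(2)] p'(3) by metis
   have Xr: "X ?z = (\<lambda>i. (c * w u v j0) * crd p' i)"
    unfolding c(2) X_def using sg[OF j(1)] by auto
   have wn: "c * w u v j0 \<noteq> 0" using z0 unfolding c(2) sg[OF j(1)] by auto
   have "h (crd p') \<noteq> 0" using hz wn unfolding Xr hp_scale[OF eh] by auto
   hence "\<forall>k<r. f k (crd p') = 0" using f(4) p'(1) Csub by blast
   hence "\<forall>k<r. f k (X ?z) = 0" unfolding Xr using hp_scale[OF e] by simp
   moreover have "q i ?z = 0" for i
    unfolding q_def c(2) sg[OF j(1)] sg[OF j(2)] by simp
   ultimately show "\<forall>k<2 * n + 1 - 2. g k ?z = 0" unfolding gall by blast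
  next
   assume "\<forall>k<2 * n + 1 - 2. g k ?z = 0"
   hence fz: "\<forall>k<r. f k (X ?z) = 0" and qz: "\<forall>m<n. q (im m) ?z = 0" unfolding gall by auto
   have z_big: "?z k = 0" if "k > 2 * n + 1" for k using rr(1) that by (simp add: proj_space_def)
   have qall: "q i ?z = 0" for i
   proof (cases "i \<le> n \<and> i \<noteq> i0")
    case True
    thus ?thesis using im_surj[of i] qz by auto
   next
    case False
    then consider "i = i0" | "i > n" by linarith
    thus ?thesis by cases (auto simp: q_def z_big)
   qed
   have Xn: "X ?z \<noteq> (\<lambda>_. 0)" using z0 by (auto simp: X_def fun_eq_iff)
   define p' where "p' = abs_point (X ?z)"
   obtain c where c: "c \<noteq> 0" "crd p' = (\<lambda>i. c * X ?z i)" using rep_abs_point[OF Xn] unfolding p'_def .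
   have "p' \<in> proj_space n" unfolding p'_def proj_space_abs[OF Xn] by (auto simp: X_def z_big)
   moreover have "h (crd p') \<noteq> 0" unfolding c(2) hp_scale[OF eh] using c(1) hz by simp
   moreover have "\<forall>k<r. f k (crd p') = 0" unfolding c(2) using hp_scale[OF e] fz by simp
   ultimately have p'C: "p' \<in> C" using f(4) by blast
   let ?u = "?z (2 * i0)" and ?v = "?z (2 * i0 + 1)"
   have uv: "?u \<noteq> 0 \<or> ?v \<noteq> 0" using z0 by (auto simp: j0_def split: if_splits)
   have W: "w ?u ?v l = ?z (2 * i0 + l)" if "l < 2" for l
   proof -
    have "l = 0 \<or> l = 1" using that by auto
    thus ?thesis by (auto simp: w_def)
   qed
   have "seg (crd p') ?u ?v = (\<lambda>k. (c * ?z (2 * i0 + j0)) * ?z k)"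
   proof
    fix k :: nat
    define i l where "i = k div 2" and "l = k mod 2"
    have k: "k = 2 * i + l" "l < 2" by (simp_all add: i_def l_def)
    have "?z (2 * i + j0) * ?z (2 * i0 + l) = ?z (2 * i0 + j0) * ?z (2 * i + l)"
    proof (cases "l = j0")
     case True
     thus ?thesis by simp
    next
     case False
     hence "l = j1" using k(2) j by (auto simp: j0_def j1_def split: if_splits)
     thus ?thesis using qall[of i] by (simp add: q_def mult.commute)
    qed
    thus "seg (crd p') ?u ?v k = (c * ?z (2 * i0 + j0)) * ?z k"
     unfolding k(1) sg[OF k(2)] W[OF k(2)] c(2) by (simp add: X_def)
   qed
   hence "rp p' ?u ?v = rr"
    unfolding rp_def using abs_point_scale[of "c * ?z (2 * i0 + j0)" ?z] c(1) z0 rep_point_nonzero[of rr] by simp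
   moreover have "rp p' ?u ?v \<in> ruled C" unfolding ruled_iff using p'C uv by blast
   ultimately show "rr \<in> ruled C" by simp
  qed
 next
  fix c :: "nat => complex"
  let ?z = "crd ?s"
  assume c: "\<forall>i\<le>2 * n + 1. (\<Sum>k<2 * n + 1 - 2. c k * pd (g k) i ?z) = 0"
  have split: "(\<Sum>k<2 * n + 1 - 2. c k * pd (g k) i ?z) =
    (\<Sum>k<r. c k * pd (\<lambda>z. f k (X z)) i ?z) + (\<Sum>m<n. c (r + m) * pd (q (im m)) i ?z)" for i
   unfolding num sum_lessThan_add by (simp add: hg1 hg2)
  have Xupd: "X (v(2 * i + l := t)) = (if l = j0 then (X v)(i := t) else X v)" if "l < 2" for v i l t
   using that j by (auto simp: X_def fun_eq_iff j0_def split: if_splits) presburger+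
  have pdfX0: "pd (\<lambda>z. f k (X z)) (2 * i + j1) v = 0" for k i v
   unfolding pd_def Xupd[OF j(2)] using j(3) by simp
  have pdfX1: "pd (\<lambda>z. f k (X z)) (2 * i + j0) v = pd (f k) i (X v)" for k i v
   unfolding pd_def Xupd[OF j(1)] by (simp add: X_def)
  have ne: "2 * i + j1 \<noteq> 2 * i' + j0" "2 * i' + j0 \<noteq> 2 * i + j1" for i i'
   using j by (auto simp: j0_def j1_def split: if_splits) presburger+
  have pdq: "pd (q i') (2 * i + j1) v = (if i = i' then v (2 * i0 + j0) else 0)" if "i \<noteq> i0" for i i' v
  proof (rule pd_eqI[OF hq])
   have e1: "2 * i0 + j1 \<noteq> 2 * i + j1" using that by simp
   show "((\<lambda>z. q i' (v(2 * i + j1 := z))) has_field_derivative (if i = i' then v (2 * i0 + j0) else 0)) (at (v (2 * i + j1)))"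
   proof (cases "i = i'")
    case True
    have "(\<lambda>z. q i' (v(2 * i + j1 := z))) = (\<lambda>z. z * v (2 * i0 + j0) - v (2 * i + j0) * v (2 * i0 + j1))"
     using True e1 ne j(3) by (auto simp: q_def fun_eq_iff)
    moreover have "((\<lambda>z. z * v (2 * i0 + j0) - v (2 * i + j0) * v (2 * i0 + j1)) has_field_derivative v (2 * i0 + j0)) (at (v (2 * i + j1)))"
     by (auto intro!: derivative_eq_intros)
    ultimately show ?thesis using True by simp
   next
    case False
    hence "2 * i' + j1 \<noteq> 2 * i + j1" by simp
    hence "(\<lambda>z. q i' (v(2 * i + j1 := z))) = (\<lambda>z. q i' v)"
     using e1 ne by (simp add: q_def fun_eq_iff)
    thus ?thesis using False by simp
   qed
  qed
  \<comment> \<open>In the direction of the coordinate \<open>2 * im m + j1\<close> only the minor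
    of row \<open>im m\<close> has a non-zero derivative, namely the pivot entry.\<close>
  have c2: "c (r + m) = 0" if m: "m < n" for m
  proof -
   have "2 * im m + j1 \<le> 2 * n + 1" using im(1)[OF m] j(2) by linarith
   hence "(\<Sum>k<r. c k * pd (\<lambda>z. f k (X z)) (2 * im m + j1) ?z) +
     (\<Sum>m'<n. c (r + m') * pd (q (im m')) (2 * im m + j1) ?z) = 0"
    using c split by simp
   hence "(\<Sum>m'<n. c (r + m') * (if im m = im m' then ?z (2 * i0 + j0) else 0)) = 0"
    by (simp only: pdfX0 pdq[OF im(2)[OF m]]) simp
   also have "(\<Sum>m'<n. c (r + m') * (if im m = im m' then ?z (2 * i0 + j0) else 0)) =
     (\<Sum>m'<n. if m' = m then c (r + m) * ?z (2 * i0 + j0) else 0)"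
    by (rule sum.cong) (auto simp: im_inj)
   finally show ?thesis using m zs by (simp add: sum.delta)
  qed
  have c1: "\<forall>k<r. c k = 0"
  proof -
   let ?l = "c0 * w a b j0"
   have l: "?l \<noteq> 0" using c0(1) wj0 by simp
   \<comment> \<open>Independence on \<open>C\<close> is known at \<open>crd p\<close>, whereas
     column \<open>j0\<close> of the point is \<open>?l\<close> times this vector. The resulting
     powers of \<open>?l\<close> differ with the degrees \<open>e k\<close>, so they are absorbed
     into the coefficients.\<close>
   have "(\<Sum>k<r. (c k * ?l ^ e k) * pd (f k) i (crd p)) = 0" if i: "i \<le> n" for i
   proof -
    have "2 * i + j0 \<le> 2 * n + 1" using i j(1) by linarith
    hence "(\<Sum>k<r. c k * pd (\<lambda>z. f k (X z)) (2 * i + j0) ?z) +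
      (\<Sum>m<n. c (r + m) * pd (q (im m)) (2 * i + j0) ?z) = 0"
     using c split by simp
    moreover have "(\<Sum>m<n. c (r + m) * pd (q (im m)) (2 * i + j0) ?z) = 0" by (simp add: c2)
    ultimately have "(\<Sum>k<r. c k * pd (f k) i (\<lambda>i. ?l * crd p i)) = 0"
     unfolding pdfX1 Xs by simp
    hence "(\<Sum>k<r. ?l * (c k * pd (f k) i (\<lambda>i. ?l * crd p i))) = 0"
     by (simp only: sum_distrib_left[symmetric]) simp
    also have "(\<Sum>k<r. ?l * (c k * pd (f k) i (\<lambda>i. ?l * crd p i))) =
      (\<Sum>k<r. (c k * ?l ^ e k) * pd (f k) i (crd p))"
    proof (rule sum.cong[OF refl])
     fix k assume "k \<in> {..<r}"
     hence "hp (e k) (f k)" using e by simp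
     from pd_scale[OF this l, of i "crd p"]
     show "?l * (c k * pd (f k) i (\<lambda>i. ?l * crd p i)) = (c k * ?l ^ e k) * pd (f k) i (crd p)"
      by (metis mult.assoc mult.left_commute)
    qed
    finally show ?thesis .
   qed
   hence "\<forall>k<r. c k * ?l ^ e k = 0" using f(5)[THEN spec, of "\<lambda>k. c k * ?l ^ e k"] by blast
   thus ?thesis using l by simp
  qed
  show "\<forall>k<2 * n + 1 - 2. c k = 0"
  proof (intro allI impI)
   fix k assume k: "k < 2 * n + 1 - 2"
   show "c k = 0"
   proof (cases "k < r")
    case False
    hence "k = r + (k - r)" "k - (r) < n" using k num by auto
    thus ?thesis using c2 by metis
   qed (use c1 in blast)
  qed
 qed
qed

lemma smooth_projective_ruled:
 assumes "smooth_projective_curve n C"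
 shows "smooth_projective_surface (2 * n + 1) (ruled C)"
proof -
 have C: "projective_variety n C" "1 \<le> n" "\<And>p. p \<in> C ==> smooth_at n 1 C p"
  using assms by (auto simp: smooth_projective_def)
 have Csub: "C \<subseteq> proj_space n" using C(1) unfolding projective_variety_def by blast
 interpret irreducible C by (rule projective_variety_irreducible[OF C(1)])
 \<comment> \<open>The full vanishing ideal serves as the set of equations; that it cuts out exactly
   \<open>ruled C\<close> is the closedness already proved.\<close>
 let ?A = "{F. is_form F \<and> (\<forall>s\<in>ruled C. vanishes F s)}"
 have sub: "ruled C \<subseteq> proj_space (2 * n + 1)"
 proof
  fix s assume "s \<in> ruled C"
  then obtain p a b where s: "p \<in> C" "a \<noteq> 0 \<or> b \<noteq> 0" "s = rp p a b" unfolding ruled_iff by blast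
  have "crd p i = 0" if "i > n" for i using Csub s(1) that by (auto simp: proj_space_def)
  thus "s \<in> proj_space (2 * n + 1)"
   unfolding s(3) rp_def proj_space_abs[OF seg_nonzero[OF rep_point_nonzero s(2)]] by (auto simp: seg_def)
 qed
 have eq: "ruled C = proj_space (2 * n + 1) \<inter> zero_set ?A"
 proof
  show "ruled C \<subseteq> proj_space (2 * n + 1) \<inter> zero_set ?A" using sub by (auto simp: zero_set_def)
  show "proj_space (2 * n + 1) \<inter> zero_set ?A \<subseteq> ruled C"
  proof
   fix q assume q: "q \<in> proj_space (2 * n + 1) \<inter> zero_set ?A"
   show "q \<in> ruled C"
   proof (rule zclosedD[OF zclosed_ruled[OF zclosed_projective_variety[OF C(1)]]])
    fix e G assume G: "hp e G" "\<And>p. p \<in> ruled C ==> G (crd p) = 0"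
    obtain F where F: "homogeneous e F" "G = peval F" using hp_imp_homogeneous[OF G(1)] by blast
    have "F \<in> ?A" using F G(2) by (auto simp: is_form_def vanishes_def)
    thus "G (crd q) = 0" using q F(2) by (auto simp: zero_set_def vanishes_def)
   qed
  qed
 qed
 have "projective_variety (2 * n + 1) (ruled C)"
  by (rule irreducible_projective_variety[OF ruled_irreducible[OF irreducible_axioms] _ eq]) auto
 moreover have "smooth_at (2 * n + 1) 2 (ruled C) s" if "s \<in> ruled C" for s
  using that smooth_at_ruled[OF Csub C(2,3)] unfolding ruled_iff by blast
 ultimately show ?thesis unfolding smooth_projective_def using C(2) by simp
qed

context ruled_surface
begin

lemma regularizable_normal_form:
 assumes "smooth_projective_curve n C" "\<phi> \<in> Bir_fib C" "holomorphic_vf S (pull_vf S S \<phi> X)"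
 shows "regularizable S X"
 unfolding regularizable_def
 using smooth_projective_ruled[OF assms(1)] assms(2,3) unfolding Bir_fib_def Bir_def by auto

lemma regularizable_zero:
 assumes "smooth_projective_curve n C"
 shows "regularizable S (dop (\<lambda>_. 0))"
proof -
 have cl: "zclosed C" using assms zclosed_projective_variety by (auto simp: smooth_projective_def)
 interpret M: moebius C \<alpha> \<beta> \<gamma> \<delta> "\<lambda>_. 1" "\<lambda>_. 0" "\<lambda>_. 0" "\<lambda>_. 1"
  by unfold_locales (auto intro: C.rat_germ_const)
 have "pull_vf S S (Mob (\<lambda>_. 1) (\<lambda>_. 0) (\<lambda>_. 0) (\<lambda>_. 1)) (dop (\<lambda>_. 0)) = dop (\<lambda>_. 0)"
  by (rule M.pull_vf_Mob) (auto intro: S.rat_germ_const)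
 thus ?thesis using regularizable_normal_form[OF assms M.Mob_Bir_fib[OF cl]] holomorphic_dop_0 by simp
qed

end

section \<open>The flow of a Riccati field\<close>

text \<open>With \<open>sk\<close>, the functions \<open>cosh (\<kappa> t)\<close> and
  \<open>sinh (\<kappa> t) / \<kappa>\<close>, continued to \<open>\<kappa> = 0\<close>. If the
  square of a matrix \<open>M\<close> is \<open>\<kappa>^2\<close> times the identity, the
  exponential of \<open>t M\<close> is \<open>ck \<kappa> t\<close> times the identity plus
  \<open>sk \<kappa> t\<close> times \<open>M\<close>; this covers both cases of the
  theorem.\<close>

definition ck :: "complex => complex => complex" where
 "ck \<kappa> t = (if \<kappa> = 0 then 1 else cosh (\<kappa> * t))"

definition sk :: "complex => complex => complex" where
 "sk \<kappa> t = (if \<kappa> = 0 then t else sinh (\<kappa> * t) / \<kappa>)"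

lemma ck_sk_0 [simp]: "ck \<kappa> 0 = 1" "sk \<kappa> 0 = 0"
 by (simp_all add: ck_def sk_def)

lemma ck_sk_sq: "ck \<kappa> t * ck \<kappa> t - \<kappa>\<^sup>2 * (sk \<kappa> t * sk \<kappa> t) = 1"
 using hyperbolic_pythagoras[of "\<kappa> * t"]
 by (auto simp: ck_def sk_def power2_eq_square field_simps cosh_square_eq)

lemma ck_sk_add: "ck \<kappa> (s + t) = ck \<kappa> s * ck \<kappa> t + \<kappa>\<^sup>2 * (sk \<kappa> s * sk \<kappa> t)"
 "sk \<kappa> (s + t) = sk \<kappa> s * ck \<kappa> t + ck \<kappa> s * sk \<kappa> t"
 by (auto simp: ck_def sk_def distrib_left cosh_add sinh_add power2_eq_square add_divide_distrib)

lemma ck_sk_deriv: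
 "DERIV (ck \<kappa>) t :> \<kappa>\<^sup>2 * sk \<kappa> t" "DERIV (sk \<kappa>) t :> ck \<kappa> t"
proof -
 have c: "DERIV (\<lambda>t. cosh (\<kappa> * t)) t :> sinh (\<kappa> * t) * \<kappa>"
  by (auto intro!: derivative_eq_intros)
 have s: "DERIV (\<lambda>t. sinh (\<kappa> * t)) t :> cosh (\<kappa> * t) * \<kappa>"
  by (auto intro!: derivative_eq_intros)
 show "DERIV (ck \<kappa>) t :> \<kappa>\<^sup>2 * sk \<kappa> t"
 proof (cases "\<kappa> = 0")
  case True
  thus ?thesis by (simp add: ck_def[abs_def])
 next
  case False
  thus ?thesis using c by (simp add: ck_def[abs_def] sk_def power2_eq_square mult.commute)
 qed
 show "DERIV (sk \<kappa>) t :> ck \<kappa> t"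
 proof (cases "\<kappa> = 0")
  case True
  thus ?thesis by (simp add: ck_def sk_def[abs_def])
 next
  case False
  thus ?thesis using DERIV_cdivide[OF s, of \<kappa>] by (simp add: sk_def[abs_def] ck_def)
 qed
qed

context ruled_surface
begin

lemma Mob_cong:
 assumes "\<forall>\<^sub>C p. a p = a' p \<and> b p = b' p \<and> c p = c' p \<and> d p = d' p"
 shows "Mob a b c d = Mob a' b' c' d'"
 unfolding Mob_def
 by (rule S.map_ext_cong, rule eventually_mono[OF generic_base[OF assms]]) (simp add: mob_def)

text \<open>In homogeneous coordinates the Riccati field is the linear field of the trace-zero
  matrix \<open>(b, c; -a, -b)\<close>. Over a base point where the coefficients are regular it is
  therefore holomorphic on the whole fibre, infinity included, and its integral curves come from a
  linear flow.\<close>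

lemma riccati_derivative:
 assumes reg: "regular_at C a p a'" "regular_at C b p b'" "regular_at C c p c'"
  and u: "u0 \<noteq> 0 \<or> u1 \<noteq> 0" and h: "regular_at S h (rq p u0 u1) z"
 shows "\<exists>w. regular_at S (\<lambda>s. ric a b c s * dy h s) (rq p u0 u1) w \<and>
  (\<forall>c0 c1 t. c0 t = u0 --> c1 t = u1 -->
   (DERIV c0 t :> b' * u0 + c' * u1) -->
   (DERIV c1 t :> - a' * u0 - b' * u1) -->
   (DERIV (\<lambda>\<tau>. the (RF S h (rq p (c0 \<tau>) (c1 \<tau>)))) t :> w))"
proof -
 have p: "p \<in> C" using reg(1) by (simp add: regular_at_def)
 define hs zs where "hs i = [a, b, c] ! i" and "zs i = [a', b', c'] ! i" for i
 have "regular_at C (hs i) p (zs i)" if "i < 3" for i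
 proof -
  have "i = 0 \<or> i = 1 \<or> i = 2" using that by auto
  thus ?thesis using reg by (auto simp: hs_def zs_def)
 qed
 from C.regular_at_common_denominator[of 3 hs p zs, OF this p]
 obtain e Q H where QH: "hp e Q" "Q (crd p) \<noteq> 0" "\<forall>i<3. hp e (H i) \<and> zs i = H i (crd p) / Q (crd p) \<and>
   (\<forall>\<^sub>C q. hs i q = H i (crd q) / Q (crd q))" by blast
 have Hval: "a' = H 0 (crd p) / Q (crd p)" "b' = H 1 (crd p) / Q (crd p)"
  "c' = H 2 (crd p) / Q (crd p)"
  using QH(3)[rule_format, of 0] QH(3)[rule_format, of 1] QH(3)[rule_format, of 2]
  by (auto simp: zs_def)
 have Hgen: "\<forall>\<^sub>C q. a q = H 0 (crd q) / Q (crd q)"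
  "\<forall>\<^sub>C q. b q = H 1 (crd q) / Q (crd q)"
  "\<forall>\<^sub>C q. c q = H 2 (crd q) / Q (crd q)"
  using QH(3)[rule_format, of 0] QH(3)[rule_format, of 1] QH(3)[rule_format, of 2]
  by (auto simp: hs_def)
 define U where "U = (if u1 \<noteq> 0 then U1 else U0)"
 define L where "L v0 v1 = (if u1 \<noteq> 0 then v1 else v0)" for v0 v1 :: complex
 have U: "U i (sq x v0 v1) = L v0 v1 * x i" for i x v0 v1
  by (auto simp: U_def L_def U_sq)
 have hU: "hp (Suc 0) (U i)" for i by (auto simp: U_def hp_U)
 define K where "K j z = H j (\<lambda>i. U i z)" for j z
 define QU where "QU z = Q (\<lambda>i. U i z)" for z
 have hK: "hp e (K j)" if "j < 3" for j
  unfolding K_def[abs_def] by (rule hp_subst1[OF _ hU]) (use QH(3) that in blast)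
 have hQ: "hp e QU" unfolding QU_def[abs_def] by (rule hp_subst1[OF QH(1) hU])
 have Ksq: "K j (sq x v0 v1) = L v0 v1 ^ e * H j x" if "j < 3" for j x v0 v1
  unfolding K_def U by (rule hp_scale) (use QH(3) that in blast)
 have Qsq: "QU (sq x v0 v1) = L v0 v1 ^ e * Q x" for x v0 v1
  unfolding QU_def U by (rule hp_scale[OF QH(1)])
 have Lu: "L u0 u1 \<noteq> 0" using u by (auto simp: L_def)
 define M0 where "M0 x v0 v1 = L v0 v1 ^ e * (H 1 x * v0 + H 2 x * v1)" for x v0 v1
 define M1 where "M1 x v0 v1 = L v0 v1 ^ e * (- (H 0 x) * v0 - H 1 x * v1)" for x v0 v1
 define n0 where "n0 i z = K 1 z * U0 i z + K 2 z * U1 i z" for i z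
 define n1 where "n1 i z = - (K 0 z) * U0 i z - K 1 z * U1 i z" for i z
 have hn: "hp (Suc e) (n0 i)" "hp (Suc e) (n1 i)" for i
 proof -
  have "hp (e + Suc 0) (n0 i)" unfolding n0_def[abs_def] by (intro hp.add hp.mult hK hp_U; simp)
  moreover have "hp (e + Suc 0) (n1 i)" unfolding n1_def[abs_def] by (intro hp_diff hp.mult hp_uminus hK hp_U; simp)
  ultimately show "hp (Suc e) (n0 i)" "hp (Suc e) (n1 i)" by simp_all
 qed
 have M: "n0 i (sq x v0 v1) = x i * M0 x v0 v1" "n1 i (sq x v0 v1) = x i * M1 x v0 v1" for i x v0 v1
  by (simp_all add: n0_def n1_def M0_def M1_def Ksq U_sq algebra_simps)
 have gen: "\<forall>\<^sub>S s. ric a b c s * QU (sq (crd (base_pt s)) (yc s) 1) =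
   M0 (crd (base_pt s)) (yc s) 1 - yc s * M1 (crd (base_pt s)) (yc s) 1"
  using generic_base[OF Hgen(1)] generic_base[OF Hgen(2)] generic_base[OF Hgen(3)]
   generic_base[OF C.generic_nonzero[OF QH(1) p QH(2)]]
 proof eventually_elim
  case (elim s)
  define x q where "x = crd (base_pt s)" and "q = Q (crd (base_pt s))"
  have q: "q \<noteq> 0" using elim(4) by (simp add: q_def)
  have e: "a (base_pt s) * q = H 0 x" "b (base_pt s) * q = H 1 x" "c (base_pt s) * q = H 2 x"
   using elim q by (simp_all add: q_def x_def)
  have "ric a b c s * QU (sq x (yc s) 1) = L (yc s) 1 ^ e * (a (base_pt s) * q * (yc s * yc s) + 2 * (b (base_pt s) * q) * yc s + c (base_pt s) * q)"
   unfolding Qsq ric_def x_def q_def by (simp add: algebra_simps)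
  thus ?case unfolding e M0_def M1_def x_def[symmetric] by (simp add: algebra_simps)
 qed
 have Qn: "QU (sq (crd p) u0 u1) \<noteq> 0" unfolding Qsq using Lu QH(2) by simp
 have val: "M0 (crd p) u0 u1 / QU (sq (crd p) u0 u1) = b' * u0 + c' * u1"
  "M1 (crd p) u0 u1 / QU (sq (crd p) u0 u1) = - a' * u0 - b' * u1"
  unfolding M0_def M1_def Qsq Hval using Lu QH(2) by (simp_all add: add_divide_distrib diff_divide_distrib)
 from linear_field_regular[OF hn hQ M gen h p u Qn] show ?thesis unfolding val .
qed

text \<open>The square of \<open>(b, c; -a, -b)\<close> is the discriminant times the identity. As
  the discriminant is the constant \<open>\<kappa>^2\<close>, the numbers
  \<open>ck \<kappa> t\<close> and \<open>sk \<kappa> t\<close> do not vary with the base point and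
  the exponential has entries in the function field of \<open>C\<close>.\<close>

lemma riccati_integrable:
 assumes abc: "rat_germ C a" "rat_germ C b" "rat_germ C c"
  and disc: "\<forall>\<^sub>C p. b p * b p - a p * c p = \<kappa>\<^sup>2" and closed: "zclosed C"
 shows "birationally_integrable S (dop (ric a b c))"
proof -
 let ?c = "ck \<kappa>" and ?s = "sk \<kappa>"
 \<comment> \<open>The entries of the exponential of \<open>t\<close> times the matrix; its
   determinant is \<open>ck^2 - \<kappa>^2 sk^2 = 1\<close>.\<close>
 define A B C' D where "A t p = ?c t + ?s t * b p" and "B t p = ?s t * c p"
  and "C' t p = - ?s t * a p" and "D t p = ?c t - ?s t * b p" for t p
 have AD: "A t p * D t p - B t p * C' t p = 1" if "b p * b p - a p * c p = \<kappa>\<^sup>2" for t p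
 proof -
  have "A t p * D t p - B t p * C' t p = ?c t * ?c t - (b p * b p - a p * c p) * (?s t * ?s t)"
   by (simp add: A_def B_def C'_def D_def algebra_simps)
  thus ?thesis using ck_sk_sq[of \<kappa> t] that by simp
 qed
 have mb: "moebius C \<alpha> \<beta> \<gamma> \<delta> (A t) (B t) (C' t) (D t)" for t
 proof
  show "rat_germ C (A t)" "rat_germ C (B t)" "rat_germ C (C' t)" "rat_germ C (D t)"
   unfolding A_def[abs_def] B_def[abs_def] C'_def[abs_def] D_def[abs_def]
   by (intro C.rat_germ_add C.rat_germ_mult C.rat_germ_diff C.rat_germ_const abc)+
  show "\<forall>\<^sub>C p. A t p * D t p - B t p * C' t p \<noteq> 0"
   using disc by eventually_elim (simp add: AD)
 qed
 define \<phi> where "\<phi> t = Mob (A t) (B t) (C' t) (D t)" for t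
 have hom: "\<phi> \<in> hom \<lparr>carrier = UNIV, mult = (+), one = (0::complex)\<rparr> (Bir S)"
 proof (rule homI)
  fix t show "\<phi> t \<in> carrier (Bir S)" unfolding \<phi>_def by (rule moebius.Mob_Bir[OF mb closed])
 next
  fix s t :: complex
  have "map_ext S (\<phi> s \<circ>\<^sub>m \<phi> t) = \<phi> (s + t)"
   unfolding \<phi>_def moebius.Mob_comp[OF mb mb]
  proof (rule Mob_cong)
   show "\<forall>\<^sub>C p. A s p * A t p + B s p * C' t p = A (s + t) p \<and> A s p * B t p + B s p * D t p = B (s + t) p \<and>
     C' s p * A t p + D s p * C' t p = C' (s + t) p \<and> C' s p * B t p + D s p * D t p = D (s + t) p"
    using disc
   proof eventually_elim
    case (elim p)
    have "A (s + t) p = ?c s * ?c t + (b p * b p - a p * c p) * (?s s * ?s t) + (?s s * ?c t + ?c s * ?s t) * b p"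
     "D (s + t) p = ?c s * ?c t + (b p * b p - a p * c p) * (?s s * ?s t) - (?s s * ?c t + ?c s * ?s t) * b p"
     unfolding A_def D_def ck_sk_add elim by simp_all
    thus ?case by (simp add: A_def B_def C'_def D_def ck_sk_add algebra_simps)
   qed
  qed
  thus "\<phi> (s \<otimes>\<^bsub>\<lparr>carrier = UNIV, mult = (+), one = 0\<rparr>\<^esub> t) = \<phi> s \<otimes>\<^bsub>Bir S\<^esub> \<phi> t"
   by (simp add: Bir_def)
 qed
 have "\<forall>\<^sub>C p. regular_at C a p (a p) \<and> regular_at C b p (b p) \<and> regular_at C c p (c p) \<and> b p * b p - a p * c p = \<kappa>\<^sup>2"
  using C.RF_generic[OF abc(1)] C.RF_generic[OF abc(2)] C.RF_generic[OF abc(3)] disc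
  by eventually_elim (simp add: C.RF_Some)
 then obtain d F p0 where F: "hp d F" "p0 \<in> C" "F (crd p0) \<noteq> 0"
  "\<forall>p\<in>C. F (crd p) \<noteq> 0 --> regular_at C a p (a p) \<and> regular_at C b p (b p) \<and> regular_at C c p (c p) \<and> b p * b p - a p * c p = \<kappa>\<^sup>2"
  unfolding C.eventually_generic by blast
 \<comment> \<open>Whole fibres over an open part of \<open>C\<close> where the coefficients are
   regular and the discriminant takes its value. The flow preserves these fibres and has no poles on
   them, so all complex times are allowed.\<close>
 define V where "V = {s\<in>S. F (crd (base_pt s)) \<noteq> 0}"
 have Vrq: "rq p u0 u1 \<in> V \<longleftrightarrow> p \<in> C \<and> F (crd p) \<noteq> 0" if "u0 \<noteq> 0 \<or> u1 \<noteq> 0" for p u0 u1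
 proof -
  have "rq p u0 u1 \<in> S ==> p \<in> C" using base_in[of "rq p u0 u1"] that by simp
  thus ?thesis using rq_in that by (auto simp: V_def)
 qed
 have V_E: "\<exists>p u0 u1. p \<in> C \<and> (u0 \<noteq> 0 \<or> u1 \<noteq> 0) \<and> s = rq p u0 u1 \<and> F (crd p) \<noteq> 0" if "s \<in> V" for s
 proof -
  have "s \<in> S" using that by (simp add: V_def)
  then obtain p u0 u1 where "p \<in> C" "u0 \<noteq> 0 \<or> u1 \<noteq> 0" "s = rq p u0 u1" by (rule S_E)
  thus ?thesis using that Vrq by blast
 qed
 have \<phi>_val: "A t p * u0 + B t p * u1 \<noteq> 0 \<or> C' t p * u0 + D t p * u1 \<noteq> 0"
  "\<phi> t (rq p u0 u1) = Some (rq p (A t p * u0 + B t p * u1) (C' t p * u0 + D t p * u1))"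
  if p: "p \<in> C" "F (crd p) \<noteq> 0" and u: "u0 \<noteq> 0 \<or> u1 \<noteq> 0" for t p u0 u1
 proof -
  have r: "regular_at C a p (a p)" "regular_at C b p (b p)" "regular_at C c p (c p)" "b p * b p - a p * c p = \<kappa>\<^sup>2"
   using F(4) p by blast+
  have rr: "regular_at C (A t) p (A t p)" "regular_at C (B t) p (B t p)" "regular_at C (C' t) p (C' t p)" "regular_at C (D t) p (D t p)"
  proof -
   have "D t = (\<lambda>p. ?c t + (- ?s t) * b p)" by (auto simp: D_def)
   thus "regular_at C (D t) p (D t p)"
    using C.regular_at_add[OF C.regular_at_const[OF p(1), of "?c t"] C.regular_at_mult[OF C.regular_at_const[OF p(1), of "- ?s t"] r(2)]] by simp
  qed (unfold A_def[abs_def] B_def[abs_def] C'_def[abs_def],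
    (intro C.regular_at_add C.regular_at_mult C.regular_at_const r p)+)
  interpret M: moebius C \<alpha> \<beta> \<gamma> \<delta> "A t" "B t" "C' t" "D t" by (rule mb)
  show nz: "A t p * u0 + B t p * u1 \<noteq> 0 \<or> C' t p * u0 + D t p * u1 \<noteq> 0"
   by (rule M.mob_nonzero[OF _ u]) (simp add: AD[OF r(4)])
  show "\<phi> t (rq p u0 u1) = Some (rq p (A t p * u0 + B t p * u1) (C' t p * u0 + D t p * u1))"
   unfolding \<phi>_def by (rule Mob_regular[OF rr u nz])
 qed
 define \<Phi> where "\<Phi> t s = the (\<phi> t s)" for t s
 have adm: "admissible S (UNIV \<times> V)"
  unfolding admissible_def
 proof (intro conjI)
  \<comment> \<open>The base point is not given by one family of forms on the whole surface, but
    everywhere one of the vectors \<open>U0\<close>, \<open>U1\<close> is a non-zero multiple of its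
    coordinates; this exhibits \<open>V\<close> as relatively open.\<close>
  define OS where "OS = {s. F (\<lambda>i. U0 i (crd s)) \<noteq> 0} \<union> {s. F (\<lambda>i. U1 i (crd s)) \<noteq> 0}"
  have hF: "hp d (\<lambda>z. F (\<lambda>i. U0 i z))" "hp d (\<lambda>z. F (\<lambda>i. U1 i z))"
   by (rule hp_subst1[OF F(1)], rule hp_U)+
  have "open OS" unfolding OS_def by (intro open_Un hp_open_points[OF hF(1)] hp_open_points[OF hF(2)])
  moreover have "V = S \<inter> OS"
  proof -
   have "s \<in> V \<longleftrightarrow> s \<in> OS" if s: "s \<in> S" for s
   proof -
    obtain p u0 u1 where p: "p \<in> C" "u0 \<noteq> 0 \<or> u1 \<noteq> 0" "s = rq p u0 u1" using s by (rule S_E)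
    have "F (\<lambda>i. U0 i (sq (crd p) u0 u1)) = u0 ^ d * F (crd p)"
     "F (\<lambda>i. U1 i (sq (crd p) u0 u1)) = u1 ^ d * F (crd p)"
     unfolding U_sq using hp_scale[OF F(1)] by (simp_all add: mult.commute)
    hence "s \<in> OS \<longleftrightarrow> u0 ^ d * F (crd p) \<noteq> 0 \<or> u1 ^ d * F (crd p) \<noteq> 0"
     unfolding OS_def p(3) using hp_rq_zero_iff[OF hF(1) p(2), of p] hp_rq_zero_iff[OF hF(2) p(2), of p] by simp
    thus ?thesis using Vrq[OF p(2), of p] p by auto
   qed
   thus ?thesis by (auto simp: V_def)
  qed
  ultimately have "openin (top_of_set S) V" by (auto simp: openin_open)
  thus "openin (top_of_set (UNIV \<times> S)) (UNIV \<times> V)"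
   by (intro openin_Times) simp_all
  have "\<forall>\<^sub>S s. s \<in> V"
   using generic_base[OF C.generic_nonzero[OF F(1-3)]] S.generic_in by eventually_elim (simp add: V_def)
  from S.generic_zariski_open[OF this] obtain W where "zariski_open_in S W" "W \<noteq> {}" "W \<subseteq> V" by blast
  thus "\<exists>V' W. V' \<subseteq> S \<and> zariski_open_in S W \<and> W \<noteq> {} \<and> W \<subseteq> V' \<and> {0} \<times> V' \<subseteq> UNIV \<times> V"
   by (intro exI[of _ V] exI[of _ W]) (auto simp: V_def)
 qed
 have flow: "local_flow_on S (dop (ric a b c)) (UNIV \<times> V) \<Phi>"
  unfolding local_flow_on_def Let_def
 proof (intro allI impI)
  fix s assume "{t. (t, s) \<in> (UNIV :: complex set) \<times> V} \<noteq> {}"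
  hence s: "s \<in> V" by auto
  hence T: "{t. (t, s) \<in> (UNIV :: complex set) \<times> V} = UNIV" by auto
  obtain p u0 u1 where p: "p \<in> C" "u0 \<noteq> 0 \<or> u1 \<noteq> 0" "s = rq p u0 u1" "F (crd p) \<noteq> 0" using V_E[OF s] by blast
  have r: "regular_at C a p (a p)" "regular_at C b p (b p)" "regular_at C c p (c p)" "b p * b p - a p * c p = \<kappa>\<^sup>2"
   using F(4) p by blast+
  define c0 c1 where "c0 t = A t p * u0 + B t p * u1" and "c1 t = C' t p * u0 + D t p * u1" for t
  have nz: "c0 t \<noteq> 0 \<or> c1 t \<noteq> 0" and val: "\<Phi> t s = rq p (c0 t) (c1 t)" for t
   using \<phi>_val[OF p(1,4,2)] by (simp_all add: c0_def c1_def \<Phi>_def p(3))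
  have d0: "DERIV c0 t :> b p * c0 t + c p * c1 t" for t
  proof -
   have "DERIV c0 t :> (\<kappa>\<^sup>2 * ?s t + ?c t * b p) * u0 + (?c t * c p) * u1"
    unfolding c0_def[abs_def] A_def B_def
    by (intro DERIV_add DERIV_cmult_right ck_sk_deriv)
   moreover have "(\<kappa>\<^sup>2 * ?s t + ?c t * b p) * u0 + (?c t * c p) * u1 = b p * c0 t + c p * c1 t"
    unfolding r(4)[symmetric] c0_def c1_def A_def B_def C'_def D_def by (simp add: algebra_simps)
   ultimately show ?thesis by simp
  qed
  have d1: "DERIV c1 t :> - a p * c0 t - b p * c1 t" for t
  proof -
   have "DERIV (\<lambda>t. - ?s t * a p * u0 + (?c t - ?s t * b p) * u1) t :> (- ?c t * a p) * u0 + (\<kappa>\<^sup>2 * ?s t - ?c t * b p) * u1"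
    by (intro DERIV_add DERIV_diff DERIV_minus DERIV_cmult_right ck_sk_deriv)
   moreover have "(- ?c t * a p) * u0 + (\<kappa>\<^sup>2 * ?s t - ?c t * b p) * u1 = - a p * c0 t - b p * c1 t"
    unfolding r(4)[symmetric] c0_def c1_def A_def B_def C'_def D_def by (simp add: algebra_simps)
   ultimately show ?thesis by (simp add: c1_def[abs_def] C'_def D_def)
  qed
  have cont: "continuous_on UNIV (\<lambda>t. \<Phi> t s)"
  proof -
   have "continuous_on UNIV (\<lambda>t. sq (crd p) (c0 t) (c1 t))"
   proof (rule continuous_on_coordinatewise_then_product)
    fix i
    have "isCont (\<lambda>t. sq (crd p) (c0 t) (c1 t) i) t" for t
     by (rule DERIV_isCont[OF sq_deriv[OF d0 d1]])
    thus "continuous_on UNIV (\<lambda>t. sq (crd p) (c0 t) (c1 t) i)"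
     by (simp add: continuous_at_imp_continuous_on)
   qed
   thus ?thesis unfolding val rq_abs
    by (rule continuous_on_compose2[OF continuous_on_abs_point]) (use sq_nonzero[OF nz rep_point_nonzero] in auto)
  qed
  have curve: "integral_curve S (dop (ric a b c)) UNIV (\<lambda>t. \<Phi> t s)"
   unfolding integral_curve_def
  proof (intro conjI cont ballI impI)
   fix t :: complex
   have key: "\<exists>w. dop (ric a b c) g (\<Phi> t s) = Some w \<and> (DERIV (\<lambda>\<tau>. the (g (\<Phi> \<tau> s))) t :> w)"
    if g: "g \<in> carrier (function_field S)" "\<Phi> t s \<in> dom g" for g
   proof -
    obtain h where h: "rat_germ S h" "g = RF S h" using g(1) by (rule S.carrier_E)
    obtain z where "g (\<Phi> t s) = Some z" using g(2) by auto
    hence z: "regular_at S h (rq p (c0 t) (c1 t)) z" by (simp add: h(2) S.RF_Some val)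
    from riccati_derivative[OF r(1-3) nz z]
    obtain w where w: "regular_at S (\<lambda>s. ric a b c s * dy h s) (rq p (c0 t) (c1 t)) w"
     "DERIV (\<lambda>\<tau>. the (RF S h (rq p (c0 \<tau>) (c1 \<tau>)))) t :> w"
     using d0 d1 by blast
    thus ?thesis unfolding h(2) dop_RF[OF h(1) rat_germ_ric[OF abc]] val by (auto simp: S.RF_Some)
   qed
   show "holomorphic_vf_at S (dop (ric a b c)) (\<Phi> t s)"
    unfolding holomorphic_vf_at_def
   proof (intro conjI ballI impI)
    show "\<Phi> t s \<in> S" unfolding val by (rule rq_in[OF p(1) nz])
    fix g assume "g \<in> carrier (function_field S)" "\<Phi> t s \<in> dom g"
    thus "\<Phi> t s \<in> dom (dop (ric a b c) g)" using key by blast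
   qed
   fix g assume "g \<in> carrier (function_field S)" "\<Phi> t s \<in> dom g"
   from key[OF this] show "DERIV (\<lambda>\<tau>. the (g (\<Phi> \<tau> s))) t :> the (dop (ric a b c) g (\<Phi> t s))" by auto
  qed
  have "\<Phi> 0 s = s" unfolding val using p(3) by (simp add: c0_def c1_def A_def B_def C'_def D_def)
  with curve show "0 \<in> {t. (t, s) \<in> (UNIV :: complex set) \<times> V} \<and> connected {t. (t, s) \<in> (UNIV :: complex set) \<times> V} \<and> \<Phi> 0 s = s \<and>
    integral_curve S (dop (ric a b c)) {t. (t, s) \<in> (UNIV :: complex set) \<times> V} (\<lambda>t. \<Phi> t s)"
   unfolding T by (intro conjI UNIV_I connected_UNIV)
 qed
 have "\<forall>(t, s)\<in>UNIV \<times> V. \<phi> t s = Some (\<Phi> t s)"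
 proof (clarify)
  fix t s assume "s \<in> V"
  then obtain p u0 u1 where p: "p \<in> C" "u0 \<noteq> 0 \<or> u1 \<noteq> 0" "s = rq p u0 u1" "F (crd p) \<noteq> 0" using V_E by blast
  thus "\<phi> t s = Some (\<Phi> t s)" using \<phi>_val(2)[OF p(1,4,2)] by (simp add: \<Phi>_def)
 qed
 thus ?thesis unfolding birationally_integrable_def using hom adm flow by blast
qed

end

section \<open>Linear algebra\<close>

text \<open>Gaussian elimination: a non-trivial equation expresses one unknown \<open>x i0\<close>
  by the others and leaves one equation and one unknown less.\<close>

lemma homogeneous_system_nontrivial:
 fixes A :: "'j => 'i => complex"
 assumes "finite J" "finite I" "card J < card I"
 shows "\<exists>x. (\<exists>i\<in>I. x i \<noteq> 0) \<and> (\<forall>j\<in>J. (\<Sum>i\<in>I. A j i * x i) = 0)"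
 using assms
proof (induction J arbitrary: I A rule: finite_induct)
 case empty
 then obtain i where "i \<in> I" by fastforce
 thus ?case by (intro exI[of _ "\<lambda>_. 1"]) auto
next
 case (insert j0 J)
 show ?case
 proof (cases "\<forall>i\<in>I. A j0 i = 0")
  case True
  obtain x where "\<exists>i\<in>I. x i \<noteq> 0" "\<forall>j\<in>J. (\<Sum>i\<in>I. A j i * x i) = 0"
   using insert.IH[of I A] insert.prems insert.hyps by auto
  thus ?thesis using True by (intro exI[of _ x]) auto
 next
  case False
  then obtain i0 where i0: "i0 \<in> I" "A j0 i0 \<noteq> 0" by blast
  let ?I = "I - {i0}"
  have "card J < card ?I" using insert i0 by simp
  then obtain x where x: "\<exists>i\<in>?I. x i \<noteq> 0" "\<forall>j\<in>J. (\<Sum>i\<in>?I. (A j i - A j i0 * A j0 i / A j0 i0) * x i) = 0"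
   using insert.IH[of ?I "\<lambda>j i. A j i - A j i0 * A j0 i / A j0 i0"] insert.prems by blast
  define y where "y = x(i0 := - (\<Sum>i\<in>?I. A j0 i * x i) / A j0 i0)"
  have s: "(\<Sum>i\<in>I. A j i * y i) = A j i0 * y i0 + (\<Sum>i\<in>?I. A j i * x i)" for j
  proof -
   have "(\<Sum>i\<in>I. A j i * y i) = A j i0 * y i0 + (\<Sum>i\<in>?I. A j i * y i)"
    using insert.prems i0 by (intro sum.remove) auto
   also have "(\<Sum>i\<in>?I. A j i * y i) = (\<Sum>i\<in>?I. A j i * x i)" by (rule sum.cong) (auto simp: y_def)
   finally show ?thesis .
  qed
  have "(\<Sum>i\<in>I. A j0 i * y i) = 0" unfolding s using i0 by (simp add: y_def)
  moreover have "(\<Sum>i\<in>I. A j i * y i) = 0" if "j \<in> J" for j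
  proof -
   have "(\<Sum>i\<in>?I. (A j i - A j i0 * A j0 i / A j0 i0) * x i) = (\<Sum>i\<in>?I. A j i * x i) - (A j i0 / A j0 i0) * (\<Sum>i\<in>?I. A j0 i * x i)"
    by (simp add: sum_distrib_left sum_subtractf[symmetric] algebra_simps)
   thus ?thesis unfolding s using x(2) that by (simp add: y_def)
  qed
  moreover have "\<exists>i\<in>I. y i \<noteq> 0" using x(1) by (auto simp: y_def)
  ultimately show ?thesis by (intro exI[of _ y]) auto
 qed
qed

text \<open>For a new functional \<open>k0\<close>, independence provides a unit vector whose
  projection to the common kernel of the earlier functionals is not killed by \<open>k0\<close>.
  Rescaled, it becomes the new dual vector \<open>v\<close>, and multiples of it correct the old
  ones.\<close>

lemma dual_vectors:
 fixes A :: "'k => 'i => complex"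
 assumes "finite K" "finite I"
  and "\<And>c. (\<forall>i\<in>I. (\<Sum>k\<in>K. c k * A k i) = 0) ==> (\<forall>k\<in>K. c k = 0)"
 shows "\<exists>e. \<forall>j\<in>K. \<forall>k\<in>K. (\<Sum>i\<in>I. A j i * e k i) = (if j = k then 1 else 0)"
 using assms
proof (induction K rule: finite_induct)
 case empty
 thus ?case by simp
next
 case (insert k0 K)
 have "\<forall>k\<in>K. c k = 0" if "\<forall>i\<in>I. (\<Sum>k\<in>K. c k * A k i) = 0" for c
 proof -
  let ?c = "c(k0 := 0)"
  have "(\<Sum>k\<in>insert k0 K. ?c k * A k i) = (\<Sum>k\<in>K. c k * A k i)" for i
   using insert.hyps by (simp, intro sum.cong) auto
  hence "\<forall>k\<in>insert k0 K. ?c k = 0" using insert.prems(2)[of ?c] that by simp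
  thus ?thesis using insert.hyps by (metis fun_upd_other insertCI)
 qed
 then obtain e where e: "\<forall>j\<in>K. \<forall>k\<in>K. (\<Sum>i\<in>I. A j i * e k i) = (if j = k then 1 else 0)"
  using insert.IH insert.prems(1) by blast
 define l where "l j x = (\<Sum>i\<in>I. A j i * x i)" for j x
 have el: "l j (e k) = (if j = k then 1 else 0)" if "j \<in> K" "k \<in> K" for j k
  using e that by (simp add: l_def)
 have lin: "l j (\<lambda>i. a * x i + b * y i) = a * l j x + b * l j y" for j a b x y
  by (simp add: l_def sum.distrib sum_distrib_left algebra_simps)
 have lsum: "l j (\<lambda>i. \<Sum>k\<in>K. c k * f k i) = (\<Sum>k\<in>K. c k * l j (f k))" for j c f
 proof -
  have "l j (\<lambda>i. \<Sum>k\<in>K. c k * f k i) = (\<Sum>i\<in>I. \<Sum>k\<in>K. c k * (A j i * f k i))"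
   by (simp add: l_def sum_distrib_left mult.left_commute)
  also have "\<dots> = (\<Sum>k\<in>K. \<Sum>i\<in>I. c k * (A j i * f k i))" by (rule sum.swap)
  finally show ?thesis by (simp add: l_def sum_distrib_left)
 qed
 let ?c = "\<lambda>k. if k = k0 then 1 else - l k0 (e k)"
 have "\<exists>i\<in>I. (\<Sum>k\<in>insert k0 K. ?c k * A k i) \<noteq> 0"
 proof (rule ccontr)
  assume "\<not> ?thesis"
  hence "\<forall>k\<in>insert k0 K. ?c k = 0" using insert.prems(2)[of ?c] by blast
  hence "?c k0 = 0" by blast
  thus False by simp
 qed
 then obtain i0 where i0: "i0 \<in> I" "(\<Sum>k\<in>insert k0 K. ?c k * A k i0) \<noteq> 0" by blast
 \<comment> \<open>The value of the functional \<open>k0\<close> on the projection of the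
   \<open>i0\<close>-th unit vector to the common kernel of the functionals in
   \<open>K\<close>.\<close>
 define \<mu> where "\<mu> = A k0 i0 - (\<Sum>k\<in>K. A k i0 * l k0 (e k))"
 have "(\<Sum>k\<in>K. ?c k * A k i0) = - (\<Sum>k\<in>K. A k i0 * l k0 (e k))"
  unfolding sum_negf[symmetric] using insert.hyps by (intro sum.cong) auto
 hence mu: "\<mu> \<noteq> 0" using i0(2) insert.hyps by (simp add: \<mu>_def)
 define v where "v i = (1 / \<mu>) * (if i = i0 then 1 else 0) + (- 1 / \<mu>) * (\<Sum>k\<in>K. A k i0 * e k i)" for i
 have ld: "l j (\<lambda>i. if i = i0 then 1 else 0) = A j i0" for j
 proof -
  have "(\<Sum>i\<in>I. A j i * (if i = i0 then 1 else 0)) = (\<Sum>i\<in>I. if i = i0 then A j i0 else 0)"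
   by (rule sum.cong) auto
  thus ?thesis using i0(1) insert.prems(1) by (simp add: l_def sum.delta)
 qed
 have lv: "l j v = (1 / \<mu>) * A j i0 + (- 1 / \<mu>) * (\<Sum>k\<in>K. A k i0 * l j (e k))" for j
  unfolding v_def[abs_def] lin ld lsum ..
 have v1: "l j v = 0" if "j \<in> K" for j
 proof -
  have "(\<Sum>k\<in>K. A k i0 * l j (e k)) = (\<Sum>k\<in>K. if k = j then A j i0 else 0)"
   by (rule sum.cong) (use that in \<open>auto simp: el\<close>)
  thus ?thesis unfolding lv using that insert.hyps by (simp add: sum.delta)
 qed
 have v0: "l k0 v = 1"
 proof -
  have "l k0 v = (1 / \<mu>) * \<mu>" unfolding lv right_diff_distrib \<mu>_def by simp
  thus ?thesis using mu by simp
 qed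
 define e' where "e' k = (if k = k0 then v else (\<lambda>i. 1 * e k i + (- l k0 (e k)) * v i))" for k
 have "l j (e' k) = (if j = k then 1 else 0)" if "j \<in> insert k0 K" "k \<in> insert k0 K" for j k
 proof (cases "k = k0")
  case True
  thus ?thesis using that v0 v1 insert.hyps by (auto simp: e'_def)
 next
  case False
  hence "k \<in> K" using that by simp
  have "l j (e' k) = l j (e k) - l k0 (e k) * l j v" using False by (simp only: e'_def if_False lin) simp
  thus ?thesis using that \<open>k \<in> K\<close> v0 v1 el False insert.hyps by auto
 qed
 thus ?case unfolding l_def by blast
qed

section \<open>Points near a smooth point of a curve\<close>

lemma hp_tendsto: "hp d f ==> (\<And>i. ((\<lambda>m. v m i) \<longlongrightarrow> w i) F) ==> ((\<lambda>m. f (v m)) \<longlongrightarrow> f w) F"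
 by (induction rule: hp.induct) (auto intro: tendsto_intros)

text \<open>Converts sequential continuity for coordinatewise convergence into an estimate:
  otherwise counterexamples for \<open>1 / (m + 1)\<close> form a sequence that converges in each
  coordinate.\<close>

lemma coordinatewise_eps:
 fixes f :: "(nat => complex) => complex"
 assumes lim: "\<And>X. (\<And>i. (\<lambda>m. X m i) \<longlonglongrightarrow> v i) ==> (\<lambda>m. f (X m)) \<longlonglongrightarrow> f v" and e: "\<epsilon> > 0"
 shows "\<exists>\<delta>>0. \<forall>x. (\<forall>i. cmod (x i - v i) < \<delta>) --> cmod (f x - f v) < \<epsilon>"
proof (rule ccontr)
 assume n: "\<not> ?thesis"
 have "\<forall>m. \<exists>x. (\<forall>i. cmod (x i - v i) < inverse (real (Suc m))) \<and> \<not> cmod (f x - f v) < \<epsilon>"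
 proof
  fix m
  have "inverse (real (Suc m)) > 0" by simp
  thus "\<exists>x. (\<forall>i. cmod (x i - v i) < inverse (real (Suc m))) \<and> \<not> cmod (f x - f v) < \<epsilon>" using n by blast
 qed
 from choice[OF this] obtain X where X: "\<forall>m. (\<forall>i. cmod (X m i - v i) < inverse (real (Suc m))) \<and> \<not> cmod (f (X m) - f v) < \<epsilon>" ..
 have "(\<lambda>m. X m i) \<longlonglongrightarrow> v i" for i
 proof (rule LIM_zero_cancel, rule Lim_null_comparison[OF _ LIMSEQ_inverse_real_of_nat])
  show "\<forall>\<^sub>F m in sequentially. cmod (X m i - v i) \<le> inverse (real (Suc m))"
   using X by (intro always_eventually allI less_imp_le) blast
 qed
 from tendstoD[OF lim[OF this] e] show False using X by (simp add: dist_norm)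
qed

lemma hp_continuous_eps:
 assumes "hp d f" "\<epsilon> > 0" shows "\<exists>\<delta>>0. \<forall>x. (\<forall>i. cmod (x i - v i) < \<delta>) --> cmod (f x - f v) < \<epsilon>"
 using assms(2) by (intro coordinatewise_eps hp_tendsto[OF assms(1)])

lemma pd_zero: "pd (\<lambda>_. c) i v = 0"
 by (simp add: pd_def)

lemma pd_var: "pd (\<lambda>v. v j) i v = (if i = j then 1 else 0)"
proof (rule pd_eqI[OF hp_var])
 show "((\<lambda>z. (v(i := z)) j) has_field_derivative (if i = j then 1 else 0)) (at (v i))"
  by (cases "i = j") auto
qed

lemma pd_add: "hp d f ==> hp d g ==> pd (\<lambda>v. f v + g v) i v = pd f i v + pd g i v"
 by (rule pd_eqI[OF hp.add]) (auto intro!: DERIV_add hp_partial)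

lemma pd_mult: "hp d f ==> hp e g ==> pd (\<lambda>v. f v * g v) i v = pd f i v * g v + f v * pd g i v"
proof (rule pd_eqI[OF hp.mult], assumption, assumption)
 assume "hp d f" "hp e g"
 from DERIV_mult[OF hp_partial[OF this(1), of v i] hp_partial[OF this(2), of v i]]
 show "DERIV (\<lambda>z. f (v(i := z)) * g (v(i := z))) (v i) :> pd f i v * g v + f v * pd g i v"
  by (simp add: algebra_simps)
qed

lemma pd_tendsto:
 assumes w: "\<And>i. ((\<lambda>m. v m i) \<longlongrightarrow> w i) F"
 shows "hp d f ==> ((\<lambda>m. pd f i (v m)) \<longlongrightarrow> pd f i w) F"
proof (induction rule: hp.induct)
 case (mult d f e g)
 thus ?case unfolding pd_mult[OF mult.hyps] by (intro tendsto_add tendsto_mult hp_tendsto[OF mult.hyps(1) w] hp_tendsto[OF mult.hyps(2) w])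
qed (simp_all add: pd_zero pd_var pd_add tendsto_add)

lemma hp_line_derivative:
 assumes I: "finite I" "\<And>i. i \<notin> I ==> w i = 0"
 shows "hp d f ==> ((\<lambda>t. f (\<lambda>i. y i + t * w i)) has_field_derivative
  (\<Sum>i\<in>I. pd f i (\<lambda>i. y i + t * w i) * w i)) (at t)"
proof (induction rule: hp.induct)
 case (var j)
 have "(\<Sum>i\<in>I. pd (\<lambda>v. v j) i u * w i) = (\<Sum>i\<in>I. if i = j then w j else 0)" for u
  by (rule sum.cong) (auto simp: pd_var)
 hence "(\<Sum>i\<in>I. pd (\<lambda>v. v j) i u * w i) = w j" for u using I by auto
 thus ?case by (auto intro!: derivative_eq_intros)
next
 case (add d f g)
 from DERIV_add[OF add.IH] show ?case by (simp add: pd_add[OF add.hyps] sum.distrib distrib_right)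
next
 case (mult d f e g)
 have "(\<Sum>i\<in>I. pd (\<lambda>v. f v * g v) i u * w i) = (\<Sum>i\<in>I. pd f i u * w i) * g u + (\<Sum>i\<in>I. pd g i u * w i) * f u" for u
  unfolding pd_mult[OF mult.hyps] sum_distrib_right sum.distrib[symmetric] by (rule sum.cong) (simp_all add: algebra_simps)
 thus ?case using DERIV_mult[OF mult.IH] by simp
qed (simp_all add: pd_zero)

text \<open>Strict differentiability, with both points variable and the derivative taken at the
  fixed point \<open>v\<close>. It follows from continuity of the partial derivatives by the mean
  value inequality on the segment from \<open>y\<close> to \<open>x\<close>, and it is what makes
  the iteration in \<open>smooth_curve_uncountable\<close> a contraction.\<close>

lemma hp_strict_derivative:
 assumes I: "finite I" and f: "hp d f" and e: "\<epsilon> > 0"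
 shows "\<exists>\<delta>>0. \<forall>x y. (\<forall>i. cmod (x i - v i) < \<delta>) --> (\<forall>i. cmod (y i - v i) < \<delta>) -->
  (\<forall>i. i \<notin> I --> x i = y i) -->
  cmod (f x - f y - (\<Sum>i\<in>I. pd f i v * (x i - y i))) \<le> \<epsilon> * (\<Sum>i\<in>I. cmod (x i - y i))"
proof -
 define \<Delta> where "\<Delta> z = (\<Sum>i\<in>I. cmod (pd f i z - pd f i v))" for z
 have "\<exists>\<delta>>0. \<forall>x. (\<forall>i. cmod (x i - v i) < \<delta>) --> cmod (of_real (\<Delta> x) - of_real (\<Delta> v)) < \<epsilon>"
  unfolding \<Delta>_def by (rule coordinatewise_eps[OF _ e]) (intro tendsto_intros pd_tendsto[OF _ f])
 then obtain \<delta> where d: "\<delta> > 0" "\<And>x. (\<forall>i. cmod (x i - v i) < \<delta>) ==> \<Delta> x < \<epsilon>"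
  unfolding of_real_diff[symmetric] norm_of_real by (auto simp: \<Delta>_def sum_nonneg)
 show ?thesis
 proof (intro exI[of _ \<delta>] conjI allI impI d(1))
  fix x y assume x: "\<forall>i. cmod (x i - v i) < \<delta>" and y: "\<forall>i. cmod (y i - v i) < \<delta>" and xy: "\<forall>i. i \<notin> I --> x i = y i"
  define w where "w i = x i - y i" for i
  define z where "z t i = y i + t * w i" for t i
  let ?L = "\<Sum>i\<in>I. pd f i v * w i" and ?T = "closed_segment 0 (1 :: complex)"
  have "cmod ((f (z 1) - 1 * ?L) - (f (z 0) - 0 * ?L)) \<le> (\<epsilon> * (\<Sum>i\<in>I. cmod (w i))) * cmod (1 - 0)"
  proof (rule field_differentiable_bound[where S = ?T])
   fix t assume t: "t \<in> ?T"
   have w0: "w i = 0" if "i \<notin> I" for i using xy that by (simp add: w_def)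
   have "((\<lambda>t. f (z t) - t * ?L) has_field_derivative (\<Sum>i\<in>I. pd f i (z t) * w i) - 1 * ?L) (at t)"
    unfolding z_def by (intro DERIV_diff hp_line_derivative[OF I w0 f] DERIV_cmult_right DERIV_ident)
   thus "((\<lambda>t. f (z t) - t * ?L) has_field_derivative (\<Sum>i\<in>I. pd f i (z t) * w i) - 1 * ?L) (at t within ?T)"
    by (rule has_field_derivative_at_within)
   obtain r where r: "0 \<le> r" "r \<le> 1" "t = of_real r" using t by (auto simp: in_segment scaleR_conv_of_real)
   have "cmod (z t i - v i) < \<delta>" for i
   proof -
    have "(1 - r) *\<^sub>R y i + r *\<^sub>R x i \<in> ball (v i) \<delta>"
     by (rule convexD[OF convex_ball]) (use x y r in \<open>auto simp: dist_norm norm_minus_commute\<close>)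
    thus ?thesis by (simp add: z_def w_def r(3) scaleR_conv_of_real dist_norm norm_minus_commute algebra_simps)
   qed
   hence D: "\<Delta> (z t) < \<epsilon>" using d(2) by blast
   have "cmod (\<Sum>i\<in>I. (pd f i (z t) - pd f i v) * w i) \<le> (\<Sum>i\<in>I. \<epsilon> * cmod (w i))"
   proof (rule sum_norm_le)
    fix i assume "i \<in> I"
    hence "cmod (pd f i (z t) - pd f i v) \<le> \<Delta> (z t)" unfolding \<Delta>_def by (intro member_le_sum I) auto
    thus "cmod ((pd f i (z t) - pd f i v) * w i) \<le> \<epsilon> * cmod (w i)"
     unfolding norm_mult using D by (intro mult_right_mono) auto
   qed
   thus "cmod ((\<Sum>i\<in>I. pd f i (z t) * w i) - 1 * ?L) \<le> \<epsilon> * (\<Sum>i\<in>I. cmod (w i))"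
    by (simp add: sum_subtractf[symmetric] left_diff_distrib sum_distrib_left)
  qed auto
  moreover have "z 1 = x" "z 0 = y" by (auto simp: z_def w_def)
  ultimately show "cmod (f x - f y - (\<Sum>i\<in>I. pd f i v * (x i - y i))) \<le> \<epsilon> * (\<Sum>i\<in>I. cmod (x i - y i))"
   by (simp add: w_def algebra_simps)
 qed
qed

text \<open>By homogeneity \<open>f\<close> vanishes along the whole line through \<open>v\<close>,
  so its derivative in that direction is zero.\<close>

lemma euler_zero:
 assumes f: "hp d f" and "f v = 0" and I: "finite I" "\<And>i. i \<notin> I ==> v i = 0"
 shows "(\<Sum>i\<in>I. pd f i v * v i) = 0"
proof -
 have "((\<lambda>t. f (\<lambda>i. 0 + t * v i)) has_field_derivative (\<Sum>i\<in>I. pd f i (\<lambda>i. 0 + 1 * v i) * v i)) (at 1)"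
  by (rule hp_line_derivative[OF I f])
 moreover have "f (\<lambda>i. 0 + t * v i) = 0" for t using hp_scale[OF f, of t v] assms(2) by simp
 ultimately have "((\<lambda>t :: complex. 0) has_field_derivative (\<Sum>i\<in>I. pd f i v * v i)) (at 1)" by simp
 thus ?thesis by (rule DERIV_unique) simp
qed

text \<open>An implicit function argument in three kinds of directions: the radial vector
  \<open>v\<close>, a tangent vector \<open>e0\<close>, and vectors \<open>ev\<close> dual to the
  gradients of the equations. For every small \<open>\<tau>\<close> a contraction finds a correction
  \<open>\<zeta>\<close> along the \<open>ev\<close> that puts \<open>v + \<tau> e0\<close> on the
  curve. Different \<open>\<tau>\<close> give different points because all these directions are
  linearly independent.\<close>

lemma smooth_curve_uncountable:
 assumes Csub: "C \<subseteq> proj_space n" and n: "1 \<le> n" and sm: "smooth_at n 1 C p" and p: "p \<in> C"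
 shows "uncountable C"
proof -
 define r where "r = n - 1"
 obtain f d h dh where f: "\<forall>k<r. hp (d k) (f k)" "hp dh h" "h (crd p) \<noteq> 0"
  "\<forall>q\<in>proj_space n. h (crd q) \<noteq> 0 --> (q \<in> C \<longleftrightarrow> (\<forall>k<r. f k (crd q) = 0))"
  "\<forall>c. (\<forall>i\<le>n. (\<Sum>k<r. c k * pd (f k) i (crd p)) = 0) --> (\<forall>k<r. c k = 0)"
  using smooth_atE[OF sm] unfolding r_def .
 have fd: "hp (d k) (f k)" if "k < r" for k using f(1) that by blast
 note dh = f(2)
 define v where "v = crd p"
 define I where "I = {..n}"
 have I: "finite I" "card I = n + 1" by (simp_all add: I_def)
 have vz: "v i = 0" if "i \<notin> I" for i using Csub p that by (auto simp: v_def I_def proj_space_def)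
 obtain i0 where i0: "v i0 \<noteq> 0" using rep_point_coord[of p] unfolding v_def by blast
 have fv: "f k v = 0" if "k < r" for k using f(4) p Csub f(3) that by (auto simp: v_def)
 define A where "A k i = pd (f k) i v" for k i
 obtain e' where e': "\<forall>j\<in>{..<r}. \<forall>k\<in>{..<r}. (\<Sum>i\<in>I. A j i * e' k i) = (if j = k then 1 else 0)"
  using dual_vectors[of "{..<r}" I A] f(5) I(1) unfolding A_def v_def I_def atMost_iff lessThan_iff Ball_def by blast
 define ev where "ev k i = (if i \<in> I then e' k i else 0)" for k i
 have ev: "(\<Sum>i\<in>I. A j i * ev k i) = (if j = k then 1 else 0)" if "j < r" "k < r" for j k
  using e' that by (simp add: ev_def)
 \<comment> \<open>The additional row \<open>r\<close> demands that coordinate \<open>i0\<close> of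
   \<open>e0\<close> be zero. Since \<open>v i0\<close> is non-zero, \<open>e0\<close> is then not a
   multiple of \<open>v\<close>.\<close>
 define A' where "A' j i = (if j = r then (if i = i0 then 1 else 0) else A j i)" for j i
 have "card {..r} < card I" using n by (simp add: I r_def)
 then obtain e0' where e0': "\<exists>i\<in>I. e0' i \<noteq> 0" "\<forall>j\<in>{..r}. (\<Sum>i\<in>I. A' j i * e0' i) = 0"
  using homogeneous_system_nontrivial[of "{..r}" I A'] I(1) by auto
 define e0 where "e0 i = (if i \<in> I then e0' i else 0)" for i
 have e0: "(\<Sum>i\<in>I. A j i * e0 i) = 0" if "j < r" for j
  using e0'(2)[rule_format, of j] that by (simp add: e0_def A'_def)
 have e0i0: "e0 i0 = 0"
 proof -
  have "(\<Sum>i\<in>I. A' r i * e0' i) = (\<Sum>i\<in>I. if i = i0 then e0' i0 else 0)"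
   by (rule sum.cong) (auto simp: A'_def)
  thus ?thesis using e0'(2)[rule_format, of r] I(1) by (auto simp: e0_def sum.delta split: if_splits)
 qed
 obtain i1 where "i1 \<in> I" "e0' i1 \<noteq> 0" using e0'(1) by blast
 hence i1: "e0 i1 \<noteq> 0" by (simp add: e0_def)
 have Av: "(\<Sum>i\<in>I. A j i * v i) = 0" if "j < r" for j
  unfolding A_def using euler_zero[OF fd fv I(1) vz] that by simp
 define X where "X \<tau> \<zeta> i = v i + \<tau> * e0 i + (\<Sum>k<r. \<zeta> k * ev k i)" for \<tau> :: complex and \<zeta> :: "nat => complex" and i
 have XI: "X \<tau> \<zeta> i = 0" if "i \<notin> I" for \<tau> \<zeta> i using that by (simp add: X_def vz e0_def ev_def)
 define E where "E = (\<Sum>i\<in>I. \<Sum>k<r. cmod (ev k i)) + 1"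
 define E0 where "E0 = (\<Sum>i\<in>I. cmod (e0 i)) + 1"
 have EE: "E > 0" "E0 > 0" by (simp_all add: E_def E0_def sum_nonneg add_nonneg_pos)
 define N where "N \<zeta> = (\<Sum>k<r. cmod (\<zeta> k))" for \<zeta> :: "nat => complex"
 have N0: "N \<zeta> \<ge> 0" for \<zeta> by (simp add: N_def sum_nonneg)
 have Nk: "cmod (\<zeta> k) \<le> N \<zeta>" if "k < r" for \<zeta> k
  unfolding N_def by (rule member_le_sum) (use that in auto)
 have dual: "(\<Sum>i\<in>I. A j i * (\<Sum>k<r. c k * ev k i)) = c j" if "j < r" for c j
 proof -
  have "(\<Sum>i\<in>I. A j i * (\<Sum>k<r. c k * ev k i)) = (\<Sum>i\<in>I. \<Sum>k<r. c k * (A j i * ev k i))"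
   by (simp add: sum_distrib_left mult.left_commute)
  also have "\<dots> = (\<Sum>k<r. c k * (\<Sum>i\<in>I. A j i * ev k i))" by (subst sum.swap) (simp add: sum_distrib_left)
  also have "\<dots> = (\<Sum>k<r. if k = j then c j else 0)" by (rule sum.cong) (use that in \<open>auto simp: ev\<close>)
  finally show ?thesis using that by (simp add: sum.delta)
 qed
 have sumI: "(\<Sum>i\<in>I. cmod (\<Sum>k<r. c k * ev k i)) \<le> E * N c" for c
 proof -
  have "(\<Sum>i\<in>I. cmod (\<Sum>k<r. c k * ev k i)) \<le> (\<Sum>i\<in>I. \<Sum>k<r. N c * cmod (ev k i))"
   by (intro sum_mono sum_norm_le) (simp add: norm_mult mult_right_mono Nk)
  also have "\<dots> = N c * (E - 1)" by (simp add: E_def sum_distrib_left)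
  also have "\<dots> \<le> E * N c" using N0[of c] by (simp add: algebra_simps)
  finally show ?thesis .
 qed
 \<comment> \<open>Chosen so that \<open>r\<close> errors of size \<open>\<epsilon> * E\<close> add
   up to at most \<open>1 / 2\<close>, the contraction factor.\<close>
 define \<epsilon> where "\<epsilon> = 1 / (2 * (real r + 1) * E)"
 have eps: "\<epsilon> > 0" using EE by (simp add: \<epsilon>_def)
 have "\<exists>\<delta>>0. \<forall>k<r. \<forall>x y. (\<forall>i. cmod (x i - v i) < \<delta>) --> (\<forall>i. cmod (y i - v i) < \<delta>) -->
  (\<forall>i. i \<notin> I --> x i = y i) -->
  cmod (f k x - f k y - (\<Sum>i\<in>I. A k i * (x i - y i))) \<le> \<epsilon> * (\<Sum>i\<in>I. cmod (x i - y i))"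
 proof -
  define P where "P k \<delta> \<longleftrightarrow> (\<forall>x y. (\<forall>i. cmod (x i - v i) < \<delta>) --> (\<forall>i. cmod (y i - v i) < \<delta>) -->
   (\<forall>i. i \<notin> I --> x i = y i) -->
   cmod (f k x - f k y - (\<Sum>i\<in>I. A k i * (x i - y i))) \<le> \<epsilon> * (\<Sum>i\<in>I. cmod (x i - y i)))" for k \<delta>
  have mono: "P k \<delta>'" if "P k \<delta>" "\<delta>' \<le> \<delta>" for k \<delta> \<delta>'
   using that(1) unfolding P_def by (meson order_less_le_trans that(2))
  have ex: "\<exists>\<delta>>0. P k \<delta>" if "k < r" for k
   using hp_strict_derivative[OF I(1) fd eps, of k v] that unfolding P_def A_def by blast
  have "\<exists>\<delta>>0. \<forall>k<m. P k \<delta>" if "m \<le> r" for m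
   using that
  proof (induction m)
   case 0
   show ?case by (intro exI[of _ 1]) auto
  next
   case (Suc m)
   obtain d1 where d1: "d1 > 0" "\<forall>k<m. P k d1" using Suc by auto
   obtain d2 where d2: "d2 > 0" "P m d2" using ex[of m] Suc.prems by auto
   show ?case
    by (intro exI[of _ "min d1 d2"]) (use d1 d2 mono in \<open>auto simp: less_Suc_eq\<close>)
  qed
  thus ?thesis unfolding P_def by blast
 qed
 then obtain \<delta>1 where d1: "\<delta>1 > 0" "\<And>k x y. k < r ==> (\<forall>i. cmod (x i - v i) < \<delta>1) ==> (\<forall>i. cmod (y i - v i) < \<delta>1) ==>
  (\<forall>i. i \<notin> I --> x i = y i) ==>
  cmod (f k x - f k y - (\<Sum>i\<in>I. A k i * (x i - y i))) \<le> \<epsilon> * (\<Sum>i\<in>I. cmod (x i - y i))" by blast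
 have "cmod (h v) > 0" using f(3) by (simp add: v_def)
 then obtain \<delta>2 where d2: "\<delta>2 > 0" "\<And>x. (\<forall>i. cmod (x i - v i) < \<delta>2) ==> cmod (h x - h v) < cmod (h v)"
  using hp_continuous_eps[OF dh, of "cmod (h v)" v] by blast
 define \<delta> where "\<delta> = min \<delta>1 \<delta>2"
 have d: "\<delta> > 0" using d1(1) d2(1) by (simp add: \<delta>_def)
 define \<rho> where "\<rho> = \<delta> / (4 * E)"
 have rho: "\<rho> > 0" using d EE by (simp add: \<rho>_def)
 \<comment> \<open>The first bound keeps the tangential displacement below
   \<open>\<delta> / 4\<close>, as \<open>\<rho>\<close> does for the correction, so that all points
   stay within \<open>\<delta>\<close> of \<open>v\<close>. The second makes the first step of the
   iteration at most \<open>\<rho> / 2\<close>, so that the contraction maps the ball of radius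
   \<open>\<rho>\<close> to itself.\<close>
 define \<tau>0 where "\<tau>0 = min (\<delta> / (4 * E0)) (\<rho> / (2 * (real r + 1) * \<epsilon> * E0))"
 have t0: "\<tau>0 > 0" using d EE rho eps by (simp add: \<tau>0_def)
 have near: "cmod (X \<tau> \<zeta> i - v i) < \<delta>" if "cmod \<tau> < \<tau>0" "N \<zeta> \<le> \<rho>" for \<tau> \<zeta> i
 proof (cases "i \<in> I")
  case True
  have "cmod (e0 i) \<le> (\<Sum>i\<in>I. cmod (e0 i))" by (rule member_le_sum[OF True _ I(1)]) simp
  hence 1: "cmod (\<tau> * e0 i) \<le> \<delta> / (4 * E0) * E0"
   unfolding norm_mult using that(1) t0 EE d by (intro mult_mono) (auto simp: \<tau>0_def E0_def)
  have "cmod (\<Sum>k<r. \<zeta> k * ev k i) \<le> (\<Sum>i\<in>I. cmod (\<Sum>k<r. \<zeta> k * ev k i))"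
   by (rule member_le_sum[OF True _ I(1)]) simp
  also have "\<dots> \<le> E * \<rho>" using sumI[of \<zeta>] that(2) EE(1) by (meson less_imp_le mult_left_mono order_trans)
  finally have 2: "cmod (\<Sum>k<r. \<zeta> k * ev k i) \<le> \<delta> / 4" using EE(1) by (simp add: \<rho>_def)
  have "cmod (X \<tau> \<zeta> i - v i) \<le> cmod (\<tau> * e0 i) + cmod (\<Sum>k<r. \<zeta> k * ev k i)"
   unfolding X_def using norm_triangle_ineq[of "\<tau> * e0 i" "\<Sum>k<r. \<zeta> k * ev k i"] by (simp add: algebra_simps)
  thus ?thesis using 1 2 d EE(2) by simp
 next
  case False
  thus ?thesis using XI vz d by simp
 qed
 have sol: "\<exists>\<zeta>. N \<zeta> \<le> \<rho> \<and> (\<forall>k<r. f k (X \<tau> \<zeta>) = 0)" if tau: "cmod \<tau> < \<tau>0" for \<tau>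
 proof -
  \<comment> \<open>A simplified Newton iteration. By duality the Jacobian of the equations in the
    variables \<open>\<zeta>\<close> is the identity at the given point, so no inverse matrix
    appears.\<close>
  define T where "T \<zeta> j = \<zeta> j - f j (X \<tau> \<zeta>)" for \<zeta> and j :: nat
  have Tc: "N (\<lambda>k. T \<zeta> k - T \<zeta>' k) \<le> N (\<lambda>k. \<zeta> k - \<zeta>' k) / 2" if z: "N \<zeta> \<le> \<rho>" "N \<zeta>' \<le> \<rho>" for \<zeta> \<zeta>'
  proof -
   let ?D = "\<lambda>k. \<zeta> k - \<zeta>' k"
   have XX: "X \<tau> \<zeta> i - X \<tau> \<zeta>' i = (\<Sum>k<r. ?D k * ev k i)" for i
    by (simp add: X_def sum_subtractf[symmetric] algebra_simps)
   have "cmod (T \<zeta> k - T \<zeta>' k) \<le> \<epsilon> * (E * N ?D)" if k: "k < r" for k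
   proof -
    have "cmod (f k (X \<tau> \<zeta>) - f k (X \<tau> \<zeta>') - (\<Sum>i\<in>I. A k i * (X \<tau> \<zeta> i - X \<tau> \<zeta>' i))) \<le> \<epsilon> * (\<Sum>i\<in>I. cmod (X \<tau> \<zeta> i - X \<tau> \<zeta>' i))"
     by (rule d1(2)[OF k]) (use near[OF tau z(1)] near[OF tau z(2)] XI in \<open>auto simp: \<delta>_def\<close>)
    moreover have "f k (X \<tau> \<zeta>) - f k (X \<tau> \<zeta>') - (\<Sum>i\<in>I. A k i * (X \<tau> \<zeta> i - X \<tau> \<zeta>' i)) = - (T \<zeta> k - T \<zeta>' k)"
     unfolding XX dual[OF k] by (simp add: T_def)
    ultimately have "cmod (T \<zeta> k - T \<zeta>' k) \<le> \<epsilon> * (\<Sum>i\<in>I. cmod (\<Sum>k<r. ?D k * ev k i))"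
     by (simp only: norm_minus_cancel XX)
    also have "\<dots> \<le> \<epsilon> * (E * N ?D)" using sumI[of ?D] eps by (intro mult_left_mono) auto
    finally show ?thesis .
   qed
   hence "N (\<lambda>k. T \<zeta> k - T \<zeta>' k) \<le> (\<Sum>k<r. \<epsilon> * (E * N ?D))" unfolding N_def[of "\<lambda>k. T \<zeta> k - T \<zeta>' k"] by (intro sum_mono) auto
   also have "\<dots> = (real r * (\<epsilon> * E)) * N ?D" by simp
   also have "\<dots> \<le> (1 / 2) * N ?D"
   proof (rule mult_right_mono[OF _ N0])
    have "real r * (\<epsilon> * E) = (1 / 2) * (real r / (real r + 1))" using EE(1) by (simp add: \<epsilon>_def)
    also have "\<dots> \<le> (1 / 2) * 1" by (intro mult_left_mono) auto
    finally show "real r * (\<epsilon> * E) \<le> 1 / 2" by simp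
   qed
   finally show ?thesis by simp
  qed
  have T0: "N (T (\<lambda>_. 0)) \<le> \<rho> / 2"
  proof -
   have "cmod (T (\<lambda>_. 0) k) \<le> \<epsilon> * (E0 * \<tau>0)" if k: "k < r" for k
   proof -
    have X0: "X \<tau> (\<lambda>_. 0) i - v i = \<tau> * e0 i" for i by (simp add: X_def)
    have "N (\<lambda>_. 0) \<le> \<rho>" using rho by (simp add: N_def)
    from near[OF tau this] have nr: "\<forall>i. cmod (X \<tau> (\<lambda>_. 0) i - v i) < \<delta>1" by (auto simp: \<delta>_def)
    have "cmod (f k (X \<tau> (\<lambda>_. 0)) - f k v - (\<Sum>i\<in>I. A k i * (X \<tau> (\<lambda>_. 0) i - v i))) \<le> \<epsilon> * (\<Sum>i\<in>I. cmod (X \<tau> (\<lambda>_. 0) i - v i))"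
     by (rule d1(2)[OF k nr]) (use d1(1) XI vz in auto)
    moreover have "(\<Sum>i\<in>I. A k i * (X \<tau> (\<lambda>_. 0) i - v i)) = \<tau> * (\<Sum>i\<in>I. A k i * e0 i)"
     unfolding X0 sum_distrib_left by (rule sum.cong) auto
    ultimately have "cmod (f k (X \<tau> (\<lambda>_. 0))) \<le> \<epsilon> * (\<Sum>i\<in>I. cmod (\<tau> * e0 i))"
     using e0[OF k] fv[OF k] by (simp add: X0)
    also have "\<dots> = \<epsilon> * (cmod \<tau> * (E0 - 1))" by (simp add: norm_mult sum_distrib_left E0_def)
    also have "\<dots> \<le> \<epsilon> * (\<tau>0 * E0)"
     using eps tau t0 EE(2) by (intro mult_left_mono mult_mono) (auto simp: E0_def sum_nonneg)
    finally show ?thesis by (simp add: T_def mult.commute)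
   qed
   hence "N (T (\<lambda>_. 0)) \<le> (\<Sum>k<r. \<epsilon> * (E0 * \<tau>0))" unfolding N_def by (intro sum_mono) auto
   also have "\<dots> = real r * \<epsilon> * E0 * \<tau>0" by simp
   also have "\<dots> \<le> real r * \<epsilon> * E0 * (\<rho> / (2 * (real r + 1) * \<epsilon> * E0))"
    using eps EE(2) by (intro mult_left_mono) (auto simp: \<tau>0_def)
   also have "\<dots> = (\<rho> / 2) * (real r / (real r + 1))" using eps EE(2) by simp
   also have "\<dots> \<le> (\<rho> / 2) * 1" using rho by (intro mult_left_mono) auto
   also have "\<dots> = \<rho> / 2" by simp
   finally show ?thesis .
  qed
  define z where "z = rec_nat (\<lambda>_. 0) (\<lambda>_. T)"
  have z0: "z 0 = (\<lambda>_. 0)" and zS: "z (Suc m) = T (z m)" for m by (simp_all add: z_def)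
  have zN: "N (z m) \<le> \<rho>" for m
  proof (induction m)
   case 0
   thus ?case using rho by (simp add: z0 N_def)
  next
   case (Suc m)
   have "N (\<lambda>_. 0) \<le> \<rho>" using rho by (simp add: N_def)
   from Tc[OF Suc this] have "N (\<lambda>k. T (z m) k - T (\<lambda>_. 0) k) \<le> \<rho> / 2" using Suc by simp
   moreover have "N (T (z m)) \<le> N (\<lambda>k. T (z m) k - T (\<lambda>_. 0) k) + N (T (\<lambda>_. 0))"
    unfolding N_def sum.distrib[symmetric]
    by (rule sum_mono) (metis norm_triangle_sub add.commute)
   ultimately show ?case using T0 by (simp add: zS)
  qed
  have zd: "N (\<lambda>k. z (Suc m) k - z m k) \<le> (1 / 2) ^ m * (\<rho> / 2)" for m
  proof (induction m)
   case 0
   thus ?case using T0 by (simp add: z0 zS)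
  next
   case (Suc m)
   have "N (\<lambda>k. z (Suc (Suc m)) k - z (Suc m) k) \<le> N (\<lambda>k. z (Suc m) k - z m k) / 2"
    using Tc[OF zN[of "Suc m"] zN[of m]] unfolding zS[of "Suc m"] zS[of m, symmetric] .
   thus ?case using Suc by simp
  qed
  have "\<exists>l. (\<lambda>m. z m k) \<longlonglongrightarrow> l" if k: "k < r" for k
  proof -
   have "summable (\<lambda>m. z (Suc m) k - z m k)"
   proof (rule summable_comparison_test')
    show "summable (\<lambda>m. (1 / 2) ^ m * (\<rho> / 2))" by (intro summable_mult2 summable_geometric) simp
    show "norm (z (Suc m) k - z m k) \<le> (1 / 2) ^ m * (\<rho> / 2)" if "m \<ge> 0" for m
     using Nk[OF k, of "\<lambda>k. z (Suc m) k - z m k"] zd[of m] by linarith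
   qed
   hence "convergent (\<lambda>m. \<Sum>l<m. z (Suc l) k - z l k)" by (simp add: summable_iff_convergent)
   moreover have "(\<Sum>l<m. z (Suc l) k - z l k) = z m k" for m
    using sum_lessThan_telescope[of "\<lambda>l. z l k" m] by (simp add: z0)
   ultimately show ?thesis by (simp add: convergent_def)
  qed
  then obtain l where l: "\<And>k. k < r ==> (\<lambda>m. z m k) \<longlonglongrightarrow> l k" by metis
  have Xl: "(\<lambda>m. X \<tau> (z m) i) \<longlonglongrightarrow> X \<tau> l i" for i
   unfolding X_def by (intro tendsto_intros l) auto
  have "f k (X \<tau> l) = 0" if k: "k < r" for k
  proof -
   have "(\<lambda>m. z m k - z (Suc m) k) \<longlonglongrightarrow> l k - l k"
    by (intro tendsto_diff l[OF k] LIMSEQ_Suc)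
   moreover have "(\<lambda>m. z m k - z (Suc m) k) = (\<lambda>m. f k (X \<tau> (z m)))" by (simp add: zS T_def)
   ultimately have "(\<lambda>m. f k (X \<tau> (z m))) \<longlonglongrightarrow> 0" by simp
   moreover have "(\<lambda>m. f k (X \<tau> (z m))) \<longlonglongrightarrow> f k (X \<tau> l)"
    by (rule hp_tendsto[OF fd[OF k] Xl])
   ultimately show ?thesis using LIMSEQ_unique by blast
  qed
  moreover have "N l \<le> \<rho>"
  proof (rule LIMSEQ_le_const2)
   show "(\<lambda>m. N (z m)) \<longlonglongrightarrow> N l" unfolding N_def by (intro tendsto_intros l) auto
   show "\<exists>M. \<forall>m\<ge>M. N (z m) \<le> \<rho>" using zN by blast
  qed
  ultimately show ?thesis by blast
 qed
 define Z where "Z \<tau> = (SOME \<zeta>. N \<zeta> \<le> \<rho> \<and> (\<forall>k<r. f k (X \<tau> \<zeta>) = 0))" for \<tau>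
 have Z: "N (Z \<tau>) \<le> \<rho>" "\<And>k. k < r ==> f k (X \<tau> (Z \<tau>)) = 0" if "cmod \<tau> < \<tau>0" for \<tau>
  using someI_ex[OF sol[OF that]] unfolding Z_def by blast+
 \<comment> \<open>The gradients kill \<open>v\<close> and \<open>e0\<close> and are dual to the
   \<open>ev\<close>, so the coefficients \<open>c\<close> vanish first; coordinate
   \<open>i0\<close> then separates \<open>v\<close> from \<open>e0\<close>.\<close>
 have indep: "a = 0 \<and> b = 0" if eq: "\<And>i. a * v i + b * e0 i + (\<Sum>k<r. c k * ev k i) = 0" for a b c
 proof -
  have c: "c j = 0" if j: "j < r" for j
  proof -
   have "0 = (\<Sum>i\<in>I. A j i * (a * v i + b * e0 i + (\<Sum>k<r. c k * ev k i)))" unfolding eq by simp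
   also have "\<dots> = a * (\<Sum>i\<in>I. A j i * v i) + b * (\<Sum>i\<in>I. A j i * e0 i) + (\<Sum>i\<in>I. A j i * (\<Sum>k<r. c k * ev k i))"
    unfolding sum_distrib_left[of a] sum_distrib_left[of b] sum.distrib[symmetric]
    by (rule sum.cong[OF refl]) (simp add: distrib_left)
   finally show ?thesis using Av[OF j] e0[OF j] dual[OF j] by simp
  qed
  have eq': "a * v i + b * e0 i = 0" for i using eq[of i] c by simp
  have "a = 0" using eq'[of i0] e0i0 i0 by simp
  thus ?thesis using eq'[of i1] i1 by simp
 qed
 define P where "P \<tau> = abs_point (X \<tau> (Z \<tau>))" for \<tau>
 have Xn: "X \<tau> (Z \<tau>) \<noteq> (\<lambda>_. 0)" for \<tau>
 proof
  assume "X \<tau> (Z \<tau>) = (\<lambda>_. 0)"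
  hence "X \<tau> (Z \<tau>) i = 0" for i by simp
  hence "1 * v i + \<tau> * e0 i + (\<Sum>k<r. Z \<tau> k * ev k i) = 0" for i
   by (simp add: X_def)
  hence "1 = (0 :: complex) \<and> \<tau> = 0" by (rule indep)
  thus False by simp
 qed
 have PC: "P \<tau> \<in> C" if tau: "cmod \<tau> < \<tau>0" for \<tau>
 proof -
  obtain c where c: "c \<noteq> 0" "crd (P \<tau>) = (\<lambda>i. c * X \<tau> (Z \<tau>) i)" using rep_abs_point[OF Xn] unfolding P_def .
  have "P \<tau> \<in> proj_space n" unfolding P_def proj_space_abs[OF Xn] using XI by (auto simp: I_def)
  moreover have "h (X \<tau> (Z \<tau>)) \<noteq> 0"
   using d2(2)[of "X \<tau> (Z \<tau>)"] near[OF tau Z(1)[OF tau]] by (auto simp: \<delta>_def)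
  hence "h (crd (P \<tau>)) \<noteq> 0" unfolding c(2) hp_scale[OF dh] using c(1) by simp
  moreover have "\<forall>k<r. f k (crd (P \<tau>)) = 0"
   unfolding c(2) using hp_scale[OF fd] Z(2)[OF tau] by simp
  ultimately show ?thesis using f(4) by blast
 qed
 have inj: "inj_on P (ball 0 \<tau>0)"
 proof (rule inj_onI)
  fix s t assume st: "P s = P t"
  then obtain c where c: "X t (Z t) = (\<lambda>i. c * X s (Z s) i)"
   unfolding P_def abs_point_eq_iff[OF Xn Xn] by blast
  have "(1 - c) * v i + (t - c * s) * e0 i + (\<Sum>k<r. (Z t k - c * Z s k) * ev k i) = 0" for i
  proof -
   have "X t (Z t) i - c * X s (Z s) i = 0" using c by simp
   moreover have "(\<Sum>k<r. (Z t k - c * Z s k) * ev k i) = (\<Sum>k<r. Z t k * ev k i) - c * (\<Sum>k<r. Z s k * ev k i)"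
    unfolding sum_distrib_left sum_subtractf[symmetric] by (rule sum.cong[OF refl]) (simp add: left_diff_distrib)
   ultimately show ?thesis by (simp only: X_def) (simp add: algebra_simps)
  qed
  hence "1 - c = 0 \<and> t - c * s = 0" by (rule indep)
  thus "s = t" by simp
 qed
 have "uncountable (P ` ball 0 \<tau>0)"
  using inj t0 uncountable_ball[of \<tau>0 "0::complex"] countable_image_inj_on by blast
 moreover have "P ` ball 0 \<tau>0 \<subseteq> C" using PC by auto
 ultimately show ?thesis using countable_subset by blast
qed

section \<open>Extension of point derivations\<close>

definition subalg :: "('i => complex) set => bool" where
 "subalg A \<longleftrightarrow> (\<forall>c. (\<lambda>_. c) \<in> A) \<and> (\<forall>u\<in>A. \<forall>v\<in>A. u + v \<in> A) \<and> (\<forall>u\<in>A. \<forall>v\<in>A. u * v \<in> A)"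

text \<open>Point derivations at \<open>q\<close>, that is, tangent vectors at \<open>q\<close> of
  the variety with coordinate algebra \<open>A\<close>.\<close>

definition pder :: "'i => ('i => complex) set => (('i => complex) => complex) => bool" where
 "pder q A D \<longleftrightarrow> (\<forall>c. D (\<lambda>_. c) = 0) \<and> (\<forall>u\<in>A. \<forall>v\<in>A. D (u + v) = D u + D v) \<and>
   (\<forall>u\<in>A. \<forall>v\<in>A. D (u * v) = D u * v q + u q * D v)"

text \<open>The ambient ring of all functions has zero divisors, so polynomials are taken over it
  and their coefficients are restricted to \<open>A\<close> afterwards.\<close>

definition polyin :: "('i => complex) set => ('i => complex) poly => bool" where
 "polyin A P \<longleftrightarrow> (\<forall>i. coeff P i \<in> A)"

definition adjoin :: "('i => complex) set => ('i => complex) => ('i => complex) set" where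
 "adjoin A h = {poly P h | P. polyin A P}"

definition Ev :: "'i => ('i => complex) poly => complex poly" where
 "Ev q P = map_poly (\<lambda>u. u q) P"

definition cfuns :: "('i => complex) set" where
 "cfuns = range (\<lambda>c _. c)"

lemma zero_fun_eq: "(\<lambda>_. 0) = (0 :: 'i => complex)" "(\<lambda>_. 1) = (1 :: 'i => complex)"
 by (auto simp: fun_eq_iff)

lemma sum_fun_apply: "(sum f A) x = (\<Sum>a\<in>A. f a x)" for f :: "'a => 'i => complex"
 by (induction A rule: infinite_finite_induct) auto

lemma power_fun_apply: "(h ^ k) x = h x ^ k" for h :: "'i => complex"
 by (induction k) auto

lemma coeff_Ev: "coeff (Ev q P) i = coeff P i q"
 by (simp add: Ev_def coeff_map_poly)

lemma Ev_add: "Ev q (P + R) = Ev q P + Ev q R"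
 by (rule poly_eqI) (simp add: coeff_Ev)

lemma Ev_mult: "Ev q (P * R) = Ev q P * Ev q R"
 by (rule poly_eqI) (simp add: coeff_Ev coeff_mult sum_fun_apply)

lemma Ev_pCons: "Ev q (pCons a P) = pCons (a q) (Ev q P)"
 by (rule poly_eqI) (simp add: coeff_Ev coeff_pCons split: nat.split)

lemma Ev_0: "Ev q 0 = 0"
 by (rule poly_eqI) (simp add: coeff_Ev)

lemma poly_Ev: "poly P h q = poly (Ev q P) (h q)"
 by (induction P) (simp_all add: Ev_0 Ev_pCons)

context
 fixes A :: "('i => complex) set"
 assumes A: "subalg A"
begin

lemma subalg_const: "(\<lambda>_. c) \<in> A" and subalg_add: "u \<in> A ==> v \<in> A ==> u + v \<in> A"
 and subalg_mult: "u \<in> A ==> v \<in> A ==> u * v \<in> A"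
 using A by (auto simp: subalg_def)

lemma subalg_0: "0 \<in> A" and subalg_1: "1 \<in> A"
 using subalg_const[of 0] subalg_const[of 1] by (simp_all add: zero_fun_eq)

lemma subalg_uminus: "u \<in> A ==> - u \<in> A"
proof -
 assume "u \<in> A"
 hence "(\<lambda>_. - 1) * u \<in> A" by (intro subalg_mult subalg_const)
 moreover have "(\<lambda>_. - 1) * u = - u" by (auto simp: fun_eq_iff)
 ultimately show ?thesis by simp
qed

lemma subalg_sum: "(\<And>i. i \<in> I ==> f i \<in> A) ==> (\<Sum>i\<in>I. f i) \<in> A"
 by (induction I rule: infinite_finite_induct) (auto intro: subalg_0 subalg_add)

lemma subalg_power: "u \<in> A ==> u ^ k \<in> A"
 by (induction k) (auto intro: subalg_1 subalg_mult)

lemma polyin_add: "polyin A P ==> polyin A R ==> polyin A (P + R)"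
 by (simp add: polyin_def subalg_add)

lemma polyin_mult: "polyin A P ==> polyin A R ==> polyin A (P * R)"
 by (simp add: polyin_def coeff_mult subalg_sum subalg_mult)

lemma polyin_smult: "u \<in> A ==> polyin A P ==> polyin A (smult u P)"
 by (simp add: polyin_def subalg_mult)

lemma polyin_uminus: "polyin A P ==> polyin A (- P)"
 by (simp add: polyin_def subalg_uminus)

lemma polyin_const: "u \<in> A ==> polyin A [:u:]"
 by (simp add: polyin_def coeff_pCons subalg_0 split: nat.split)

lemma polyin_X: "polyin A [:0, 1:]"
 by (auto simp: polyin_def coeff_pCons subalg_0 subalg_1 split: nat.split)

lemma polyin_monom: "u \<in> A ==> polyin A (monom u k)"
 by (simp add: polyin_def coeff_monom subalg_0)

lemma adjoin_subalg: "subalg (adjoin A h)"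
 unfolding subalg_def
proof (intro conjI allI ballI)
 fix c show "(\<lambda>_. c) \<in> adjoin A h"
  unfolding adjoin_def using polyin_const[OF subalg_const[of c]]
  by (intro CollectI exI[of _ "[:\<lambda>_. c:]"]) simp
next
 fix u v assume "u \<in> adjoin A h" "v \<in> adjoin A h"
 then obtain P R where "polyin A P" "u = poly P h" "polyin A R" "v = poly R h" by (auto simp: adjoin_def)
 thus "u + v \<in> adjoin A h" "u * v \<in> adjoin A h"
  unfolding adjoin_def using polyin_add[of P R] polyin_mult[of P R]
  by (auto intro: exI[of _ "P + R"] exI[of _ "P * R"])
qed

lemma adjoin_superset: "A \<subseteq> adjoin A h"
proof
 fix u assume "u \<in> A"
 thus "u \<in> adjoin A h" unfolding adjoin_def using polyin_const[of u]
  by (intro CollectI exI[of _ "[:u:]"]) simp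
qed

lemma adjoin_gen: "h \<in> adjoin A h"
 unfolding adjoin_def using polyin_X by (intro CollectI exI[of _ "[:0, 1:]"]) simp

lemma adjoin_subset: "subalg B ==> A \<subseteq> B ==> h \<in> B ==> adjoin A h \<subseteq> B"
proof
 fix u assume B: "subalg B" "A \<subseteq> B" "h \<in> B" and "u \<in> adjoin A h"
 then obtain P where P: "polyin A P" "u = poly P h" by (auto simp: adjoin_def)
 have "poly P h \<in> B" if "polyin A P" for P
  using that
 proof (induction P)
  case 0
  thus ?case using B(1) by (auto simp: subalg_def zero_fun_eq[symmetric])
 next
  case (pCons a P)
  have "a \<in> A" using pCons.prems unfolding polyin_def by (metis coeff_pCons_0)
  moreover have "polyin A P" using pCons.prems unfolding polyin_def by (metis coeff_pCons_Suc)
  ultimately have "a \<in> B" "poly P h \<in> B" using pCons.IH B by auto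
  moreover have "\<And>u v. u \<in> B ==> v \<in> B ==> u + v \<in> B" "\<And>u v. u \<in> B ==> v \<in> B ==> u * v \<in> B"
   using B(1) unfolding subalg_def by blast+
  ultimately show ?case using B(3) by (simp only: poly_pCons)
 qed
 thus "u \<in> B" using P by simp
qed

text \<open>The leading coefficient of \<open>Q\<close> need not be invertible, so each reduction
  step multiplies the dividend by it instead; \<open>P'\<close> is one such step, which removes the
  leading term of \<open>P\<close>.\<close>

lemma pseudo_division:
 assumes Q: "polyin A Q" "degree Q = m" and P: "polyin A P"
 shows "\<exists>k B R. polyin A B \<and> polyin A R \<and> smult (coeff Q m ^ k) P = Q * B + R \<and> (R = 0 \<or> degree R < m)"
 using P
proof (induction "degree P" arbitrary: P rule: less_induct)
 case less
 show ?case
 proof (cases "P = 0 \<or> degree P < m")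
  case True
  have "polyin A 0" by (simp add: polyin_def subalg_0)
  thus ?thesis using less.prems True
   by (intro exI[of _ 0] exI[of _ "0 :: ('i => complex) poly"] exI[of _ P]) auto
 next
  case False
  hence P0: "P \<noteq> 0" "m \<le> degree P" by auto
  let ?a = "coeff Q m" and ?n = "degree P"
  let ?M = "monom (coeff P ?n) (?n - m)"
  define P' where "P' = smult ?a P - Q * ?M"
  have inA: "?a \<in> A" "coeff P ?n \<in> A" using Q less.prems by (auto simp: polyin_def)
  have pM: "polyin A ?M" by (rule polyin_monom[OF inA(2)])
  have pP': "polyin A P'"
   unfolding P'_def using polyin_add[OF polyin_smult[OF inA(1) less.prems] polyin_uminus[OF polyin_mult[OF Q(1) pM]]] by simp
  have cM: "coeff (Q * ?M) j = (if j < ?n - m then 0 else coeff Q (j - (?n - m)) * coeff P ?n)" for j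
   using coeff_monom_mult[of "coeff P ?n" "?n - m" Q j] by (simp only: mult.commute[of Q ?M] mult.commute[of "coeff P ?n"])
  have z: "coeff P' j = 0" if "j \<ge> ?n" for j
  proof (cases "j = ?n")
   case True
   thus ?thesis using P0 by (simp add: P'_def cM)
  next
   case False
   hence "j > ?n" using that by simp
   hence "coeff P j = 0" "coeff Q (j - (?n - m)) = 0" using P0(2) Q(2) by (auto intro!: coeff_eq_0)
   thus ?thesis by (simp add: P'_def cM)
  qed
  have ex: "\<exists>k B R. polyin A B \<and> polyin A R \<and> smult (?a ^ k) P' = Q * B + R \<and> (R = 0 \<or> degree R < m)"
  proof (cases "P' = 0")
   case True
   have "polyin A 0" by (simp add: polyin_def subalg_0)
   thus ?thesis using True
    by (intro exI[of _ 0] exI[of _ "0 :: ('i => complex) poly"] exI[of _ "0 :: ('i => complex) poly"]) auto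
  next
   case False
   hence "degree P' < ?n" using z by (metis leading_coeff_0_iff not_le)
   thus ?thesis using less.hyps pP' by blast
  qed
  then obtain k B R where kBR: "polyin A B" "polyin A R" "smult (?a ^ k) P' = Q * B + R" "R = 0 \<or> degree R < m" by blast
  have "smult (?a ^ Suc k) P = smult (?a ^ k) P' + smult (?a ^ k) (Q * ?M)"
   by (simp add: P'_def smult_diff_right mult.commute)
  also have "\<dots> = Q * (B + smult (?a ^ k) ?M) + R" unfolding kBR(3) by (simp add: algebra_simps)
  finally have "smult (?a ^ Suc k) P = Q * (B + smult (?a ^ k) ?M) + R" .
  moreover have "polyin A (B + smult (?a ^ k) ?M)"
   by (intro polyin_add kBR polyin_smult subalg_power inA pM)
  ultimately show ?thesis using kBR(2,4) by blast
 qed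
qed

context
 fixes q :: 'i and D :: "('i => complex) => complex" and h :: "'i => complex" and \<xi> :: complex
 assumes D: "pder q A D"
begin

lemma D_0: "D 0 = 0"
 using D unfolding pder_def zero_fun_eq[symmetric] by blast

lemma D_add: "u \<in> A ==> v \<in> A ==> D (u + v) = D u + D v"
 and D_mult: "u \<in> A ==> v \<in> A ==> D (u * v) = D u * v q + u q * D v"
 using D by (auto simp: pder_def)

lemma D_sum: "(\<And>i. i \<in> I ==> f i \<in> A) ==> D (\<Sum>i\<in>I. f i) = (\<Sum>i\<in>I. D (f i))"
proof (induction I rule: infinite_finite_induct)
 case (insert x F)
 have "D (f x + sum f F) = D (f x) + D (sum f F)" using insert by (intro D_add subalg_sum) auto
 thus ?case using insert.IH[OF insert.prems] unfolding sum.insert[OF insert(1,2)] by (simp only: insertI2)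
qed (simp_all add: D_0)

text \<open>The value at \<open>poly P h\<close> of an extension of \<open>D\<close> that sends
  \<open>h\<close> to \<open>\<xi>\<close>, as forced by the Leibniz rule. It depends on the
  polynomial and not only on the function \<open>poly P h\<close>; that it vanishes on all relations
  of \<open>h\<close> is the condition in \<open>derivation_extends\<close>.\<close>

definition dt :: "('i => complex) poly => complex" where
 "dt P = poly (map_poly D P) (h q) + poly (pderiv (Ev q P)) (h q) * \<xi>"

lemma dt_add: "polyin A P ==> polyin A R ==> dt (P + R) = dt P + dt R"
proof -
 assume "polyin A P" "polyin A R"
 hence "map_poly D (P + R) = map_poly D P + map_poly D R"
  by (intro poly_eqI) (simp add: coeff_map_poly D_0 D_add polyin_def)
 thus ?thesis by (simp add: dt_def Ev_add pderiv_add algebra_simps)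
qed

lemma dt_mult: "polyin A P ==> polyin A R ==> dt (P * R) = dt P * poly R h q + poly P h q * dt R"
proof -
 assume PR: "polyin A P" "polyin A R"
 have "map_poly D (P * R) = map_poly D P * Ev q R + Ev q P * map_poly D R"
 proof (rule poly_eqI)
  fix n
  have "coeff (map_poly D (P * R)) n = (\<Sum>i\<le>n. D (coeff P i * coeff R (n - i)))"
   using PR by (simp add: coeff_map_poly D_0 coeff_mult D_sum polyin_def subalg_mult)
  also have "\<dots> = (\<Sum>i\<le>n. D (coeff P i) * coeff R (n - i) q + coeff P i q * D (coeff R (n - i)))"
   using PR by (simp add: D_mult polyin_def)
  finally show "coeff (map_poly D (P * R)) n = coeff (map_poly D P * Ev q R + Ev q P * map_poly D R) n"
   by (simp add: coeff_mult coeff_map_poly D_0 coeff_Ev sum.distrib)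
 qed
 thus ?thesis by (simp add: dt_def Ev_mult pderiv_mult poly_Ev algebra_simps)
qed

lemma dt_const: "dt [:u:] = D u"
 by (simp add: dt_def Ev_pCons Ev_0 map_poly_pCons D_0 pderiv_pCons)

lemma dt_smult: "u \<in> A ==> polyin A P ==> dt (smult u P) = D u * poly P h q + u q * dt P"
 using dt_mult[OF polyin_const, of u P] by (simp add: dt_const)

lemma derivation_extends:
 assumes wd: "\<And>P. polyin A P ==> poly P h = 0 ==> dt P = 0"
 shows "\<exists>D'. pder q (adjoin A h) D' \<and> D' h = \<xi> \<and> (\<forall>u\<in>A. D' u = D u)"
proof -
 define pick where "pick w = (SOME P. polyin A P \<and> poly P h = w)" for w
 define D' where "D' w = dt (pick w)" for w
 have D': "D' (poly P h) = dt P" if P: "polyin A P" for P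
 proof -
  let ?R = "pick (poly P h)"
  have R: "polyin A ?R" "poly ?R h = poly P h"
   using someI[of "\<lambda>R. polyin A R \<and> poly R h = poly P h" P] P unfolding pick_def by blast+
  have m: "(\<lambda>_. - 1) \<in> A" by (rule subalg_const)
  have pm: "polyin A (smult (\<lambda>_. - 1) P)" by (rule polyin_smult[OF m P])
  have "poly (?R + smult (\<lambda>_. - 1) P) h = 0" using R(2) by (auto simp: fun_eq_iff)
  hence "dt (?R + smult (\<lambda>_. - 1) P) = 0" using wd polyin_add[OF R(1) pm] by blast
  moreover have "D (\<lambda>_. - 1) = 0" using D by (simp add: pder_def)
  ultimately show ?thesis using dt_add[OF R(1) pm] dt_smult[OF m P] by (simp add: D'_def)
 qed
 have "pder q (adjoin A h) D'"
  unfolding pder_def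
 proof (intro conjI allI ballI)
  fix c
  have "D' (poly [:\<lambda>_. c:] h) = dt [:\<lambda>_. c:]" by (rule D'[OF polyin_const[OF subalg_const]])
  thus "D' (\<lambda>_. c) = 0" using D by (simp add: dt_const pder_def)
 next
  fix u v assume "u \<in> adjoin A h" "v \<in> adjoin A h"
  then obtain P R where PR: "polyin A P" "u = poly P h" "polyin A R" "v = poly R h" by (auto simp: adjoin_def)
  show "D' (u + v) = D' u + D' v"
   using D'[OF polyin_add[OF PR(1,3)]] D'[OF PR(1)] D'[OF PR(3)] dt_add[OF PR(1,3)] by (simp add: PR)
  show "D' (u * v) = D' u * v q + u q * D' v"
   using D'[OF polyin_mult[OF PR(1,3)]] D'[OF PR(1)] D'[OF PR(3)] dt_mult[OF PR(1,3)] by (simp add: PR)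
 qed
 moreover have "D' h = \<xi>"
 proof -
  have "D 1 = 0" using D unfolding pder_def zero_fun_eq[symmetric] by blast
  hence "dt [:0, 1:] = \<xi>" by (simp add: dt_def Ev_pCons Ev_0 map_poly_pCons D_0 pderiv_pCons)
  thus ?thesis using D'[OF polyin_X] by simp
 qed
 moreover have "\<forall>u\<in>A. D' u = D u"
 proof
  fix u assume "u \<in> A"
  thus "D' u = D u" using D'[OF polyin_const, of u] by (simp add: dt_const)
 qed
 ultimately show ?thesis by blast
qed

end

lemma derivation_extends_transcendental:
 assumes "\<And>P. polyin A P ==> poly P h = 0 ==> P = 0" and D: "pder q A D"
 shows "\<exists>D'. pder q (adjoin A h) D' \<and> D' h = \<xi> \<and> (\<forall>u\<in>A. D' u = D u)"
proof (rule derivation_extends[OF D])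
 fix P assume "polyin A P" "poly P h = 0"
 hence "P = 0" by (rule assms(1))
 thus "dt q D h \<xi> P = 0" by (simp add: dt_def[OF D] Ev_0)
qed

text \<open>If \<open>h\<close> is transcendental over \<open>A\<close>, every value for
  \<open>h\<close> is allowed. Otherwise a relation \<open>Q\<close> of least degree imposes one
  linear equation on that value. In \<open>s\<close>, the factor \<open>poly Q' h\<close> makes the
  equation solvable, and the leading coefficient of \<open>Q\<close> lets pseudo-division reduce all
  other relations to \<open>Q\<close>. The former is non-zero by minimality, as \<open>Q'\<close>
  has smaller degree and is not zero in characteristic zero.\<close>

lemma derivation_extends_generic:
 assumes dom: "\<And>u v. u \<in> adjoin A h ==> v \<in> adjoin A h ==> u * v = 0 ==> u = 0 \<or> v = 0"
 shows "\<exists>s\<in>adjoin A h. s \<noteq> 0 \<and> (\<forall>q. s q \<noteq> 0 --> (\<forall>D. pder q A D -->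
  (\<exists>D'. pder q (adjoin A h) D' \<and> (\<forall>u\<in>A. D' u = D u))))"
proof (cases "\<forall>P. polyin A P --> poly P h = 0 --> P = 0")
 case True
 have "1 \<in> adjoin A h" using adjoin_superset subalg_1 by blast
 thus ?thesis using derivation_extends_transcendental True
  by (intro bexI[of _ 1]) (auto simp: fun_eq_iff, metis)
next
 case False
 then obtain Q0 where "polyin A Q0 \<and> poly Q0 h = 0 \<and> Q0 \<noteq> 0" by blast
 from exists_least_iff[of "\<lambda>m. \<exists>Q. polyin A Q \<and> poly Q h = 0 \<and> Q \<noteq> 0 \<and> degree Q = m"] this
 obtain m where "\<exists>Q. polyin A Q \<and> poly Q h = 0 \<and> Q \<noteq> 0 \<and> degree Q = m"
  "\<forall>m'<m. \<not> (\<exists>Q. polyin A Q \<and> poly Q h = 0 \<and> Q \<noteq> 0 \<and> degree Q = m')" by blast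
 then obtain Q where Q: "polyin A Q" "poly Q h = 0" "Q \<noteq> 0" "degree Q = m"
  and least: "\<And>R. polyin A R ==> poly R h = 0 ==> degree R < m ==> R = 0" by blast
 let ?a = "coeff Q m"
 have a: "?a \<noteq> 0" "?a \<in> A" using Q by (auto simp: polyin_def)
 have m: "m > 0"
 proof (rule ccontr)
  assume "\<not> m > 0"
  then obtain u where "Q = [:u:]" using Q(4) by (metis degree_eq_zeroE gr0I)
  thus False using Q(2,3) by simp
 qed
 define Q' where "Q' = Poly (map (\<lambda>i. (\<lambda>_. of_nat (Suc i)) * coeff Q (Suc i)) [0..<m])"
 have cQ': "coeff Q' i = (\<lambda>_. of_nat (Suc i)) * coeff Q (Suc i)" for i
 proof (cases "i < m")
  case True
  thus ?thesis by (simp add: Q'_def nth_default_def)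
 next
  case False
  hence "coeff Q (Suc i) = 0" using Q(4) by (intro coeff_eq_0) simp
  thus ?thesis using False by (simp add: Q'_def nth_default_def)
 qed
 have pQ': "polyin A Q'" using Q(1) by (simp add: polyin_def cQ' subalg_mult subalg_const)
 have dQ': "degree Q' < m"
 proof -
  have "degree Q' \<le> m - 1"
  proof (rule degree_le, intro allI impI)
   fix i assume "m - 1 < i"
   hence "coeff Q (Suc i) = 0" using Q(4) by (intro coeff_eq_0) simp
   thus "coeff Q' i = 0" by (simp add: cQ')
  qed
  thus ?thesis using m by simp
 qed
 have "coeff Q' (m - 1) \<noteq> 0"
 proof
  assume "coeff Q' (m - 1) = 0"
  hence "(\<lambda>_. of_nat m) * ?a = 0" using m by (simp add: cQ')
  hence "of_nat m * ?a x = 0" for x by (metis times_fun_apply zero_fun_apply)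
  hence "?a x = 0" for x using m by simp
  thus False using a(1) by (auto simp: fun_eq_iff)
 qed
 hence "Q' \<noteq> 0" by auto
 hence Q'h: "poly Q' h \<noteq> 0" using least[OF pQ' _ dQ'] by blast
 have EvQ': "Ev q Q' = pderiv (Ev q Q)" for q
  by (rule poly_eqI) (simp add: coeff_Ev cQ' coeff_pderiv)
 let ?s = "?a * poly Q' h"
 have in1: "?a \<in> adjoin A h" using adjoin_superset a(2) by blast
 have in2: "poly Q' h \<in> adjoin A h" unfolding adjoin_def using pQ' by blast
 have "?s \<in> adjoin A h" using in1 in2 adjoin_subalg by (auto simp: subalg_def)
 moreover have "?s \<noteq> 0" using dom[OF in1 in2] a(1) Q'h by blast
 moreover have "\<exists>D'. pder q (adjoin A h) D' \<and> (\<forall>u\<in>A. D' u = D u)" if s: "?s q \<noteq> 0" and D: "pder q A D" for q D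
 proof -
  have aq: "?a q \<noteq> 0" and dq: "poly (pderiv (Ev q Q)) (h q) \<noteq> 0" using s by (auto simp: poly_Ev EvQ')
  \<comment> \<open>The solution of the linear equation that says that \<open>dt\<close> vanishes on
    \<open>Q\<close>.\<close>
  define \<xi> where "\<xi> = - poly (map_poly D Q) (h q) / poly (pderiv (Ev q Q)) (h q)"
  have dtQ: "dt q D h \<xi> Q = 0" using dq by (simp add: dt_def[OF D] \<xi>_def)
  have "\<exists>D'. pder q (adjoin A h) D' \<and> D' h = \<xi> \<and> (\<forall>u\<in>A. D' u = D u)"
  proof (rule derivation_extends[OF D])
   fix P assume P: "polyin A P" "poly P h = 0"
   obtain k B R where kBR: "polyin A B" "polyin A R" "smult (?a ^ k) P = Q * B + R" "R = 0 \<or> degree R < m"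
    using pseudo_division[OF Q(1,4) P(1)] by blast
   have "poly (smult (?a ^ k) P) h = poly (Q * B + R) h" by (simp only: kBR(3))
   hence "poly R h = 0" using P(2) Q(2) by simp
   hence R: "R = 0" using least kBR(2,4) by blast
   have "dt q D h \<xi> (smult (?a ^ k) P) = D (?a ^ k) * poly P h q + (?a ^ k) q * dt q D h \<xi> P"
    by (rule dt_smult[OF D subalg_power[OF a(2)] P(1)])
   moreover have "dt q D h \<xi> (Q * B) = dt q D h \<xi> Q * poly B h q + poly Q h q * dt q D h \<xi> B"
    by (rule dt_mult[OF D Q(1) kBR(1)])
   ultimately have "(?a ^ k) q * dt q D h \<xi> P = 0" using P(2) Q(2) dtQ kBR(3) R by simp
   thus "dt q D h \<xi> P = 0" using aq by (simp add: power_fun_apply)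
  qed
  thus ?thesis by blast
 qed
 ultimately show ?thesis by blast
qed

end

lemma foldl_adjoin_subalg: "subalg A ==> subalg (foldl adjoin A hs) \<and> A \<subseteq> foldl adjoin A hs"
proof (induction hs arbitrary: A)
 case (Cons h hs)
 thus ?case using Cons.IH[OF adjoin_subalg[OF Cons.prems, of h]] adjoin_superset[OF Cons.prems, of h] by auto
qed simp

lemma foldl_adjoin_gen: "subalg A ==> h \<in> set hs ==> h \<in> foldl adjoin A hs"
proof (induction hs arbitrary: A)
 case (Cons k hs)
 show ?case
 proof (cases "h = k")
  case True
  thus ?thesis using foldl_adjoin_subalg[OF adjoin_subalg[OF Cons.prems(1), of k], of hs] adjoin_gen[OF Cons.prems(1), of k] by auto
 next
  case False
  thus ?thesis using Cons.IH[OF adjoin_subalg[OF Cons.prems(1), of k]] Cons.prems by simp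
 qed
qed simp

lemma foldl_adjoin_subset: "subalg A ==> subalg B ==> A \<subseteq> B ==> set hs \<subseteq> B ==> foldl adjoin A hs \<subseteq> B"
proof (induction hs arbitrary: A)
 case (Cons k hs)
 have "foldl adjoin (adjoin A k) hs \<subseteq> B"
  using Cons.prems adjoin_subset[OF Cons.prems(1,2,3)] by (intro Cons.IH adjoin_subalg) auto
 thus ?case by simp
qed simp

lemma derivation_extends_chain:
 assumes "subalg A"
  and dom: "\<And>u v. u \<in> foldl adjoin A hs ==> v \<in> foldl adjoin A hs ==> u * v = 0 ==> u = 0 \<or> v = 0"
 shows "\<exists>s\<in>foldl adjoin A hs. s \<noteq> 0 \<and> (\<forall>q. s q \<noteq> 0 --> (\<forall>D. pder q A D -->
  (\<exists>D'. pder q (foldl adjoin A hs) D' \<and> (\<forall>u\<in>A. D' u = D u))))"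
 using assms
proof (induction hs arbitrary: A)
 case Nil
 thus ?case using subalg_1[OF Nil(1)] by (intro bexI[of _ 1]) (auto simp: fun_eq_iff)
next
 case (Cons h hs)
 let ?A = "adjoin A h" and ?B = "foldl adjoin A (h # hs)"
 have sA: "subalg ?A" by (rule adjoin_subalg[OF Cons.prems(1)])
 have AB: "?A \<subseteq> ?B" and sB: "subalg ?B" using foldl_adjoin_subalg[OF sA, of hs] by auto
 obtain s1 where s1: "s1 \<in> ?A" "s1 \<noteq> 0" "\<forall>q. s1 q \<noteq> 0 --> (\<forall>D. pder q A D -->
  (\<exists>D'. pder q ?A D' \<and> (\<forall>u\<in>A. D' u = D u)))"
  using derivation_extends_generic[OF Cons.prems(1), of h] Cons.prems(2) AB by blast
 obtain s2 where s2: "s2 \<in> ?B" "s2 \<noteq> 0" "\<forall>q. s2 q \<noteq> 0 --> (\<forall>D. pder q ?A D -->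
  (\<exists>D'. pder q ?B D' \<and> (\<forall>u\<in>?A. D' u = D u)))"
  using Cons.IH[OF sA Cons.prems(2)] unfolding foldl_Cons by blast
 have "s1 * s2 \<in> ?B" using s1(1) s2(1) AB sB unfolding subalg_def by blast
 moreover have "s1 * s2 \<noteq> 0" using Cons.prems(2)[of s1 s2] s1 s2 AB by blast
 moreover have "\<exists>D'. pder q ?B D' \<and> (\<forall>u\<in>A. D' u = D u)" if q: "(s1 * s2) q \<noteq> 0" and D: "pder q A D" for q D
 proof -
  have "s1 q \<noteq> 0" "s2 q \<noteq> 0" using q by auto
  then obtain D1 where D1: "pder q ?A D1" "\<forall>u\<in>A. D1 u = D u" using s1(3) D by blast
  then obtain D2 where "pder q ?B D2" "\<forall>u\<in>?A. D2 u = D1 u" using s2(3) \<open>s2 q \<noteq> 0\<close> by blast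
  thus ?thesis using D1(2) adjoin_superset[OF Cons.prems(1), of h] by (intro exI[of _ D2]) auto
 qed
 ultimately show ?case by blast
qed

section \<open>Curves have transcendence degree one\<close>

lemma hp_directional:
 assumes "finite I" "\<And>i. i \<notin> I ==> \<eta> i = 0" "hp d f"
 shows "((\<lambda>t. f (\<lambda>i. v i + t * \<eta> i)) has_field_derivative (\<Sum>i\<in>I. pd f i v * \<eta> i)) (at 0)"
 using hp_line_derivative[OF assms, where y = v and t = 0] by simp

lemma consts_subalg: "subalg cfuns"
 unfolding subalg_def cfuns_def
proof (intro conjI allI ballI)
 fix u v :: "'i => complex" assume "u \<in> range (\<lambda>c _. c)" "v \<in> range (\<lambda>c _. c)"
 then obtain a b where "u = (\<lambda>_. a)" "v = (\<lambda>_. b)" by auto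
 hence "u + v = (\<lambda>_. a + b)" "u * v = (\<lambda>_. a * b)" by (auto simp: fun_eq_iff)
 thus "u + v \<in> range (\<lambda>c _. c)" "u * v \<in> range (\<lambda>c _. c)" by auto
qed auto

lemma consts_poly:
 assumes "polyin cfuns P" shows "poly P h x = poly (Ev y P) (h x)"
proof -
 have "Ev x P = Ev y P"
 proof (rule poly_eqI)
  fix i have "coeff P i \<in> cfuns" using assms by (simp add: polyin_def)
  thus "coeff (Ev x P) i = coeff (Ev y P) i" by (auto simp: coeff_Ev cfuns_def)
 qed
 thus ?thesis by (simp add: poly_Ev)
qed

lemma polyin_zero_iff:
 assumes "\<And>i. coeff P i \<in> cfuns" "Ev y P = 0" shows "P = 0"
proof (rule poly_eqI)
 fix i
 have "coeff (Ev y P) i = 0" using assms(2) by simp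
 hence "coeff P i y = 0" by (simp add: coeff_Ev)
 thus "coeff P i = coeff 0 i" using assms(1)[of i] by (auto simp: cfuns_def fun_eq_iff)
qed

text \<open>
 If \<open>f\<close> and \<open>g\<close> were algebraically independent, the derivations \<open>\<partial>/\<partial>f\<close> and \<open>\<partial>/\<partial>g\<close> would extend
 to the affine coordinate ring at some point of the curve, which would hence two independent
 tangent directions.
\<close>

lemma curve_algebraic_dependence:
 assumes C: "smooth_projective_curve n C"
  and f: "rat_germ C f" and g: "rat_germ C g"
 shows "\<exists>P :: complex poly poly. P \<noteq> 0 \<and>
  (\<forall>\<^sub>F p in generic C. (\<Sum>i\<le>degree P. poly (coeff P i) (f p) * g p ^ i) = 0)"
proof -
 have pv: "projective_variety n C" and n: "1 \<le> n" and sm: "\<And>p. p \<in> C ==> smooth_at n 1 C p"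
  using C by (auto simp: smooth_projective_def)
 have Csub: "C \<subseteq> proj_space n" using pv unfolding projective_variety_def by blast
 interpret irreducible C by (rule projective_variety_irreducible[OF pv])
 obtain d1 F1 G1 where F1: "hp d1 F1" "hp d1 G1"
  "\<forall>\<^sub>F q in generic C. G1 (crd q) \<noteq> 0 \<and> f q = F1 (crd q) / G1 (crd q)"
  using f unfolding rat_germ_def by blast
 obtain d2 F2 G2 where F2: "hp d2 F2" "hp d2 G2"
  "\<forall>\<^sub>F q in generic C. G2 (crd q) \<noteq> 0 \<and> g q = F2 (crd q) / G2 (crd q)"
  using g unfolding rat_germ_def by blast
 obtain p0 where p0: "p0 \<in> C" using nonempty by auto
 obtain i0 where i0: "crd p0 i0 \<noteq> 0" by (rule rep_point_coord)
 have xi0: "\<forall>\<^sub>F q in generic C. crd q i0 \<noteq> 0" by (rule generic_nonzero[OF hp_var p0 i0])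
 define \<Omega> where "\<Omega> = {q\<in>C. G1 (crd q) \<noteq> 0 \<and> G2 (crd q) \<noteq> 0 \<and> crd q i0 \<noteq> 0}"
 have \<Omega>gen: "\<forall>\<^sub>F q in generic C. q \<in> \<Omega> \<and> f q = F1 (crd q) / G1 (crd q) \<and> g q = F2 (crd q) / G2 (crd q)"
  using F1(3) F2(3) xi0 generic_in by eventually_elim (simp add: \<Omega>_def)
 obtain q0 where q0: "q0 \<in> \<Omega>" using generic_ex[OF \<Omega>gen] by blast
 \<comment> \<open>Points outside \<open>\<Omega>\<close> are redirected to \<open>q0\<close>. The
   regular functions on \<open>\<Omega>\<close> thus become total functions, and equality of
   functions means equality on \<open>\<Omega>\<close>.\<close>
 define \<rho> where "\<rho> q = (if q \<in> \<Omega> then q else q0)" for q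
 have \<rho>: "\<rho> q \<in> \<Omega>" "\<rho> q \<in> C" for q using q0 by (auto simp: \<rho>_def \<Omega>_def)
 have \<rho>id: "\<rho> q = q" if "q \<in> \<Omega>" for q using that by (simp add: \<rho>_def)
 define R :: "(point => complex) set" where "R = {u. \<exists>d K L. hp d K \<and> hp d L \<and> (\<forall>q\<in>\<Omega>. L (crd q) \<noteq> 0) \<and>
  u = (\<lambda>q. K (crd (\<rho> q)) / L (crd (\<rho> q)))}"
 have RI: "(\<lambda>q. K (crd (\<rho> q)) / L (crd (\<rho> q))) \<in> R" if "hp d K" "hp d L" "\<forall>q\<in>\<Omega>. L (crd q) \<noteq> 0" for d K L
  using that unfolding R_def by blast
 have Rsub: "subalg R"
  unfolding subalg_def
 proof (intro conjI allI ballI)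
  fix c show "(\<lambda>_. c) \<in> R" using RI[OF hp.const[of c] hp.const[of 1]] by simp
 next
  fix u v assume "u \<in> R" "v \<in> R"
  then obtain d K L e K' L' where *: "hp d K" "hp d L" "\<forall>q\<in>\<Omega>. L (crd q) \<noteq> 0" "u = (\<lambda>q. K (crd (\<rho> q)) / L (crd (\<rho> q)))"
   "hp e K'" "hp e L'" "\<forall>q\<in>\<Omega>. L' (crd q) \<noteq> 0" "v = (\<lambda>q. K' (crd (\<rho> q)) / L' (crd (\<rho> q)))"
   unfolding R_def by blast
  have h: "hp (d + e) (\<lambda>v. K v * L' v + L v * K' v)" "hp (d + e) (\<lambda>v. L v * L' v)" "hp (d + e) (\<lambda>v. K v * K' v)"
   using * by (auto intro: hp.intros)
  have nz: "L (crd (\<rho> q)) \<noteq> 0" "L' (crd (\<rho> q)) \<noteq> 0" for q using * \<rho> by auto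
  have nn: "\<forall>q\<in>\<Omega>. L (crd q) * L' (crd q) \<noteq> 0" using * by auto
  have "u + v = (\<lambda>q. (K (crd (\<rho> q)) * L' (crd (\<rho> q)) + L (crd (\<rho> q)) * K' (crd (\<rho> q))) / (L (crd (\<rho> q)) * L' (crd (\<rho> q))))"
   unfolding *(4,8) using nz by (auto simp: fun_eq_iff field_simps)
  thus "u + v \<in> R" using RI[OF h(1,2) nn] by simp
  have "u * v = (\<lambda>q. (K (crd (\<rho> q)) * K' (crd (\<rho> q))) / (L (crd (\<rho> q)) * L' (crd (\<rho> q))))"
   unfolding *(4,8) by (auto simp: fun_eq_iff)
  thus "u * v \<in> R" using RI[OF h(3,2) nn] by simp
 qed
 \<comment> \<open>Irreducibility of the curve: a product of two numerators that vanishes on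
   \<open>\<Omega>\<close> has a factor vanishing on \<open>C\<close>.\<close>
 have Rdom: "u = 0 \<or> v = 0" if uv: "u \<in> R" "v \<in> R" "u * v = 0" for u v
 proof -
  obtain d K L e K' L' where *: "hp d K" "hp d L" "\<forall>q\<in>\<Omega>. L (crd q) \<noteq> 0" "u = (\<lambda>q. K (crd (\<rho> q)) / L (crd (\<rho> q)))"
   "hp e K'" "hp e L'" "\<forall>q\<in>\<Omega>. L' (crd q) \<noteq> 0" "v = (\<lambda>q. K' (crd (\<rho> q)) / L' (crd (\<rho> q)))"
   using uv(1,2) unfolding R_def by blast
  have z: "K (crd q) * K' (crd q) = 0" if "q \<in> \<Omega>" for q
  proof -
   have "(u * v) q = 0" using uv(3) by simp
   thus ?thesis using *(3,7) that unfolding *(4,8) by (auto simp: \<rho>id)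
  qed
  have "(\<forall>q\<in>C. K (crd q) = 0) \<or> (\<forall>q\<in>C. K' (crd q) = 0)"
  proof (rule ccontr)
   assume "\<not> ?thesis"
   then obtain q q' where "q \<in> C" "K (crd q) \<noteq> 0" "q' \<in> C" "K' (crd q') \<noteq> 0" by blast
   hence "\<forall>\<^sub>F q in generic C. K (crd q) \<noteq> 0" "\<forall>\<^sub>F q in generic C. K' (crd q) \<noteq> 0"
    using generic_nonzero *(1,5) by blast+
   hence "\<forall>\<^sub>F q in generic C. False" using \<Omega>gen by eventually_elim (use z in auto)
   thus False using generic_ex by blast
  qed
  thus ?thesis using \<rho>(2) unfolding *(4,8) by (auto simp: fun_eq_iff)
 qed
 define f' where "f' = (\<lambda>q. F1 (crd (\<rho> q)) / G1 (crd (\<rho> q)))"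
 define g' where "g' = (\<lambda>q. F2 (crd (\<rho> q)) / G2 (crd (\<rho> q)))"
 have f'R: "f' \<in> R" and g'R: "g' \<in> R"
  unfolding f'_def g'_def using RI[OF F1(1,2)] RI[OF F2(1,2)] by (auto simp: \<Omega>_def)
 define A1 where "A1 = adjoin cfuns f'"
 define A2 where "A2 = adjoin A1 g'"
 have sA1: "subalg A1" unfolding A1_def by (rule adjoin_subalg[OF consts_subalg])
 have sA2: "subalg A2" unfolding A2_def by (rule adjoin_subalg[OF sA1])
 have cR: "cfuns \<subseteq> R" using Rsub by (auto simp: cfuns_def subalg_def)
 have A1R: "A1 \<subseteq> R" unfolding A1_def by (rule adjoin_subset[OF consts_subalg Rsub cR f'R])
 have A2R: "A2 \<subseteq> R" unfolding A2_def by (rule adjoin_subset[OF sA1 Rsub A1R g'R])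
 show ?thesis
 proof (cases "\<exists>P. polyin cfuns P \<and> poly P f' = 0 \<and> P \<noteq> 0")
  case True
  then obtain P where P: "polyin cfuns P" "poly P f' = 0" "P \<noteq> 0" by blast
  let ?p = "Ev q0 P"
  have p0: "?p \<noteq> 0" using polyin_zero_iff[of P q0] P by (auto simp: polyin_def)
  have "\<forall>\<^sub>F p in generic C. poly ?p (f p) = 0"
   using \<Omega>gen
  proof eventually_elim
   case (elim p)
   have "poly P f' p = 0" using P(2) by simp
   thus ?case using consts_poly[OF P(1), of f' p q0] elim by (simp add: f'_def \<rho>id)
  qed
  thus ?thesis using p0 by (intro exI[of _ "[:?p:]"]) simp
 next
  case f_trans: False
  show ?thesis
  proof (cases "\<exists>P. polyin A1 P \<and> poly P g' = 0 \<and> P \<noteq> 0")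
   case True
   then obtain P where P: "polyin A1 P" "poly P g' = 0" "P \<noteq> 0" by blast
   have "\<forall>i. \<exists>B. polyin cfuns B \<and> coeff P i = poly B f'"
   proof
    fix i
    have "coeff P i \<in> A1" using P(1) unfolding polyin_def by (rule spec)
    thus "\<exists>B. polyin cfuns B \<and> coeff P i = poly B f'" unfolding A1_def adjoin_def mem_Collect_eq by (elim exE conjE) (intro exI conjI)
   qed
   then obtain B where B: "\<And>i. polyin cfuns (B i)" "\<And>i. coeff P i = poly (B i) f'" by metis
   define b where "b i = Ev q0 (B i)" for i
   have b: "coeff P i x = poly (b i) (f' x)" for i x
    unfolding B(2) b_def by (rule consts_poly[OF B(1)])
   define PP where "PP = (\<Sum>i\<le>degree P. monom (b i) i)"
   have cPP: "coeff PP i = (if i \<le> degree P then b i else 0)" for i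
    by (simp add: PP_def coeff_sum coeff_monom)
   have "b (degree P) \<noteq> 0"
   proof
    assume "b (degree P) = 0"
    hence "coeff P (degree P) = 0" using b by (auto simp: fun_eq_iff)
    thus False using P(3) by simp
   qed
   hence PP0: "PP \<noteq> 0" using cPP[of "degree P"] by auto
   have "degree PP = degree P"
   proof (rule antisym)
    show "degree PP \<le> degree P" by (rule degree_le) (simp add: cPP)
    show "degree P \<le> degree PP" using cPP[of "degree P"] \<open>b (degree P) \<noteq> 0\<close> by (intro le_degree) simp
   qed
   hence "\<forall>\<^sub>F p in generic C. (\<Sum>i\<le>degree PP. poly (coeff PP i) (f p) * g p ^ i) = 0"
    using \<Omega>gen
   proof (elim eventually_mono)
    fix p assume dg: "degree PP = degree P"
     and e: "p \<in> \<Omega> \<and> f p = F1 (crd p) / G1 (crd p) \<and> g p = F2 (crd p) / G2 (crd p)"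
    have "0 = poly P g' p" using P(2) by simp
    also have "\<dots> = (\<Sum>i\<le>degree P. coeff P i p * g' p ^ i)"
     by (simp add: poly_altdef sum_fun_apply power_fun_apply)
    also have "\<dots> = (\<Sum>i\<le>degree PP. poly (coeff PP i) (f p) * g p ^ i)"
     unfolding dg by (rule sum.cong) (use e in \<open>simp_all add: b cPP f'_def g'_def \<rho>id\<close>)
    finally show "(\<Sum>i\<le>degree PP. poly (coeff PP i) (f p) * g p ^ i) = 0" by simp
   qed
   thus ?thesis using PP0 by blast
  next
   case g_trans: False
   \<comment> \<open>The affine coordinates \<open>x_i / x_i0\<close>. They generate the algebra to
     which derivations are extended; setting them to zero beyond \<open>n\<close> matches the
     coordinates of points of \<open>C\<close>.\<close>
   define \<xi> where "\<xi> i q = (if i \<le> n then crd (\<rho> q) i / crd (\<rho> q) i0 else 0)" for i q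
   define hs where "hs = map \<xi> [0..<Suc n]"
   define B where "B = foldl adjoin A2 hs"
   have \<xi>R: "\<xi> i \<in> R" for i
   proof (cases "i \<le> n")
    case True
    have "(\<lambda>q. crd (\<rho> q) i / crd (\<rho> q) i0) \<in> R"
     by (rule RI[OF hp_var hp_var]) (simp add: \<Omega>_def)
    thus ?thesis using True by (simp add: \<xi>_def[abs_def])
   next
    case False
    hence "\<xi> i = 0" by (auto simp: \<xi>_def fun_eq_iff)
    thus ?thesis using subalg_0[OF Rsub] by simp
   qed
   have BR: "B \<subseteq> R" unfolding B_def
    by (rule foldl_adjoin_subset[OF sA2 Rsub A2R]) (use \<xi>R in \<open>auto simp: hs_def\<close>)
   have sB: "subalg B" and A2B: "A2 \<subseteq> B" using foldl_adjoin_subalg[OF sA2, of hs] by (auto simp: B_def)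
   have \<xi>B: "\<xi> i \<in> B" for i
   proof (cases "i \<le> n")
    case True
    thus ?thesis unfolding B_def using True
     by (intro foldl_adjoin_gen[OF sA2]) (simp only: hs_def set_map set_upt, intro imageI, simp)
   next
    case False
    hence "\<xi> i = 0" by (auto simp: \<xi>_def fun_eq_iff)
    thus ?thesis using subalg_0[OF sB] by simp
   qed
   have f'A: "f' \<in> A1" "f' \<in> A2" "g' \<in> A2"
    using adjoin_gen[OF consts_subalg, of f'] adjoin_gen[OF sA1, of g'] adjoin_superset[OF sA1, of g']
    by (auto simp: A1_def A2_def)
   obtain s where s: "s \<in> B" "s \<noteq> 0" "\<forall>q. s q \<noteq> 0 --> (\<forall>D. pder q A2 D -->
    (\<exists>D'. pder q B D' \<and> (\<forall>u\<in>A2. D' u = D u)))"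
    using derivation_extends_chain[OF sA2, of hs] Rdom BR unfolding B_def by blast
   obtain q where q: "s q \<noteq> 0" using s(2) by (auto simp: fun_eq_iff)
   \<comment> \<open>Both adjunctions are transcendental, so the values on \<open>f'\<close> and
     \<open>g'\<close> can be prescribed freely; the remaining extension to the affine coordinates
     is possible where \<open>s\<close> is non-zero.\<close>
   have exD: "\<exists>D. pder q B D \<and> D f' = a \<and> D g' = b" for a b
   proof -
    have "pder q cfuns (\<lambda>_. 0)" by (simp add: pder_def)
    then obtain D1 where D1: "pder q A1 D1" "D1 f' = a"
     using derivation_extends_transcendental[OF consts_subalg, of f' q "\<lambda>_. 0" a] f_trans unfolding A1_def by blast
    obtain D2 where D2: "pder q A2 D2" "D2 g' = b" "\<forall>u\<in>A1. D2 u = D1 u"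
     using derivation_extends_transcendental[OF sA1 _ D1(1), of g' b] g_trans unfolding A2_def by blast
    obtain D3 where "pder q B D3" "\<forall>u\<in>A2. D3 u = D2 u" using s(3) q D2(1) by blast
    thus ?thesis using D1 D2 f'A by (intro exI[of _ D3]) auto
   qed
   define x0 where "x0 = \<rho> q"
   define v where "v = crd x0"
   define c where "c = 1 / v i0"
   have x0: "x0 \<in> C" "x0 \<in> \<Omega>" using \<rho> by (auto simp: x0_def)
   have vi0: "v i0 \<noteq> 0" and c0: "c \<noteq> 0" using x0(2) by (auto simp: \<Omega>_def v_def c_def)
   have vz: "v i = 0" if "i \<notin> {..n}" for i using Csub x0(1) that by (auto simp: v_def proj_space_def)
   have i0n: "i0 \<le> n" using vz[of i0] vi0 by (cases "i0 \<le> n") auto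
   have \<xi>rep: "(\<lambda>i. \<xi> i x) = (\<lambda>i. (1 / crd (\<rho> x) i0) * crd (\<rho> x) i)" for x
   proof
    fix i show "\<xi> i x = (1 / crd (\<rho> x) i0) * crd (\<rho> x) i"
     using Csub \<rho>(2)[of x] by (auto simp: \<xi>_def proj_space_def)
   qed
   have \<xi>q: "(\<lambda>i. \<xi> i q) = (\<lambda>i. c * v i)" unfolding \<xi>rep by (simp add: c_def v_def x0_def)
   have \<xi>i0: "\<xi> i0 = (\<lambda>_. 1)"
    using i0n \<rho>(1) by (auto simp: \<xi>_def fun_eq_iff \<Omega>_def)
   \<comment> \<open>On forms in the affine coordinates a derivation is the directional derivative
     along the vector of its values on the \<open>\<xi> i\<close>, which turns derivations into
     tangent vectors.\<close>
   have Dform: "(\<lambda>x. K (\<lambda>i. \<xi> i x)) \<in> B \<and>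
     (DERIV (\<lambda>t. K (\<lambda>i. \<xi> i q + t * D (\<xi> i))) 0 :> D (\<lambda>x. K (\<lambda>i. \<xi> i x)))"
    if K: "hp d K" and D: "pder q B D" for d K D
    using K
   proof (induction rule: hp.induct)
    case (zero d)
    thus ?case using D subalg_const[OF sB] by (simp add: pder_def)
   next
    case (const c)
    thus ?case using D subalg_const[OF sB] by (simp add: pder_def)
   next
    case (var i)
    thus ?case using \<xi>B[of i] by (auto intro!: derivative_eq_intros)
   next
    case (add d f g)
    have "(\<lambda>x. f (\<lambda>i. \<xi> i x) + g (\<lambda>i. \<xi> i x)) = (\<lambda>x. f (\<lambda>i. \<xi> i x)) + (\<lambda>x. g (\<lambda>i. \<xi> i x))" by (auto simp: fun_eq_iff)
    thus ?case using add.IH subalg_add[OF sB] D DERIV_add[OF conjunct2[OF add.IH(1)] conjunct2[OF add.IH(2)]]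
     by (simp add: pder_def)
   next
    case (mult d f e g)
    have "(\<lambda>x. f (\<lambda>i. \<xi> i x) * g (\<lambda>i. \<xi> i x)) = (\<lambda>x. f (\<lambda>i. \<xi> i x)) * (\<lambda>x. g (\<lambda>i. \<xi> i x))" by (auto simp: fun_eq_iff)
    thus ?case using mult.IH subalg_mult[OF sB] D DERIV_mult[OF conjunct2[OF mult.IH(1)] conjunct2[OF mult.IH(2)]]
     by (simp add: pder_def mult.commute)
   qed
   define r where "r = n - 1"
   obtain fk e hh eh where fk: "\<forall>k<r. hp (e k) (fk k)" "hp eh hh" "hh (crd x0) \<noteq> 0"
    "\<forall>q\<in>proj_space n. hh (crd q) \<noteq> 0 --> (q \<in> C \<longleftrightarrow> (\<forall>k<r. fk k (crd q) = 0))"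
    "\<forall>c. (\<forall>i\<le>n. (\<Sum>k<r. c k * pd (fk k) i (crd x0)) = 0) --> (\<forall>k<r. c k = 0)"
    using smooth_atE[OF sm[OF x0(1)]] unfolding r_def .
   have fkv: "fk k v = 0" if "k < r" for k using fk(3,4) x0(1) Csub that by (auto simp: v_def)
   define A where "A k i = pd (fk k) i v" for k i
   have kerD: "(\<Sum>i\<le>n. A k i * D (\<xi> i)) = 0" if k: "k < r" and D: "pder q B D" for k D
   proof -
    have hk: "hp (e k) (fk k)" using fk(1) k by blast
    let ?\<eta> = "\<lambda>i. D (\<xi> i)"
    have \<eta>0: "?\<eta> i = 0" if "i \<notin> {..n}" for i
    proof -
     have "\<xi> i = (\<lambda>_. 0)" using that by (auto simp: \<xi>_def)
     thus ?thesis using D by (simp add: pder_def)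
    qed
    \<comment> \<open>The equation \<open>fk k\<close> is known to vanish on \<open>C\<close> only
      where \<open>hh\<close> does not. The product vanishes on all of \<open>C\<close>, so a
      derivation can be applied to it.\<close>
    have z: "(\<lambda>x. hh (\<lambda>i. \<xi> i x) * fk k (\<lambda>i. \<xi> i x)) = (\<lambda>_. 0)"
    proof
     fix x
     have "\<rho> x \<in> C" "\<rho> x \<in> proj_space n" using \<rho> Csub by auto
     hence "hh (crd (\<rho> x)) * fk k (crd (\<rho> x)) = 0" using fk(4) k by auto
     thus "hh (\<lambda>i. \<xi> i x) * fk k (\<lambda>i. \<xi> i x) = 0"
      unfolding \<xi>rep hp_scale[OF fk(2)] hp_scale[OF hk] by auto
    qed
    have "DERIV (\<lambda>t. hh (\<lambda>i. \<xi> i q + t * ?\<eta> i) * fk k (\<lambda>i. \<xi> i q + t * ?\<eta> i)) 0 :> 0"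
     using conjunct2[OF Dform[OF hp.mult[OF fk(2) hk] D]] D unfolding z by (simp add: pder_def)
    moreover have dh: "((\<lambda>t. hh (\<lambda>i. \<xi> i q + t * ?\<eta> i)) has_field_derivative (\<Sum>i\<in>{..n}. pd hh i (\<lambda>i. \<xi> i q) * ?\<eta> i)) (at 0)"
     by (rule hp_directional[OF _ \<eta>0 fk(2)]) auto
    moreover have df: "((\<lambda>t. fk k (\<lambda>i. \<xi> i q + t * ?\<eta> i)) has_field_derivative (\<Sum>i\<in>{..n}. pd (fk k) i (\<lambda>i. \<xi> i q) * ?\<eta> i)) (at 0)"
     by (rule hp_directional[OF _ \<eta>0 hk]) auto
    ultimately have "0 = (\<Sum>i\<in>{..n}. pd hh i (\<lambda>i. \<xi> i q) * ?\<eta> i) * fk k (\<lambda>i. \<xi> i q) + (\<Sum>i\<in>{..n}. pd (fk k) i (\<lambda>i. \<xi> i q) * ?\<eta> i) * hh (\<lambda>i. \<xi> i q)"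
     using DERIV_unique DERIV_mult[OF dh df] by fastforce
    moreover have "fk k (\<lambda>i. \<xi> i q) = 0" unfolding \<xi>q hp_scale[OF hk] using fkv[OF k] by simp
    moreover have "hh (\<lambda>i. \<xi> i q) \<noteq> 0" unfolding \<xi>q hp_scale[OF fk(2)] using fk(3) c0 by (simp add: v_def)
    ultimately have S0: "(\<Sum>i\<le>n. pd (fk k) i (\<lambda>i. \<xi> i q) * ?\<eta> i) = 0" by simp
    have "c ^ e k * (\<Sum>i\<le>n. A k i * ?\<eta> i) = c * (\<Sum>i\<le>n. pd (fk k) i (\<lambda>i. \<xi> i q) * ?\<eta> i)"
     unfolding sum_distrib_left
    proof (rule sum.cong[OF refl])
     fix i
     have "c * pd (fk k) i (\<lambda>j. c * v j) = c ^ e k * pd (fk k) i v" by (rule pd_scale[OF hk c0])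
     thus "c ^ e k * (A k i * ?\<eta> i) = c * (pd (fk k) i (\<lambda>i. \<xi> i q) * ?\<eta> i)"
      unfolding \<xi>q A_def by (simp only: mult.assoc[symmetric])
    qed
    thus ?thesis using S0 c0 by simp
   qed
   have kerv: "(\<Sum>i\<le>n. A k i * v i) = 0" if "k < r" for k
    unfolding A_def using euler_zero[OF fk(1)[rule_format, OF that] fkv[OF that] finite_atMost vz] by simp
   obtain D1 where D1: "pder q B D1" "D1 f' = 1" "D1 g' = 0" using exD by blast
   obtain D2 where D2: "pder q B D2" "D2 f' = 0" "D2 g' = 1" using exD by blast
   obtain ev where ev: "\<forall>j\<in>{..<r}. \<forall>k\<in>{..<r}. (\<Sum>i\<in>{..n}. A j i * ev k i) = (if j = k then 1 else 0)"
    using dual_vectors[of "{..<r}" "{..n}" A] fk(5) unfolding A_def v_def atMost_iff lessThan_iff Ball_def by blast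
   \<comment> \<open>There are \<open>n + 1\<close> coordinates and \<open>n + 2\<close> vectors:
     the \<open>r = n - 1\<close> dual vectors, the directions of \<open>D1\<close> and
     \<open>D2\<close>, and the radial vector \<open>v\<close>. Hence a non-trivial linear relation
     exists.\<close>
   define M where "M i k = (if k < r then ev k i else if k = r then D1 (\<xi> i) else if k = Suc r then D2 (\<xi> i) else v i)" for i k
   have "card {..n} < card {..<Suc (Suc (Suc r))}" using n by (simp add: r_def)
   then obtain z where z: "\<exists>k\<in>{..<Suc (Suc (Suc r))}. z k \<noteq> 0" "\<forall>i\<in>{..n}. (\<Sum>k\<in>{..<Suc (Suc (Suc r))}. M i k * z k) = 0"
    using homogeneous_system_nontrivial[of "{..n}" "{..<Suc (Suc (Suc r))}" M] by auto
   define a b l where "a = z r" and "b = z (Suc r)" and "l = z (Suc (Suc r))"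
   have eq: "(\<Sum>k<r. ev k i * z k) + D1 (\<xi> i) * a + D2 (\<xi> i) * b + v i * l = 0" if "i \<le> n" for i
   proof -
    have "(\<Sum>k<r. M i k * z k) = (\<Sum>k<r. ev k i * z k)" by (rule sum.cong) (auto simp: M_def)
    thus ?thesis using z(2)[rule_format, of i] that by (simp add: M_def a_def b_def l_def)
   qed
   have zj: "z j = 0" if j: "j < r" for j
   proof -
    have "0 = (\<Sum>i\<le>n. A j i * ((\<Sum>k<r. ev k i * z k) + D1 (\<xi> i) * a + D2 (\<xi> i) * b + v i * l))"
     by (simp add: eq)
    also have "\<dots> = (\<Sum>i\<le>n. \<Sum>k<r. z k * (A j i * ev k i)) + a * (\<Sum>i\<le>n. A j i * D1 (\<xi> i)) + b * (\<Sum>i\<le>n. A j i * D2 (\<xi> i)) + l * (\<Sum>i\<le>n. A j i * v i)"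
     by (simp add: sum_distrib_left sum.distrib[symmetric] algebra_simps)
    also have "\<dots> = (\<Sum>k<r. z k * (\<Sum>i\<le>n. A j i * ev k i))"
     unfolding kerD[OF j D1(1)] kerD[OF j D2(1)] kerv[OF j] by (subst sum.swap) (simp add: sum_distrib_left)
    also have "\<dots> = (\<Sum>k<r. if k = j then z j else 0)"
     by (rule sum.cong) (use ev j in auto)
    finally show ?thesis using j by (simp add: sum.delta)
   qed
   \<comment> \<open>Derivations kill the constant \<open>\<xi> i0\<close>, whereas
     \<open>v i0\<close> is non-zero; coordinate \<open>i0\<close> therefore removes the radial
     vector from the relation.\<close>
   have D10: "D1 (\<xi> i0) = 0" "D2 (\<xi> i0) = 0" unfolding \<xi>i0 using D1(1) D2(1) by (auto simp: pder_def)
   have l0: "l = 0" using eq[OF i0n] zj D10 vi0 by simp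
   have ab: "D1 (\<xi> i) * a + D2 (\<xi> i) * b = 0" for i
   proof (cases "i \<le> n")
    case True
    thus ?thesis using eq[OF True] zj l0 by simp
   next
    case False
    hence "\<xi> i = (\<lambda>_. 0)" by (auto simp: \<xi>_def)
    thus ?thesis using D1(1) D2(1) by (simp add: pder_def)
   qed
   \<comment> \<open>The combination of \<open>D1\<close> and \<open>D2\<close> given by the
     relation kills all affine coordinates, hence \<open>f'\<close> and \<open>g'\<close>, whose
     values then show \<open>a = b = 0\<close>.\<close>
   define D where "D u = a * D1 u + b * D2 u" for u
   have D: "pder q B D" using D1(1) D2(1) unfolding pder_def D_def by (auto simp: algebra_simps)
   have D\<xi>: "D (\<xi> i) = 0" for i using ab[of i] by (simp add: D_def mult.commute)
   have DK: "D (\<lambda>x. K (\<lambda>i. \<xi> i x)) = 0" "(\<lambda>x. K (\<lambda>i. \<xi> i x)) \<in> B" if "hp d K" for d K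
   proof -
    have "DERIV (\<lambda>t. K (\<lambda>i. \<xi> i q)) 0 :> D (\<lambda>x. K (\<lambda>i. \<xi> i x))"
     using Dform[OF that D] by (simp add: D\<xi>)
    thus "D (\<lambda>x. K (\<lambda>i. \<xi> i x)) = 0" using DERIV_unique DERIV_const by blast
    show "(\<lambda>x. K (\<lambda>i. \<xi> i x)) \<in> B" using Dform[OF that D] by blast
   qed
   have quot: "D u = 0" if u: "u \<in> B" "u = (\<lambda>x. F (crd (\<rho> x)) / G (crd (\<rho> x)))" and h: "hp d F" "hp d G"
    and G: "\<And>x. G (crd (\<rho> x)) \<noteq> 0" for u F G d
   proof -
    let ?F = "\<lambda>x. F (\<lambda>i. \<xi> i x)" and ?G = "\<lambda>x. G (\<lambda>i. \<xi> i x)"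
    have "?G * u = ?F"
     unfolding u(2) \<xi>rep hp_scale[OF h(1)] hp_scale[OF h(2)] using G by (auto simp: fun_eq_iff)
    moreover have "D (?G * u) = D ?G * u q + ?G q * D u" using D DK(2)[OF h(2)] u(1) by (simp add: pder_def)
    ultimately have "?G q * D u = 0" using DK(1)[OF h(1)] DK(1)[OF h(2)] by simp
    moreover have "?G q \<noteq> 0" unfolding \<xi>q hp_scale[OF h(2)] using c0 G[of q] by (simp add: v_def x0_def)
    ultimately show ?thesis by simp
   qed
   have "D f' = 0" by (rule quot[OF _ f'_def F1(1,2)]) (use f'A A2B \<rho>(1) in \<open>auto simp: \<Omega>_def\<close>)
   moreover have "D g' = 0" by (rule quot[OF _ g'_def F2(1,2)]) (use f'A A2B \<rho>(1) in \<open>auto simp: \<Omega>_def\<close>)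
   ultimately have "a = 0" "b = 0" using D1 D2 by (simp_all add: D_def)
   hence "z k = 0" if "k < Suc (Suc (Suc r))" for k
    using that zj l0 unfolding a_def b_def l_def by (metis less_SucE)
   thus ?thesis using z(1) by blast
  qed
 qed
qed

section \<open>Generic subsets of a curve are cofinite\<close>

context irreducible
begin

lemma regular_at_poly:
 assumes "regular_at S f p z" shows "regular_at S (\<lambda>q. poly P (f q)) p (poly P z)"
proof (induction P)
 case 0
 thus ?case using regular_at_const[of p 0] assms by (simp add: regular_at_def)
next
 case (pCons a P)
 have "p \<in> S" using assms by (simp add: regular_at_def)
 from regular_at_add[OF regular_at_const[OF this, of a] regular_at_mult[OF assms pCons(2)]]
 show ?case by simp
qed

lemma regular_at_power:
 assumes "regular_at S f p z" shows "regular_at S (\<lambda>q. f q ^ k) p (z ^ k)"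
 using regular_at_poly[OF assms, of "monom 1 k"] by (simp add: poly_monom)

lemma regular_at_sum:
 assumes "p \<in> S" "\<And>i. i \<in> I ==> regular_at S (f i) p (z i)"
 shows "regular_at S (\<lambda>q. \<Sum>i\<in>I. f i q) p (\<Sum>i\<in>I. z i)"
 using assms(2)
proof (induction I rule: infinite_finite_induct)
 case (insert x F)
 thus ?case using regular_at_add[of "f x" p "z x" "\<lambda>q. \<Sum>i\<in>F. f i q" "\<Sum>i\<in>F. z i"] by simp
qed (simp_all add: regular_at_const[OF assms(1)])

text \<open>A relation all of whose coefficients vanish at \<open>f = 0\<close> can be divided by
  \<open>f\<close>, which lowers their degrees. In the end, setting \<open>f = 0\<close> leaves a
  non-trivial relation for \<open>g\<close>.\<close>

lemma relation_lowest_coefficient: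
 fixes f g :: "point => complex"
 assumes nz: "\<forall>\<^sub>G p. f p \<noteq> 0"
 shows "k \<le> N ==> q k \<noteq> 0 ==> \<forall>\<^sub>G p. (\<Sum>i\<le>N. poly (q i) (f p) * g p ^ i) = 0 ==>
  \<exists>q'. (\<exists>i\<le>N. poly (q' i) 0 \<noteq> 0) \<and> (\<forall>\<^sub>G p. (\<Sum>i\<le>N. poly (q' i) (f p) * g p ^ i) = 0)"
proof (induction "degree (q k)" arbitrary: q rule: less_induct)
 case less
 show ?case
 proof (cases "\<exists>i\<le>N. poly (q i) 0 \<noteq> 0")
  case True
  thus ?thesis using less.prems(3) by blast
 next
  case False
  hence "\<forall>i\<le>N. \<exists>r. q i = [:0, 1:] * r"
   using poly_eq_0_iff_dvd[of _ "0 :: complex"] by (auto simp: dvd_def)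
  then obtain r where r: "\<And>i. i \<le> N ==> q i = [:0, 1:] * r i" by metis
  have rk: "r k \<noteq> 0" using r[OF less.prems(1)] less.prems(2) by auto
  have "degree (q k) = Suc (degree (r k))"
   unfolding r[OF less.prems(1)] using rk by (subst degree_mult_eq) auto
  hence lt: "degree (r k) < degree (q k)" by simp
  have "\<forall>\<^sub>G p. (\<Sum>i\<le>N. poly (r i) (f p) * g p ^ i) = 0"
   using less.prems(3) nz
  proof eventually_elim
   case (elim p)
   have "(\<Sum>i\<le>N. poly (q i) (f p) * g p ^ i) = f p * (\<Sum>i\<le>N. poly (r i) (f p) * g p ^ i)"
    unfolding sum_distrib_left by (rule sum.cong[OF refl]) (simp add: r mult.assoc)
   thus ?case using elim by simp
  qed
  from less.hyps[OF lt less.prems(1) rk this] show ?thesis .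
 qed
qed

end

text \<open>In the chart \<open>crd p i0 \<noteq> 0\<close> the exceptional points are among the
  zeros of the function \<open>f = F / x_i0^d\<close>. Each affine coordinate is algebraically
  dependent on \<open>f\<close>, and a relation that survives at \<open>f = 0\<close> leaves only
  finitely many values for it. So finitely many points remain in each of the \<open>n + 1\<close>
  charts.\<close>

lemma curve_generic_cofinite:
 assumes C: "smooth_projective_curve n C" and P: "eventually P (generic C)"
 shows "finite {p\<in>C. \<not> P p}"
proof -
 interpret irreducible C by (rule projective_variety_irreducible) (use C in \<open>auto simp: smooth_projective_def\<close>)
 have Csub: "C \<subseteq> proj_space n" using C by (auto simp: smooth_projective_def projective_variety_def)
 obtain d F p1 where F: "hp d F" "p1 \<in> C" "F (crd p1) \<noteq> 0" "\<forall>p\<in>C. F (crd p) \<noteq> 0 --> P p"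
  using P unfolding eventually_generic by blast
 have zn: "crd p i = 0" if "p \<in> C" "i > n" for p i using that Csub by (auto simp: proj_space_def)
 define Z where "Z i0 = {p\<in>C. F (crd p) = 0 \<and> crd p i0 \<noteq> 0}" for i0
 have fin: "finite (Z i0)" for i0
 proof (cases "Z i0 = {}")
  case False
  then obtain p0 where p0: "p0 \<in> C" "crd p0 i0 \<noteq> 0" by (auto simp: Z_def)
  define f where "f p = F (crd p) / crd p i0 ^ d" for p
  define g where "g j p = crd p j / crd p i0" for j p
  have hx: "hp d (\<lambda>v. v i0 ^ d)" using hp_power[OF hp_var[of i0], of d] by simp
  have rf: "regular_at C f p (f p)" if "p \<in> C" "crd p i0 \<noteq> 0" for p
   by (rule regular_atI[OF that(1) F(1) hx]) (use that in \<open>auto simp: f_def\<close>)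
  have rg: "regular_at C (g j) p (g j p)" if "p \<in> C" "crd p i0 \<noteq> 0" for j p
   by (rule regular_atI[OF that(1) hp_var[of j] hp_var[of i0]]) (use that in \<open>auto simp: g_def\<close>)
  have f0: "\<forall>\<^sub>F p in generic C. f p \<noteq> 0"
   using generic_nonzero[OF F(1-3)] generic_nonzero[OF hp_var[of i0] p0] by eventually_elim (simp add: f_def)
  have "\<exists>R::complex poly. R \<noteq> 0 \<and> (\<forall>p\<in>Z i0. poly R (g j p) = 0)" for j
  proof -
   obtain PP :: "complex poly poly" where PP: "PP \<noteq> 0" "\<forall>\<^sub>F p in generic C. (\<Sum>i\<le>degree PP. poly (coeff PP i) (f p) * g j p ^ i) = 0"
    using curve_algebraic_dependence[OF C regular_at_germ[OF rf[OF p0]] regular_at_germ[OF rg[OF p0, of j]]] by blast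
   define N where "N = degree PP"
   obtain q where q: "\<exists>i\<le>N. poly (q i) 0 \<noteq> 0" "\<forall>\<^sub>F p in generic C. (\<Sum>i\<le>N. poly (q i) (f p) * g j p ^ i) = 0"
    using relation_lowest_coefficient[OF f0, of N N "coeff PP" "g j"] PP by (auto simp: N_def)
   define R where "R = (\<Sum>i\<le>N. monom (poly (q i) 0) i)"
   have pR: "poly R x = (\<Sum>i\<le>N. poly (q i) 0 * x ^ i)" for x by (simp add: R_def poly_sum poly_monom)
   have "R \<noteq> 0"
   proof
    assume "R = 0"
    obtain i where i: "i \<le> N" "poly (q i) 0 \<noteq> 0" using q(1) by blast
    have "coeff R i = (\<Sum>k\<le>N. if k = i then poly (q i) 0 else 0)"
     unfolding R_def coeff_sum by (rule sum.cong) auto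
    thus False using i \<open>R = 0\<close> by simp
   qed
   moreover have "poly R (g j p) = 0" if "p \<in> Z i0" for p
   proof -
    have p: "p \<in> C" "crd p i0 \<noteq> 0" "f p = 0" using that by (auto simp: Z_def f_def)
    \<comment> \<open>The relation holds generically only; regularity of all its terms carries it
      over to the point \<open>p\<close>, where \<open>f\<close> vanishes.\<close>
    have "regular_at C (\<lambda>p. \<Sum>i\<le>N. poly (q i) (f p) * g j p ^ i) p (\<Sum>i\<le>N. poly (q i) (f p) * g j p ^ i)"
     by (intro regular_at_sum regular_at_mult regular_at_poly regular_at_power rf rg p)
    hence "regular_at C (\<lambda>p. 0) p (\<Sum>i\<le>N. poly (q i) (f p) * g j p ^ i)"
     by (rule regular_at_cong[OF q(2)])
    from regular_at_unique[OF this regular_at_const[OF p(1)]] show ?thesis by (simp add: pR p(3))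
   qed
   ultimately show ?thesis by blast
  qed
  then obtain R :: "nat => complex poly" where R: "\<And>j. R j \<noteq> 0" "\<And>j p. p \<in> Z i0 ==> poly (R j) (g j p) = 0" by metis
  show ?thesis
  proof (rule inj_on_finite)
   show "finite (Pi\<^sub>E {..n} (\<lambda>j. {x. poly (R j) x = 0}))"
    by (intro finite_PiE ballI) (simp_all add: poly_roots_finite R)
   show "(\<lambda>p. \<lambda>j\<in>{..n}. g j p) ` Z i0 \<subseteq> Pi\<^sub>E {..n} (\<lambda>j. {x. poly (R j) x = 0})" 
    by (rule image_subsetI, rule PiE_I) (simp_all add: R)
   show "inj_on (\<lambda>p. \<lambda>j\<in>{..n}. g j p) (Z i0)"
   proof (rule inj_onI)
    fix p q assume p: "p \<in> Z i0" and q: "q \<in> Z i0" and e: "(\<lambda>j\<in>{..n}. g j p) = (\<lambda>j\<in>{..n}. g j q)"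
    have g: "g j p = g j q" for j
    proof (cases "j \<le> n")
     case True
     thus ?thesis using fun_cong[OF e, of j] by simp
    next
     case False
     thus ?thesis using zn[of p j] zn[of q j] p q by (simp add: g_def Z_def)
    qed
    have x: "crd p j = g j p * crd p i0" "crd q j = g j p * crd q i0" for j
    proof -
     show "crd p j = g j p * crd p i0" using p by (simp add: g_def Z_def)
     show "crd q j = g j p * crd q i0" unfolding g[of j] using q by (simp add: g_def Z_def)
    qed
    show "p = q"
    proof (rule point_eqI)
     fix i j
     show "crd p i * crd q j = crd p j * crd q i"
      unfolding x[of i] x[of j] by simp
    qed
   qed
  qed
 qed simp
 have "{p\<in>C. \<not> P p} \<subseteq> (\<Union>i\<le>n. Z i)"
 proof
  fix p assume p: "p \<in> {p\<in>C. \<not> P p}"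
  obtain i where i: "crd p i \<noteq> 0" by (rule rep_point_coord)
  have "i \<le> n"
  proof (rule ccontr)
   assume "\<not> i \<le> n"
   thus False using zn[of p i] p i by simp
  qed
  thus "p \<in> (\<Union>i\<le>n. Z i)" using p i F(4) by (auto simp: Z_def)
 qed
 thus ?thesis by (rule finite_subset) (intro finite_UN_I finite_atMost fin)
qed

section \<open>The filter of cocountable sets\<close>

text \<open>In contrast to cofinite sets, cocountable sets are stable under countable intersections
  (\<open>eventually_coc_all\<close>), as needed for conditions indexed by all times
  \<open>e / 2 ^ k\<close>.\<close>

definition coc :: "'a set => 'a filter" where
 "coc A = Abs_filter (\<lambda>P. countable {x\<in>A. \<not> P x})"

lemma eventually_coc: "eventually P (coc A) \<longleftrightarrow> countable {x\<in>A. \<not> P x}"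
 unfolding coc_def
proof (rule eventually_Abs_filter, rule is_filter.intro)
 fix P Q :: "'a => bool" assume "countable {x\<in>A. \<not> P x}" "countable {x\<in>A. \<not> Q x}"
 hence "countable ({x\<in>A. \<not> P x} \<union> {x\<in>A. \<not> Q x})" by simp
 thus "countable {x\<in>A. \<not> (P x \<and> Q x)}" by (rule countable_subset[rotated]) auto
next
 fix P Q :: "'a => bool" assume PQ: "\<forall>x. P x --> Q x" and "countable {x\<in>A. \<not> P x}"
 thus "countable {x\<in>A. \<not> Q x}" using countable_subset[of "{x\<in>A. \<not> Q x}" "{x\<in>A. \<not> P x}"] by auto
qed simp

lemma eventually_coc_all: "(\<And>k :: nat. eventually (P k) (coc A)) ==> eventually (\<lambda>x. \<forall>k. P k x) (coc A)"
proof -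
 assume a: "\<And>k :: nat. eventually (P k) (coc A)"
 have "countable (\<Union>k. {x\<in>A. \<not> P k x})" using a by (simp add: eventually_coc)
 thus ?thesis unfolding eventually_coc by (rule countable_subset[rotated]) auto
qed

lemma coc_ex: assumes "eventually P (coc A)" "uncountable A" shows "\<exists>x\<in>A. P x"
proof (rule ccontr)
 assume "\<not> ?thesis"
 hence "{x\<in>A. \<not> P x} = A" by auto
 thus False using assms by (simp add: eventually_coc)
qed

lemma coc_infinite:
 assumes "eventually P (coc A)" "uncountable A" shows "uncountable {x\<in>A. P x}"
proof
 assume "countable {x\<in>A. P x}"
 hence "countable ({x\<in>A. P x} \<union> {x\<in>A. \<not> P x})" using assms(1) by (simp add: eventually_coc)
 moreover have "{x\<in>A. P x} \<union> {x\<in>A. \<not> P x} = A" by auto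
 ultimately show False using assms(2) by simp
qed

lemma coc_UNIV_infinite:
 fixes P :: "complex => bool"
 assumes "eventually P (coc UNIV)" shows "infinite {u. P u}"
 using coc_infinite[OF assms uncountable_UNIV_complex] uncountable_infinite by auto

lemma finite_coc: "finite {x\<in>A. \<not> P x} ==> eventually P (coc A)"
 by (simp add: eventually_coc countable_finite)

lemma coc_in: "\<forall>\<^sub>F x in coc A. x \<in> A"
 by (simp add: eventually_coc)

lemma coc_distinct3:
 fixes P :: "complex => bool"
 assumes "eventually P (coc UNIV)"
 obtains u1 u2 u3 where "P u1" "P u2" "P u3" "u1 \<noteq> u2" "u1 \<noteq> u3" "u2 \<noteq> u3"
proof -
 obtain T where "T \<subseteq> {u. P u}" "finite T" "card T = 3"
  using infinite_arbitrarily_large[OF coc_UNIV_infinite[OF assms], of 3] by blast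
 then obtain x y z where "T = {x, y, z}" "x \<noteq> y" "x \<noteq> z" "y \<noteq> z" by (auto simp: card_3_iff)
 thus thesis using \<open>T \<subseteq> {u. P u}\<close> by (intro that[of x y z]) auto
qed

section \<open>Injective rational functions\<close>

lemma common_factor:
 fixes P Q :: "complex poly"
 assumes "Q \<noteq> 0"
 shows "\<exists>p q g. P = g * p \<and> Q = g * q \<and> (\<forall>w. \<not> (poly p w = 0 \<and> poly q w = 0))"
 using assms
proof (induction "degree Q" arbitrary: P Q rule: less_induct)
 case less
 show ?case
 proof (cases "\<exists>w. poly P w = 0 \<and> poly Q w = 0")
  case False
  thus ?thesis by (intro exI[of _ P] exI[of _ Q] exI[of _ 1]) auto
 next
  case True
  then obtain w where "[:- w, 1:] dvd P" "[:- w, 1:] dvd Q" unfolding poly_eq_0_iff_dvd by blast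
  then obtain P' Q' where PQ: "P = [:- w, 1:] * P'" "Q = [:- w, 1:] * Q'" by (auto simp: dvd_def)
  have Q': "Q' \<noteq> 0" using less.prems PQ by auto
  have "degree Q = Suc (degree Q')" unfolding PQ(2) using Q' by (subst degree_mult_eq) auto
  then obtain p q g where "P' = g * p" "Q' = g * q" "\<forall>w. \<not> (poly p w = 0 \<and> poly q w = 0)"
   using less.hyps[of Q' P'] Q' by auto
  thus ?thesis unfolding PQ by (intro exI[of _ p] exI[of _ q] exI[of _ "[:- w, 1:] * g"]) (simp only: mult.assoc, simp)
 qed
qed

text \<open>If the degree were at least \<open>2\<close>, then after splitting off one factor the
  quotient would still have a root, again \<open>u\<close>, and \<open>u\<close> would be a multiple
  root.\<close>

lemma single_root_degree:
 fixes H :: "complex poly"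
 assumes "\<And>w. poly H w = 0 ==> w = u" "poly (pderiv H) u \<noteq> 0"
 shows "degree H \<le> 1"
proof (rule ccontr)
 assume d: "\<not> degree H \<le> 1"
 hence "\<not> constant (poly H)" by (simp add: constant_degree)
 then obtain z where "poly H z = 0" using fundamental_theorem_of_algebra by blast
 hence "[:- u, 1:] dvd H" using assms(1) unfolding poly_eq_0_iff_dvd by blast
 then obtain H' where H': "H = [:- u, 1:] * H'" by (auto simp: dvd_def)
 have "H' \<noteq> 0" using d H' by auto
 hence "degree H = Suc (degree H')" unfolding H' by (subst degree_mult_eq) auto
 hence "degree H' \<noteq> 0" using d by simp
 hence "\<not> constant (poly H')" by (simp add: constant_degree)
 then obtain z' where z': "poly H' z' = 0" using fundamental_theorem_of_algebra by blast
 hence "poly H z' = 0" by (simp add: H')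
 hence "poly H' u = 0" using z' assms(1) by blast
 moreover have "poly (pderiv H) u = poly H' u" unfolding H' pderiv_mult by (simp add: pderiv_pCons)
 ultimately show False using assms(2) by simp
qed

definition moebius_on :: "(complex => bool) => (complex => complex) => bool" where
 "moebius_on R h \<longleftrightarrow> (\<exists>A B C D. A * D - B * C \<noteq> 0 \<and>
  (\<forall>u. R u --> C * u + D \<noteq> 0 \<and> h u = (A * u + B) / (C * u + D)))"

lemma moebius_on_mono:
 assumes "moebius_on R h" "\<And>u. R' u ==> R u \<and> h' u = h u" shows "moebius_on R' h'"
proof -
 obtain A B C D where M: "A * D - B * C \<noteq> 0" "\<And>u. R u ==> C * u + D \<noteq> 0 \<and> h u = (A * u + B) / (C * u + D)"
  using assms(1) unfolding moebius_on_def by blast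
 show ?thesis unfolding moebius_on_def
  by (intro exI[of _ A] exI[of _ B] exI[of _ C] exI[of _ D]) (use M assms(2) in simp)
qed

text \<open>In lowest terms \<open>p / q\<close>, the roots of \<open>H u\<close> are the points
  with the same value as \<open>u\<close>. For all but finitely many \<open>u\<close> the only root
  is \<open>u\<close>, and it is simple because an injective holomorphic function has non-zero
  derivative; so \<open>H u\<close> has degree at most \<open>1\<close>. Two such polynomials
  \<open>H a\<close>, \<open>H b\<close> span \<open>p\<close> and \<open>q\<close>, since the
  values at \<open>a\<close> and \<open>b\<close> differ.\<close>

lemma injective_rational_moebius:
 fixes P Q :: "complex poly"
 assumes Z: "finite Z" and Q: "\<And>u. u \<notin> Z ==> poly Q u \<noteq> 0"
  and inj: "inj_on (\<lambda>u. poly P u / poly Q u) (- Z)"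
 shows "moebius_on (\<lambda>u. poly Q u \<noteq> 0) (\<lambda>u. poly P u / poly Q u)"
proof -
 have inf: "infinite (- X)" if "finite X" for X :: "complex set"
  using that infinite_UNIV_char_0 by (metis Compl_eq_Diff_UNIV Diff_infinite_finite)
 obtain u' where "u' \<in> - Z" using inf[OF Z] infinite_imp_nonempty by blast
 hence "Q \<noteq> 0" using Q[of u'] by auto
 then obtain p q g where pq: "P = g * p" "Q = g * q" "\<And>w. \<not> (poly p w = 0 \<and> poly q w = 0)"
  using common_factor by blast
 define r where "r u = poly p u / poly q u" for u
 have qz: "poly q u \<noteq> 0" if "u \<notin> Z" for u using Q[OF that] by (auto simp: pq(2))
 have rr: "poly P u / poly Q u = r u" if "poly Q u \<noteq> 0" for u using that by (simp add: r_def pq)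
 have injr: "inj_on r (- Z)" using inj rr Q by (simp add: inj_on_def)
 define H where "H u = smult (poly q u) p - smult (poly p u) q" for u
 have Hnz: "smult (poly p w) q - smult (poly q w) p \<noteq> 0" for w
 proof
  assume "smult (poly p w) q - smult (poly q w) p = 0"
  hence e: "poly p w * poly q u = poly q w * poly p u" for u
   by (metis eq_iff_diff_eq_0 poly_smult)
  obtain T where "T \<subseteq> - Z" "finite T" "card T = 2" using infinite_arbitrarily_large[OF inf[OF Z]] by blast
  then obtain a b where ab: "a \<in> - Z" "b \<in> - Z" "a \<noteq> b" by (metis card_2_iff insert_subset)
  have "poly q w \<noteq> 0" using e[of a] qz[of a] ab(1) pq(3)[of w] by auto
  hence "r a = poly p w / poly q w" "r b = poly p w / poly q w"
   using e[of a] e[of b] qz[of a] qz[of b] ab by (simp_all add: r_def field_simps)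
  thus False using injr ab by (auto simp: inj_on_def)
 qed
 \<comment> \<open>Besides \<open>Z\<close>, the points that share their value with a point of
   \<open>Z\<close> are excluded, since nothing is known about injectivity there.\<close>
 define Y where "Y = Z \<union> (\<Union>w\<in>Z. {u. poly (smult (poly p w) q - smult (poly q w) p) u = 0})"
 have Y: "finite Y" unfolding Y_def using Z poly_roots_finite[OF Hnz] by blast
 have op: "open (- Z)" using Z finite_imp_closed by blast
 have dH: "degree (H u) \<le> 1" if u: "u \<notin> Y" for u
 proof (rule single_root_degree)
  have uZ: "u \<notin> Z" using u by (simp add: Y_def)
  fix w assume w: "poly (H u) w = 0"
  have wZ: "w \<notin> Z"
  proof
   assume "w \<in> Z"
   moreover have "poly (smult (poly p w) q - smult (poly q w) p) u = 0" using w by (simp add: H_def algebra_simps)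
   ultimately show False using u by (auto simp: Y_def)
  qed
  have "r w = r u" using w qz[OF wZ] qz[OF uZ] by (simp add: H_def r_def field_simps)
  thus "w = u" using injr wZ uZ by (auto simp: inj_on_def)
 next
  have uZ: "u \<in> - Z" using u by (simp add: Y_def)
  have "r holomorphic_on - Z" unfolding r_def[abs_def] by (intro holomorphic_intros) (use qz in auto)
  from holomorphic_injective_imp_regular[OF this op injr uZ] have d: "deriv r u \<noteq> 0" .
  have "DERIV r u :> (poly (pderiv p) u * poly q u - poly p u * poly (pderiv q) u) / (poly q u * poly q u)"
   unfolding r_def[abs_def] by (rule DERIV_divide[OF poly_DERIV poly_DERIV qz]) (use uZ in simp)
  hence "poly (pderiv p) u * poly q u - poly p u * poly (pderiv q) u \<noteq> 0" using d DERIV_imp_deriv by fastforce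
  thus "poly (pderiv (H u)) u \<noteq> 0" by (simp add: H_def pderiv_diff pderiv_smult mult.commute)
 qed
 obtain T where "T \<subseteq> - Y" "finite T" "card T = 2" using infinite_arbitrarily_large[OF inf[OF Y]] by blast
 then obtain a b where ab: "a \<in> - Y" "b \<in> - Y" "a \<noteq> b" by (metis card_2_iff insert_subset)
 have abZ: "a \<in> - Z" "b \<in> - Z" using ab by (auto simp: Y_def)
 define \<delta> where "\<delta> = poly p a * poly q b - poly p b * poly q a"
 have dl: "\<delta> \<noteq> 0"
 proof
  assume "\<delta> = 0"
  hence "r a = r b" using qz[of a] qz[of b] abZ by (simp add: \<delta>_def r_def field_simps)
  thus False using injr abZ ab(3) by (auto simp: inj_on_def)
 qed
 have "smult \<delta> p = smult (poly p a) (H b) - smult (poly p b) (H a)"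
  by (rule poly_eqI) (simp add: H_def \<delta>_def algebra_simps)
 hence "degree (smult \<delta> p) \<le> 1" using dH ab by (auto intro!: degree_diff_le order_trans[OF degree_smult_le])
 hence dp: "degree p \<le> 1" using dl by simp
 have "smult \<delta> q = smult (poly q a) (H b) - smult (poly q b) (H a)"
  by (rule poly_eqI) (simp add: H_def \<delta>_def algebra_simps)
 hence "degree (smult \<delta> q) \<le> 1" using dH ab by (auto intro!: degree_diff_le order_trans[OF degree_smult_le])
 hence dq: "degree q \<le> 1" using dl by simp
 define A B C D where "A = coeff p 1" and "B = coeff p 0" and "C = coeff q 1" and "D = coeff q 0"
 have lin: "poly s u = coeff s 1 * u + coeff s 0" if "degree s \<le> 1" for s :: "complex poly" and u
  using that poly_altdef[of s u] by (cases "degree s") (auto simp: coeff_eq_0)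
 have pq': "poly p u = A * u + B" "poly q u = C * u + D" for u
  using lin[OF dp] lin[OF dq] by (simp_all add: A_def B_def C_def D_def)
 have "\<delta> = (A * D - B * C) * (a - b)" unfolding \<delta>_def pq' by (simp add: algebra_simps)
 hence "A * D - B * C \<noteq> 0" using dl by auto
 moreover have "C * u + D \<noteq> 0 \<and> poly P u / poly Q u = (A * u + B) / (C * u + D)" if "poly Q u \<noteq> 0" for u
  using that rr[OF that] unfolding pq'[symmetric] by (auto simp: r_def pq)
 ultimately show ?thesis unfolding moebius_on_def by blast
qed

lemma moebius_agree:
 fixes A B C D A' B' C' D' :: complex
 assumes "infinite {u. (A * u + B) * (C' * u + D') = (A' * u + B') * (C * u + D)}"
 shows "(A * u + B) * (C' * u + D') = (A' * u + B') * (C * u + D)"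
proof -
 define H where "H = [:B, A:] * [:D', C':] - [:B', A':] * [:D, C:]"
 have H: "poly H u = (A * u + B) * (C' * u + D') - (A' * u + B') * (C * u + D)" for u
  by (simp add: H_def algebra_simps)
 have "infinite {u. poly H u = 0}" using assms unfolding H by simp
 hence "H = 0" using poly_roots_finite by blast
 thus ?thesis using H[of u] by simp
qed

lemma moebius_inj:
 fixes A B C D :: complex
 assumes "A * D - B * C \<noteq> 0" "C * u + D \<noteq> 0" "C * w + D \<noteq> 0" "(A * u + B) / (C * u + D) = (A * w + B) / (C * w + D)"
 shows "u = w"
proof -
 have "(A * u + B) * (C * w + D) = (A * w + B) * (C * u + D)" using assms by (simp add: field_simps)
 hence "(A * D - B * C) * (u - w) = 0" by (simp add: algebra_simps)
 thus ?thesis using assms(1) by simp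
qed

lemma moebius_on_inj: "moebius_on R h ==> inj_on h {u. R u}"
 unfolding moebius_on_def inj_on_def by (metis mem_Collect_eq moebius_inj)

text \<open>Each difference of values is the difference of arguments times the determinant over two
  of the denominators \<open>c i\<close>, and every \<open>c i\<close> occurs equally often on both
  sides. The invariance of the cross-ratio is kept free of quotients so that it can be
  differentiated.\<close>

lemma moebius_cross:
 fixes A B C D :: complex
 assumes "\<And>i. i \<in> {1,2,3,4::nat} ==> C * u i + D \<noteq> 0 \<and> x i = (A * u i + B) / (C * u i + D)"
 shows "(x 1 - x 2) * (x 3 - x 4) * ((u 1 - u 3) * (u 2 - u 4)) = (x 1 - x 3) * (x 2 - x 4) * ((u 1 - u 2) * (u 3 - u 4))"
proof -
 define c where "c i = C * u i + D" for i
 have c: "c 1 \<noteq> 0" "c 2 \<noteq> 0" "c 3 \<noteq> 0" "c 4 \<noteq> 0" using assms by (simp_all add: c_def)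
 have d: "x i - x j = (A * D - B * C) * (u i - u j) / (c i * c j)" if "i \<in> {1,2,3,4}" "j \<in> {1,2,3,4}" for i j
 proof -
  have cc: "c i \<noteq> 0" "c j \<noteq> 0" and xx: "x i = (A * u i + B) / c i" "x j = (A * u j + B) / c j"
   using assms that unfolding c_def by blast+
  have "x i - x j = ((A * u i + B) * c j - (A * u j + B) * c i) / (c i * c j)" unfolding xx by (rule diff_frac_eq[OF cc])
  also have "(A * u i + B) * c j - (A * u j + B) * c i = (A * D - B * C) * (u i - u j)" by (simp add: c_def algebra_simps)
  finally show ?thesis .
 qed
 have "x 1 - x 2 = (A * D - B * C) * (u 1 - u 2) / (c 1 * c 2)" "x 3 - x 4 = (A * D - B * C) * (u 3 - u 4) / (c 3 * c 4)"
  "x 1 - x 3 = (A * D - B * C) * (u 1 - u 3) / (c 1 * c 3)" "x 2 - x 4 = (A * D - B * C) * (u 2 - u 4) / (c 2 * c 4)"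
  by (rule d; simp)+
 thus ?thesis by (simp only:) (simp add: c divide_simps)
qed

section \<open>Complex analysis\<close>

text \<open>An integrating factor: \<open>q\<close> has a primitive \<open>Q\<close> on the ball,
  and \<open>L * exp (- Q)\<close> has derivative zero.\<close>

lemma linear_ode_zero:
 fixes L q :: "complex => complex"
 assumes q: "q holomorphic_on ball 0 r" and L: "\<And>t. t \<in> ball 0 r ==> (DERIV L t :> q t * L t)"
  and L0: "L 0 = 0" and t: "t \<in> ball 0 r"
 shows "L t = 0"
proof -
 obtain Q where Q: "\<And>x. x \<in> ball 0 r ==> (Q has_field_derivative q x) (at x within ball 0 r)"
  using holomorphic_convex_primitive'[OF convex_ball open_ball q] by blast
 have Q': "DERIV Q x :> q x" if "x \<in> ball 0 r" for x
  using Q[OF that] at_within_open[OF that open_ball] by simp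
 have "((\<lambda>x. L x * exp (- Q x)) has_field_derivative 0) (at x within ball 0 r)" if "x \<in> ball 0 r" for x
 proof -
  have "DERIV (\<lambda>x. L x * exp (- Q x)) x :> q x * L x * exp (- Q x) + exp (- Q x) * (- q x) * L x"
   by (intro DERIV_mult L that DERIV_fun_exp DERIV_minus Q')
  thus ?thesis by (simp add: has_field_derivative_at_within)
 qed
 then obtain c where c: "\<And>x. x \<in> ball 0 r ==> L x * exp (- Q x) = c"
  using has_field_derivative_zero_constant[OF convex_ball, of 0 r "\<lambda>x. L x * exp (- Q x)"] by blast
 have "0 \<in> ball (0 :: complex) r" using t by (simp add: le_less_trans[OF norm_ge_zero])
 hence "c = 0" using c[of 0] L0 by simp
 thus ?thesis using c[OF t] by simp
qed

lemma derivative_zero_of_sequence: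
 fixes H :: "complex => complex"
 assumes "DERIV H 0 :> h" "\<tau> \<longlonglongrightarrow> 0" "\<And>k. \<tau> k \<noteq> 0" "\<forall>\<^sub>F k in sequentially. H (\<tau> k) = 0" "H 0 = 0"
 shows "h = 0"
proof -
 have "((\<lambda>x. (H x - H 0) / (x - 0)) \<longlongrightarrow> h) (at 0)" using assms(1) by (simp add: has_field_derivative_iff)
 moreover have "filterlim \<tau> (at 0) sequentially" using assms(2,3) by (simp add: filterlim_at)
 ultimately have "((\<lambda>k. (H (\<tau> k) - H 0) / (\<tau> k - 0)) \<longlongrightarrow> h) sequentially" by (rule filterlim_compose)
 moreover have "((\<lambda>k. (H (\<tau> k) - H 0) / (\<tau> k - 0)) \<longlongrightarrow> 0) sequentially"
  by (rule tendsto_eventually) (use assms(4) in \<open>eventually_elim, simp add: assms(5)\<close>)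
 ultimately show ?thesis by (rule LIMSEQ_unique)
qed

text \<open>A non-constant holomorphic function on the connected punctured plane has only countably
  many zeros. The origin is left out because of the quotient \<open>sinh (z * t0) / z\<close> in the
  application.\<close>

lemma holomorphic_uncountable_zeros:
 assumes H: "H holomorphic_on - {0 :: complex}" and A: "uncountable A" "A \<subseteq> - {0}" "\<And>z. z \<in> A ==> H z = 0" and z: "z \<noteq> 0"
 shows "H z = 0"
proof (rule ccontr)
 assume nz: "H z \<noteq> 0"
 have conn: "connected (- {0 :: complex})"
  using connected_punctured_universe[of "0 :: complex"] by simp
 obtain a where a: "a \<in> A" using A(1) by fastforce
 have fs: "fsigma (- {0 :: complex})"
 proof -
  have "x \<noteq> 0 \<longleftrightarrow> (\<exists>n. inverse (real (Suc n)) \<le> cmod x)" for x :: complex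
  proof
   assume "x \<noteq> 0"
   then obtain n where "inverse (real (Suc n)) < cmod x" using reals_Archimedean[of "cmod x"] by auto
   thus "\<exists>n. inverse (real (Suc n)) \<le> cmod x" by (intro exI[of _ n]) simp
  next
   assume "\<exists>n. inverse (real (Suc n)) \<le> cmod x"
   then obtain n where n: "inverse (real (Suc n)) \<le> cmod x" by blast
   have "0 < inverse (real (Suc n))" by simp
   from this n have "0 < cmod x" by (rule order_less_le_trans)
   thus "x \<noteq> 0" by simp
  qed
  hence "- {0 :: complex} = (\<Union>n. - ball 0 (inverse (real (Suc n))))" by (simp add: set_eq_iff not_less del: of_nat_Suc)
  thus ?thesis using fsigma.intros[of "\<lambda>n. - ball (0 :: complex) (inverse (real (Suc n)))"] by (simp add: closed_Compl)
 qed
 have nc: "\<not> H constant_on - {0}"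
 proof
  assume "H constant_on - {0}"
  then obtain c where c: "\<And>x. x \<in> - {0} ==> H x = c" unfolding constant_on_def by metis
  have "a \<in> - {0}" using a A(2) by blast
  thus False using c[of a] c[of z] A(3)[OF a] nz z by simp
 qed
 have "countable {x\<in>- {0}. H x = 0}"
  by (rule holomorphic_countable_zeros[OF H _ conn fs nc]) (simp add: open_Compl)
 hence "countable A" by (rule countable_subset[rotated]) (use A in auto)
 thus False using A(1) by simp
qed

text \<open>Once the coefficients below \<open>k\<close> are known to vanish, the relation is
  divided by the power \<open>2 * k\<close> of \<open>sinh (z * t0) / z\<close>. The resulting
  function \<open>H\<close> has uncountably many zeros, so it vanishes on the whole punctured plane,
  in particular at the non-zero zeros of \<open>sinh (z * t0)\<close>. There only the term with
  index \<open>k\<close> survives, which gives \<open>q k\<close> infinitely many roots.\<close>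

lemma sinh_algebraically_independent:
 fixes q :: "nat => complex poly"
 assumes t0: "t0 \<noteq> 0" and A: "uncountable A"
  and rel: "\<And>z. z \<in> A ==> z \<noteq> 0 \<and> (\<Sum>i\<le>N. poly (q i) (z\<^sup>2) * (sinh (z * t0) / z) ^ (2 * i)) = 0"
  and k: "k \<le> N"
 shows "q k = 0"
 using k
proof (induction k rule: less_induct)
 case (less k)
 define H where "H z = (\<Sum>i\<in>{k..N}. poly (q i) (z\<^sup>2) * (sinh (z * t0) / z) ^ (2 * (i - k)))" for z
 have hol: "H holomorphic_on - {0}"
  unfolding H_def[abs_def] sinh_def by (intro holomorphic_intros) auto
 have snc: "\<not> (\<lambda>z. sinh (z * t0)) constant_on (UNIV :: complex set)"
 proof
  assume "(\<lambda>z. sinh (z * t0)) constant_on UNIV"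
  then obtain c where c: "\<And>z. sinh (z * t0) = c" by (auto simp: constant_on_def)
  have "c = 0" using c[of 0] by simp
  hence "sinh (1 / 1 :: complex) = 0" using c[of "1 / t0"] t0 by simp
  hence "exp (1 :: complex) = exp (- 1)" by (simp add: sinh_field_def)
  hence "exp (2 :: complex) = 1" using exp_add[of "1 :: complex" 1] exp_minus_inverse[of "1 :: complex"] by simp
  hence "exp (2 :: real) = 1" using norm_exp_eq_Re[of 2] by simp
  thus False by simp
 qed
 have "countable {z\<in>UNIV. sinh (z * t0) = 0}"
  by (rule holomorphic_countable_zeros[OF _ open_UNIV connected_UNIV fsigma_UNIV snc]) (unfold sinh_def, intro holomorphic_intros)
 hence "\<forall>\<^sub>F z in coc A. sinh (z * t0) \<noteq> 0"
  unfolding eventually_coc by (rule countable_subset[rotated]) auto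
 hence unc: "uncountable {z\<in>A. sinh (z * t0) \<noteq> 0}" by (rule coc_infinite[OF _ A])
 have Hz: "H z = 0" if "z \<noteq> 0" for z
 proof (rule holomorphic_uncountable_zeros[OF hol unc _ _ that])
  show "{z\<in>A. sinh (z * t0) \<noteq> 0} \<subseteq> - {0}" using rel by auto
  fix z assume z: "z \<in> {z\<in>A. sinh (z * t0) \<noteq> 0}"
  define s where "s = sinh (z * t0) / z"
  have s: "s \<noteq> 0" using z rel[of z] by (simp add: s_def)
  have "0 = (\<Sum>i\<le>N. poly (q i) (z\<^sup>2) * s ^ (2 * i))" using rel[of z] z by (simp add: s_def)
  also have "\<dots> = (\<Sum>i\<in>{k..N}. poly (q i) (z\<^sup>2) * s ^ (2 * i))"
  proof (rule sum.mono_neutral_right)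
   show "\<forall>i\<in>{..N} - {k..N}. poly (q i) (z\<^sup>2) * s ^ (2 * i) = 0"
    using less by auto
  qed auto
  also have "\<dots> = s ^ (2 * k) * H z"
   unfolding H_def s_def[symmetric] sum_distrib_left
  proof (rule sum.cong[OF refl])
   fix i assume "i \<in> {k..N}"
   hence "2 * i = 2 * k + 2 * (i - k)" by auto
   hence "s ^ (2 * i) = s ^ (2 * k) * s ^ (2 * (i - k))" by (metis power_add)
   thus "poly (q i) (z\<^sup>2) * s ^ (2 * i) = s ^ (2 * k) * (poly (q i) (z\<^sup>2) * s ^ (2 * (i - k)))" by simp
  qed
  finally show "H z = 0" using s by simp
 qed
 \<comment> \<open>The zeros of \<open>sinh (z * t0)\<close> other than the origin;
   \<open>Suc j\<close> leaves out \<open>z = 0\<close>, where \<open>H\<close> is not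
   controlled.\<close>
 have root: "poly (q k) ((\<i> * (of_nat (Suc j) * of_real pi) / t0)\<^sup>2) = 0" for j
 proof -
  define z where "z = \<i> * (of_nat (Suc j) * of_real pi) / t0"
  have z: "z \<noteq> 0" unfolding z_def using t0 by (simp del: of_nat_Suc)
  have zt: "z * t0 = \<i> * of_real (real (Suc j) * pi)" using t0 by (simp add: z_def)
  have "sinh (z * t0) = (exp (\<i> * of_real (real (Suc j) * pi)) - exp (- (\<i> * of_real (real (Suc j) * pi)))) / 2"
   unfolding zt by (simp add: sinh_field_def)
  also have "\<dots> = \<i> * sin (of_real (real (Suc j) * pi))" by (simp only: sin_exp_eq) (simp add: divide_simps)
  also have "\<dots> = 0" by (simp only: sin_of_real sin_npi) simp
  finally have "H z = (\<Sum>i\<in>{k..N}. if i = k then poly (q k) (z\<^sup>2) else 0)"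
   unfolding H_def by (intro sum.cong) auto
  thus ?thesis using Hz[OF z] less.prems by (simp add: z_def)
 qed
 have "inj (\<lambda>j. (\<i> * (of_nat (Suc j) * of_real pi) / t0)\<^sup>2)"
 proof (rule injI)
  fix i j assume "(\<i> * (of_nat (Suc i) * of_real pi) / t0)\<^sup>2 = (\<i> * (of_nat (Suc j) * of_real pi) / t0)\<^sup>2"
  hence "(of_nat (Suc i))\<^sup>2 = ((of_nat (Suc j))\<^sup>2 :: complex)" using t0 by (simp add: power_mult_distrib power_divide del: of_nat_Suc)
  hence "of_nat ((Suc i)\<^sup>2) = (of_nat ((Suc j)\<^sup>2) :: complex)" by (simp del: of_nat_Suc)
  hence "(Suc i)\<^sup>2 = (Suc j)\<^sup>2" using of_nat_eq_iff by blast
  thus "i = j" by (simp add: power2_eq_iff_nonneg)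
 qed
 hence "infinite (range (\<lambda>j. (\<i> * (of_nat (Suc j) * of_real pi) / t0)\<^sup>2))" by (rule range_inj_infinite)
 hence "infinite {x. poly (q k) x = 0}" by (rule infinite_super[rotated]) (use root in blast)
 thus ?case using poly_roots_finite by blast
qed

section \<open>Generic points of a ruled surface over a curve\<close>

lemma curve_uncountable: assumes "smooth_projective_curve n C" shows "uncountable C"
proof -
 have C: "projective_variety n C" "1 \<le> n" "\<forall>p\<in>C. smooth_at n 1 C p" using assms by (auto simp: smooth_projective_def)
 then obtain p where "p \<in> C" by (auto simp: projective_variety_def)
 moreover have "C \<subseteq> proj_space n" using C(1) by (auto simp: projective_variety_def)
 ultimately show ?thesis using smooth_curve_uncountable C by blast
qed

lemma generic_coc:
 "smooth_projective_curve n C ==> eventually P (generic C) ==> eventually P (coc C)"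
 by (rule finite_coc) (rule curve_generic_cofinite)

lemma (in irreducible) rat_germ_regular: "rat_germ S h ==> \<forall>\<^sub>G p. regular_at S h p (h p)"
 using RF_generic by (simp add: RF_Some)

context ruled_surface
begin

lemma generic_coc_fibre:
 assumes "smooth_projective_curve n C" "eventually P (generic S)"
 shows "\<forall>\<^sub>F p in coc C. \<forall>\<^sub>F u in coc UNIV. P (pt p u)"
 using generic_coc[OF assms(1) generic_fibre[OF assms(2)]]
 by eventually_elim (simp add: finite_coc)

lemma generic_coc_section:
 assumes "smooth_projective_curve n C" "eventually P (generic S)"
 shows "\<forall>\<^sub>F u in coc UNIV. \<forall>\<^sub>F p in coc C. P (pt p u)"
proof -
 have "\<forall>\<^sub>F u in coc UNIV. \<forall>\<^sub>C p. P (pt p u)"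
  by (rule finite_coc) (use generic_section[OF assms(2)] in simp)
 thus ?thesis by eventually_elim (rule generic_coc[OF assms(1)])
qed

lemma rat_germ_section:
 assumes "rat_germ S h" shows "\<forall>\<^sub>F u in coc UNIV. rat_germ C (\<lambda>p. h (pt p u))"
proof -
 obtain d F G where F: "hp d F" "hp d G"
  "\<forall>\<^sub>S q. G (crd q) \<noteq> 0 \<and> h q = F (crd q) / G (crd q)"
  using assms unfolding rat_germ_def by blast
 have "\<forall>\<^sub>F u in coc UNIV. \<forall>\<^sub>C p. G (crd (pt p u)) \<noteq> 0 \<and> h (pt p u) = F (crd (pt p u)) / G (crd (pt p u))"
  by (rule finite_coc) (use generic_section[OF F(3)] in simp)
 thus ?thesis
 proof eventually_elim
  case (elim u)
  have "\<forall>\<^sub>C p. G (sq (crd p) u 1) \<noteq> 0 \<and> h (pt p u) = F (sq (crd p) u 1) / G (sq (crd p) u 1)"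
   using elim by eventually_elim (simp only: hp_pt_zero_iff[OF F(2)] hp_pt_quotient[OF F(1,2)] simp_thms)
  thus ?case unfolding rat_germ_def using hp_sq[OF F(1), of u 1] hp_sq[OF F(2), of u 1] by blast
 qed
qed

lemma rat_germ_fibrewise_zero:
 assumes C: "smooth_projective_curve n C" and h: "rat_germ S h"
  and z: "\<forall>\<^sub>F p in coc C. \<forall>\<^sub>F u in coc UNIV. h (pt p u) = 0"
 shows "\<forall>\<^sub>S s. h s = 0"
proof (rule ccontr)
 assume "\<not> ?thesis"
 hence "\<forall>\<^sub>S s. h s \<noteq> 0" using S.rat_germ_zero_or_nonzero[OF h] by blast
 from eventually_conj[OF generic_coc_fibre[OF C this] z]
 obtain p where "\<forall>\<^sub>F u in coc UNIV. h (pt p u) \<noteq> 0" "\<forall>\<^sub>F u in coc UNIV. h (pt p u) = 0"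
  using coc_ex[OF _ curve_uncountable[OF C]] by blast
 from eventually_conj[OF this] show False using coc_ex[OF _ uncountable_UNIV_complex] by blast
qed

text \<open>Infinitely many points on each of infinitely many fibres are Zariski dense: a generic
  condition fails on finitely many points of a fibre, apart from finitely many fibres.\<close>

lemma dense_generic:
 assumes C: "smooth_projective_curve n C" and E: "infinite {p\<in>C. infinite {u. E p u}}" and P: "eventually P (generic S)"
 obtains p u where "p \<in> C" "E p u" "P (pt p u)"
proof -
 have "finite {p\<in>C. \<not> finite {u. \<not> P (pt p u)}}" by (rule curve_generic_cofinite[OF C generic_fibre[OF P]])
 from Diff_infinite_finite[OF this E] obtain p where p: "p \<in> C" "infinite {u. E p u}" "finite {u. \<not> P (pt p u)}"
  using infinite_imp_nonempty by blast
 from Diff_infinite_finite[OF p(3,2)] obtain u where "E p u" "P (pt p u)" using infinite_imp_nonempty by blast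
 thus thesis using that p(1) by blast
qed

section \<open>The flow stays in the fibres\<close>

definition flow_at :: "(point => complex) => (complex => ratmap) => real => point => complex => (complex => complex) => bool" where
 "flow_at v \<phi> \<epsilon> p u \<eta> \<longleftrightarrow> \<eta> 0 = u \<and> (\<forall>t\<in>ball 0 \<epsilon>. \<phi> t (pt p u) = Some (pt p (\<eta> t)) \<and>
   (\<exists>w. regular_at S v (pt p (\<eta> t)) w \<and> (DERIV (\<eta>) t :> w)))"

text \<open>Functions of the base are killed by a tangent field, so they are constant along an
  integral curve wherever they are regular, and the base point cannot move. The derivative of the
  fibre coordinate is then the value of \<open>v\<close>.\<close>

lemma integral_curve_fibre:
 assumes v: "rat_germ S v" and T: "open T" "0 \<in> T" and curve: "integral_curve S (dop v) T \<gamma>'"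
  and g0: "\<gamma>' 0 = pt p u" and p: "p \<in> C"
 shows "\<exists>\<epsilon>>0. \<exists>\<eta>. \<eta> 0 = u \<and> ball 0 \<epsilon> \<subseteq> T \<and> (\<forall>t\<in>ball 0 \<epsilon>. \<gamma>' t = pt p (\<eta> t) \<and>
  (\<exists>w. regular_at S v (pt p (\<eta> t)) w \<and> (DERIV (\<eta>) t :> w)))"
proof -
 obtain i0 where i0: "crd p i0 \<noteq> 0" by (rule rep_point_coord)
 have U1z: "U1 i0 (crd (pt q w)) = 0 \<longleftrightarrow> crd q i0 = 0" for q w
  unfolding hp_pt_zero_iff[OF hp_U(2)] by (simp add: U_sq)
 \<comment> \<open>On the part of \<open>N\<close> inside the surface the fibre coordinate is finite
   and the base coordinate \<open>i0\<close> is non-zero; by continuity the curve stays there for a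
   short time.\<close>
 define N where "N = {s. U1 i0 (crd s) \<noteq> 0}"
 have "open N" unfolding N_def by (rule hp_open_points[OF hp_U(2)])
 hence "open (\<gamma>' -` N \<inter> T)"
  using curve continuous_on_open_vimage[OF T(1), of \<gamma>'] unfolding integral_curve_def by blast
 moreover have "0 \<in> \<gamma>' -` N \<inter> T" using T(2) i0 U1z[of p u] g0 by (simp add: N_def)
 ultimately obtain \<epsilon> where e: "\<epsilon> > 0" "ball 0 \<epsilon> \<subseteq> \<gamma>' -` N \<inter> T" by (rule openE)
 have inS: "\<gamma>' t \<in> S" and dom_v: "g \<in> carrier (function_field S) ==> \<gamma>' t \<in> dom g ==> \<gamma>' t \<in> dom (dop v g)"
  and der: "g \<in> carrier (function_field S) ==> \<gamma>' t \<in> dom g ==>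
   (DERIV (\<lambda>s. the (g (\<gamma>' s))) t :> the (dop v g (\<gamma>' t)))" if "t \<in> ball 0 \<epsilon>" for t g
  using curve e(2) that unfolding integral_curve_def holomorphic_vf_at_def by blast+
 define b where "b t = base_pt (\<gamma>' t)" for t
 define \<eta> where "\<eta> t = yc (\<gamma>' t)" for t
 have bt: "\<gamma>' t = pt (b t) (\<eta> t)" "b t \<in> C" "crd (b t) i0 \<noteq> 0" if t: "t \<in> ball 0 \<epsilon>" for t
 proof -
  have "U1 i0 (crd (\<gamma>' t)) \<noteq> 0" using e(2) t by (auto simp: N_def)
  then obtain q w where "q \<in> C" "\<gamma>' t = pt q w" by (rule U1_nonzero_pt[OF inS[OF t]])
  moreover from this have "crd q i0 \<noteq> 0" using \<open>U1 i0 (crd (\<gamma>' t)) \<noteq> 0\<close> U1z by simp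
  ultimately show "\<gamma>' t = pt (b t) (\<eta> t)" "b t \<in> C" "crd (b t) i0 \<noteq> 0" by (simp_all add: b_def \<eta>_def)
 qed
 have z0: "0 \<in> ball 0 \<epsilon>" using e(1) by simp
 have b0: "b 0 = p" by (simp add: b_def g0)
 have const: "crd (b t) j / crd (b t) i0 = crd p j / crd p i0" if t: "t \<in> ball 0 \<epsilon>" for t j
 proof -
  define a where "a q = crd q j / crd q i0" for q
  have ra: "regular_at C a q (a q)" if "q \<in> C" "crd q i0 \<noteq> 0" for q
   by (rule regular_atI[OF that(1) hp_var[of j] hp_var[of i0]]) (use that in \<open>auto simp: a_def\<close>)
  have ga: "rat_germ C a" by (rule C.regular_at_germ[OF ra[OF p i0]])
  let ?g = "RF S (\<lambda>s. a (base_pt s))"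
  have gc: "?g \<in> carrier (function_field S)" by (rule S.RF_carrier[OF rat_germ_base[OF ga]])
  have val: "?g (\<gamma>' s) = Some (a (b s))" if "s \<in> ball 0 \<epsilon>" for s
   unfolding S.RF_Some by (rule regular_at_base[OF ra[OF bt(2,3)[OF that]] inS[OF that]]) (simp add: b_def)
  have "dop v ?g = RF S (\<lambda>s. v s * dy (\<lambda>s. a (base_pt s)) s)" by (rule dop_RF[OF rat_germ_base[OF ga] v])
  also have "\<dots> = RF S (\<lambda>_. 0)" by (rule S.RF_cong) (use dy_base[OF ga] in \<open>eventually_elim, simp\<close>)
  finally have dv: "dop v ?g (\<gamma>' s) = Some 0" if "s \<in> ball 0 \<epsilon>" for s
   using S.regular_at_const[OF inS[OF that], of 0] by (simp add: S.RF_Some)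
  have "((\<lambda>s. the (?g (\<gamma>' s))) has_field_derivative 0) (at s within ball 0 \<epsilon>)" if s: "s \<in> ball 0 \<epsilon>" for s
   using der[OF s gc] val[OF s] dv[OF s] by (auto intro: has_field_derivative_at_within)
  then obtain k where "\<And>s. s \<in> ball 0 \<epsilon> ==> the (?g (\<gamma>' s)) = k"
   using has_field_derivative_zero_constant[OF convex_ball, of 0 \<epsilon> "\<lambda>s. the (?g (\<gamma>' s))"] by blast
  hence "a (b t) = a (b 0)" using val[OF t] val[OF z0] t z0 by (metis option.sel)
  thus ?thesis by (simp add: a_def b0)
 qed
 have bp: "b t = p" if t: "t \<in> ball 0 \<epsilon>" for t
 proof (rule point_eqI)
  fix i j
  have x: "crd (b t) i = (crd p i / crd p i0) * crd (b t) i0" for i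
   using const[OF t, of i] bt(3)[OF t] by (simp add: field_simps)
  show "crd (b t) i * crd p j = crd (b t) j * crd p i"
   unfolding x[of i] x[of j] by simp
 qed
 have "\<gamma>' t = pt p (\<eta> t) \<and> (\<exists>w. regular_at S v (pt p (\<eta> t)) w \<and> (DERIV (\<eta>) t :> w))" if t: "t \<in> ball 0 \<epsilon>" for t
 proof -
  have yc: "RF S yc (\<gamma>' s) = Some (\<eta> s)" if s: "s \<in> ball 0 \<epsilon>" for s
   using regular_at_yc[OF p, of 1 "\<eta> s"] bt(1)[OF s] bp[OF s] by (simp add: S.RF_Some pt_def)
  have gc: "RF S yc \<in> carrier (function_field S)" by (rule S.RF_carrier[OF rat_germ_yc])
  have dm: "\<gamma>' t \<in> dom (RF S yc)" using yc[OF t] by auto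
  obtain w where w: "RF S v (\<gamma>' t) = Some w" using dom_v[OF t gc dm] unfolding dop_yc[OF v] by auto
  have "DERIV (\<lambda>s. the (RF S yc (\<gamma>' s))) t :> w"
   using der[OF t gc dm] unfolding dop_yc[OF v] w by simp
  hence "DERIV (\<eta>) t :> w"
   by (rule has_field_derivative_transform_within_open[OF _ open_ball t]) (simp add: yc)
  thus ?thesis using w bt(1)[OF t] bp[OF t] unfolding S.RF_Some by auto
 qed
 moreover have "\<eta> 0 = u" by (simp add: \<eta>_def g0)
 ultimately show ?thesis using e by blast
qed

lemma flow_at_generic:
 assumes v: "rat_germ S v" and adm: "admissible S U" and flow: "local_flow_on S (dop v) U \<Phi>"
  and \<phi>: "\<forall>(t, s)\<in>U. \<phi> t s = Some (\<Phi> t s)"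
 shows "\<forall>\<^sub>S s. \<forall>p u. s = pt p u --> (\<exists>\<epsilon>>0. \<exists>\<eta>. flow_at v \<phi> \<epsilon> p u \<eta>)"
proof -
 obtain V W where W: "zariski_open_in S W" "W \<noteq> {}" "W \<subseteq> V" "V \<subseteq> S" "{0} \<times> V \<subseteq> U"
  using adm unfolding admissible_def by blast
 obtain N where N: "open N" "U = (UNIV \<times> S) \<inter> N" using adm unfolding admissible_def openin_open by blast
 show ?thesis
  using S.zariski_open_generic[OF W(1,2)]
 proof (eventually_elim, intro allI impI)
  fix s p u assume s: "s \<in> W" "s = pt p u"
  define T where "T = {t. (t, s) \<in> U}"
  have sS: "s \<in> S" and zT: "0 \<in> T" using s W by (auto simp: T_def)
  have "T = (\<lambda>t. (t, s)) -` N" using N(2) sS by (auto simp: T_def)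
  hence oT: "open T" using N(1) by (simp add: open_vimage continuous_on_Pair)
  have cv: "\<Phi> 0 s = s" "integral_curve S (dop v) T (\<lambda>t. \<Phi> t s)"
   using flow zT unfolding local_flow_on_def Let_def T_def by blast+
  have p: "p \<in> C" using base_in[OF sS] s(2) by simp
  obtain \<epsilon> \<eta> where "\<epsilon> > 0" "\<eta> 0 = u" "ball 0 \<epsilon> \<subseteq> T" and h: "\<forall>t\<in>ball 0 \<epsilon>. \<Phi> t s = pt p (\<eta> t) \<and>
   (\<exists>w. regular_at S v (pt p (\<eta> t)) w \<and> (DERIV (\<eta>) t :> w))"
   using integral_curve_fibre[OF v oT zT cv(2) _ p, of u] cv(1) s(2) by auto
  moreover have "\<phi> t s = Some (\<Phi> t s)" if "t \<in> ball 0 \<epsilon>" for t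
   using \<phi> that \<open>ball 0 \<epsilon> \<subseteq> T\<close> by (auto simp: T_def)
  ultimately have "flow_at v \<phi> \<epsilon> p u \<eta>" unfolding flow_at_def s(2)[symmetric] by auto
  thus "\<exists>\<epsilon>>0. \<exists>\<eta>. flow_at v \<phi> \<epsilon> p u \<eta>" using \<open>\<epsilon> > 0\<close> by blast
 qed
qed

text \<open>The pigeonhole principle over the bounds \<open>1 / (N + 1)\<close> is used twice: for
  the uncountably many points of one fibre, then for the uncountably many fibres.\<close>

lemma uniform_flow_time:
 assumes C: "smooth_projective_curve n C"
  and fl: "\<forall>\<^sub>S s. \<forall>p u. s = pt p u --> (\<exists>\<epsilon>>0. \<exists>\<eta>. flow_at v \<phi> \<epsilon> p u \<eta>)"
 shows "\<exists>\<epsilon>>0. infinite {p\<in>C. infinite {u. \<exists>\<eta>. flow_at v \<phi> \<epsilon> p u \<eta>}}"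
proof -
 define E where "E N p = {u. \<exists>\<eta>. flow_at v \<phi> (inverse (real (Suc N))) p u \<eta>}" for N p
 define A where "A = {p\<in>C. \<forall>\<^sub>F u in coc UNIV. \<exists>\<epsilon>>0. \<exists>\<eta>. flow_at v \<phi> \<epsilon> p u \<eta>}"
 have "\<forall>\<^sub>F p in coc C. \<forall>\<^sub>F u in coc UNIV. \<exists>\<epsilon>>0. \<exists>\<eta>. flow_at v \<phi> \<epsilon> p u \<eta>"
  using generic_coc_fibre[OF C fl] by (auto elim!: eventually_mono)
 hence unc: "uncountable A" unfolding A_def by (rule coc_infinite[OF _ curve_uncountable[OF C]])
 have "\<exists>N. infinite (E N p)" if "p \<in> A" for p
 proof (rule ccontr)
  assume "\<not> ?thesis"
  hence "countable (\<Union>N. E N p)" by (auto intro: countable_finite)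
  moreover have "{u. \<exists>\<epsilon>>0. \<exists>\<eta>. flow_at v \<phi> \<epsilon> p u \<eta>} \<subseteq> (\<Union>N. E N p)"
  proof
   fix u assume "u \<in> {u. \<exists>\<epsilon>>0. \<exists>\<eta>. flow_at v \<phi> \<epsilon> p u \<eta>}"
   then obtain \<epsilon> \<eta> where e: "\<epsilon> > 0" "flow_at v \<phi> \<epsilon> p u \<eta>" by blast
   obtain N where "inverse (real (Suc N)) < \<epsilon>" using reals_Archimedean[OF e(1)] by blast
   hence "flow_at v \<phi> (inverse (real (Suc N))) p u \<eta>"
    using e(2) subset_ball[of "inverse (real (Suc N))" \<epsilon> "0 :: complex"] unfolding flow_at_def by auto
   thus "u \<in> (\<Union>N. E N p)" by (auto simp: E_def)
  qed
  ultimately have "countable {u. \<exists>\<epsilon>>0. \<exists>\<eta>. flow_at v \<phi> \<epsilon> p u \<eta>}" by (rule countable_subset[rotated])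
  moreover have "uncountable {u\<in>UNIV. \<exists>\<epsilon>>0. \<exists>\<eta>. flow_at v \<phi> \<epsilon> p u \<eta>}"
   by (rule coc_infinite[OF _ uncountable_UNIV_complex]) (use that in \<open>simp add: A_def\<close>)
  ultimately show False by simp
 qed
 hence "A \<subseteq> (\<Union>N. {p\<in>C. infinite (E N p)})" by (auto simp: A_def)
 hence "\<not> countable (\<Union>N. {p\<in>C. infinite (E N p)})" using unc countable_subset by blast
 hence "\<exists>N. \<not> countable {p\<in>C. infinite (E N p)}" by (rule contrapos_np) simp
 then obtain N where "infinite {p\<in>C. infinite (E N p)}" using countable_finite by blast
 thus ?thesis unfolding E_def by (intro exI[of _ "inverse (real (Suc N))"]) simp
qed

text \<open>The points with flow time \<open>\<epsilon>\<close> are dense, and at them the map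
  preserves the fibre. As preservation of fibres is a system of form equations, it holds everywhere;
  \<open>g\<close> is the fibre coordinate \<open>U0 / U1\<close> of the image.\<close>

lemma flow_fibre_map:
 assumes C: "smooth_projective_curve n C"
  and E: "infinite {p\<in>C. infinite {u. \<exists>\<eta>. flow_at v \<phi> \<epsilon> p u \<eta>}}"
  and rm: "rational_map S S (\<phi> t)" and t: "t \<in> ball 0 \<epsilon>"
 shows "\<exists>g. rat_germ S g \<and> (\<forall>\<^sub>S s. \<phi> t s = Some (pt (base_pt s) (g s)))"
proof -
 have ext: "\<phi> t = map_ext S (\<phi> t)" and ran: "ran (\<phi> t) \<subseteq> S" using rm by (auto simp: rational_map_def)
 have "dom (\<phi> t) \<noteq> {}" using rm by (simp add: rational_map_def)
 then obtain s0 q0 where "\<phi> t s0 = Some q0" by blast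
 hence "map_ext S (\<phi> t) s0 = Some q0" using ext by simp
 then obtain e F i where F: "s0 \<in> S" "\<forall>i. hp e (F i)" "F i (crd s0) \<noteq> 0"
  "\<forall>\<^sub>S r. \<phi> t r = Some (fmap F r)"
  unfolding S.map_ext_Some S.regular_map_value_iff by blast
 have Fi: "\<forall>\<^sub>S r. F i (crd r) \<noteq> 0" by (rule S.generic_nonzero[OF F(2)[rule_format] F(1,3)])
 \<comment> \<open>Every non-empty open set contains a point whose flow is defined at time
   \<open>t\<close>, and there the forms \<open>F\<close> give a finite point of the same
   fibre.\<close>
 have meets: "\<exists>p u w. p \<in> C \<and> P (pt p u) \<and> fmap F (pt p u) = pt p w \<and> F i (crd (pt p u)) \<noteq> 0" if P: "eventually P (generic S)" for P
 proof -
  obtain p u where p: "p \<in> C" "\<exists>\<eta>. flow_at v \<phi> \<epsilon> p u \<eta>" "P (pt p u) \<and> \<phi> t (pt p u) = Some (fmap F (pt p u)) \<and> F i (crd (pt p u)) \<noteq> 0"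
   by (rule dense_generic[OF C E eventually_conj[OF P eventually_conj[OF F(4) Fi]]])
  then obtain \<eta> where "flow_at v \<phi> \<epsilon> p u \<eta>" by blast
  hence "\<phi> t (pt p u) = Some (pt p (\<eta> t))" using t by (simp add: flow_at_def)
  hence "fmap F (pt p u) = pt p (\<eta> t)" using p(3) by simp
  thus ?thesis using p(1,3) by blast
 qed
 have rel: "crd r (2 * i' + k) * F (2 * j + l) (crd r) = crd r (2 * j + k) * F (2 * i' + l) (crd r)"
  if r: "r \<in> S" and kl: "k < 2" "l < 2" for r i' j k l
 proof (rule ccontr)
  assume nz: "crd r (2 * i' + k) * F (2 * j + l) (crd r) \<noteq> crd r (2 * j + k) * F (2 * i' + l) (crd r)"
  have "hp (Suc 0 + e) (\<lambda>z. z (2 * i' + k) * F (2 * j + l) z - z (2 * j + k) * F (2 * i' + l) z)"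
   by (intro hp_diff hp.mult hp_var F(2)[rule_format])
  from S.generic_nonzero[OF this r] nz
  have "\<forall>\<^sub>S r. crd r (2 * i' + k) * F (2 * j + l) (crd r) \<noteq> crd r (2 * j + k) * F (2 * i' + l) (crd r)"
   by simp
  from meets[OF this] obtain p u w where p: "p \<in> C" "fmap F (pt p u) = pt p w" "F i (crd (pt p u)) \<noteq> 0"
   "crd (pt p u) (2 * i' + k) * F (2 * j + l) (crd (pt p u)) \<noteq> crd (pt p u) (2 * j + k) * F (2 * i' + l) (crd (pt p u))"
   by blast
  have "crd (pt p u) (2 * i' + k) * F (2 * j + l) (crd (pt p u)) = crd (pt p u) (2 * j + k) * F (2 * i' + l) (crd (pt p u))"
   by (rule base_relation[where F = F and ?i0.0 = i]) (simp_all add: p(2,3) kl pt_in[OF p(1)])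
  thus False using p(4) by simp
 qed
 hence gen: "\<forall>\<^sub>S r. \<forall>i j k l. k < 2 --> l < 2 -->
   crd r (2 * i + k) * F (2 * j + l) (crd r) = crd r (2 * j + k) * F (2 * i + l) (crd r)"
  using S.generic_in by (auto elim!: eventually_mono)
 obtain p1 u1 w1 where p1: "p1 \<in> C" "fmap F (pt p1 u1) = pt p1 w1" "F i (crd (pt p1 u1)) \<noteq> 0"
  using meets[of "\<lambda>_. True"] by auto
 obtain i1 where i1: "crd p1 i1 \<noteq> 0" by (rule rep_point_coord)
 have U1z: "U1 i1 (crd (pt q w)) = 0 \<longleftrightarrow> crd q i1 = 0" for q w
  unfolding hp_pt_zero_iff[OF hp_U(2)] by (simp add: U_sq)
 have hU: "hp (Suc 0 * e) (\<lambda>z. U0 i1 (\<lambda>i. F i z))" "hp (Suc 0 * e) (\<lambda>z. U1 i1 (\<lambda>i. F i z))"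
  by (rule hp_subst[OF _ F(2)[rule_format]], rule hp_U)+
 have u1nz: "U1 i1 (\<lambda>i. F i (crd (pt p1 u1))) \<noteq> 0"
  using hp_fmap_zero_iff[OF hp_U(2), of F i "pt p1 u1" i1] p1(2,3) U1z[of p1 w1] i1 by simp
 have Un: "\<forall>\<^sub>S r. U1 i1 (\<lambda>i. F i (crd r)) \<noteq> 0"
  by (rule S.generic_nonzero[OF hU(2) pt_in[OF p1(1)] u1nz])
 define g where "g r = U0 i1 (\<lambda>i. F i (crd r)) / U1 i1 (\<lambda>i. F i (crd r))" for r
 have "rat_germ S g" unfolding g_def[abs_def] by (rule S.rat_germ_quotient[OF hU pt_in[OF p1(1)] u1nz])
 moreover have "\<forall>\<^sub>S s. \<phi> t s = Some (pt (base_pt s) (g s))"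
  using F(4) Fi Un S.generic_in
 proof eventually_elim
  case (elim s)
  have fS: "fmap F s \<in> S" using elim(1) ran by (auto simp: ran_def)
  have bs: "base_pt (fmap F s) = base_pt s" by (rule base_from_relation[OF F(2) gen elim(4) elim(2) fS])
  have "U1 i1 (crd (fmap F s)) \<noteq> 0" using hp_fmap_zero_iff[OF hp_U(2), of F i s i1] elim(2,3) by simp
  from U1_nonzero_pt[OF fS this] obtain q w where q: "q \<in> C" "fmap F s = pt q w" by metis
  have qi: "crd q i1 \<noteq> 0" using \<open>U1 i1 (crd (fmap F s)) \<noteq> 0\<close> q(2) U1z by simp
  obtain k where k: "k \<noteq> 0" "crd (fmap F s) = (\<lambda>i. k * F i (crd s))" using fmap_rep[of F] elim(2) .
  have "w = U0 i1 (crd (pt q w)) / U1 i1 (crd (pt q w))"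
   unfolding hp_pt_quotient[OF hp_U] using qi by (simp add: U_sq)
  also have "\<dots> = g s" unfolding q(2)[symmetric] k(2) g_def hp_scale[OF hp_U(1)] hp_scale[OF hp_U(2)] using k(1) by simp
  finally show ?case using elim(1) q bs by simp
 qed
 ultimately show ?thesis by blast
qed

text \<open>On almost every fibre the birational inverse is defined at the images of all but
  finitely many points, so the rational function induced on the fibre is injective there, and
  \<open>injective_rational_moebius\<close> applies.\<close>

lemma fibre_map_moebius:
 assumes g: "rat_germ S g" and f: "\<forall>\<^sub>S s. f s = Some (pt (base_pt s) (g s))"
  and \<psi>: "map_ext S (\<psi> \<circ>\<^sub>m f) = id_map S"
 shows "\<exists>R. eventually R (generic S) \<and> (\<forall>\<^sub>C p. moebius_on (\<lambda>u. R (pt p u)) (\<lambda>u. g (pt p u)))"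
proof -
 obtain d F G where F: "hp d F" "hp d G"
  "\<forall>\<^sub>S q. G (crd q) \<noteq> 0 \<and> g q = F (crd q) / G (crd q)"
  using g unfolding rat_germ_def by blast
 let ?R = "\<lambda>q. G (crd q) \<noteq> 0 \<and> g q = F (crd q) / G (crd q)"
 have "\<forall>\<^sub>S s. ?R s \<and> f s = Some (pt (base_pt s) (g s)) \<and> (\<psi> \<circ>\<^sub>m f) s = Some s"
  using F(3) f S.map_ext_id_generic[OF \<psi>] by eventually_elim simp
 from generic_fibre[OF this]
 have "\<forall>\<^sub>C p. moebius_on (\<lambda>u. ?R (pt p u)) (\<lambda>u. g (pt p u))"
 proof eventually_elim
  case (elim p)
  define Z where "Z = {u. \<not> (?R (pt p u) \<and> f (pt p u) = Some (pt (base_pt (pt p u)) (g (pt p u))) \<and> (\<psi> \<circ>\<^sub>m f) (pt p u) = Some (pt p u))}"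
  have Z: "finite Z" unfolding Z_def by (rule elim)
  obtain P where P: "\<And>u. F (sq (crd p) u 1) = poly P u" using hp_sq_poly[OF F(1)] by blast
  obtain Q where Q: "\<And>u. G (sq (crd p) u 1) = poly Q u" using hp_sq_poly[OF F(2)] by blast
  have GQ: "G (crd (pt p u)) = 0 \<longleftrightarrow> poly Q u = 0" for u unfolding hp_pt_zero_iff[OF F(2)] Q ..
  have FG: "F (crd (pt p u)) / G (crd (pt p u)) = poly P u / poly Q u" for u
   unfolding hp_pt_quotient[OF F(1,2)] P Q ..
  have "inj_on (\<lambda>u. poly P u / poly Q u) (- Z)"
  proof (rule inj_onI)
   fix u w assume u: "u \<in> - Z" and w: "w \<in> - Z" and e: "poly P u / poly Q u = poly P w / poly Q w"
   have gg: "g (pt p u) = g (pt p w)" using u w e FG by (auto simp: Z_def)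
   have "(\<psi> \<circ>\<^sub>m f) (pt p u) = (\<psi> \<circ>\<^sub>m f) (pt p w)" using u w gg by (simp add: Z_def map_comp_def)
   hence "Some (pt p u) = Some (pt p w)" using u w by (simp add: Z_def)
   thus "u = w" by simp
  qed
  moreover have "poly Q u \<noteq> 0" if "u \<notin> Z" for u using that GQ by (auto simp: Z_def)
  ultimately have "moebius_on (\<lambda>u. poly Q u \<noteq> 0) (\<lambda>u. poly P u / poly Q u)"
   by (intro injective_rational_moebius[OF Z])
  thus ?case by (rule moebius_on_mono) (simp add: GQ FG)
 qed
 thus ?thesis using F(3) by blast
qed

text \<open>The first application of \<open>g\<close> could lead into the exceptional set of the
  second. As \<open>g\<close> is injective on the fibre, only finitely many points are sent into a
  finite set.\<close>

lemma fibre_map_iterate: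
 assumes C: "smooth_projective_curve n C"
  and f: "\<forall>\<^sub>S s. f s = Some (pt (base_pt s) (g s))"
  and h: "\<forall>\<^sub>S s. h s = Some (pt (base_pt s) (k s))" "rational_map S S h" "h = map_ext S (f \<circ>\<^sub>m f)"
  and R: "eventually R (generic S)" "\<forall>\<^sub>C p. moebius_on (\<lambda>u. R (pt p u)) (\<lambda>u. g (pt p u))"
 shows "\<forall>\<^sub>F p in coc C. \<forall>\<^sub>F u in coc UNIV. k (pt p u) = g (pt p (g (pt p u)))"
proof (rule generic_coc[OF C])
 have "dom h \<noteq> {}" using h(2) by (simp add: rational_map_def)
 then obtain s0 q0 where "h s0 = Some q0" by blast
 hence "\<forall>\<^sub>S s. h s = (f \<circ>\<^sub>m f) s" using S.map_ext_generic[of "f \<circ>\<^sub>m f" s0 q0] h(3) by (auto elim!: eventually_mono)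
 hence "\<forall>\<^sub>S s. R s \<and> f s = Some (pt (base_pt s) (g s)) \<and> (f \<circ>\<^sub>m f) s = Some (pt (base_pt s) (k s))"
  using R(1) f h(1) by eventually_elim simp
 from generic_fibre[OF this] generic_fibre[OF f] R(2)
 show "\<forall>\<^sub>C p. \<forall>\<^sub>F u in coc UNIV. k (pt p u) = g (pt p (g (pt p u)))"
 proof eventually_elim
  case (elim p)
  define Z1 where "Z1 = {u. \<not> (R (pt p u) \<and> f (pt p u) = Some (pt (base_pt (pt p u)) (g (pt p u))) \<and> (f \<circ>\<^sub>m f) (pt p u) = Some (pt (base_pt (pt p u)) (k (pt p u))))}"
  define Z2 where "Z2 = {u. \<not> f (pt p u) = Some (pt (base_pt (pt p u)) (g (pt p u)))}"
  have "inj_on (\<lambda>u. g (pt p u)) {u. R (pt p u)}" by (rule moebius_on_inj[OF elim(3)])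
  hence "finite (Z1 \<union> ((\<lambda>u. g (pt p u)) -` Z2 \<inter> {u. R (pt p u)}))"
   using finite_vimage_IntI[of Z2 "\<lambda>u. g (pt p u)" "{u. R (pt p u)}"] elim(1,2) unfolding Z1_def Z2_def by simp
  moreover have "{u\<in>UNIV. k (pt p u) \<noteq> g (pt p (g (pt p u)))} \<subseteq> Z1 \<union> ((\<lambda>u. g (pt p u)) -` Z2 \<inter> {u. R (pt p u)})"
  proof
   fix u assume u: "u \<in> {u\<in>UNIV. k (pt p u) \<noteq> g (pt p (g (pt p u)))}"
   show "u \<in> Z1 \<union> ((\<lambda>u. g (pt p u)) -` Z2 \<inter> {u. R (pt p u)})"
   proof (rule ccontr)
    assume n: "u \<notin> Z1 \<union> ((\<lambda>u. g (pt p u)) -` Z2 \<inter> {u. R (pt p u)})"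
    hence a: "f (pt p u) = Some (pt p (g (pt p u)))" "(f \<circ>\<^sub>m f) (pt p u) = Some (pt p (k (pt p u)))" "R (pt p u)"
     by (auto simp: Z1_def)
    hence "f (pt p (g (pt p u))) = Some (pt p (g (pt p (g (pt p u)))))" using n by (auto simp: Z2_def)
    hence "(f \<circ>\<^sub>m f) (pt p u) = Some (pt p (g (pt p (g (pt p u)))))" using a(1) by (simp add: map_comp_def)
    thus False using a(2) u by simp
   qed
  qed
  ultimately have "finite {u\<in>UNIV. k (pt p u) \<noteq> g (pt p (g (pt p u)))}" by (rule finite_subset[rotated])
  thus ?case by (rule finite_coc)
 qed
qed

end

section \<open>Fields whose flow consists of Moebius transformations\<close>

text \<open>The hypothesis \<open>h\<close> is the derivative of the cross-ratio identity for four
  points \<open>u1, ..., u4\<close> moving with velocities \<open>v1, ..., v4\<close>. Solved for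
  \<open>v4\<close>, it is Lagrange interpolation, hence quadratic in \<open>u4\<close>.\<close>

lemma lagrange_from_cross_ratio:
 fixes u1 u2 u3 u4 v1 v2 v3 v4 :: complex
 assumes d: "u1 \<noteq> u2" "u1 \<noteq> u3" "u2 \<noteq> u3"
  and h: "((v1 - v2) * (u3 - u4) + (v3 - v4) * (u1 - u2)) * ((u1 - u3) * (u2 - u4)) =
   ((v1 - v3) * (u2 - u4) + (v2 - v4) * (u1 - u3)) * ((u1 - u2) * (u3 - u4))"
 shows "v4 = v1 * ((u4 - u2) * (u4 - u3) / ((u1 - u2) * (u1 - u3))) + v2 * ((u4 - u1) * (u4 - u3) / ((u2 - u1) * (u2 - u3))) +
  v3 * ((u4 - u1) * (u4 - u2) / ((u3 - u1) * (u3 - u2)))"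
proof -
 have "v4 * ((u1 - u2) * (u1 - u3) * (u2 - u3)) = v1 * ((u2 - u3) * ((u4 - u2) * (u4 - u3))) -
  v2 * ((u1 - u3) * ((u4 - u1) * (u4 - u3))) + v3 * ((u1 - u2) * ((u4 - u1) * (u4 - u2)))"
  using h by (simp add: algebra_simps)
 hence e: "v4 = (v1 * ((u2 - u3) * ((u4 - u2) * (u4 - u3))) -
  v2 * ((u1 - u3) * ((u4 - u1) * (u4 - u3))) + v3 * ((u1 - u2) * ((u4 - u1) * (u4 - u2)))) / ((u1 - u2) * (u1 - u3) * (u2 - u3))"
  using d by (simp add: nonzero_eq_divide_eq)
 have 1: "(u2 - u3) * x / ((u1 - u2) * (u1 - u3) * (u2 - u3)) = x / ((u1 - u2) * (u1 - u3))" for x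
  using d by simp
 have 2: "(u1 - u3) * x / ((u1 - u2) * (u1 - u3) * (u2 - u3)) = - (x / ((u2 - u1) * (u2 - u3)))" for x
 proof -
  have "(u1 - u3) * x / ((u1 - u2) * (u1 - u3) * (u2 - u3)) = x / ((u1 - u2) * (u2 - u3))" using d by simp
  also have "(u1 - u2) * (u2 - u3) = - ((u2 - u1) * (u2 - u3))" by (simp add: algebra_simps)
  finally show ?thesis by (simp only: divide_minus_right)
 qed
 have 3: "(u1 - u2) * x / ((u1 - u2) * (u1 - u3) * (u2 - u3)) = x / ((u3 - u1) * (u3 - u2))" for x
 proof -
  have "(u1 - u2) * x / ((u1 - u2) * (u1 - u3) * (u2 - u3)) = x / ((u1 - u3) * (u2 - u3))" using d by simp
  also have "(u1 - u3) * (u2 - u3) = (u3 - u1) * (u3 - u2)" by (simp add: algebra_simps)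
  finally show ?thesis .
 qed
 have "v4 = v1 * ((u2 - u3) * ((u4 - u2) * (u4 - u3)) / ((u1 - u2) * (u1 - u3) * (u2 - u3))) -
  v2 * ((u1 - u3) * ((u4 - u1) * (u4 - u3)) / ((u1 - u2) * (u1 - u3) * (u2 - u3))) +
  v3 * ((u1 - u2) * ((u4 - u1) * (u4 - u2)) / ((u1 - u2) * (u1 - u3) * (u2 - u3)))"
  using e by (simp only: add_divide_distrib diff_divide_distrib times_divide_eq_right)
 thus ?thesis unfolding 1 2 3 by (simp only: mult_minus_right diff_minus_eq_add)
qed

text \<open>
 Conditions that hold for all points outside countably many proper closed subsets are collected
 in \<open>G\<close>; the times \<open>e / 2 ^ k\<close> tend to \<open>0\<close>, and the time \<open>e / 2 ^ k\<close> map is \<open>g k\<close> in the fibre coordinate.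
\<close>

locale fibre_flow = ruled_surface +
 fixes n :: nat and v :: "point => complex" and e :: real and g :: "nat => point => complex" and G :: "point => bool"
 assumes curve: "smooth_projective_curve n C" and v: "rat_germ S v" and e: "0 < e" and g: "rat_germ S (g k)"
  and G_fibre: "\<forall>\<^sub>F p in coc C. \<forall>\<^sub>F u in coc UNIV. G (pt p u)"
  and G_section: "\<forall>\<^sub>F u in coc UNIV. \<forall>\<^sub>F p in coc C. G (pt p u)"
  and G_flow: "p \<in> C ==> G (pt p u) ==> regular_at S v (pt p u) (v (pt p u)) \<and>
   (\<exists>r>0. \<exists>\<eta>. \<eta> 0 = u \<and> (\<forall>t\<in>ball 0 r. \<exists>w. regular_at S v (pt p (\<eta> t)) w \<and> (DERIV (\<eta>) t :> w)) \<and>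
    (\<forall>k. of_real (e / 2 ^ k) \<in> ball (0 :: complex) r --> g k (pt p u) = \<eta> (of_real (e / 2 ^ k))))"
  and G_moebius: "\<forall>\<^sub>F p in coc C. \<forall>k. moebius_on (\<lambda>u. G (pt p u)) (\<lambda>u. g k (pt p u))"
  and g_double: "\<forall>\<^sub>F p in coc C. \<forall>k. \<forall>\<^sub>F u in coc UNIV. g k (pt p u) = g (Suc k) (pt p (g (Suc k) (pt p u)))"
begin

definition \<tau> :: "nat => complex" where "\<tau> k = of_real (e / 2 ^ k)"

lemma tau_double: "\<tau> k = \<tau> (Suc k) + \<tau> (Suc k)"
proof -
 have "e / 2 ^ k = e / 2 ^ Suc k + e / 2 ^ Suc k" by simp
 thus ?thesis unfolding \<tau>_def by (simp only: of_real_add)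
qed

lemma tau_nonzero: "\<tau> k \<noteq> 0"
 using e by (simp add: \<tau>_def)

lemma tau_tendsto: "\<tau> \<longlonglongrightarrow> 0"
proof -
 have "(\<lambda>k. e * (1 / 2) ^ k) \<longlonglongrightarrow> e * 0" by (intro tendsto_mult_left LIMSEQ_power_zero) simp
 hence "(\<lambda>k. of_real (e * (1 / 2) ^ k) :: complex) \<longlonglongrightarrow> of_real 0" by (intro tendsto_of_real) simp
 thus ?thesis by (simp add: \<tau>_def[abs_def] power_divide)
qed

lemma tau_ball: "r > 0 ==> \<forall>\<^sub>F k in sequentially. \<tau> k \<in> ball 0 r"
 using tau_tendsto unfolding tendsto_iff by (auto simp: dist_commute)

text \<open>Four integral curves are moved by the same Moebius transformation at each time
  \<open>\<tau> k\<close>, so for large \<open>k\<close> they satisfy the cross-ratio identity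
  there. Such times accumulate at \<open>0\<close>, so the derivative of the identity vanishes at
  \<open>0\<close>.\<close>

lemma flow_quadratic:
 assumes p: "p \<in> C" and M: "\<And>k. moebius_on (\<lambda>u. G (pt p u)) (\<lambda>u. g k (pt p u))"
  and u: "G (pt p u1)" "G (pt p u2)" "G (pt p u3)" "G (pt p u4)" and d: "u1 \<noteq> u2" "u1 \<noteq> u3" "u2 \<noteq> u3"
 shows "v (pt p u4) = v (pt p u1) * ((u4 - u2) * (u4 - u3) / ((u1 - u2) * (u1 - u3))) +
  v (pt p u2) * ((u4 - u1) * (u4 - u3) / ((u2 - u1) * (u2 - u3))) +
  v (pt p u3) * ((u4 - u1) * (u4 - u2) / ((u3 - u1) * (u3 - u2)))"
proof -
 have fl: "\<exists>r \<eta>. r > 0 \<and> \<eta> 0 = u \<and> (DERIV (\<eta>) 0 :> v (pt p u)) \<and> (\<forall>k. \<tau> k \<in> ball 0 r --> g k (pt p u) = \<eta> (\<tau> k))"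
  if Gu: "G (pt p u)" for u
 proof -
  obtain r \<eta> where r: "regular_at S v (pt p u) (v (pt p u))" "r > 0" "\<eta> 0 = u"
   "\<forall>t\<in>ball 0 r. \<exists>w. regular_at S v (pt p (\<eta> t)) w \<and> (DERIV (\<eta>) t :> w)"
   "\<forall>k. \<tau> k \<in> ball 0 r --> g k (pt p u) = \<eta> (\<tau> k)"
   using G_flow[OF p Gu] unfolding \<tau>_def by blast
  have "0 \<in> ball (0 :: complex) r" using r(2) by simp
  then obtain w where w: "regular_at S v (pt p (\<eta> 0)) w" "DERIV (\<eta>) 0 :> w" using r(4) by blast
  have "w = v (pt p u)" using S.regular_at_unique[OF w(1)[unfolded r(3)] r(1)] .
  thus ?thesis using r w by blast
 qed
 obtain r1 \<eta>1 where 1: "r1 > 0" "\<eta>1 0 = u1" "DERIV (\<eta>1) 0 :> v (pt p u1)" "\<forall>k. \<tau> k \<in> ball 0 r1 --> g k (pt p u1) = \<eta>1 (\<tau> k)"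
  using fl[OF u(1)] by blast
 obtain r2 \<eta>2 where 2: "r2 > 0" "\<eta>2 0 = u2" "DERIV (\<eta>2) 0 :> v (pt p u2)" "\<forall>k. \<tau> k \<in> ball 0 r2 --> g k (pt p u2) = \<eta>2 (\<tau> k)"
  using fl[OF u(2)] by blast
 obtain r3 \<eta>3 where 3: "r3 > 0" "\<eta>3 0 = u3" "DERIV (\<eta>3) 0 :> v (pt p u3)" "\<forall>k. \<tau> k \<in> ball 0 r3 --> g k (pt p u3) = \<eta>3 (\<tau> k)"
  using fl[OF u(3)] by blast
 obtain r4 \<eta>4 where 4: "r4 > 0" "\<eta>4 0 = u4" "DERIV (\<eta>4) 0 :> v (pt p u4)" "\<forall>k. \<tau> k \<in> ball 0 r4 --> g k (pt p u4) = \<eta>4 (\<tau> k)"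
  using fl[OF u(4)] by blast
 \<comment> \<open>The defect of the cross-ratio identity between the curves at time
   \<open>t\<close> and their initial points.\<close>
 define H where "H t = (\<eta>1 t - \<eta>2 t) * (\<eta>3 t - \<eta>4 t) * ((u1 - u3) * (u2 - u4)) - (\<eta>1 t - \<eta>3 t) * (\<eta>2 t - \<eta>4 t) * ((u1 - u2) * (u3 - u4))" for t
 have dH: "DERIV H 0 :> ((v (pt p u1) - v (pt p u2)) * (\<eta>3 0 - \<eta>4 0) + (v (pt p u3) - v (pt p u4)) * (\<eta>1 0 - \<eta>2 0)) * ((u1 - u3) * (u2 - u4)) -
   ((v (pt p u1) - v (pt p u3)) * (\<eta>2 0 - \<eta>4 0) + (v (pt p u2) - v (pt p u4)) * (\<eta>1 0 - \<eta>3 0)) * ((u1 - u2) * (u3 - u4))"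
  unfolding H_def[abs_def]
  by (rule DERIV_diff; rule DERIV_cmult_right; rule DERIV_mult; rule DERIV_diff; rule 1 2 3 4)
 have Hz: "H (\<tau> k) = 0" if k: "\<tau> k \<in> ball 0 r1" "\<tau> k \<in> ball 0 r2" "\<tau> k \<in> ball 0 r3" "\<tau> k \<in> ball 0 r4" for k
 proof -
  obtain A B C' D where A: "\<And>u. G (pt p u) ==> C' * u + D \<noteq> 0 \<and> g k (pt p u) = (A * u + B) / (C' * u + D)"
   using M[of k] unfolding moebius_on_def by blast
  define U where "U i = (if i = 1 then u1 else if i = 2 then u2 else if i = 3 then u3 else u4)" for i :: nat
  have GU: "G (pt p (U i))" for i using u by (simp add: U_def)
  have U: "U 1 = u1" "U 2 = u2" "U 3 = u3" "U 4 = u4" by (simp_all add: U_def)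
  have "C' * U i + D \<noteq> 0 \<and> g k (pt p (U i)) = (A * U i + B) / (C' * U i + D)" for i using A[OF GU] .
  hence "(g k (pt p (U 1)) - g k (pt p (U 2))) * (g k (pt p (U 3)) - g k (pt p (U 4))) * ((U 1 - U 3) * (U 2 - U 4)) =
   (g k (pt p (U 1)) - g k (pt p (U 3))) * (g k (pt p (U 2)) - g k (pt p (U 4))) * ((U 1 - U 2) * (U 3 - U 4))"
   by (intro moebius_cross[where C = C' and D = D and A = A and B = B and x = "\<lambda>i. g k (pt p (U i))" and u = U])
  thus ?thesis unfolding U H_def using 1(4) 2(4) 3(4) 4(4) k by simp
 qed
 have "\<forall>\<^sub>F k in sequentially. H (\<tau> k) = 0"
  using tau_ball[OF 1(1)] tau_ball[OF 2(1)] tau_ball[OF 3(1)] tau_ball[OF 4(1)] by eventually_elim (rule Hz)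
 from derivative_zero_of_sequence[OF dH tau_tendsto tau_nonzero this]
 have "((v (pt p u1) - v (pt p u2)) * (u3 - u4) + (v (pt p u3) - v (pt p u4)) * (u1 - u2)) * ((u1 - u3) * (u2 - u4)) -
   ((v (pt p u1) - v (pt p u3)) * (u2 - u4) + (v (pt p u2) - v (pt p u4)) * (u1 - u3)) * ((u1 - u2) * (u3 - u4)) = 0"
  by (simp add: H_def 1(2) 2(2) 3(2) 4(2))
 hence "((v (pt p u1) - v (pt p u2)) * (u3 - u4) + (v (pt p u3) - v (pt p u4)) * (u1 - u2)) * ((u1 - u3) * (u2 - u4)) =
   ((v (pt p u1) - v (pt p u3)) * (u2 - u4) + (v (pt p u2) - v (pt p u4)) * (u1 - u3)) * ((u1 - u2) * (u3 - u4))"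
  by (simp only: right_minus_eq)
 thus ?thesis by (rule lagrange_from_cross_ratio[OF d])
qed

lemma riccati_form:
 obtains a b c where "rat_germ C a" "rat_germ C b" "rat_germ C c" "\<forall>\<^sub>S s. v s = ric a b c s"
proof -
 obtain u1 u2 u3 where u: "(\<forall>\<^sub>F p in coc C. G (pt p u1)) \<and> rat_germ C (\<lambda>p. v (pt p u1))"
  "(\<forall>\<^sub>F p in coc C. G (pt p u2)) \<and> rat_germ C (\<lambda>p. v (pt p u2))"
  "(\<forall>\<^sub>F p in coc C. G (pt p u3)) \<and> rat_germ C (\<lambda>p. v (pt p u3))"
  and d: "u1 \<noteq> u2" "u1 \<noteq> u3" "u2 \<noteq> u3"
  by (rule coc_distinct3[OF eventually_conj[OF G_section rat_germ_section[OF v]]])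
 \<comment> \<open>Normalising factors of the Lagrange polynomials through \<open>u1\<close>,
   \<open>u2\<close>, \<open>u3\<close>. Expanded in powers of the fibre coordinate, these
   polynomials give \<open>a\<close>, \<open>2 b\<close> and \<open>c\<close>, whence the halves in
   \<open>b\<close>.\<close>
 define l1 l2 l3 where "l1 = 1 / ((u1 - u2) * (u1 - u3))" and "l2 = 1 / ((u2 - u1) * (u2 - u3))" and "l3 = 1 / ((u3 - u1) * (u3 - u2))"
 define a where "a p = l1 * v (pt p u1) + l2 * v (pt p u2) + l3 * v (pt p u3)" for p
 define b where "b p = - (l1 * (u2 + u3) / 2) * v (pt p u1) + - (l2 * (u1 + u3) / 2) * v (pt p u2) + - (l3 * (u1 + u2) / 2) * v (pt p u3)" for p
 define c where "c p = (l1 * (u2 * u3)) * v (pt p u1) + (l2 * (u1 * u3)) * v (pt p u2) + (l3 * (u1 * u2)) * v (pt p u3)" for p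
 have abc: "rat_germ C a" "rat_germ C b" "rat_germ C c"
  unfolding a_def[abs_def] b_def[abs_def] c_def[abs_def]
  by (intro C.rat_germ_add C.rat_germ_mult C.rat_germ_const u[THEN conjunct2])+
 have quad: "v (pt p u4) = ric a b c (pt p u4)"
  if "v (pt p u4) = v (pt p u1) * ((u4 - u2) * (u4 - u3) / ((u1 - u2) * (u1 - u3))) +
   v (pt p u2) * ((u4 - u1) * (u4 - u3) / ((u2 - u1) * (u2 - u3))) +
   v (pt p u3) * ((u4 - u1) * (u4 - u2) / ((u3 - u1) * (u3 - u2)))" for p u4
 proof -
  have x: "x / ((u1 - u2) * (u1 - u3)) = l1 * x" "x / ((u2 - u1) * (u2 - u3)) = l2 * x" "x / ((u3 - u1) * (u3 - u2)) = l3 * x" for x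
   by (simp_all add: l1_def l2_def l3_def)
  show ?thesis unfolding that x ric_def a_def b_def c_def base_pt_pt yc_pt by (simp add: field_simps)
 qed
 have "\<forall>\<^sub>S s. v s - ric a b c s = 0"
 proof (rule rat_germ_fibrewise_zero[OF curve S.rat_germ_diff[OF v rat_germ_ric[OF abc]]])
  show "\<forall>\<^sub>F p in coc C. \<forall>\<^sub>F u in coc UNIV. v (pt p u) - ric a b c (pt p u) = 0"
   using coc_in u(1)[THEN conjunct1] u(2)[THEN conjunct1] u(3)[THEN conjunct1] G_moebius G_fibre
  proof eventually_elim
   case (elim p)
   note E = elim
   from elim(6) show ?case
   proof eventually_elim
    case (elim u)
    have "v (pt p u) = ric a b c (pt p u)"
     by (rule quad, rule flow_quadratic[OF E(1) _ E(2-4) elim d], rule spec[OF E(5)])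
    thus ?case by simp
   qed
  qed
 qed
 hence "\<forall>\<^sub>S s. v s = ric a b c s" by eventually_elim simp
 thus thesis using that abc by blast
qed

end

context ruled_surface
begin

lemma regular_at_ric:
 assumes "regular_at C a p a'" "regular_at C b p b'" "regular_at C c p c'"
 shows "regular_at S (ric a b c) (pt p w) (a' * (w * w) + 2 * b' * w + c')"
proof -
 have p: "p \<in> C" using assms(1) by (simp add: regular_at_def)
 note b = regular_at_base[OF _ pt_in[OF p] base_pt_pt]
 have y: "regular_at S yc (pt p w) w" using regular_at_yc[OF p, of 1 w] by (simp add: pt_def)
 show ?thesis unfolding ric_def[abs_def]
  by (intro S.regular_at_add S.regular_at_mult S.regular_at_const b assms y pt_in p)
qed

end

text \<open>Numerator and denominator of the time \<open>t\<close> map of \<open>(a u\<^sup>2 + 2 b u + c) \<partial>\<^sub>u\<close> when \<open>\<kappa>\<^sup>2 = b\<^sup>2 - a c\<close>.\<close>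

definition rnum :: "complex => complex => complex => complex => complex => complex" where
 "rnum b c \<kappa> t u = (ck \<kappa> t + sk \<kappa> t * b) * u + sk \<kappa> t * c"

definition rden :: "complex => complex => complex => complex => complex => complex" where
 "rden a b \<kappa> t u = (- (sk \<kappa> t * a)) * u + (ck \<kappa> t - sk \<kappa> t * b)"

lemma rnum_rden_deriv:
 assumes "\<kappa>\<^sup>2 = b * b - a * c"
 shows "DERIV (\<lambda>t. rnum b c \<kappa> t u) t :> b * rnum b c \<kappa> t u + c * rden a b \<kappa> t u"
  "DERIV (\<lambda>t. rden a b \<kappa> t u) t :> - (a * rnum b c \<kappa> t u) - b * rden a b \<kappa> t u"
proof -
 have "DERIV (\<lambda>t. rnum b c \<kappa> t u) t :> (\<kappa>\<^sup>2 * sk \<kappa> t + ck \<kappa> t * b) * u + ck \<kappa> t * c"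
  unfolding rnum_def by (intro DERIV_add DERIV_cmult_right ck_sk_deriv)
 moreover have "(\<kappa>\<^sup>2 * sk \<kappa> t + ck \<kappa> t * b) * u + ck \<kappa> t * c = b * rnum b c \<kappa> t u + c * rden a b \<kappa> t u"
  unfolding assms rnum_def rden_def by (simp add: algebra_simps)
 ultimately show "DERIV (\<lambda>t. rnum b c \<kappa> t u) t :> b * rnum b c \<kappa> t u + c * rden a b \<kappa> t u" by simp
 have "DERIV (\<lambda>t. rden a b \<kappa> t u) t :> (- (ck \<kappa> t * a)) * u + (\<kappa>\<^sup>2 * sk \<kappa> t - ck \<kappa> t * b)"
  unfolding rden_def by (intro DERIV_add DERIV_diff DERIV_minus DERIV_cmult_right ck_sk_deriv)
 moreover have "(- (ck \<kappa> t * a)) * u + (\<kappa>\<^sup>2 * sk \<kappa> t - ck \<kappa> t * b) = - (a * rnum b c \<kappa> t u) - b * rden a b \<kappa> t u"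
  unfolding assms rnum_def rden_def by (simp add: algebra_simps)
 ultimately show "DERIV (\<lambda>t. rden a b \<kappa> t u) t :> - (a * rnum b c \<kappa> t u) - b * rden a b \<kappa> t u" by simp
qed

lemma rnum_rden_0 [simp]: "rnum b c \<kappa> 0 u = u" "rden a b \<kappa> 0 u = 1"
 by (simp_all add: rnum_def rden_def)

lemma rnum_rden_add:
 assumes "\<kappa>\<^sup>2 = b * b - a * c"
 shows "(ck \<kappa> s + sk \<kappa> s * b) * rnum b c \<kappa> t u + sk \<kappa> s * c * rden a b \<kappa> t u = rnum b c \<kappa> (s + t) u"
  "(- (sk \<kappa> s * a)) * rnum b c \<kappa> t u + (ck \<kappa> s - sk \<kappa> s * b) * rden a b \<kappa> t u = rden a b \<kappa> (s + t) u"
 unfolding rnum_def rden_def ck_sk_add assms by (simp_all add: algebra_simps)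

text \<open>The defect \<open>L\<close> of the cross-multiplied formula satisfies the linear
  equation \<open>L' = (a \<eta> + b) L\<close> with \<open>L 0 = 0\<close>. Cross-multiplication
  makes the argument independent of zeros of the denominator.\<close>

lemma riccati_solution:
 assumes k: "\<kappa>\<^sup>2 = b * b - a * c" and \<eta>0: "\<eta> 0 = u"
  and \<eta>: "\<And>t. t \<in> ball 0 r ==> (DERIV (\<eta>) t :> a * (\<eta> t * \<eta> t) + 2 * b * \<eta> t + c)"
  and t: "t \<in> ball 0 r"
 shows "\<eta> t * rden a b \<kappa> t u = rnum b c \<kappa> t u"
proof -
 define L where "L t = \<eta> t * rden a b \<kappa> t u - rnum b c \<kappa> t u" for t
 have hol: "\<eta> holomorphic_on ball 0 r"
  using \<eta> unfolding holomorphic_on_open[OF open_ball] by blast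
 have "DERIV L t :> (a * \<eta> t + b) * L t" if t: "t \<in> ball 0 r" for t
 proof -
  have "DERIV L t :> (a * (\<eta> t * \<eta> t) + 2 * b * \<eta> t + c) * rden a b \<kappa> t u +
   (- (a * rnum b c \<kappa> t u) - b * rden a b \<kappa> t u) * \<eta> t - (b * rnum b c \<kappa> t u + c * rden a b \<kappa> t u)"
   unfolding L_def[abs_def] by (intro DERIV_diff DERIV_mult \<eta>[OF t] rnum_rden_deriv[OF k])
  moreover have "(a * (\<eta> t * \<eta> t) + 2 * b * \<eta> t + c) * rden a b \<kappa> t u +
   (- (a * rnum b c \<kappa> t u) - b * rden a b \<kappa> t u) * \<eta> t - (b * rnum b c \<kappa> t u + c * rden a b \<kappa> t u) = (a * \<eta> t + b) * L t"
   unfolding L_def by (simp add: algebra_simps)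
  ultimately show ?thesis by simp
 qed
 moreover have "(\<lambda>t. a * \<eta> t + b) holomorphic_on ball 0 r" by (intro holomorphic_intros hol)
 ultimately have "L t = 0" using linear_ode_zero[of "\<lambda>t. a * \<eta> t + b" r L t] t \<eta>0 by (simp add: L_def)
 thus ?thesis by (simp add: L_def)
qed

context fibre_flow
begin

lemma explicit_flow_eventually:
 assumes p: "p \<in> C" and u: "G (pt p u)" and vr: "\<forall>\<^sub>S s. v s = ric a b c s"
  and reg: "regular_at C a p (a p)" "regular_at C b p (b p)" "regular_at C c p (c p)"
  and k: "\<kappa>\<^sup>2 = b p * b p - a p * c p"
 shows "\<exists>K. \<forall>k\<ge>K. g k (pt p u) * rden (a p) (b p) \<kappa> (\<tau> k) u = rnum (b p) (c p) \<kappa> (\<tau> k) u"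
proof -
 obtain r \<eta> where r: "r > 0" "\<eta> 0 = u"
  "\<forall>t\<in>ball 0 r. \<exists>w. regular_at S v (pt p (\<eta> t)) w \<and> (DERIV (\<eta>) t :> w)"
  "\<forall>k. \<tau> k \<in> ball 0 r --> g k (pt p u) = \<eta> (\<tau> k)"
  using G_flow[OF p u] unfolding \<tau>_def by blast
 have "DERIV (\<eta>) t :> a p * (\<eta> t * \<eta> t) + 2 * b p * \<eta> t + c p" if t: "t \<in> ball 0 r" for t
 proof -
  obtain w where w: "regular_at S v (pt p (\<eta> t)) w" "DERIV (\<eta>) t :> w" using r(3) t by blast
  have "w = a p * (\<eta> t * \<eta> t) + 2 * b p * \<eta> t + c p"
   by (rule S.regular_at_unique[OF S.regular_at_cong[OF vr w(1)] regular_at_ric[OF reg]])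
  thus ?thesis using w(2) by simp
 qed
 from riccati_solution[OF k r(2) this]
 have "g k (pt p u) * rden (a p) (b p) \<kappa> (\<tau> k) u = rnum (b p) (c p) \<kappa> (\<tau> k) u" if "\<tau> k \<in> ball 0 r" for k
  using r(4) that by simp
 thus ?thesis using tau_ball[OF r(1)] unfolding eventually_sequentially by blast
qed

text \<open>For each \<open>u\<close> the formula is known for large \<open>k\<close>. Uncountably
  many \<open>u\<close> share one bound \<open>K\<close>, and the Moebius property extends the
  formula from these to all good \<open>u\<close>, for \<open>k\<close> at least \<open>K\<close>.
  Descending induction then reaches every \<open>k\<close>, because the map for \<open>k\<close> is
  the square of the map for \<open>Suc k\<close>.\<close>

lemma explicit_flow:
 assumes p: "p \<in> C" and vr: "\<forall>\<^sub>S s. v s = ric a b c s"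
  and reg: "regular_at C a p (a p)" "regular_at C b p (b p)" "regular_at C c p (c p)"
  and k: "\<kappa>\<^sup>2 = b p * b p - a p * c p" and GF: "\<forall>\<^sub>F u in coc UNIV. G (pt p u)"
  and M: "\<forall>k. moebius_on (\<lambda>u. G (pt p u)) (\<lambda>u. g k (pt p u))"
  and dbl: "\<forall>k. \<forall>\<^sub>F u in coc UNIV. g k (pt p u) = g (Suc k) (pt p (g (Suc k) (pt p u)))"
 shows "G (pt p u) ==> g k (pt p u) * rden (a p) (b p) \<kappa> (\<tau> k) u = rnum (b p) (c p) \<kappa> (\<tau> k) u"
proof -
 define rel where "rel k u \<longleftrightarrow> g k (pt p u) * rden (a p) (b p) \<kappa> (\<tau> k) u = rnum (b p) (c p) \<kappa> (\<tau> k) u" for k u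
 \<comment> \<open>Cross-multiplied, the relation is a polynomial equation in \<open>u\<close> of
   degree at most \<open>2\<close>, so infinitely many solutions make it an identity.\<close>
 have all: "rel k u" if inf: "infinite {u. G (pt p u) \<and> rel k u}" and Gu: "G (pt p u)" for k u
 proof -
  obtain A B C' D where A: "\<And>u. G (pt p u) ==> C' * u + D \<noteq> 0 \<and> g k (pt p u) = (A * u + B) / (C' * u + D)"
   using M unfolding moebius_on_def by metis
  have iff: "rel k u \<longleftrightarrow> (A * u + B) * (- (sk \<kappa> (\<tau> k) * a p) * u + (ck \<kappa> (\<tau> k) - sk \<kappa> (\<tau> k) * b p)) =
   ((ck \<kappa> (\<tau> k) + sk \<kappa> (\<tau> k) * b p) * u + sk \<kappa> (\<tau> k) * c p) * (C' * u + D)" if "G (pt p u)" for u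
  proof -
   have "C' * u + D \<noteq> 0" "g k (pt p u) = (A * u + B) / (C' * u + D)" using A[OF that] by blast+
   thus ?thesis unfolding rel_def rnum_def rden_def by (simp only:) (simp add: divide_eq_eq)
  qed
  have "infinite {u. (A * u + B) * (- (sk \<kappa> (\<tau> k) * a p) * u + (ck \<kappa> (\<tau> k) - sk \<kappa> (\<tau> k) * b p)) =
   ((ck \<kappa> (\<tau> k) + sk \<kappa> (\<tau> k) * b p) * u + sk \<kappa> (\<tau> k) * c p) * (C' * u + D)}"
   by (rule infinite_super[OF _ inf]) (use iff in blast)
  from moebius_agree[OF this] show ?thesis using iff[OF Gu] by blast
 qed
 have unc: "uncountable {u. G (pt p u)}" using coc_infinite[OF GF uncountable_UNIV_complex] by simp
 define E where "E K = {u. G (pt p u) \<and> (\<forall>k\<ge>K. rel k u)}" for K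
 have "{u. G (pt p u)} \<subseteq> (\<Union>K. E K)"
  using explicit_flow_eventually[OF p _ vr reg k] by (auto simp: E_def rel_def)
 hence "\<not> countable (\<Union>K. E K)" using unc countable_subset by blast
 hence "\<exists>K. \<not> countable (E K)" by (rule contrapos_np) simp
 then obtain K where K: "infinite (E K)" using countable_finite by blast
 have large: "rel k u" if "k \<ge> K" "G (pt p u)" for k u
  by (rule all[OF infinite_super[OF _ K] that(2)]) (use that(1) in \<open>auto simp: E_def\<close>)
 have step: "rel k u" if IH: "\<And>u. G (pt p u) ==> rel (Suc k) u" and Gu: "G (pt p u)" for k u
 proof (rule all[OF _ Gu])
  define h where "h u = g (Suc k) (pt p u)" for u
  \<comment> \<open>The map for \<open>Suc k\<close> may send a good \<open>u\<close> to a fibre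
    coordinate where \<open>G\<close> fails; by injectivity this happens for countably many
    \<open>u\<close> only.\<close>
  define N where "N = {w\<in>UNIV. \<not> G (pt p w)}"
  have "countable N" using GF unfolding N_def eventually_coc .
  have injh: "inj_on h {u. G (pt p u)}"
   unfolding h_def by (rule moebius_on_inj) (use M in blast)
  have "countable {u. G (pt p u) \<and> h u \<in> N}"
  proof (rule countable_image_inj_on)
   show "countable (h ` {u. G (pt p u) \<and> h u \<in> N})"
    by (rule countable_subset[OF _ \<open>countable N\<close>]) auto
   show "inj_on h {u. G (pt p u) \<and> h u \<in> N}" by (rule inj_on_subset[OF injh]) auto
  qed
  hence "\<forall>\<^sub>F u in coc UNIV. \<not> (G (pt p u) \<and> h u \<in> N)" unfolding eventually_coc by simp
  with GF dbl[rule_format, of k] have "\<forall>\<^sub>F u in coc UNIV. G (pt p u) \<and> rel k u"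
  proof eventually_elim
   case (elim u)
   let ?t = "\<tau> (Suc k)"
   have Gw: "G (pt p (h u))" using elim by (auto simp: N_def)
   have r1: "h u * rden (a p) (b p) \<kappa> ?t u = rnum (b p) (c p) \<kappa> ?t u" using IH[OF elim(1)] by (simp add: rel_def h_def)
   have r2: "g k (pt p u) * rden (a p) (b p) \<kappa> ?t (h u) = rnum (b p) (c p) \<kappa> ?t (h u)"
    using IH[OF Gw] elim(2) by (simp add: rel_def h_def)
   have n: "rnum (b p) (c p) \<kappa> ?t (h u) * rden (a p) (b p) \<kappa> ?t u = rnum (b p) (c p) \<kappa> (\<tau> k) u"
    unfolding tau_double[of k] rnum_rden_add[OF k, symmetric] r1[symmetric] by (simp add: rnum_def algebra_simps)
   have d: "rden (a p) (b p) \<kappa> ?t (h u) * rden (a p) (b p) \<kappa> ?t u = rden (a p) (b p) \<kappa> (\<tau> k) u"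
    unfolding tau_double[of k] rnum_rden_add[OF k, symmetric] r1[symmetric] by (simp add: rden_def[of _ _ _ _ "h u"] algebra_simps)
   have "g k (pt p u) * rden (a p) (b p) \<kappa> (\<tau> k) u = rnum (b p) (c p) \<kappa> (\<tau> k) u"
    unfolding d[symmetric] n[symmetric] r2[symmetric] by simp
   thus ?case using elim by (simp add: rel_def)
  qed
  thus "infinite {u. G (pt p u) \<and> rel k u}" by (rule coc_UNIV_infinite)
 qed
 have "\<forall>u. G (pt p u) --> rel k u" for k
 proof (cases "k \<le> K")
  case True
  thus ?thesis
  proof (induction k rule: inc_induct)
   case base
   thus ?case using large by blast
  next
   case (step m)
   thus ?case using \<open>\<And>u k. (\<And>u. G (pt p u) ==> rel (Suc k) u) ==> G (pt p u) ==> rel k u\<close> by blast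
  qed
 qed (use large in auto)
 thus "G (pt p u) ==> g k (pt p u) * rden (a p) (b p) \<kappa> (\<tau> k) u = rnum (b p) (c p) \<kappa> (\<tau> k) u"
  by (simp add: rel_def)
qed

text \<open>For a fixed section \<open>u1\<close> its image \<open>K\<close> is a rational function
  on \<open>C\<close>. The explicit flow and the relation between \<open>ck\<close> and
  \<open>sk\<close> express the square of \<open>sk\<close> by \<open>K\<close> and the
  coefficients, hence as a rational function \<open>r\<close>. A non-constant discriminant would
  take uncountably many values, so a relation between it and \<open>r\<close> would contradict
  \<open>sinh_algebraically_independent\<close>.\<close>

lemma discriminant_constant:
 assumes abc: "rat_germ C a" "rat_germ C b" "rat_germ C c" and vr: "\<forall>\<^sub>S s. v s = ric a b c s"
  and nz: "\<not> (\<forall>\<^sub>S s. v s = 0)"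
 shows "\<exists>d. \<forall>\<^sub>C p. b p * b p - a p * c p = d"
proof (rule ccontr)
 assume nc: "\<not> ?thesis"
 define \<Delta> where "\<Delta> p = b p * b p - a p * c p" for p
 have gD: "rat_germ C \<Delta>" unfolding \<Delta>_def[abs_def] by (intro C.rat_germ_diff C.rat_germ_mult abc)
 have vnz: "\<forall>\<^sub>S s. v s \<noteq> 0" using S.rat_germ_zero_or_nonzero[OF v] nz by blast
 have "\<forall>\<^sub>F u in coc UNIV. \<forall>\<^sub>C p. v (pt p u) \<noteq> 0 \<and> v (pt p u) = ric a b c (pt p u)"
  by (rule finite_coc) (use generic_section[OF eventually_conj[OF vnz vr]] in simp)
 \<comment> \<open>The section is chosen so that the field does not vanish along it; otherwise the
   flow would fix it and its image would carry no information.\<close>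
 from eventually_conj[OF this eventually_conj[OF G_section rat_germ_section[OF g[of 0]]]]
 obtain u1 where u1: "\<forall>\<^sub>C p. v (pt p u1) \<noteq> 0 \<and> v (pt p u1) = ric a b c (pt p u1)"
  "\<forall>\<^sub>F p in coc C. G (pt p u1)" "rat_germ C (\<lambda>p. g 0 (pt p u1))"
  using coc_ex[OF _ uncountable_UNIV_complex] by blast
 define K where "K p = g 0 (pt p u1)" for p
 \<comment> \<open>The flow formula for \<open>u1\<close> reads
   \<open>ck * (K - u1) = sk * E\<close>. Squaring it and inserting
   \<open>ck^2 = 1 + \<Delta> sk^2\<close> gives \<open>sk^2 * D1 = (K - u1)^2\<close>.\<close>
 define E where "E p = b p * u1 + c p + K p * (a p * u1 + b p)" for p
 define D1 where "D1 p = E p * E p - \<Delta> p * ((K p - u1) * (K p - u1))" for p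
 define r where "r p = (K p - u1) * (K p - u1) / D1 p" for p
 have gK: "rat_germ C K" unfolding K_def by (rule u1(3))
 have gE: "rat_germ C E" unfolding E_def[abs_def] by (intro C.rat_germ_add C.rat_germ_mult C.rat_germ_const abc gK)
 have gD1: "rat_germ C D1" unfolding D1_def[abs_def] by (intro C.rat_germ_diff C.rat_germ_mult C.rat_germ_const gE gD gK)
 have gr: "rat_germ C r" unfolding r_def[abs_def] by (intro C.rat_germ_divide C.rat_germ_mult C.rat_germ_diff C.rat_germ_const gK gD1)
 \<comment> \<open>A pointwise square root, with no continuity in \<open>p\<close>; this is harmless
   because only even expressions in it, such as the square of \<open>sk\<close>, are compared with
   rational functions.\<close>
 define \<kappa> where "\<kappa> p = csqrt (\<Delta> p)" for p
 have kap: "(\<kappa> p)\<^sup>2 = b p * b p - a p * c p" for p by (simp add: \<kappa>_def \<Delta>_def)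
 have sE: "\<forall>\<^sub>F p in coc C. (sk (\<kappa> p) (\<tau> 0))\<^sup>2 * D1 p = (K p - u1) * (K p - u1)"
  using coc_in generic_coc[OF curve C.rat_germ_regular[OF abc(1)]] generic_coc[OF curve C.rat_germ_regular[OF abc(2)]]
   generic_coc[OF curve C.rat_germ_regular[OF abc(3)]] G_fibre G_moebius g_double u1(2)
 proof eventually_elim
  case (elim p)
  let ?s = "sk (\<kappa> p) (\<tau> 0)" and ?c = "ck (\<kappa> p) (\<tau> 0)"
  have "K p * rden (a p) (b p) (\<kappa> p) (\<tau> 0) u1 = rnum (b p) (c p) (\<kappa> p) (\<tau> 0) u1"
   unfolding K_def by (rule explicit_flow[OF elim(1) vr elim(2-4) kap elim(5-8)])
  hence x: "?c * (K p - u1) = ?s * E p" by (simp add: rden_def rnum_def E_def algebra_simps)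
  have "(K p - u1) * (K p - u1) = (?c * ?c - (\<kappa> p)\<^sup>2 * (?s * ?s)) * ((K p - u1) * (K p - u1))"
   unfolding ck_sk_sq by simp
  also have "\<dots> = (?c * (K p - u1)) * (?c * (K p - u1)) - \<Delta> p * (?s * ?s) * ((K p - u1) * (K p - u1))"
   unfolding kap \<Delta>_def by (simp add: algebra_simps)
  also have "\<dots> = ?s\<^sup>2 * D1 p" unfolding x D1_def by (simp add: power2_eq_square algebra_simps)
  finally show ?case by simp
 qed
 have D1nz: "\<forall>\<^sub>C p. D1 p \<noteq> 0"
 proof (rule ccontr)
  assume "\<not> ?thesis"
  hence D0: "\<forall>\<^sub>C p. D1 p = 0" using C.rat_germ_zero_or_nonzero[OF gD1] by blast
  have "\<forall>\<^sub>F p in coc C. False"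
   using generic_coc[OF curve D0] generic_coc[OF curve u1(1)] sE
  proof eventually_elim
   case (elim p)
   hence k: "K p = u1" by simp
   have "E p = ric a b c (pt p u1)" unfolding E_def k ric_def by (simp add: algebra_simps)
   moreover have "E p = 0" using elim(1) unfolding D1_def k by simp
   ultimately show False using elim(2) by simp
  qed
  thus False using coc_ex[OF _ curve_uncountable[OF curve]] by blast
 qed
 have rs: "\<forall>\<^sub>F p in coc C. r p = (sk (\<kappa> p) (\<tau> 0))\<^sup>2"
  using sE generic_coc[OF curve D1nz] by eventually_elim (simp add: r_def divide_eq_eq)
 obtain PP :: "complex poly poly" where PP: "PP \<noteq> 0" "\<forall>\<^sub>C p. (\<Sum>i\<le>degree PP. poly (coeff PP i) (\<Delta> p) * r p ^ i) = 0"
  using curve_algebraic_dependence[OF curve gD gr] by blast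
 have Dnz: "\<forall>\<^sub>F p in coc C. \<Delta> p \<noteq> x" for x
 proof -
  have "rat_germ C (\<lambda>p. \<Delta> p - x)" by (intro C.rat_germ_diff gD C.rat_germ_const)
  from C.rat_germ_zero_or_nonzero[OF this] have "\<forall>\<^sub>C p. \<Delta> p - x \<noteq> 0"
   using nc unfolding \<Delta>_def by auto
  from generic_coc[OF curve this] show ?thesis by eventually_elim simp
 qed
 define Q where "Q = {p\<in>C. \<kappa> p \<noteq> 0 \<and> (\<Sum>i\<le>degree PP. poly (coeff PP i) ((\<kappa> p)\<^sup>2) * (sinh (\<kappa> p * \<tau> 0) / \<kappa> p) ^ (2 * i)) = 0}"
 have "\<forall>\<^sub>F p in coc C. \<kappa> p \<noteq> 0 \<and> (\<Sum>i\<le>degree PP. poly (coeff PP i) ((\<kappa> p)\<^sup>2) * (sinh (\<kappa> p * \<tau> 0) / \<kappa> p) ^ (2 * i)) = 0"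
  using rs generic_coc[OF curve PP(2)] Dnz[of 0]
 proof eventually_elim
  case (elim p)
  have k0: "\<kappa> p \<noteq> 0" using elim(3) by (simp add: \<kappa>_def)
  have "(\<kappa> p)\<^sup>2 = \<Delta> p" by (simp add: \<kappa>_def)
  hence "(\<Sum>i\<le>degree PP. poly (coeff PP i) ((\<kappa> p)\<^sup>2) * (sinh (\<kappa> p * \<tau> 0) / \<kappa> p) ^ (2 * i)) = (\<Sum>i\<le>degree PP. poly (coeff PP i) (\<Delta> p) * r p ^ i)"
   unfolding elim(1) power_mult using k0 by (simp add: sk_def)
  thus ?case using elim(2) k0 by simp
 qed
 hence Qunc: "uncountable Q" unfolding Q_def by (rule coc_infinite[OF _ curve_uncountable[OF curve]])
 \<comment> \<open>A non-constant discriminant takes each value at countably many points only, so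
   countably many values of \<open>\<kappa>\<close> could not cover the uncountable set
   \<open>Q\<close>.\<close>
 have "uncountable (\<kappa> ` Q)"
 proof
  assume ct: "countable (\<kappa> ` Q)"
  have "countable {p\<in>C. \<kappa> p = x}" for x
  proof -
   have "countable {p\<in>C. \<not> \<Delta> p \<noteq> x\<^sup>2}" using Dnz[of "x\<^sup>2"] unfolding eventually_coc .
   thus ?thesis by (rule countable_subset[rotated]) (auto simp: kap \<Delta>_def)
  qed
  hence "countable (\<Union>x\<in>\<kappa> ` Q. {p\<in>C. \<kappa> p = x})" using ct by (intro countable_UN) auto
  hence "countable Q" by (rule countable_subset[rotated]) (auto simp: Q_def)
  thus False using Qunc by simp
 qed
 hence "coeff PP (degree PP) = 0"
  by (rule sinh_algebraically_independent[OF tau_nonzero[of 0], where N = "degree PP"]) (auto simp: Q_def)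
 thus False using PP(1) by simp
qed

end

section \<open>Birationally integrable fields are Riccati fields\<close>

context ruled_surface
begin

lemma birationally_integrable_fibre_flow:
 assumes C: "smooth_projective_curve n C" and v: "rat_germ S v" and bi: "birationally_integrable S (dop v)"
 shows "\<exists>e g G. fibre_flow C \<alpha> \<beta> \<gamma> \<delta> n v e g G"
proof -
 obtain \<phi> U \<Phi> where hom: "\<phi> \<in> hom \<lparr>carrier = UNIV, mult = (+), one = (0::complex)\<rparr> (Bir S)"
  and U: "admissible S U" "local_flow_on S (dop v) U \<Phi>" "\<forall>(t, s)\<in>U. \<phi> t s = Some (\<Phi> t s)"
  using bi unfolding birationally_integrable_def by blast
 have bir: "birational_map S S (\<phi> t)" for t using hom by (auto simp: hom_def Bir_def)
 have add: "\<phi> (s + t) = map_ext S (\<phi> s \<circ>\<^sub>m \<phi> t)" for s t using hom by (auto simp: hom_def Bir_def)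
 note fl = flow_at_generic[OF v U]
 obtain \<epsilon> where eps: "\<epsilon> > 0" "infinite {p\<in>C. infinite {u. \<exists>\<eta>. flow_at v \<phi> \<epsilon> p u \<eta>}}"
  using uniform_flow_time[OF C fl] by blast
 \<comment> \<open>Halved because the flow is known on an open ball: the largest time used,
   \<open>e\<close> itself, must lie inside it.\<close>
 define e where "e = \<epsilon> / 2"
 define T where "T k = (of_real (e / 2 ^ k) :: complex)" for k
 have e: "e > 0" using eps(1) by (simp add: e_def)
 have Tb: "T k \<in> ball 0 \<epsilon>" for k
 proof -
  have "e / 2 ^ k \<le> e / 1" using e by (intro divide_left_mono) auto
  also have "\<dots> < \<epsilon>" using eps(1) by (simp add: e_def)
  finally show ?thesis using e by (simp add: T_def norm_divide norm_power)
 qed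
 have Td: "T k = T (Suc k) + T (Suc k)" for k
 proof -
  have "e / 2 ^ k = e / 2 ^ Suc k + e / 2 ^ Suc k" by simp
  thus ?thesis unfolding T_def by (simp only: of_real_add)
 qed
 have rm: "rational_map S S (\<phi> t)" for t using bir[of t] by (simp add: birational_map_def)
 have "\<forall>k. \<exists>g. rat_germ S g \<and> (\<forall>\<^sub>S s. \<phi> (T k) s = Some (pt (base_pt s) (g s)))"
  using flow_fibre_map[where \<phi> = \<phi>, OF C eps(2) rm Tb] by blast
 then obtain g where g: "\<And>k. rat_germ S (g k)" "\<And>k. \<forall>\<^sub>S s. \<phi> (T k) s = Some (pt (base_pt s) (g k s))" by metis
 have "\<forall>k. \<exists>R. eventually R (generic S) \<and> (\<forall>\<^sub>C p. moebius_on (\<lambda>u. R (pt p u)) (\<lambda>u. g k (pt p u)))"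
 proof
  fix k
  obtain \<psi> where "map_ext S (\<psi> \<circ>\<^sub>m \<phi> (T k)) = id_map S" using bir[of "T k"] unfolding birational_map_def by blast
  from fibre_map_moebius[OF g this] show "\<exists>R. eventually R (generic S) \<and> (\<forall>\<^sub>C p. moebius_on (\<lambda>u. R (pt p u)) (\<lambda>u. g k (pt p u)))" .
 qed
 from choice[OF this] obtain R where R0: "\<forall>k. eventually (R k) (generic S) \<and> (\<forall>\<^sub>C p. moebius_on (\<lambda>u. R k (pt p u)) (\<lambda>u. g k (pt p u)))" ..
 note R = R0[THEN spec, THEN conjunct1] R0[THEN spec, THEN conjunct2]
 define G1 where "G1 k s \<longleftrightarrow> (\<forall>p u. s = pt p u --> (\<exists>\<epsilon>>0. \<exists>\<eta>. flow_at v \<phi> \<epsilon> p u \<eta>)) \<and> regular_at S v s (v s) \<and>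
  \<phi> (T k) s = Some (pt (base_pt s) (g k s)) \<and> R k s" for k s
 \<comment> \<open>An intersection of countably many generic conditions; it need not be generic
   itself, but its exceptions remain countable on almost every fibre and along almost every
   section.\<close>
 define G where "G s \<longleftrightarrow> (\<forall>k. G1 k s)" for s
 have G1: "eventually (G1 k) (generic S)" for k
  using fl S.rat_germ_regular[OF v] g(2)[of k] R(1)[of k] by eventually_elim (simp add: G1_def)
 have "fibre_flow C \<alpha> \<beta> \<gamma> \<delta> n v e g G"
 proof unfold_locales
  show "smooth_projective_curve n C" "rat_germ S v" "0 < e" by fact+
  show "rat_germ S (g k)" for k by (rule g(1))
  show "\<forall>\<^sub>F p in coc C. \<forall>\<^sub>F u in coc UNIV. G (pt p u)"
  proof -
   have "\<forall>\<^sub>F p in coc C. \<forall>k. \<forall>\<^sub>F u in coc UNIV. G1 k (pt p u)"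
    by (rule eventually_coc_all) (rule generic_coc_fibre[OF C G1])
   thus ?thesis unfolding G_def by eventually_elim (rule eventually_coc_all, blast)
  qed
  show "\<forall>\<^sub>F u in coc UNIV. \<forall>\<^sub>F p in coc C. G (pt p u)"
  proof -
   have "\<forall>\<^sub>F u in coc UNIV. \<forall>k. \<forall>\<^sub>F p in coc C. G1 k (pt p u)"
    by (rule eventually_coc_all) (rule generic_coc_section[OF C G1])
   thus ?thesis unfolding G_def by eventually_elim (rule eventually_coc_all, blast)
  qed
  have "\<forall>\<^sub>F p in coc C. \<forall>k. moebius_on (\<lambda>u. R k (pt p u)) (\<lambda>u. g k (pt p u))"
   by (rule eventually_coc_all) (rule generic_coc[OF C R(2)])
  thus "\<forall>\<^sub>F p in coc C. \<forall>k. moebius_on (\<lambda>u. G (pt p u)) (\<lambda>u. g k (pt p u))"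
  proof eventually_elim
   case (elim p)
   show ?case by (intro allI, rule moebius_on_mono[OF elim[rule_format]]) (simp add: G_def G1_def)
  qed
  show "\<forall>\<^sub>F p in coc C. \<forall>k. \<forall>\<^sub>F u in coc UNIV. g k (pt p u) = g (Suc k) (pt p (g (Suc k) (pt p u)))"
  proof (rule eventually_coc_all)
   fix k
   have "\<phi> (T k) = map_ext S (\<phi> (T (Suc k)) \<circ>\<^sub>m \<phi> (T (Suc k)))" unfolding Td[of k] add ..
   from fibre_map_iterate[OF C g(2)[of "Suc k"] g(2)[of k] rm this R(1)[of "Suc k"] R(2)[of "Suc k"]]
   show "\<forall>\<^sub>F p in coc C. \<forall>\<^sub>F u in coc UNIV. g k (pt p u) = g (Suc k) (pt p (g (Suc k) (pt p u)))" .
  qed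
  fix p u assume p: "p \<in> C" and Gp: "G (pt p u)"
  have G': "\<exists>\<epsilon>>0. \<exists>\<eta>. flow_at v \<phi> \<epsilon> p u \<eta>" "regular_at S v (pt p u) (v (pt p u))"
   "\<And>k. \<phi> (T k) (pt p u) = Some (pt p (g k (pt p u)))"
   using Gp by (simp_all add: G_def G1_def)
  obtain r \<eta> where r: "r > 0" "flow_at v \<phi> r p u \<eta>" using G'(1) by blast
  have "g k (pt p u) = \<eta> (T k)" if "T k \<in> ball 0 r" for k
   using r(2) that G'(3)[of k] unfolding flow_at_def by simp
  hence "\<eta> 0 = u \<and> (\<forall>t\<in>ball 0 r. \<exists>w. regular_at S v (pt p (\<eta> t)) w \<and> (DERIV (\<eta>) t :> w)) \<and>
    (\<forall>k. of_real (e / 2 ^ k) \<in> ball (0 :: complex) r --> g k (pt p u) = \<eta> (of_real (e / 2 ^ k)))"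
   using r(2) unfolding flow_at_def T_def by blast
  thus "regular_at S v (pt p u) (v (pt p u)) \<and>
   (\<exists>r>0. \<exists>\<eta>. \<eta> 0 = u \<and> (\<forall>t\<in>ball 0 r. \<exists>w. regular_at S v (pt p (\<eta> t)) w \<and> (DERIV (\<eta>) t :> w)) \<and>
    (\<forall>k. of_real (e / 2 ^ k) \<in> ball (0 :: complex) r --> g k (pt p u) = \<eta> (of_real (e / 2 ^ k))))"
   using r(1) G'(2) by blast
 qed
 thus ?thesis by blast
qed

lemma birationally_integrable_riccati:
 assumes C: "smooth_projective_curve n C" and v: "rat_germ S v" and bi: "birationally_integrable S (dop v)"
 obtains a b c \<kappa> where "rat_germ C a" "rat_germ C b" "rat_germ C c" "dop v = dop (ric a b c)"
  "\<forall>\<^sub>C p. b p * b p - a p * c p = \<kappa>\<^sup>2"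
proof (cases "\<forall>\<^sub>S s. v s = 0")
 \<comment> \<open>The zero field is treated apart, because the proof that the discriminant is
   constant needs a section along which the field is non-zero.\<close>
 case True
 have z: "rat_germ C (\<lambda>_. 0)" by (rule C.rat_germ_const)
 have "dop v = dop (ric (\<lambda>_. 0) (\<lambda>_. 0) (\<lambda>_. 0))"
  unfolding dop_eq_iff[OF v rat_germ_ric[OF z z z]] using True by (simp add: ric_def)
 thus thesis by (rule that[OF z z z, of 0]) simp
next
 case False
 obtain e g G where "fibre_flow C \<alpha> \<beta> \<gamma> \<delta> n v e g G" using birationally_integrable_fibre_flow[OF assms] by blast
 then interpret fibre_flow C \<alpha> \<beta> \<gamma> \<delta> n v e g G .
 obtain a b c where abc: "rat_germ C a" "rat_germ C b" "rat_germ C c" and vr: "\<forall>\<^sub>S s. v s = ric a b c s"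
  by (rule riccati_form)
 obtain d where d: "\<forall>\<^sub>C p. b p * b p - a p * c p = d"
  using discriminant_constant[OF abc vr False] by blast
 show thesis
  by (rule that[OF abc, of "csqrt d"]) (use d vr dop_eq_iff[OF v rat_germ_ric[OF abc]] in simp_all)
qed

end

section \<open>The equivalence, the normal forms and the theorem\<close>

context ruled_surface
begin

lemma riccati_germs:
 assumes "a \<in> carrier (function_field C)" "b \<in> carrier (function_field C)" "c \<in> carrier (function_field C)"
  and d: "discriminant C a b c = const_fun C (\<kappa>\<^sup>2)"
 obtains a' b' c' where "rat_germ C a'" "rat_germ C b'" "rat_germ C c'" "riccati_vf C yfun a b c = dop (ric a' b' c')"
  "\<forall>\<^sub>C p. b' p * b' p - a' p * c' p = \<kappa>\<^sup>2"
proof -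
 obtain a' where a: "rat_germ C a'" "a = RF C a'" using assms(1) by (rule C.carrier_E)
 obtain b' where b: "rat_germ C b'" "b = RF C b'" using assms(2) by (rule C.carrier_E)
 obtain c' where c: "rat_germ C c'" "c = RF C c'" using assms(3) by (rule C.carrier_E)
 have g: "rat_germ C (\<lambda>p. b' p * b' p - a' p * c' p)" by (intro C.rat_germ_diff C.rat_germ_mult a b c)
 have "\<forall>\<^sub>C p. b' p * b' p - a' p * c' p = \<kappa>\<^sup>2"
  using d unfolding a b c discriminant_RF[OF a(1) b(1) c(1)] C.const_fun_RF C.RF_eq_iff[OF g C.rat_germ_const] .
 moreover have "riccati_vf C yfun a b c = dop (ric a' b' c')"
  unfolding a b c riccati_dop[OF a(1) b(1) c(1)] ric_def[abs_def] ..
 ultimately show thesis using that a(1) b(1) c(1) by blast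
qed

lemma integrable_iff_riccati:
 assumes C: "smooth_projective_curve n C" and X: "rational_vector_field S X" "tangent_to_fibration C X"
 shows "birationally_integrable S X \<longleftrightarrow>
  (\<exists>a \<in> carrier (function_field C). \<exists>b \<in> carrier (function_field C). \<exists>c \<in> carrier (function_field C). \<exists>\<kappa>.
   X = riccati_vf C yfun a b c \<and> discriminant C a b c = const_fun C (\<kappa>\<^sup>2))"
proof
 assume bi: "birationally_integrable S X"
 obtain v where v: "rat_germ S v" "X = dop v" using X by (rule tangent_vf_E)
 obtain a b c \<kappa> where abc: "rat_germ C a" "rat_germ C b" "rat_germ C c" "dop v = dop (ric a b c)"
  and d: "\<forall>\<^sub>C p. b p * b p - a p * c p = \<kappa>\<^sup>2"
  using birationally_integrable_riccati[OF C v(1) bi[unfolded v(2)]] .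
 have g: "rat_germ C (\<lambda>p. b p * b p - a p * c p)" by (intro C.rat_germ_diff C.rat_germ_mult abc)
 have "X = riccati_vf C yfun (RF C a) (RF C b) (RF C c)"
  unfolding v(2) abc(4) riccati_dop[OF abc(1-3)] ric_def[abs_def] ..
 moreover have "discriminant C (RF C a) (RF C b) (RF C c) = const_fun C (\<kappa>\<^sup>2)"
  unfolding discriminant_RF[OF abc(1-3)] C.const_fun_RF C.RF_eq_iff[OF g C.rat_germ_const] by (rule d)
 ultimately show "\<exists>a \<in> carrier (function_field C). \<exists>b \<in> carrier (function_field C). \<exists>c \<in> carrier (function_field C). \<exists>\<kappa>.
   X = riccati_vf C yfun a b c \<and> discriminant C a b c = const_fun C (\<kappa>\<^sup>2)"
  using C.RF_carrier[OF abc(1)] C.RF_carrier[OF abc(2)] C.RF_carrier[OF abc(3)] by blast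
next
 assume "\<exists>a \<in> carrier (function_field C). \<exists>b \<in> carrier (function_field C). \<exists>c \<in> carrier (function_field C). \<exists>\<kappa>.
   X = riccati_vf C yfun a b c \<and> discriminant C a b c = const_fun C (\<kappa>\<^sup>2)"
 then obtain a b c \<kappa> where c: "a \<in> carrier (function_field C)" "b \<in> carrier (function_field C)" "c \<in> carrier (function_field C)"
  and X: "X = riccati_vf C yfun a b c" and d: "discriminant C a b c = const_fun C (\<kappa>\<^sup>2)" by blast
 obtain a' b' c' where abc: "rat_germ C a'" "rat_germ C b'" "rat_germ C c'" "riccati_vf C yfun a b c = dop (ric a' b' c')"
  "\<forall>\<^sub>C p. b' p * b' p - a' p * c' p = \<kappa>\<^sup>2"
  using riccati_germs[OF c d] .
 have "zclosed C" using C by (intro zclosed_projective_variety[of n]) (simp add: smooth_projective_def)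
 thus "birationally_integrable S X" unfolding X abc(4) by (rule riccati_integrable[OF abc(1-3,5)])
qed

lemma riccati_normal_forms:
 assumes C: "smooth_projective_curve n C"
  and c: "a \<in> carrier (function_field C)" "b \<in> carrier (function_field C)" "c \<in> carrier (function_field C)"
  and X: "X = riccati_vf C yfun a b c" and d: "discriminant C a b c = const_fun C (\<kappa>\<^sup>2)"
 shows "(\<kappa> \<noteq> 0 --> (\<exists>\<phi> \<in> Bir_fib C. pull_vf S S \<phi> X =
   vf_scale S (const_fun S (2 * \<kappa>) \<otimes>\<^bsub>function_field S\<^esub> from_fibre C yfun) (partial_y C yfun))) \<and>
  (\<kappa> = 0 --> X \<noteq> zero_vf S --> (\<exists>\<phi> \<in> Bir_fib C. pull_vf S S \<phi> X = partial_y C yfun)) \<and> regularizable S X"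
proof -
 obtain a' b' c' where abc: "rat_germ C a'" "rat_germ C b'" "rat_germ C c'" "riccati_vf C yfun a b c = dop (ric a' b' c')"
  "\<forall>\<^sub>C p. b' p * b' p - a' p * c' p = \<kappa>\<^sup>2"
  using riccati_germs[OF c d] .
 have closed: "zclosed C" using C by (intro zclosed_projective_variety[of n]) (simp add: smooth_projective_def)
 have X': "X = dop (ric a' b' c')" using X abc(4) by simp
 show ?thesis
 proof (cases "\<kappa> = 0")
  case False
  obtain \<phi> where p: "\<phi> \<in> Bir_fib C" "pull_vf S S \<phi> X = dop (\<lambda>s. 2 * \<kappa> * yc s)"
   using normal_form_nonzero[OF abc(1-3,5) False closed] unfolding X' by blast
  have "const_fun S (2 * \<kappa>) \<otimes>\<^bsub>function_field S\<^esub> from_fibre C yfun = RF S (\<lambda>s. 2 * \<kappa> * yc s)"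
   unfolding S.const_fun_RF from_fibre_RF by (rule S.RF_mult[OF S.rat_germ_const rat_germ_yc])
  moreover have "rat_germ S (\<lambda>s. 2 * \<kappa> * yc s)" by (intro S.rat_germ_mult S.rat_germ_const rat_germ_yc)
  ultimately have "vf_scale S (const_fun S (2 * \<kappa>) \<otimes>\<^bsub>function_field S\<^esub> from_fibre C yfun) (partial_y C yfun) = pull_vf S S \<phi> X"
   unfolding p(2) by (simp only: scale_partial_y)
  moreover have "regularizable S X"
   by (rule regularizable_normal_form[OF C p(1)]) (simp only: p(2) holomorphic_dop_yc)
  ultimately show ?thesis using False p(1) by metis
 next
  case True
  show ?thesis
  proof (cases "X = zero_vf S")
   \<comment> \<open>The zero field has no normal form but is holomorphic already; the identity
     transformation shows that it is regularizable.\<close>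
   case True
   thus ?thesis using \<open>\<kappa> = 0\<close> regularizable_zero[OF C] by (simp add: zero_vf_dop)
  next
   case False
   obtain \<phi> where p: "\<phi> \<in> Bir_fib C" "pull_vf S S \<phi> X = dop (\<lambda>s. 1)"
    using normal_form_zero[OF abc(1-3) _ closed] abc(5) \<open>\<kappa> = 0\<close> False unfolding X' by auto
   have "regularizable S X"
    by (rule regularizable_normal_form[OF C p(1)]) (simp only: p(2) holomorphic_dop_1)
   thus ?thesis using p \<open>\<kappa> = 0\<close> unfolding partial_y_dop by blast
  qed
 qed
qed

end

theorem theorem4p10:
  fixes n :: nat and C S :: "point set" and y :: ratfun and X :: vfield
  assumes "smooth_projective_curve n C"
    and "S = ruled C"
    and "affine_coordinate y"
    and "rational_vector_field S X"
    and "tangent_to_fibration C X"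
  shows "(birationally_integrable S X \<longleftrightarrow>
           (\<exists>a \<in> carrier (function_field C). \<exists>b \<in> carrier (function_field C).
            \<exists>c \<in> carrier (function_field C). \<exists>\<kappa>.
              X = riccati_vf C y a b c \<and> discriminant C a b c = const_fun C (\<kappa>\<^sup>2)))
       \<and> (\<forall>a \<in> carrier (function_field C). \<forall>b \<in> carrier (function_field C).
          \<forall>c \<in> carrier (function_field C). \<forall>\<kappa>.
            X = riccati_vf C y a b c \<longrightarrow> discriminant C a b c = const_fun C (\<kappa>\<^sup>2) \<longrightarrow>
              (\<kappa> \<noteq> 0 \<longrightarrow> (\<exists>\<phi> \<in> Bir_fib C.
                 pull_vf S S \<phi> X =
                   vf_scale S (const_fun S (2 * \<kappa>) \<otimes>\<^bsub>function_field S\<^esub> from_fibre C y)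
                     (partial_y C y))) \<and>
              (\<kappa> = 0 \<longrightarrow> X \<noteq> zero_vf S \<longrightarrow> (\<exists>\<phi> \<in> Bir_fib C. pull_vf S S \<phi> X = partial_y C y)) \<and>
              regularizable S X)"
proof -
 obtain \<alpha> \<beta> \<gamma> \<delta> where det: "\<alpha> * \<delta> - \<beta> * \<gamma> \<noteq> 0"
  and y: "y = (\<lambda>w. if w \<in> proj_space 1 \<and> \<gamma> * crd w 0 + \<delta> * crd w 1 \<noteq> 0
         then Some ((\<alpha> * crd w 0 + \<beta> * crd w 1) /
              (\<gamma> * crd w 0 + \<delta> * crd w 1))
         else None)"
  using assms(3) unfolding affine_coordinate_def by blast
 interpret irreducible C by (rule projective_variety_irreducible) (use assms(1) in \<open>auto simp: smooth_projective_def\<close>)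
 interpret R: ruled_surface C \<alpha> \<beta> \<gamma> \<delta> by unfold_locales (rule det)
 have yf: "y = R.yfun" unfolding y R.yfun_def ..
 show ?thesis
  unfolding yf assms(2)
  using R.integrable_iff_riccati[OF assms(1) assms(4)[unfolded assms(2)] assms(5)] R.riccati_normal_forms[OF assms(1)]
  by blast
qed

end
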